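(* Let $\mathcal X$ be a metric space and let $w:\mathcal X\times\mathcal X\to\mathbb R$ be a continuous, positive-definite function, not necessarily symmetric, such that $$d(x)\,w(x,x')=d(x')\,w(x',x)\qquad\text{for all }x,x'\in\mathcal X,$$ for a continuous, strictly positive function $d:\mathcal X\to\mathbb R$. Then the function $k:\mathcal X\times\mathcal X\to\mathbb R$, $k(x,x')=w(x,x')/d(x')$, is a continuous, symmetric, positive-definite kernel. Moreover, let $\rho$ be any compactly supported finite Borel measure on $\mathcal X$, let $\mathcal K$ be the reproducing kernel Hilbert space with kernel $k$, let $\iota:\mathcal K\to L^2(\rho)$ be the inclusion map (sending a function to its equivalence class), and let $\tilde T=\iota^+$ be the Nyström operator, where $^+$ denotes the Moore--Penrose pseudoinverse. Then the following hold. (i) The integral operator $W:f\mapsto\int_{\mathcal X}w(\cdot,x)f(x)\,d\rho(x)$ is well-defined as a bounded operator $W:L^2(\rho)\to\mathcal K$. (ii) The integral operator $J=\iota W$ is a trace-class operator on $L^2(\rho)$, with real eigenvalues $\eta_1\ge\eta_2\ge\cdots\searrow0^+$. Moreover, there exist a Riesz basis $\{\xi_1,\xi_2,\dots\}$ of $L^2(\rho)$ and a dual basis $\{\xi_1',\xi_2',\dots\}$ with $\langle\xi_i',\xi_j\rangle_{L^2(\rho)}=\delta_{ij}$, consisting of eigenfunctions of $J$ and $J^*$, respectively, i.e., $J\xi_j=\eta_j\xi_j$ and $J^*\xi_j'=\eta_j\xi_j'$. (iii) The domain $D(J^+)$ of the Moore--Penrose pseudoinverse of $J$ is a dense subspace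 of $D(\tilde T)$, and on this subspace the Nyström operator takes the form $\tilde T|_{D(J^+)}=WJ^+$. As a result, for every $f\in D(\tilde T)$, $$\tilde Tf=\sum_{i:\eta_i>0}\frac{\langle\xi_i',f\rangle_{L^2(\rho)}}{\eta_i^{1/2}}\,\vartheta_i,$$ where $\vartheta_i=W\xi_i/\eta_i^{1/2}$ are orthogonal functions in $\mathcal K$. Here the $\xi_i,\xi_i'$ are given by $\xi_i=d^{-1/2}\hat\phi_i$ and $\xi_i'=d^{1/2}\hat\phi_i$, where $\{\hat\phi_i\}$ is an orthonormal basis of $L^2(\rho)$ consisting of eigenfunctions, with eigenvalues $\eta_i$, of the self-adjoint integral operator on $L^2(\rho)$ with kernel $\hat k(x,x')=d^{1/2}(x)\,k(x,x')\,d^{1/2}(x')$.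
   Context: **Positive-definiteness.** A function $w:\mathcal X\times\mathcal X\to\mathbb R$ is positive-definite if $\sum_{i,j=1}^ma_ia_jw(x_i,x_j)\ge0$ for all $m$, all $x_1,\dots,x_m\in\mathcal X$ and all $a_1,\dots,a_m\in\mathbb R$ (for real symmetric kernels this is equivalent to the condition with complex coefficients $a_i^*a_j$). **Conventions.** $L^2(\rho)$ is the complex Hilbert space of $\rho$-a.e. equivalence classes of square-integrable functions $\mathcal X\to\mathbb C$, inner products are conjugate-linear in the first argument, and $\mathcal K$ is the complex RKHS of functions on $\mathcal X$ with reproducing kernel $k$. Eigenvalues are listed with multiplicity; the notation $\eta_1\ge\eta_2\ge\cdots\searrow0^+$ means that they are non-negative, non-increasing and, when $L^2(\rho)$ is infinite-dimensional, tend to $0$ (when $L^2(\rho)$ is finite-dimensional the lists are finite). **Moore--Penrose pseudoinverse.** For a closed linear map $A:D(A)\to H_2$ with dense domain $D(A)\subseteq H_1$ between complex Hilbert spaces, $A^+:D(A^+)\to H_1$ is the operator with domain $D(A^+)=\operatorname{ran}A\oplus(\operatorname{ran}A)^\perp\subseteq H_2$ such that $\ker A^+=(\operatorname{ran}A)^\perp$, $\overline{\operatorname{ran}A^+}=(\ker A)^\perp$, and $AA^+f=f$ for all $f\in\operatorname{ran}A$. In particular, $D(\tilde T)=\operatorname{ran}\iota\oplus\ker\iota^*$. "Dense subspace of $D(\tilde T)$" means a linear subspace of $D(\tilde T)$ that is dense in it in the norm of $L^2(\rho)$.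
   Formalization: When J has infinitely many positive eigenvalues and a nontrivial kernel, no complete eigenbasis can be listed with non-increasing eigenvalues; in that case only the positive eigenvalues are required to be non-increasing and zero eigenvalues may be interleaved. *)

theory Defs
  imports "HOL-Analysis.Analysis" "HOL-Algebra.Algebraic_Closure_Type"
begin

section \<open>Complex inner product spaces with explicit carriers\<close>

text \<open>
  Both $L^2(\rho)$ and the RKHS depend on terms (a measure, a kernel), so Hilbert spaces are
  modules over the complex field in the sense of HOL-Algebra, extended by an inner product that
  is conjugate-linear in its first argument. The fields \<open>mult\<close> and \<open>one\<close>, which the record
  \<open>module\<close> inherits from \<open>ring\<close>, play no role.
\<close>

abbreviation complex_ring :: "complex ring" where
  "complex_ring \<equiv> ring_of_type_algebra"

record 'v inner_space = "(complex, 'v) module" +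
  cinner :: "'v \<Rightarrow> 'v \<Rightarrow> complex"

definition cnorm :: "'v inner_space \<Rightarrow> 'v \<Rightarrow> real" where
  "cnorm V x = sqrt (Re (cinner V x x))"

text \<open>The value outside the carrier merely makes this an instance of \<open>Metric_space\<close>.\<close>

definition cdist :: "'v inner_space \<Rightarrow> 'v \<Rightarrow> 'v \<Rightarrow> real" where
  "cdist V x y = (if x \<in> carrier V \<and> y \<in> carrier V then cnorm V (x \<ominus>\<^bsub>V\<^esub> y) else 0)"

abbreviation norm_topology :: "'v inner_space \<Rightarrow> 'v topology" where
  "norm_topology V \<equiv> Metric_space.mtopology (carrier V) (cdist V)"

locale complex_inner_space = module complex_ring V for V :: "'v inner_space" (structure) +
  assumes cinner_commute:
      "\<lbrakk>x \<in> carrier V; y \<in> carrier V\<rbrakk> \<Longrightarrow> cinner V x y = cnj (cinner V y x)"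
    and cinner_add_right:
      "\<lbrakk>x \<in> carrier V; y \<in> carrier V; z \<in> carrier V\<rbrakk> \<Longrightarrow>
        cinner V x (y \<oplus> z) = cinner V x y + cinner V x z"
    and cinner_smult_right:
      "\<lbrakk>x \<in> carrier V; y \<in> carrier V\<rbrakk> \<Longrightarrow> cinner V x (c \<odot> y) = c * cinner V x y"
    and cinner_pos:
      "\<lbrakk>x \<in> carrier V; x \<noteq> \<zero>\<rbrakk> \<Longrightarrow> 0 < Re (cinner V x x)"

locale complex_hilbert_space = complex_inner_space +
  assumes complete: "Metric_space.mcomplete (carrier V) (cdist V)"

definition orth_complement :: "'v inner_space \<Rightarrow> 'v set \<Rightarrow> 'v set" where
  "orth_complement V S = {x \<in> carrier V. \<forall>y\<in>S. cinner V y x = 0}"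

definition lin_span :: "'v inner_space \<Rightarrow> 'v set \<Rightarrow> 'v set" where
  "lin_span V S = {(\<Oplus>\<^bsub>V\<^esub>x\<in>F. c x \<odot>\<^bsub>V\<^esub> x) | c F. finite F \<and> F \<subseteq> S}"

text \<open>\<open>(e\<^sub>i)\<^sub>i\<^sub>\<in>\<^sub>I\<close> is an orthonormal basis of the closed subspace \<open>S\<close>.\<close>

definition orthonormal_basis ::
    "'v inner_space \<Rightarrow> 'v set \<Rightarrow> 'i set \<Rightarrow> ('i \<Rightarrow> 'v) \<Rightarrow> bool" where
  "orthonormal_basis V S I e \<longleftrightarrow>
     e ` I \<subseteq> carrier V \<and>
     (\<forall>i\<in>I. \<forall>j\<in>I. cinner V (e i) (e j) = of_bool (i = j)) \<and>
     norm_topology V closure_of lin_span V (e ` I) = S"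

text \<open>Unordered (unconditional) summation in norm, as for \<open>has_sum\<close> on type classes.\<close>

definition has_sum_in :: "'v inner_space \<Rightarrow> ('i \<Rightarrow> 'v) \<Rightarrow> 'i set \<Rightarrow> 'v \<Rightarrow> bool" where
  "has_sum_in V f I s \<longleftrightarrow>
     limitin (norm_topology V) (\<lambda>F. \<Oplus>\<^bsub>V\<^esub>i\<in>F. f i) s (finite_subsets_at_top I)"


section \<open>Operators\<close>

text \<open>
  A (possibly unbounded) operator is a partial map; \<open>dom\<close> and \<open>ran\<close> are its domain and range,
  and \<open>\<circ>\<^sub>m\<close> is composition of operators with its natural domain.
\<close>

definition linear_operator :: "'v inner_space \<Rightarrow> 'w inner_space \<Rightarrow> ('v \<rightharpoonup> 'w) \<Rightarrow> bool" where
  "linear_operator V U A \<longleftrightarrow>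
     submodule (dom A) complex_ring V \<and> ran A \<subseteq> carrier U \<and>
     (\<forall>x\<in>dom A. \<forall>y\<in>dom A. A (x \<oplus>\<^bsub>V\<^esub> y) = Some (the (A x) \<oplus>\<^bsub>U\<^esub> the (A y))) \<and>
     (\<forall>c. \<forall>x\<in>dom A. A (c \<odot>\<^bsub>V\<^esub> x) = Some (c \<odot>\<^bsub>U\<^esub> the (A x)))"

definition bounded_operator :: "'v inner_space \<Rightarrow> 'w inner_space \<Rightarrow> ('v \<rightharpoonup> 'w) \<Rightarrow> bool" where
  "bounded_operator V U A \<longleftrightarrow>
     linear_operator V U A \<and> dom A = carrier V \<and>
     (\<exists>C. \<forall>x\<in>carrier V. cnorm U (the (A x)) \<le> C * cnorm V x)"

definition op_kernel :: "'v inner_space \<Rightarrow> 'w inner_space \<Rightarrow> ('v \<rightharpoonup> 'w) \<Rightarrow> 'v set" where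
  "op_kernel V U A = {x \<in> carrier V. A x = Some \<zero>\<^bsub>U\<^esub>}"

text \<open>The adjoint of an everywhere defined bounded operator.\<close>

definition adjoint_op :: "'v inner_space \<Rightarrow> 'w inner_space \<Rightarrow> ('v \<rightharpoonup> 'w) \<Rightarrow> ('w \<rightharpoonup> 'v)" where
  "adjoint_op V U A =
     (THE B. bounded_operator U V B \<and>
        (\<forall>x\<in>carrier V. \<forall>y\<in>carrier U. cinner V (the (B y)) x = cinner U y (the (A x))))"

definition moore_penrose ::
    "'v inner_space \<Rightarrow> 'w inner_space \<Rightarrow> ('v \<rightharpoonup> 'w) \<Rightarrow> ('w \<rightharpoonup> 'v) \<Rightarrow> bool" where
  "moore_penrose V U A B \<longleftrightarrow>
     linear_operator U V B \<and>
     dom B = ran A <+>\<^bsub>U\<^esub> orth_complement U (ran A) \<and>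
     op_kernel U V B = orth_complement U (ran A) \<and>
     norm_topology V closure_of ran B = orth_complement V (op_kernel V U A) \<and>
     (\<forall>f\<in>ran A. (A \<circ>\<^sub>m B) f = Some f)"

definition pinv :: "'v inner_space \<Rightarrow> 'w inner_space \<Rightarrow> ('v \<rightharpoonup> 'w) \<Rightarrow> ('w \<rightharpoonup> 'v)" where
  "pinv V U A = (THE B. moore_penrose V U A B)"

definition positive_operator :: "'v inner_space \<Rightarrow> ('v \<rightharpoonup> 'v) \<Rightarrow> bool" where
  "positive_operator V P \<longleftrightarrow>
     bounded_operator V V P \<and> (\<forall>x\<in>carrier V. cinner V x (the (P x)) \<in> \<real>\<^sub>\<ge>\<^sub>0)"

text \<open>\<open>P\<close> is the absolute value of \<open>A\<close>, the positive square root of \<open>A\<^sup>*A\<close>.\<close>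

definition trace_class :: "'v inner_space \<Rightarrow> ('v \<rightharpoonup> 'v) \<Rightarrow> bool" where
  "trace_class V A \<longleftrightarrow>
     bounded_operator V V A \<and>
     (\<exists>P E. positive_operator V P \<and> P \<circ>\<^sub>m P = adjoint_op V V A \<circ>\<^sub>m A \<and>
        orthonormal_basis V (carrier V) E (\<lambda>e. e) \<and>
        (\<lambda>e. Re (cinner V e (the (P e)))) summable_on E)"

text \<open>A Riesz basis is the image of an orthonormal basis under a bounded invertible operator.\<close>

definition riesz_basis :: "'v inner_space \<Rightarrow> 'i set \<Rightarrow> ('i \<Rightarrow> 'v) \<Rightarrow> bool" where
  "riesz_basis V I \<xi> \<longleftrightarrow>
     (\<exists>e A B. orthonormal_basis V (carrier V) I e \<and>
        bounded_operator V V A \<and> bounded_operator V V B \<and>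
        B \<circ>\<^sub>m A = Some |` carrier V \<and> A \<circ>\<^sub>m B = Some |` carrier V \<and>
        (\<forall>i\<in>I. A (e i) = Some (\<xi> i)))"

definition eigenfunctions ::
    "'v inner_space \<Rightarrow> ('v \<rightharpoonup> 'v) \<Rightarrow> 'i set \<Rightarrow> ('i \<Rightarrow> real) \<Rightarrow> ('i \<Rightarrow> 'v) \<Rightarrow> bool" where
  "eigenfunctions V A I \<eta> \<xi> \<longleftrightarrow>
     (\<forall>i\<in>I. \<xi> i \<in> carrier V \<and> \<xi> i \<noteq> \<zero>\<^bsub>V\<^esub> \<and> A (\<xi> i) = Some (of_real (\<eta> i) \<odot>\<^bsub>V\<^esub> \<xi> i))"

definition eigenspace :: "'v inner_space \<Rightarrow> ('v \<rightharpoonup> 'v) \<Rightarrow> complex \<Rightarrow> 'v set" where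
  "eigenspace V A \<mu> = {x \<in> carrier V. A x = Some (\<mu> \<odot>\<^bsub>V\<^esub> x)}"

text \<open>
  The family \<open>\<eta>\<close> contains every complex eigenvalue as often as the dimension of its eigenspace
  indicates; a \<open>\<mu>\<close> that does not occur in \<open>\<eta>\<close> has eigenspace \<open>{\<zero>}\<close>.
\<close>

definition lists_eigenvalues ::
    "'v inner_space \<Rightarrow> ('v \<rightharpoonup> 'v) \<Rightarrow> 'i set \<Rightarrow> ('i \<Rightarrow> real) \<Rightarrow> bool" where
  "lists_eigenvalues V A I \<eta> \<longleftrightarrow>
     (\<forall>\<mu>. \<exists>e. orthonormal_basis V (eigenspace V A \<mu>) {i \<in> I. complex_of_real (\<eta> i) = \<mu>} e)"

definition dual_eigenbases ::
    "'v inner_space \<Rightarrow> ('v \<rightharpoonup> 'v) \<Rightarrow> 'i set \<Rightarrow> ('i \<Rightarrow> real) \<Rightarrow> ('i \<Rightarrow> 'v) \<Rightarrow> ('i \<Rightarrow> 'v) \<Rightarrow> bool"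
  where
  "dual_eigenbases V A I \<eta> \<xi> \<xi>' \<longleftrightarrow>
     riesz_basis V I \<xi> \<and> riesz_basis V I \<xi>' \<and>
     (\<forall>i\<in>I. \<forall>j\<in>I. cinner V (\<xi>' i) (\<xi> j) = of_bool (i = j)) \<and>
     eigenfunctions V A I \<eta> \<xi> \<and> eigenfunctions V (adjoint_op V V A) I \<eta> \<xi>'"

text \<open>
  The condition $\eta_1 \ge \eta_2 \ge \cdots \searrow 0^+$, indices starting at \<open>0\<close>. An operator
  with infinitely many positive eigenvalues and a nontrivial kernel has no non-increasing
  enumeration by \<open>nat\<close> of all its eigenvalues. In that case, and only then, zeros may be
  interleaved with the non-increasing positive entries.
\<close>

definition eigenvalue_sequence :: "nat set \<Rightarrow> (nat \<Rightarrow> real) \<Rightarrow> bool" where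
  "eigenvalue_sequence I \<eta> \<longleftrightarrow>
     (I = UNIV \<and> \<eta> \<longlonglongrightarrow> 0 \<or> (\<exists>n. I = {..<n})) \<and>
     (\<forall>i\<in>I. 0 \<le> \<eta> i) \<and>
     antimono_on {i \<in> I. 0 < \<eta> i} \<eta> \<and>
     (finite {i \<in> I. 0 < \<eta> i} \<or> (\<forall>i\<in>I. 0 < \<eta> i) \<longrightarrow> antimono_on I \<eta>)"


section \<open>Square-integrable functions\<close>

definition square_integrable :: "'a measure \<Rightarrow> ('a \<Rightarrow> complex) set" where
  "square_integrable \<rho> =
     {f \<in> borel_measurable \<rho>. integrable \<rho> (\<lambda>x. (cmod (f x))\<^sup>2)}"

definition ae_equal :: "'a measure \<Rightarrow> (('a \<Rightarrow> complex) \<times> ('a \<Rightarrow> complex)) set" where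
  "ae_equal \<rho> =
     {(f, g) \<in> square_integrable \<rho> \<times> square_integrable \<rho>. AE x in \<rho>. f x = g x}"

definition l2_class :: "'a measure \<Rightarrow> ('a \<Rightarrow> complex) \<Rightarrow> ('a \<Rightarrow> complex) set" where
  "l2_class \<rho> f = ae_equal \<rho> `` {f}"

definition L2 :: "'a measure \<Rightarrow> ('a \<Rightarrow> complex) set inner_space" where
  "L2 \<rho> = \<lparr>
     carrier = square_integrable \<rho> // ae_equal \<rho>,
     monoid.mult = undefined,
     one = undefined,
     ring.zero = l2_class \<rho> (\<lambda>x. 0),
     add = (\<lambda>F G. \<Union>f\<in>F. \<Union>g\<in>G. l2_class \<rho> (\<lambda>x. f x + g x)),
     smult = (\<lambda>c F. \<Union>f\<in>F. l2_class \<rho> (\<lambda>x. c * f x)),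
     cinner = (\<lambda>F G. the_elem (\<Union>f\<in>F. \<Union>g\<in>G. {LINT x|\<rho>. cnj (f x) * g x})) \<rparr>"

definition l2_mult :: "'a measure \<Rightarrow> ('a \<Rightarrow> real) \<Rightarrow> ('a \<Rightarrow> complex) set \<Rightarrow> ('a \<Rightarrow> complex) set"
  where "l2_mult \<rho> g F = (\<Union>f\<in>F. l2_class \<rho> (\<lambda>x. of_real (g x) * f x))"

text \<open>
  \<open>integral_op\<close> yields functions defined everywhere, \<open>l2_integral_op\<close> their equivalence classes.
\<close>

definition integral_op ::
    "'a measure \<Rightarrow> ('a \<Rightarrow> 'a \<Rightarrow> real) \<Rightarrow> (('a \<Rightarrow> complex) set \<rightharpoonup> ('a \<Rightarrow> complex))" where
  "integral_op \<rho> \<kappa> F =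
     (if F \<in> carrier (L2 \<rho>)
      then Some (the_elem (\<Union>f\<in>F. {\<lambda>x. LINT y|\<rho>. of_real (\<kappa> x y) * f y})) else None)"

definition l2_integral_op ::
    "'a measure \<Rightarrow> ('a \<Rightarrow> 'a \<Rightarrow> real) \<Rightarrow> (('a \<Rightarrow> complex) set \<rightharpoonup> ('a \<Rightarrow> complex) set)" where
  "l2_integral_op \<rho> \<kappa> F = map_option (l2_class \<rho>) (integral_op \<rho> \<kappa> F)"

text \<open>The measure is concentrated on a compact set.\<close>

definition compactly_supported :: "'a::topological_space measure \<Rightarrow> bool" where
  "compactly_supported \<rho> \<longleftrightarrow> (\<exists>S. compact S \<and> (AE x in \<rho>. x \<in> S))"


section \<open>Kernels\<close>

definition positive_definite :: "('a \<Rightarrow> 'a \<Rightarrow> real) \<Rightarrow> bool" where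
  "positive_definite w \<longleftrightarrow>
     (\<forall>m (x :: nat \<Rightarrow> 'a) (a :: nat \<Rightarrow> real).
        0 \<le> (\<Sum>i<m. \<Sum>j<m. a i * a j * w (x i) (x j)))"

definition is_rkhs :: "('a \<Rightarrow> 'a \<Rightarrow> real) \<Rightarrow> ('a \<Rightarrow> complex) inner_space \<Rightarrow> bool" where
  "is_rkhs k K \<longleftrightarrow>
     complex_hilbert_space K \<and>
     \<zero>\<^bsub>K\<^esub> = (\<lambda>x. 0) \<and>
     (\<forall>f\<in>carrier K. \<forall>g\<in>carrier K. f \<oplus>\<^bsub>K\<^esub> g = (\<lambda>x. f x + g x)) \<and>
     (\<forall>c. \<forall>f\<in>carrier K. c \<odot>\<^bsub>K\<^esub> f = (\<lambda>x. c * f x)) \<and>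
     (\<forall>x. (\<lambda>y. complex_of_real (k y x)) \<in> carrier K \<and>
        (\<forall>f\<in>carrier K. cinner K (\<lambda>y. complex_of_real (k y x)) f = f x))"

definition inclusion_op ::
    "'a measure \<Rightarrow> ('a \<Rightarrow> complex) inner_space \<Rightarrow> (('a \<Rightarrow> complex) \<rightharpoonup> ('a \<Rightarrow> complex) set)" where
  "inclusion_op \<rho> K f = (if f \<in> carrier K then Some (l2_class \<rho> f) else None)"

end

theory Submission
  imports Defs "HOL-Complex_Analysis.Great_Picard"
begin

text \<open>
  Let $A = \iota\iota^*$ and let $D$ be multiplication by $d$, so that $W = \iota^* D$,
  $J = A D$ and $\hat K = D^{1/2} A D^{1/2} = D^{1/2} J D^{-1/2}$. The operator $\hat K$ is positive
  and has finite trace, because the squares of an orthonormal family $(b)$ of $\mathcal K$ satisfy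
  $\sum_b |b(x)|^2 \le k(x,x)$; the spectral theorem for $\hat K$ gives $\hat\phi_i$, and
  conjugation with $D^{1/2}$ gives $\xi_i$ and $\xi_i'$. The $\vartheta_i$ are an orthonormal basis of
  $(\ker\iota)^\perp$, and $\langle \xi_i', \iota g\rangle = \eta_i^{1/2}\langle\vartheta_i, g\rangle$.
  The expansion of $\tilde T$ also needs $\langle\xi_i', h\rangle = 0$ for $h \in \ker\iota^*$ and
  $\eta_i > 0$, that is, $J h = 0$. This is where the positive definiteness of $w$ itself enters: since
  $\mathrm{Re}\langle f, J f\rangle \ge 0$ for all $f$ and $\langle h, J g\rangle = 0$, the inequality for
  $f = h + t g$ with $t \in \mathbb R$ small forces $\mathrm{Re}\langle g, J h\rangle = 0$ for every $g$.
\<close>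

section \<open>Geometry of inner product spaces\<close>

text \<open>Two orthogonalities compete. Pseudoinverses refer to the inner product of
  \<open>L2 \<rho>\<close>, whereas J is symmetric only for the inner product weighted by d, in
  which the \<xi>_i are orthonormal. So the part h of f orthogonal to the range of \<iota> is not
  visibly annihilated by the \<xi>_i': multiplication by d may move h out of the kernel of the
  adjoint of \<iota>, and positive definiteness of k does not prevent this. Since J need not be
  normal, its trace norm and its multiplicities cannot be read off the diagonalisation either: the
  former is bounded through a factorisation of J into two Hilbert-Schmidt operators, the latter are
  counted by a Gram-Schmidt process inside each eigenspace. The metric space may be non-separable.
  Compact support supplies what is missing: almost everywhere boundedness of continuous functions,
  uniform continuity of w, which turns positive definiteness into nonnegativity of an integral, and
  countability of orthonormal sets, so that eigenvalues can be indexed by natural numbers.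
  Compactness of operators is derived from bounds on finite traces.\<close>

lemma complex_ring_simps [simp]:
  "carrier complex_ring = UNIV"
  "x \<otimes>\<^bsub>complex_ring\<^esub> y = x * y"
  "\<one>\<^bsub>complex_ring\<^esub> = 1"
  "\<zero>\<^bsub>complex_ring\<^esub> = 0"
  "x \<oplus>\<^bsub>complex_ring\<^esub> y = x + y"
  by (simp_all add: ring_of_type_algebra_def)

context complex_inner_space
begin

lemma smult_carrier [simp, intro]: "x \<in> carrier V \<Longrightarrow> c \<odot> x \<in> carrier V"
  by simp

lemma smult_add_left: "x \<in> carrier V \<Longrightarrow> (a + b) \<odot> x = a \<odot> x \<oplus> b \<odot> x"
  using smult_l_distr[of a b x] by simp

lemma smult_smult [simp]: "x \<in> carrier V \<Longrightarrow> a \<odot> (b \<odot> x) = (a * b) \<odot> x"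
  using smult_assoc1[of a b x] by simp

lemma smult_1 [simp]: "x \<in> carrier V \<Longrightarrow> 1 \<odot> x = x"
  using smult_one[of x] by simp

lemma smult_0 [simp]: "x \<in> carrier V \<Longrightarrow> 0 \<odot> x = \<zero>"
  using smult_l_null[of x] by simp

lemma smult_zero [simp]: "c \<odot> \<zero> = \<zero>"
  using smult_r_null[of c] by simp

lemma cinner_add_left:
  "\<lbrakk>x \<in> carrier V; y \<in> carrier V; z \<in> carrier V\<rbrakk> \<Longrightarrow>
     cinner V (x \<oplus> y) z = cinner V x z + cinner V y z"
  using cinner_commute[of "x \<oplus> y" z] cinner_commute[of x z] cinner_commute[of y z]
  by (simp add: cinner_add_right)

lemma cinner_smult_left:
  "\<lbrakk>x \<in> carrier V; y \<in> carrier V\<rbrakk> \<Longrightarrow> cinner V (c \<odot> x) y = cnj c * cinner V x y"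
  using cinner_commute[of "c \<odot> x" y] cinner_commute[of x y] by (simp add: cinner_smult_right)

lemma cinner_zero_right [simp]: "x \<in> carrier V \<Longrightarrow> cinner V x \<zero> = 0"
  using cinner_smult_right[of x \<zero> 0] by simp

lemma cinner_zero_left [simp]: "x \<in> carrier V \<Longrightarrow> cinner V \<zero> x = 0"
  using cinner_smult_left[of \<zero> x 0] by simp

lemma cinner_minus_right [simp]:
  "\<lbrakk>x \<in> carrier V; y \<in> carrier V\<rbrakk> \<Longrightarrow> cinner V x (\<ominus> y) = - cinner V x y"
  using cinner_add_right[of x y "\<ominus> y"] by (simp add: r_neg add_eq_0_iff)

lemma cinner_minus_left [simp]:
  "\<lbrakk>x \<in> carrier V; y \<in> carrier V\<rbrakk> \<Longrightarrow> cinner V (\<ominus> x) y = - cinner V x y"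
  using cinner_add_left[of x "\<ominus> x" y] by (simp add: r_neg add_eq_0_iff)

lemma cinner_diff_right:
  "\<lbrakk>x \<in> carrier V; y \<in> carrier V; z \<in> carrier V\<rbrakk> \<Longrightarrow>
     cinner V x (y \<ominus> z) = cinner V x y - cinner V x z"
  by (simp add: a_minus_def cinner_add_right)

lemma cinner_diff_left:
  "\<lbrakk>x \<in> carrier V; y \<in> carrier V; z \<in> carrier V\<rbrakk> \<Longrightarrow>
     cinner V (x \<ominus> y) z = cinner V x z - cinner V y z"
  by (simp add: a_minus_def cinner_add_left)

lemmas cinner_simps = cinner_add_left cinner_add_right cinner_smult_left cinner_smult_right
  cinner_diff_left cinner_diff_right

lemma cinner_self_real: "x \<in> carrier V \<Longrightarrow> Im (cinner V x x) = 0"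
  using cinner_commute[of x x] by (metis Reals_cnj_iff complex_is_Real_iff)

lemma cinner_self_nonneg: "x \<in> carrier V \<Longrightarrow> 0 \<le> Re (cinner V x x)"
  by (cases "x = \<zero>") (auto dest: cinner_pos[THEN less_imp_le])

lemma cnorm_sq: "x \<in> carrier V \<Longrightarrow> (cnorm V x)\<^sup>2 = Re (cinner V x x)"
  by (simp add: cnorm_def cinner_self_nonneg)

lemma cinner_self: "x \<in> carrier V \<Longrightarrow> cinner V x x = of_real ((cnorm V x)\<^sup>2)"
  by (simp add: cnorm_sq complex_eq_iff cinner_self_real)

lemma cnorm_nonneg [simp]: "x \<in> carrier V \<Longrightarrow> 0 \<le> cnorm V x"
  by (simp add: cnorm_def cinner_self_nonneg)

lemma cnorm_zero [simp]: "cnorm V \<zero> = 0"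
  by (simp add: cnorm_def)

lemma cinner_self_eq_0: "x \<in> carrier V \<Longrightarrow> cinner V x x = 0 \<longleftrightarrow> x = \<zero>"
  using cinner_pos by fastforce

lemma cnorm_eq_0 [simp]: "x \<in> carrier V \<Longrightarrow> cnorm V x = 0 \<longleftrightarrow> x = \<zero>"
  using cinner_self_eq_0 cinner_self by auto

lemma diff_eq_zero_iff: "\<lbrakk>x \<in> carrier V; y \<in> carrier V\<rbrakk> \<Longrightarrow> x \<ominus> y = \<zero> \<longleftrightarrow> x = y"
  by (metis a_minus_def minus_equality minus_minus r_neg a_inv_closed)

text \<open>Vector identities are proved by pairing both sides with an arbitrary vector, which turns
  them into identities between complex numbers.\<close>

lemma cinner_ext:
  assumes "x \<in> carrier V" "y \<in> carrier V" "\<And>z. z \<in> carrier V \<Longrightarrow> cinner V z x = cinner V z y"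
  shows "x = y"
  using assms diff_eq_zero_iff[of x y] cinner_self_eq_0[of "x \<ominus> y"]
  by (simp add: cinner_diff_right)

lemma cnorm_smult: "x \<in> carrier V \<Longrightarrow> cnorm V (c \<odot> x) = cmod c * cnorm V x"
proof -
  assume x: "x \<in> carrier V"
  have "cinner V (c \<odot> x) (c \<odot> x) = (c * cnj c) * cinner V x x"
    using x by (simp add: cinner_simps)
  also have "\<dots> = of_real ((cmod c)\<^sup>2 * (cnorm V x)\<^sup>2)"
    using x complex_norm_square[of c] by (simp add: cinner_self)
  finally have "(cnorm V (c \<odot> x))\<^sup>2 = (cmod c * cnorm V x)\<^sup>2"
    using x by (simp add: cnorm_sq power_mult_distrib)
  then show ?thesis
    using x by (simp add: power2_eq_iff_nonneg)
qed

lemma cnorm_sq_add: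
  "\<lbrakk>x \<in> carrier V; y \<in> carrier V\<rbrakk> \<Longrightarrow>
     (cnorm V (x \<oplus> y))\<^sup>2 = (cnorm V x)\<^sup>2 + (cnorm V y)\<^sup>2 + 2 * Re (cinner V x y)"
  using cinner_commute[of y x] by (simp add: cnorm_sq cinner_simps)

lemma cnorm_sq_diff:
  "\<lbrakk>x \<in> carrier V; y \<in> carrier V\<rbrakk> \<Longrightarrow>
     (cnorm V (x \<ominus> y))\<^sup>2 = (cnorm V x)\<^sup>2 + (cnorm V y)\<^sup>2 - 2 * Re (cinner V x y)"
  using cinner_commute[of y x] by (simp add: cnorm_sq cinner_simps)

lemma cauchy_schwarz:
  assumes x: "x \<in> carrier V" and y: "y \<in> carrier V"
  shows "cmod (cinner V x y) \<le> cnorm V x * cnorm V y"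
proof (cases "y = \<zero>")
  case True
  then show ?thesis using x by simp
next
  case False
  define n where "n = (cnorm V y)\<^sup>2"
  define a where "a = cinner V y x"
  have n: "n > 0" using False y by (simp add: n_def zero_less_power2)
  have yx: "cinner V x y = cnj a"
    using cinner_commute[of x y] x y by (simp add: a_def)
  \<comment> \<open>c y is the orthogonal projection of x on y; the inequality is the nonnegativity
    of the squared norm of x - c y.\<close>
  define c where "c = a / of_real n"
  have "cmod c = cmod a / n"
    using n by (simp add: c_def norm_divide)
  then have "(cnorm V (c \<odot> y))\<^sup>2 = (cmod a / n)\<^sup>2 * n"
    using y by (simp only: cnorm_smult n_def power_mult_distrib)
  then have "(cnorm V (c \<odot> y))\<^sup>2 = (cmod a)\<^sup>2 / n"
    using n by (simp add: power2_eq_square)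
  moreover have "Re (cinner V x (c \<odot> y)) = (cmod a)\<^sup>2 / n"
    using n x y by (simp add: cinner_simps yx c_def cmod_power2)
      (simp add: power2_eq_square add_divide_distrib)
  ultimately have "(cnorm V (x \<ominus> c \<odot> y))\<^sup>2 = (cnorm V x)\<^sup>2 - (cmod a)\<^sup>2 / n"
    using cnorm_sq_diff[of x "c \<odot> y"] x y by simp
  then have "(cmod a)\<^sup>2 / n \<le> (cnorm V x)\<^sup>2"
    by (metis diff_ge_0_iff_ge zero_le_power2)
  then have "(cmod a)\<^sup>2 \<le> (cnorm V x * cnorm V y)\<^sup>2"
    using n by (simp add: n_def divide_le_eq power_mult_distrib)
  then have "cmod a \<le> cnorm V x * cnorm V y"
    using x y by (simp add: power2_le_iff_abs_le)
  then show ?thesis by (simp add: yx)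
qed

lemma cnorm_triangle:
  assumes x: "x \<in> carrier V" and y: "y \<in> carrier V"
  shows "cnorm V (x \<oplus> y) \<le> cnorm V x + cnorm V y"
proof -
  have "Re (cinner V x y) \<le> cnorm V x * cnorm V y"
    using cauchy_schwarz[OF x y] complex_Re_le_cmod order_trans by blast
  then have "(cnorm V (x \<oplus> y))\<^sup>2 \<le> (cnorm V x + cnorm V y)\<^sup>2"
    using cnorm_sq_add[OF x y] by (simp add: power2_sum)
  then show ?thesis using x y by (simp add: power2_le_iff_abs_le)
qed

lemma cnorm_uminus [simp]: "x \<in> carrier V \<Longrightarrow> cnorm V (\<ominus> x) = cnorm V x"
  by (simp add: cnorm_def)

lemma diff_add_diff:
  "\<lbrakk>x \<in> carrier V; y \<in> carrier V; z \<in> carrier V\<rbrakk> \<Longrightarrow> (x \<ominus> y) \<oplus> (y \<ominus> z) = x \<ominus> z"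
  by (rule cinner_ext) (simp_all add: cinner_simps)

lemma cnorm_diff_commute: "\<lbrakk>x \<in> carrier V; y \<in> carrier V\<rbrakk> \<Longrightarrow> cnorm V (x \<ominus> y) = cnorm V (y \<ominus> x)"
  by (simp add: cnorm_def cinner_simps)

lemma cnorm_triangle_diff:
  "\<lbrakk>x \<in> carrier V; y \<in> carrier V; z \<in> carrier V\<rbrakk> \<Longrightarrow>
     cnorm V (x \<ominus> z) \<le> cnorm V (x \<ominus> y) + cnorm V (y \<ominus> z)"
  using cnorm_triangle[of "x \<ominus> y" "y \<ominus> z"] by (simp add: diff_add_diff)

lemma cnorm_triangle_add_diff:
  "\<lbrakk>x \<in> carrier V; y \<in> carrier V; x' \<in> carrier V; y' \<in> carrier V\<rbrakk> \<Longrightarrow>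
     cnorm V ((x \<oplus> y) \<ominus> (x' \<oplus> y')) \<le> cnorm V (x \<ominus> x') + cnorm V (y \<ominus> y')"
proof -
  assume *: "x \<in> carrier V" "y \<in> carrier V" "x' \<in> carrier V" "y' \<in> carrier V"
  then have "(x \<oplus> y) \<ominus> (x' \<oplus> y') = (x \<ominus> x') \<oplus> (y \<ominus> y')"
    by (intro cinner_ext) (simp_all add: cinner_simps)
  then show ?thesis using * cnorm_triangle[of "x \<ominus> x'" "y \<ominus> y'"] by simp
qed

lemma smult_diff: "\<lbrakk>x \<in> carrier V; y \<in> carrier V\<rbrakk> \<Longrightarrow> c \<odot> x \<ominus> c \<odot> y = c \<odot> (x \<ominus> y)"
  by (rule cinner_ext) (simp_all add: cinner_simps algebra_simps)

lemma metric_space_cdist: "Metric_space (carrier V) (cdist V)"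
proof
  show "0 \<le> cdist V x y" for x y by (simp add: cdist_def)
  show "cdist V x y = cdist V y x" for x y by (simp add: cdist_def cnorm_diff_commute)
  show "cdist V x y = 0 \<longleftrightarrow> x = y" if "x \<in> carrier V" "y \<in> carrier V" for x y
    using that by (simp add: cdist_def diff_eq_zero_iff)
  show "cdist V x z \<le> cdist V x y + cdist V y z"
    if "x \<in> carrier V" "y \<in> carrier V" "z \<in> carrier V" for x y z
    using that by (simp add: cdist_def cnorm_triangle_diff)
qed

lemma in_closure_iff:
  assumes "S \<subseteq> carrier V"
  shows "x \<in> norm_topology V closure_of S \<longleftrightarrow>
    x \<in> carrier V \<and> (\<forall>\<epsilon>>0. \<exists>y\<in>S. cnorm V (x \<ominus> y) < \<epsilon>)"
  using assms unfolding Metric_space.metric_closure_of[OF metric_space_cdist]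
    Metric_space.in_mball[OF metric_space_cdist]
  by (fastforce simp: cdist_def)

text \<open>\<open>cdist\<close> takes the default value 0 off the carrier, so eventual membership
  in the carrier has to accompany the convergence of norms.\<close>

lemma limitin_norm_iff:
  "limitin (norm_topology V) f l F \<longleftrightarrow>
     l \<in> carrier V \<and> (\<forall>\<^sub>F i in F. f i \<in> carrier V) \<and> ((\<lambda>i. cnorm V (f i \<ominus> l)) \<longlongrightarrow> 0) F"
  (is "?lhs \<longleftrightarrow> ?rhs")
proof -
  have *: "((\<lambda>i. cdist V (f i) l) \<longlongrightarrow> 0) F \<longleftrightarrow> ((\<lambda>i. cnorm V (f i \<ominus> l)) \<longlongrightarrow> 0) F"
    if "l \<in> carrier V" "\<forall>\<^sub>F i in F. f i \<in> carrier V"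
    using that by (intro tendsto_cong eventually_mono[OF that(2)]) (simp add: cdist_def)
  show ?thesis
    unfolding Metric_space.limitin_metric_dist_null[OF metric_space_cdist] using * by blast
qed

lemma cinner_finsum_right:
  assumes "finite F" "f \<in> F \<rightarrow> carrier V" "x \<in> carrier V"
  shows "cinner V x (\<Oplus>i\<in>F. f i) = (\<Sum>i\<in>F. cinner V x (f i))"
  using assms by (induction F rule: finite_induct) (auto simp: cinner_add_right)

lemma cinner_finsum_left:
  assumes "finite F" "f \<in> F \<rightarrow> carrier V" "x \<in> carrier V"
  shows "cinner V (\<Oplus>i\<in>F. f i) x = (\<Sum>i\<in>F. cinner V (f i) x)"
  using assms by (induction F rule: finite_induct) (auto simp: cinner_add_left)

lemma has_sum_in_iff:
  assumes "f \<in> I \<rightarrow> carrier V"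
  shows "has_sum_in V f I s \<longleftrightarrow> s \<in> carrier V \<and>
    (\<forall>\<epsilon>>0. \<exists>F. finite F \<and> F \<subseteq> I \<and>
       (\<forall>F'. finite F' \<and> F \<subseteq> F' \<and> F' \<subseteq> I \<longrightarrow> cnorm V ((\<Oplus>i\<in>F'. f i) \<ominus> s) < \<epsilon>))"
proof -
  have *: "\<forall>\<^sub>F F in finite_subsets_at_top I. (\<Oplus>i\<in>F. f i) \<in> carrier V"
    using assms by (intro eventually_finite_subsets_at_top_weakI) (auto intro!: finsum_closed)
  have cl: "(\<Oplus>i\<in>F'. f i) \<in> carrier V" if "F' \<subseteq> I" for F'
    using assms that by (intro finsum_closed) auto
  show ?thesis
    unfolding has_sum_in_def limitin_norm_iff tendsto_iff eventually_finite_subsets_at_top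
    using * cl unfolding eventually_finite_subsets_at_top by (auto simp: dist_real_def) 
qed


subsection \<open>Subspaces\<close>

text \<open>Closure under negation, which \<open>submoduleI\<close> also asks for, is closure under
  the scalar -1.\<close>

lemma subspaceI:
  assumes "M \<subseteq> carrier V" "\<zero> \<in> M" "\<And>x y. \<lbrakk>x \<in> M; y \<in> M\<rbrakk> \<Longrightarrow> x \<oplus> y \<in> M"
    "\<And>c x. x \<in> M \<Longrightarrow> c \<odot> x \<in> M"
  shows "submodule M complex_ring V"
proof (rule submoduleI)
  fix a assume a: "a \<in> M"
  then have "\<ominus> a = (-1) \<odot> a"
    using assms(1) by (intro cinner_ext) (auto simp: cinner_simps)
  then show "\<ominus> a \<in> M" using assms(4) a by simp
qed (use assms in auto)

lemma subspaceD:
  assumes "submodule M complex_ring V"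
  shows "M \<subseteq> carrier V" "x \<in> M \<Longrightarrow> x \<in> carrier V" "\<zero> \<in> M"
    "\<lbrakk>x \<in> M; y \<in> M\<rbrakk> \<Longrightarrow> x \<oplus> y \<in> M" "x \<in> M \<Longrightarrow> c \<odot> x \<in> M"
    "\<lbrakk>x \<in> M; y \<in> M\<rbrakk> \<Longrightarrow> x \<ominus> y \<in> M"
proof -
  note S = submoduleE[OF assms]
  show sub: "M \<subseteq> carrier V" and "x \<in> M \<Longrightarrow> x \<in> carrier V" using S(1) by auto
  show "\<lbrakk>x \<in> M; y \<in> M\<rbrakk> \<Longrightarrow> x \<oplus> y \<in> M" "\<lbrakk>x \<in> M; y \<in> M\<rbrakk> \<Longrightarrow> x \<ominus> y \<in> M" "x \<in> M \<Longrightarrow> c \<odot> x \<in> M"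
    using S(3-5) by (simp_all add: a_minus_def)
  obtain a where "a \<in> M" using S(2) by auto
  then have "0 \<odot> a \<in> M" "a \<in> carrier V" using S(1,4) by auto
  then show "\<zero> \<in> M" by simp
qed

lemma subspace_finsum:
  assumes "submodule M complex_ring V" "finite F" "\<And>i. i \<in> F \<Longrightarrow> f i \<in> M"
  shows "(\<Oplus>i\<in>F. f i) \<in> M"
  using assms(2,3)
proof (induction F rule: finite_induct)
  case empty
  then show ?case using subspaceD(3)[OF assms(1)] by simp
next
  case (insert a F)
  then have "f \<in> F \<rightarrow> carrier V" "f a \<in> carrier V" using subspaceD(2)[OF assms(1)] by auto
  then show ?case using insert subspaceD(4)[OF assms(1)] by simp
qed

lemma closed_iff:
  assumes "M \<subseteq> carrier V"
  shows "closedin (norm_topology V) M \<longleftrightarrow>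
    (\<forall>x\<in>carrier V. (\<forall>\<epsilon>>0. \<exists>y\<in>M. cnorm V (x \<ominus> y) < \<epsilon>) \<longrightarrow> x \<in> M)"
proof -
  have "closedin (norm_topology V) M \<longleftrightarrow> norm_topology V closure_of M \<subseteq> M"
    using assms Metric_space.topspace_mtopology[OF metric_space_cdist]
    by (simp add: closure_of_subset_eq[symmetric])
  also have "\<dots> \<longleftrightarrow> (\<forall>x\<in>carrier V. (\<forall>\<epsilon>>0. \<exists>y\<in>M. cnorm V (x \<ominus> y) < \<epsilon>) \<longrightarrow> x \<in> M)"
    using in_closure_iff[OF assms] by blast
  finally show ?thesis .
qed

lemma closure_superset: "M \<subseteq> carrier V \<Longrightarrow> M \<subseteq> norm_topology V closure_of M"
  by (rule closure_of_subset) (simp add: Metric_space.topspace_mtopology[OF metric_space_cdist])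

lemma closure_subset_carrier: "norm_topology V closure_of M \<subseteq> carrier V"
  using closure_of_subset_topspace[of "norm_topology V" M]
  by (simp add: Metric_space.topspace_mtopology[OF metric_space_cdist])

lemma closure_minimal:
  "\<lbrakk>M \<subseteq> N; closedin (norm_topology V) N\<rbrakk> \<Longrightarrow> norm_topology V closure_of M \<subseteq> N"
  by (rule closure_of_minimal)

lemma closure_submodule:
  assumes M: "submodule M complex_ring V"
  shows "submodule (norm_topology V closure_of M) complex_ring V"
proof (rule subspaceI)
  note Mc = subspaceD(1)[OF M]
  show "norm_topology V closure_of M \<subseteq> carrier V" by (rule closure_subset_carrier)
  show "\<zero> \<in> norm_topology V closure_of M"
    using closure_superset[OF Mc] subspaceD(3)[OF M] by blast
next
  note Mc = subspaceD(1)[OF M]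
  fix x y assume "x \<in> norm_topology V closure_of M" "y \<in> norm_topology V closure_of M"
  then have x: "x \<in> carrier V" "\<forall>\<epsilon>>0. \<exists>u\<in>M. cnorm V (x \<ominus> u) < \<epsilon>"
    and y: "y \<in> carrier V" "\<forall>\<epsilon>>0. \<exists>u\<in>M. cnorm V (y \<ominus> u) < \<epsilon>"
    using in_closure_iff[OF Mc] by auto
  have "\<exists>u\<in>M. cnorm V ((x \<oplus> y) \<ominus> u) < \<epsilon>" if "\<epsilon> > 0" for \<epsilon>
  proof -
    obtain u v where uv: "u \<in> M" "cnorm V (x \<ominus> u) < \<epsilon>/2" "v \<in> M" "cnorm V (y \<ominus> v) < \<epsilon>/2"
      using x y \<open>\<epsilon> > 0\<close> by (meson half_gt_zero)
    then have "cnorm V ((x \<oplus> y) \<ominus> (u \<oplus> v)) \<le> cnorm V (x \<ominus> u) + cnorm V (y \<ominus> v)"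
      using x y Mc by (intro cnorm_triangle_add_diff) auto
    then show ?thesis using uv subspaceD(4)[OF M, of u v] by (intro bexI[of _ "u \<oplus> v"]) auto
  qed
  then show "x \<oplus> y \<in> norm_topology V closure_of M"
    using in_closure_iff[OF Mc] x y by auto
next
  note Mc = subspaceD(1)[OF M]
  fix c x assume "x \<in> norm_topology V closure_of M"
  then have x: "x \<in> carrier V" "\<forall>\<epsilon>>0. \<exists>u\<in>M. cnorm V (x \<ominus> u) < \<epsilon>"
    using in_closure_iff[OF Mc] by auto
  have "\<exists>u\<in>M. cnorm V (c \<odot> x \<ominus> u) < \<epsilon>" if "\<epsilon> > 0" for \<epsilon>
  proof -
    \<comment> \<open>The summand 1 keeps the denominator positive when c = 0.\<close>
    have "\<epsilon> / (1 + cmod c) > 0" using \<open>\<epsilon> > 0\<close> by (simp add: add_pos_nonneg)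
    then obtain u where u: "u \<in> M" "cnorm V (x \<ominus> u) < \<epsilon> / (1 + cmod c)" using x by blast
    have "cnorm V (c \<odot> x \<ominus> c \<odot> u) = cmod c * cnorm V (x \<ominus> u)"
      using x u Mc by (subst smult_diff) (auto simp: cnorm_smult)
    also have "\<dots> \<le> (1 + cmod c) * cnorm V (x \<ominus> u)"
      using x u Mc by (intro mult_right_mono) auto
    also have "\<dots> < \<epsilon>" using u by (simp add: pos_less_divide_eq add_pos_nonneg mult.commute)
    finally show ?thesis using subspaceD(5)[OF M u(1)] by (intro bexI[of _ "c \<odot> u"])
  qed
  then show "c \<odot> x \<in> norm_topology V closure_of M"
    using in_closure_iff[OF Mc] x by auto
qed

lemma closed_closure: "closedin (norm_topology V) (norm_topology V closure_of M)"
  by simp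

lemma closed_carrier: "closedin (norm_topology V) (carrier V)"
  by (subst closed_iff) auto

lemma orth_complement_submodule:
  assumes "S \<subseteq> carrier V"
  shows "submodule (orth_complement V S) complex_ring V"
  using assms by (intro subspaceI) (auto simp: orth_complement_def cinner_simps subset_iff)

lemma orth_complement_closed:
  assumes S: "S \<subseteq> carrier V"
  shows "closedin (norm_topology V) (orth_complement V S)"
proof (subst closed_iff, safe)
  show "x \<in> carrier V" if "x \<in> orth_complement V S" for x
    using that by (simp add: orth_complement_def)
  fix x assume x: "x \<in> carrier V" "\<forall>\<epsilon>>0. \<exists>y\<in>orth_complement V S. cnorm V (x \<ominus> y) < \<epsilon>"
  have "cinner V s x = 0" if s: "s \<in> S" for s
  proof (rule ccontr)
    assume ne: "cinner V s x \<noteq> 0"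
    have sc: "s \<in> carrier V" using s S by auto
    \<comment> \<open>Within this radius of x lies some y orthogonal to s; Cauchy-Schwarz for s and
      x - y then makes |<s, x>| smaller than itself.\<close>
    have "cmod (cinner V s x) / (1 + cnorm V s) > 0"
      using ne sc by (simp add: add_pos_nonneg)
    then obtain y where y: "y \<in> orth_complement V S"
      "cnorm V (x \<ominus> y) < cmod (cinner V s x) / (1 + cnorm V s)"
      using x by blast
    then have yc: "y \<in> carrier V" "cinner V s y = 0" using s by (auto simp: orth_complement_def)
    have "cmod (cinner V s x) = cmod (cinner V s (x \<ominus> y))"
      using yc x sc by (simp add: cinner_simps)
    also have "\<dots> \<le> cnorm V s * cnorm V (x \<ominus> y)"
      using yc x sc by (intro cauchy_schwarz) auto
    also have "\<dots> \<le> (1 + cnorm V s) * cnorm V (x \<ominus> y)"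
      using yc x by (intro mult_right_mono) auto
    also have "\<dots> < cmod (cinner V s x)"
      using y(2) sc by (simp add: pos_less_divide_eq add_pos_nonneg mult.commute)
    finally show False by simp
  qed
  then show "x \<in> orth_complement V S" using x by (simp add: orth_complement_def)
qed

lemma lin_span_submodule:
  assumes S: "S \<subseteq> carrier V"
  shows "submodule (lin_span V S) complex_ring V"
proof (rule subspaceI)
  have fc: "(\<lambda>x. c x \<odot> x) \<in> F \<rightarrow> carrier V" if "F \<subseteq> S" for F and c :: "_ \<Rightarrow> complex"
    using that S by auto
  show "lin_span V S \<subseteq> carrier V"
    using fc by (auto simp: lin_span_def intro!: finsum_closed)
  show "\<zero> \<in> lin_span V S"
    unfolding lin_span_def by (rule CollectI, rule exI[of _ "\<lambda>_. 0"], rule exI[of _ "{}"]) simp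
  fix c x assume "x \<in> lin_span V S"
  then obtain a F where F: "finite F" "F \<subseteq> S" "x = (\<Oplus>v\<in>F. a v \<odot> v)"
    unfolding lin_span_def by auto
  then have "c \<odot> x = (\<Oplus>v\<in>F. c \<odot> (a v \<odot> v))"
    using fc by (simp add: finsum_smult_ldistr)
  also have "\<dots> = (\<Oplus>v\<in>F. (c * a v) \<odot> v)"
    using F S by (intro finsum_cong') auto
  finally show "c \<odot> x \<in> lin_span V S"
    unfolding lin_span_def using F
    by (intro CollectI exI[of _ "\<lambda>v. c * a v"] exI[of _ F]) auto
next
  have fc: "(\<lambda>x. c x \<odot> x) \<in> F \<rightarrow> carrier V" if "F \<subseteq> S" for F and c :: "_ \<Rightarrow> complex"
    using that S by auto
  fix x y assume "x \<in> lin_span V S" "y \<in> lin_span V S"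
  then obtain a F b G where F: "finite F" "F \<subseteq> S" "x = (\<Oplus>v\<in>F. a v \<odot> v)"
    and G: "finite G" "G \<subseteq> S" "y = (\<Oplus>v\<in>G. b v \<odot> v)"
    unfolding lin_span_def by auto
  \<comment> \<open>Coefficients in \<open>lin_span\<close> are indexed by vectors; extended by 0,
    both combinations run over F \<union> G.\<close>
  define a' where "a' v = (if v \<in> F then a v else 0)" for v
  define b' where "b' v = (if v \<in> G then b v else 0)" for v
  have "x = (\<Oplus>v\<in>F \<union> G. a' v \<odot> v)"
    unfolding F(3) using F G S by (intro add.finprod_mono_neutral_cong) (auto simp: a'_def)
  moreover have "y = (\<Oplus>v\<in>F \<union> G. b' v \<odot> v)"
    unfolding G(3) using F G S by (intro add.finprod_mono_neutral_cong) (auto simp: b'_def)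
  ultimately have "x \<oplus> y = (\<Oplus>v\<in>F \<union> G. a' v \<odot> v \<oplus> b' v \<odot> v)"
    using F G fc by (simp add: finsum_addf)
  also have "\<dots> = (\<Oplus>v\<in>F \<union> G. (a' v + b' v) \<odot> v)"
    using F G S by (intro finsum_cong') (auto simp: smult_add_left)
  finally show "x \<oplus> y \<in> lin_span V S"
    unfolding lin_span_def using F G
    by (intro CollectI exI[of _ "\<lambda>v. a' v + b' v"] exI[of _ "F \<union> G"]) auto
qed

lemma lin_span_carrier: "S \<subseteq> carrier V \<Longrightarrow> lin_span V S \<subseteq> carrier V"
  using subspaceD(1)[OF lin_span_submodule] .

lemma lin_span_superset:
  assumes "S \<subseteq> carrier V" shows "S \<subseteq> lin_span V S"
proof
  fix x assume "x \<in> S"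
  then show "x \<in> lin_span V S"
    unfolding lin_span_def using assms
    by (intro CollectI exI[of _ "\<lambda>_. 1"] exI[of _ "{x}"]) auto
qed

lemma lin_span_minimal:
  assumes "S \<subseteq> M" "submodule M complex_ring V"
  shows "lin_span V S \<subseteq> M"
  using assms by (auto simp: lin_span_def intro!: subspace_finsum subspaceD(5))

text \<open>The family e may repeat vectors, so the indexed sum is not literally a combination over
  a set as in \<open>lin_span\<close>; closure of the span under sums bridges this.\<close>

lemma lin_span_image:
  assumes "finite F" "F \<subseteq> I" "e \<in> I \<rightarrow> carrier V"
  shows "(\<Oplus>i\<in>F. c i \<odot> e i) \<in> lin_span V (e ` I)"
proof -
  have sub: "e ` I \<subseteq> carrier V" using assms by auto
  show ?thesis
    using assms(1,2) lin_span_superset[OF sub]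
    by (intro subspace_finsum lin_span_submodule[OF sub] subspaceD(5)[OF lin_span_submodule[OF sub]])
      auto
qed

text \<open>Orthogonality to x is a closed linear condition: if S lies in the complement of {x}, so
  does its closed span by minimality.\<close>

lemma orth_complement_closed_span:
  assumes S: "S \<subseteq> carrier V"
  shows "orth_complement V (norm_topology V closure_of lin_span V S) = orth_complement V S"
proof -
  have "S \<subseteq> norm_topology V closure_of lin_span V S"
    using lin_span_superset[OF S] closure_superset[OF lin_span_carrier[OF S]] by blast
  moreover have "cinner V y x = 0"
    if x: "x \<in> orth_complement V S" and y: "y \<in> norm_topology V closure_of lin_span V S" for x y
  proof -
    have xc: "x \<in> carrier V" using x by (simp add: orth_complement_def)
    have sub: "{x} \<subseteq> carrier V" using xc by simp
    have "S \<subseteq> orth_complement V {x}"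
    proof
      fix s assume "s \<in> S"
      then show "s \<in> orth_complement V {x}"
        using x S cinner_commute[of x s] xc by (auto simp: orth_complement_def)
    qed
    then have "norm_topology V closure_of lin_span V S \<subseteq> orth_complement V {x}"
      by (intro closure_minimal lin_span_minimal orth_complement_closed
          orth_complement_submodule sub)
    then have "y \<in> carrier V" "cinner V x y = 0" using y by (auto simp: orth_complement_def)
    then show ?thesis using cinner_commute[of y x] xc by simp
  qed
  ultimately show ?thesis by (auto simp: orth_complement_def)
qed

end

section \<open>Orthonormal families, the Riesz lemma and projections\<close>

text \<open>\<open>orthonormal_basis\<close> stripped of its closure clause: the part that
  subfamilies inherit and to which Bessel's inequality applies.\<close>

definition orthonormal :: "'v inner_space \<Rightarrow> 'i set \<Rightarrow> ('i \<Rightarrow> 'v) \<Rightarrow> bool" where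
  "orthonormal V I e \<longleftrightarrow>
     e ` I \<subseteq> carrier V \<and> (\<forall>i\<in>I. \<forall>j\<in>I. cinner V (e i) (e j) = of_bool (i = j))"

lemma orthonormalD:
  assumes "orthonormal V I e"
  shows "i \<in> I \<Longrightarrow> e i \<in> carrier V" "e ` I \<subseteq> carrier V" "e \<in> I \<rightarrow> carrier V"
    "\<lbrakk>i \<in> I; j \<in> I\<rbrakk> \<Longrightarrow> cinner V (e i) (e j) = (if i = j then 1 else 0)"
  using assms by (auto simp: orthonormal_def)

lemma orthonormal_subset: "\<lbrakk>orthonormal V I e; J \<subseteq> I\<rbrakk> \<Longrightarrow> orthonormal V J e"
  unfolding orthonormal_def by blast

lemma orthonormal_reindex:
  assumes "inj_on f I" "orthonormal V (f ` I) e"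
  shows "orthonormal V I (\<lambda>i. e (f i))"
  using assms unfolding orthonormal_def by (auto simp: inj_on_eq_iff)

lemma orthonormal_basis_iff:
  "orthonormal_basis V S I e \<longleftrightarrow>
     orthonormal V I e \<and> norm_topology V closure_of lin_span V (e ` I) = S"
  by (auto simp: orthonormal_basis_def orthonormal_def)

text \<open>A quadratic polynomial that vanishes at 0 and is nonnegative everywhere has a minimum at
  0, so its derivative 2 r there is zero. This is the first-variation argument behind the Riesz
  lemma and behind \<open>J_eq_0_if_coinc_eq_0\<close>.\<close>

lemma quadratic_nonneg_imp_zero:
  fixes a r :: real
  assumes "\<And>t. 0 \<le> t\<^sup>2 * a + 2 * t * r"
  shows "r = 0"
proof (rule ccontr)
  assume r: "r \<noteq> 0"
  \<comment> \<open>Any positive b above a serves: at t = - r / b the polynomial equals r^2 / b * (a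
    / b - 2).\<close>
  define b where "b = \<bar>a\<bar> + 1"
  have b: "b > 0" "a < b" by (auto simp: b_def)
  have "(- r / b)\<^sup>2 * a + 2 * (- r / b) * r = r\<^sup>2 / b * (a / b - 2)"
    using b by (simp add: power2_eq_square field_simps)
  moreover have "a / b < 2" using b by (simp add: divide_less_eq)
  moreover have "r\<^sup>2 / b > 0" using r b by simp
  ultimately have "(- r / b)\<^sup>2 * a + 2 * (- r / b) * r < 0"
    by (simp only: mult_pos_neg diff_less_0_iff_less)
  then show False using assms[of "- r / b"] by simp
qed

context complex_inner_space
begin

lemma orthonormal_cnorm: "\<lbrakk>orthonormal V I e; i \<in> I\<rbrakk> \<Longrightarrow> cnorm V (e i) = 1"
  using orthonormalD(4)[of V I e i i] by (simp add: cnorm_def)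

lemma orthonormal_coeff:
  assumes e: "orthonormal V I e" and F: "finite F" "F \<subseteq> I" and j: "j \<in> I"
  shows "cinner V (e j) (\<Oplus>i\<in>F. c i \<odot> e i) = (if j \<in> F then c j else 0)"
proof -
  have "cinner V (e j) (\<Oplus>i\<in>F. c i \<odot> e i) = (\<Sum>i\<in>F. cinner V (e j) (c i \<odot> e i))"
    using F j orthonormalD(1)[OF e] by (intro cinner_finsum_right) auto
  also have "\<dots> = (\<Sum>i\<in>F. if i = j then c i else 0)"
    using F j orthonormalD(1)[OF e] orthonormalD(4)[OF e]
    by (intro sum.cong refl) (auto simp: cinner_smult_right subset_iff)
  finally show ?thesis using F by (simp add: sum.delta')
qed

lemma orthonormal_combination_carrier:
  assumes "orthonormal V I e" "F \<subseteq> I"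
  shows "(\<Oplus>i\<in>F. c i \<odot> e i) \<in> carrier V"
  using assms orthonormalD(1) by (intro finsum_closed) (fastforce simp: Pi_iff)

lemma pythagoras:
  assumes "x \<in> carrier V" "y \<in> carrier V" "cinner V x y = 0"
  shows "(cnorm V (x \<oplus> y))\<^sup>2 = (cnorm V x)\<^sup>2 + (cnorm V y)\<^sup>2"
  using cnorm_sq_add[OF assms(1,2)] assms(3) by simp

lemma cnorm_sq_combination:
  assumes e: "orthonormal V I e" and F: "finite F" "F \<subseteq> I"
  shows "(cnorm V (\<Oplus>i\<in>F. c i \<odot> e i))\<^sup>2 = (\<Sum>i\<in>F. (cmod (c i))\<^sup>2)"
proof -
  let ?p = "\<Oplus>i\<in>F. c i \<odot> e i"
  have p: "?p \<in> carrier V" by (rule orthonormal_combination_carrier[OF e F(2)])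
  have "cinner V ?p ?p = (\<Sum>i\<in>F. cinner V (c i \<odot> e i) ?p)"
    using F p orthonormalD(1)[OF e] by (intro cinner_finsum_left) auto
  also have "\<dots> = (\<Sum>i\<in>F. cnj (c i) * c i)"
    using F p orthonormalD(1)[OF e] orthonormal_coeff[OF e F]
    by (intro sum.cong refl) (auto simp: cinner_smult_left subset_iff)
  also have "\<dots> = (\<Sum>i\<in>F. of_real ((cmod (c i))\<^sup>2))"
    by (simp only: complex_norm_square mult.commute)
  finally show ?thesis using p by (simp add: cnorm_sq)
qed

text \<open>For an orthonormal family and finite F this is the orthogonal projection of x onto the
  span of the e i with i \<in> F.\<close>

definition fourier_sum :: "('i \<Rightarrow> 'v) \<Rightarrow> 'i set \<Rightarrow> 'v \<Rightarrow> 'v" where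
  "fourier_sum e F x = (\<Oplus>i\<in>F. cinner V (e i) x \<odot> e i)"

lemma fourier_sum_carrier:
  "\<lbrakk>orthonormal V I e; F \<subseteq> I\<rbrakk> \<Longrightarrow> fourier_sum e F x \<in> carrier V"
  unfolding fourier_sum_def by (rule orthonormal_combination_carrier)

lemma fourier_residual_orth:
  assumes e: "orthonormal V I e" and F: "finite F" "F \<subseteq> I" and x: "x \<in> carrier V"
    and u: "u \<in> lin_span V (e ` F)"
  shows "cinner V (x \<ominus> fourier_sum e F x) u = 0"
proof -
  have p: "fourier_sum e F x \<in> carrier V" by (rule fourier_sum_carrier[OF e F(2)])
  have "e ` F \<subseteq> orth_complement V {x \<ominus> fourier_sum e F x}"
  proof safe
    fix i assume i: "i \<in> F"
    then have ic: "e i \<in> carrier V" "i \<in> I" using F orthonormalD(1)[OF e] by auto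
    have "cinner V (e i) (x \<ominus> fourier_sum e F x) = 0"
      using i ic p x orthonormal_coeff[OF e F, of i]
      by (simp add: cinner_diff_right fourier_sum_def)
    then show "e i \<in> orth_complement V {x \<ominus> fourier_sum e F x}"
      using ic p x cinner_commute[of "x \<ominus> fourier_sum e F x" "e i"]
      by (simp add: orth_complement_def)
  qed
  then have "lin_span V (e ` F) \<subseteq> orth_complement V {x \<ominus> fourier_sum e F x}"
    using p x by (intro lin_span_minimal orth_complement_submodule) auto
  then show ?thesis using u by (auto simp: orth_complement_def)
qed

lemma fourier_sum_in_span:
  assumes "orthonormal V I e" "finite F" "F \<subseteq> I"
  shows "fourier_sum e F x \<in> lin_span V (e ` F)"
  unfolding fourier_sum_def
  using assms orthonormalD(3)[OF orthonormal_subset[OF assms(1,3)]]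
  by (intro lin_span_image) auto

lemma fourier_residual_norm:
  assumes e: "orthonormal V I e" and F: "finite F" "F \<subseteq> I" and x: "x \<in> carrier V"
  shows "(cnorm V (x \<ominus> fourier_sum e F x))\<^sup>2
    = (cnorm V x)\<^sup>2 - (\<Sum>i\<in>F. (cmod (cinner V (e i) x))\<^sup>2)"
proof -
  have p: "fourier_sum e F x \<in> carrier V" by (rule fourier_sum_carrier[OF e F(2)])
  have "x = (x \<ominus> fourier_sum e F x) \<oplus> fourier_sum e F x"
    using x p by (intro cinner_ext) (simp_all add: cinner_simps)
  then have "(cnorm V x)\<^sup>2 =
      (cnorm V (x \<ominus> fourier_sum e F x))\<^sup>2 + (cnorm V (fourier_sum e F x))\<^sup>2"
    using pythagoras[of "x \<ominus> fourier_sum e F x" "fourier_sum e F x"] p x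
      fourier_residual_orth[OF e F x fourier_sum_in_span[OF e F]] by simp
  moreover have "(cnorm V (fourier_sum e F x))\<^sup>2 = (\<Sum>i\<in>F. (cmod (cinner V (e i) x))\<^sup>2)"
    unfolding fourier_sum_def by (rule cnorm_sq_combination[OF e F])
  ultimately show ?thesis by simp
qed

lemma bessel:
  assumes "orthonormal V I e" "finite F" "F \<subseteq> I" "x \<in> carrier V"
  shows "(\<Sum>i\<in>F. (cmod (cinner V (e i) x))\<^sup>2) \<le> (cnorm V x)\<^sup>2"
  using fourier_residual_norm[OF assms] zero_le_power2[of "cnorm V (x \<ominus> fourier_sum e F x)"]
  by linarith

lemma bessel_summable:
  assumes "orthonormal V I e" "x \<in> carrier V"
  shows "(\<lambda>i. (cmod (cinner V (e i) x))\<^sup>2) summable_on I"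
  using bessel[OF assms(1) _ _ assms(2)]
  by (intro nonneg_bdd_above_summable_on bdd_aboveI2[where M = "(cnorm V x)\<^sup>2"]) auto

text \<open>x - u is the residual, orthogonal to the span, plus a vector of the span; by Pythagoras
  the residual alone is not longer.\<close>

lemma fourier_best_approximation:
  assumes e: "orthonormal V I e" and F: "finite F" "F \<subseteq> I" and x: "x \<in> carrier V"
    and u: "u \<in> lin_span V (e ` F)"
  shows "cnorm V (x \<ominus> fourier_sum e F x) \<le> cnorm V (x \<ominus> u)"
proof -
  have sub: "e ` F \<subseteq> carrier V" using F orthonormalD(1)[OF e] by auto
  note S = lin_span_submodule[OF sub]
  have uc: "u \<in> carrier V" using lin_span_carrier[OF sub] u by auto
  have p: "fourier_sum e F x \<in> carrier V" by (rule fourier_sum_carrier[OF e F(2)])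
  let ?y = "x \<ominus> fourier_sum e F x" and ?z = "fourier_sum e F x \<ominus> u"
  have "?z \<in> lin_span V (e ` F)"
    by (intro subspaceD(6)[OF S] u fourier_sum_in_span[OF e F])
  then have "(cnorm V (?y \<oplus> ?z))\<^sup>2 = (cnorm V ?y)\<^sup>2 + (cnorm V ?z)\<^sup>2"
    using fourier_residual_orth[OF e F x] p x uc by (intro pythagoras) auto
  moreover have "?y \<oplus> ?z = x \<ominus> u" by (rule diff_add_diff[OF x p uc])
  ultimately have "(cnorm V ?y)\<^sup>2 \<le> (cnorm V (x \<ominus> u))\<^sup>2" by simp
  then show ?thesis using p x uc by (simp add: power2_le_iff_abs_le)
qed

text \<open>A vector of the span close to x involves only finitely many e i; for every larger finite
  index set the Fourier sum is at least as close, which is convergence along the net of finite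
  subsets.\<close>

lemma fourier_approximation:
  assumes e: "orthonormal V I e" and x: "x \<in> norm_topology V closure_of lin_span V (e ` I)"
    and \<epsilon>: "\<epsilon> > 0"
  obtains F where "finite F" "F \<subseteq> I"
    "\<forall>F'. finite F' \<longrightarrow> F \<subseteq> F' \<longrightarrow> F' \<subseteq> I \<longrightarrow> cnorm V (x \<ominus> fourier_sum e F' x) < \<epsilon>"
proof -
  note sub = orthonormalD(2)[OF e]
  obtain u where u: "u \<in> lin_span V (e ` I)" "cnorm V (x \<ominus> u) < \<epsilon>" and xc: "x \<in> carrier V"
    using x \<epsilon> in_closure_iff[OF lin_span_carrier[OF sub]] by blast
  obtain c G where G: "finite G" "G \<subseteq> e ` I" "u = (\<Oplus>v\<in>G. c v \<odot> v)"
    using u(1) by (auto simp: lin_span_def)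
  obtain F where F: "F \<subseteq> I" "finite F" "G = e ` F"
    using finite_subset_image[OF G(1,2)] by blast
  have "cnorm V (x \<ominus> fourier_sum e F' x) < \<epsilon>" if F': "finite F'" "F \<subseteq> F'" "F' \<subseteq> I" for F'
  proof -
    have "u \<in> lin_span V (e ` F')"
      unfolding lin_span_def using G F F' by blast
    then show ?thesis
      using fourier_best_approximation[OF e F'(1,3) xc] u(2) by force
  qed
  then show ?thesis using F that[of F] by simp
qed

lemma fourier_has_sum:
  assumes e: "orthonormal V I e" and x: "x \<in> norm_topology V closure_of lin_span V (e ` I)"
  shows "has_sum_in V (\<lambda>i. cinner V (e i) x \<odot> e i) I x"
proof (subst has_sum_in_iff)
  have xc: "x \<in> carrier V" using x closure_subset_carrier by blast
  show "(\<lambda>i. cinner V (e i) x \<odot> e i) \<in> I \<rightarrow> carrier V" using orthonormalD(1)[OF e] by auto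
  have *: "\<exists>F. finite F \<and> F \<subseteq> I \<and> (\<forall>F'. finite F' \<and> F \<subseteq> F' \<and> F' \<subseteq> I \<longrightarrow>
      cnorm V ((\<Oplus>i\<in>F'. cinner V (e i) x \<odot> e i) \<ominus> x) < \<epsilon>)" if "\<epsilon> > 0" for \<epsilon>
  proof -
    note \<epsilon> = that
    have "cnorm V (x \<ominus> fourier_sum e F' x) = cnorm V ((\<Oplus>i\<in>F'. cinner V (e i) x \<odot> e i) \<ominus> x)"
      if "F' \<subseteq> I" for F'
      using cnorm_diff_commute[OF xc fourier_sum_carrier[OF e that]] by (simp add: fourier_sum_def)
    moreover obtain F where F: "finite F" "F \<subseteq> I"
      "\<forall>F'. finite F' \<longrightarrow> F \<subseteq> F' \<longrightarrow> F' \<subseteq> I \<longrightarrow> cnorm V (x \<ominus> fourier_sum e F' x) < \<epsilon>"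
      by (rule fourier_approximation[OF e x \<epsilon>])
    ultimately show ?thesis by (intro exI[of _ F]) simp
  qed
  then show "x \<in> carrier V \<and> (\<forall>\<epsilon>>0. \<exists>F. finite F \<and> F \<subseteq> I \<and>
      (\<forall>F'. finite F' \<and> F \<subseteq> F' \<and> F' \<subseteq> I \<longrightarrow>
        cnorm V ((\<Oplus>i\<in>F'. cinner V (e i) x \<odot> e i) \<ominus> x) < \<epsilon>))"
    using xc * by (intro conjI allI impI)
qed

text \<open>By \<open>fourier_residual_norm\<close> the defect of a partial sum is the square of the
  residual norm, hence the tolerance sqrt \<epsilon>.\<close>

lemma parseval:
  assumes e: "orthonormal V I e" and x: "x \<in> norm_topology V closure_of lin_span V (e ` I)"
  shows "((\<lambda>i. (cmod (cinner V (e i) x))\<^sup>2) has_sum (cnorm V x)\<^sup>2) I"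
proof -
  have xc: "x \<in> carrier V" using x closure_subset_carrier by blast
  have "\<exists>F. finite F \<and> F \<subseteq> I \<and> (\<forall>F'. finite F' \<and> F \<subseteq> F' \<and> F' \<subseteq> I \<longrightarrow>
      dist (\<Sum>i\<in>F'. (cmod (cinner V (e i) x))\<^sup>2) ((cnorm V x)\<^sup>2) < \<epsilon>)" if "\<epsilon> > 0" for \<epsilon>
  proof -
    have s\<epsilon>: "sqrt \<epsilon> > 0" using that by simp
    obtain F where F: "finite F" "F \<subseteq> I"
      "\<forall>F'. finite F' \<longrightarrow> F \<subseteq> F' \<longrightarrow> F' \<subseteq> I \<longrightarrow> cnorm V (x \<ominus> fourier_sum e F' x) < sqrt \<epsilon>"
      by (rule fourier_approximation[OF e x s\<epsilon>])
    have "dist (\<Sum>i\<in>F'. (cmod (cinner V (e i) x))\<^sup>2) ((cnorm V x)\<^sup>2) < \<epsilon>"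
      if F': "finite F'" "F \<subseteq> F'" "F' \<subseteq> I" for F'
    proof -
      have "cnorm V (x \<ominus> fourier_sum e F' x) \<ge> 0"
        using xc fourier_sum_carrier[OF e F'(3)] by simp
      then have "(cnorm V (x \<ominus> fourier_sum e F' x))\<^sup>2 < (sqrt \<epsilon>)\<^sup>2"
        using F(3) F' by (intro power_strict_mono) auto
      then show ?thesis
        using fourier_residual_norm[OF e F'(1,3) xc] bessel[OF e F'(1,3) xc] \<open>\<epsilon> > 0\<close>
        by (simp add: dist_real_def)
    qed
    then show ?thesis using F(1,2) by (intro exI[of _ F]) auto
  qed
  then show ?thesis
    unfolding has_sum_def tendsto_iff eventually_finite_subsets_at_top by blast
qed

lemma orthonormal_basis_orth_zero:
  assumes e: "orthonormal_basis V (carrier V) I e" and x: "x \<in> carrier V"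
    and orth: "\<And>i. i \<in> I \<Longrightarrow> cinner V (e i) x = 0"
  shows "x = \<zero>"
proof -
  have "((\<lambda>i. (cmod (cinner V (e i) x))\<^sup>2) has_sum (cnorm V x)\<^sup>2) I"
    using e x by (intro parseval) (auto simp: orthonormal_basis_iff)
  moreover have "((\<lambda>i. (cmod (cinner V (e i) x))\<^sup>2) has_sum 0) I"
    by (rule has_sum_0) (simp add: orth)
  ultimately have "(cnorm V x)\<^sup>2 = 0" by (rule has_sum_unique)
  then show ?thesis using x by simp
qed

lemma orthonormal_basis_ext:
  assumes "orthonormal_basis V (carrier V) I e" "x \<in> carrier V" "y \<in> carrier V"
    and "\<And>i. i \<in> I \<Longrightarrow> cinner V (e i) x = cinner V (e i) y"
  shows "x = y"
proof -
  have "e i \<in> carrier V" if "i \<in> I" for i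
    using assms(1) that by (auto simp: orthonormal_basis_def)
  then have "x \<ominus> y = \<zero>"
    using assms by (intro orthonormal_basis_orth_zero[OF assms(1)]) (auto simp: cinner_diff_right)
  then show ?thesis using assms diff_eq_zero_iff by simp
qed

lemma tendsto_cinner_left:
  assumes "\<And>n. f n \<in> carrier V" "x \<in> carrier V" "v \<in> carrier V"
    "(\<lambda>n::nat. cnorm V (f n \<ominus> x)) \<longlonglongrightarrow> 0"
  shows "(\<lambda>n. cinner V (f n) v) \<longlonglongrightarrow> cinner V x v"
proof -
  have "(\<lambda>n. cinner V (f n) v - cinner V x v) \<longlonglongrightarrow> 0"
  proof (rule Lim_null_comparison)
    show "\<forall>\<^sub>F n in sequentially. norm (cinner V (f n) v - cinner V x v)
        \<le> cnorm V (f n \<ominus> x) * cnorm V v"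
      using assms cauchy_schwarz[of "f _ \<ominus> x" v]
      by (intro always_eventually allI) (simp add: cinner_diff_left)
    show "(\<lambda>n. cnorm V (f n \<ominus> x) * cnorm V v) \<longlonglongrightarrow> 0"
      using tendsto_mult_left_zero[OF assms(4)] by simp
  qed
  then show ?thesis by (simp add: LIM_zero_iff)
qed

end

context complex_hilbert_space
begin

lemma cauchy_limit:
  assumes s: "\<And>n. s n \<in> carrier V"
    and c: "\<And>\<epsilon>. \<epsilon> > 0 \<Longrightarrow> \<exists>N. \<forall>m\<ge>N. \<forall>n\<ge>N. cnorm V (s m \<ominus> s n) < \<epsilon>"
  obtains x where "x \<in> carrier V" "(\<lambda>n::nat. cnorm V (s n \<ominus> x)) \<longlonglongrightarrow> 0"
proof -
  have "Metric_space.MCauchy (carrier V) (cdist V) s"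
    unfolding Metric_space.MCauchy_def[OF metric_space_cdist] using s c
    by (auto simp: cdist_def)
  then obtain x where "limitin (norm_topology V) s x sequentially"
    using complete unfolding Metric_space.mcomplete_def[OF metric_space_cdist] by blast
  then show ?thesis using that unfolding limitin_norm_iff by blast
qed

text \<open>The representing vector minimises \<open>\<parallel>v\<parallel>\<^sup>2 - 2 Re (\<phi> v)\<close> over \<open>M\<close>; minimising sequences are
  Cauchy by the parallelogram law.\<close>

lemma riesz_closed_subspace:
  assumes M: "submodule M complex_ring V" and cl: "closedin (norm_topology V) M"
    and add: "\<And>x y. \<lbrakk>x \<in> M; y \<in> M\<rbrakk> \<Longrightarrow> \<phi> (x \<oplus> y) = \<phi> x + \<phi> y"
    and smult: "\<And>c x. x \<in> M \<Longrightarrow> \<phi> (c \<odot> x) = c * \<phi> x"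
    and bound: "\<And>x. x \<in> M \<Longrightarrow> 2 * Re (\<phi> x) \<le> (cnorm V x)\<^sup>2 + B"
  obtains u where "u \<in> M" "\<forall>v\<in>M. \<phi> v = cinner V u v"
proof -
  define J where "J v = (cnorm V v)\<^sup>2 - 2 * Re (\<phi> v)" for v
  define m where "m = Inf (J ` M)"
  have bdd: "bdd_below (J ` M)"
    using bound by (intro bdd_belowI2[of _ "- B"]) (fastforce simp: J_def)
  have m: "m \<le> J v" if "v \<in> M" for v
    unfolding m_def using bdd that by (intro cInf_lower) auto
  have ne: "J ` M \<noteq> {}" using subspaceD(3)[OF M] by auto
  have "\<exists>v\<in>M. J v < m + 1 / Suc n" for n
  proof -
    have "Inf (J ` M) < m + 1 / Suc n" unfolding m_def by simp
    then show ?thesis using cInf_lessD[OF ne] by blast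
  qed
  then obtain s where s: "\<And>n. s n \<in> M" "\<And>n. J (s n) < m + 1 / Suc n" by metis
  note car = subspaceD(2)[OF M]
  have sc: "s n \<in> carrier V" for n using s(1) car by blast
  have par: "(cnorm V (v \<ominus> w))\<^sup>2 \<le> 2 * (J v - m) + 2 * (J w - m)" if v: "v \<in> M" and w: "w \<in> M" for v w
  proof -
    have vw: "v \<in> carrier V" "w \<in> carrier V" using v w car by auto
    have h: "(1/2) \<odot> (v \<oplus> w) \<in> M" by (intro subspaceD(4,5)[OF M] v w)
    have "J ((1/2) \<odot> (v \<oplus> w)) = (cnorm V (v \<oplus> w))\<^sup>2 / 4 - Re (\<phi> v) - Re (\<phi> w)"
      using vw v w subspaceD(4)[OF M v w]
      by (simp add: J_def smult add cnorm_smult power_divide)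
    then show ?thesis
      using m[OF h] cnorm_sq_add[OF vw] cnorm_sq_diff[OF vw] unfolding J_def[of v] J_def[of w]
      by argo
  qed
  obtain u where u: "u \<in> carrier V" "(\<lambda>n. cnorm V (s n \<ominus> u)) \<longlonglongrightarrow> 0"
  proof (rule cauchy_limit[OF sc])
    fix \<epsilon> :: real assume \<epsilon>: "\<epsilon> > 0"
    \<comment> \<open>\<open>par\<close> bounds the squared distance of s k and s n by 2 / (k + 1) +
      2 / (n + 1).\<close>
    then obtain N where N: "4 / real (Suc N) < \<epsilon>\<^sup>2"
    proof -
      obtain N where "inverse (real (Suc N)) < \<epsilon>\<^sup>2 / 4"
        using reals_Archimedean[of "\<epsilon>\<^sup>2 / 4"] \<epsilon> by auto
      then show ?thesis using that[of N] by (simp add: inverse_eq_divide)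
    qed
    have "cnorm V (s k \<ominus> s n) < \<epsilon>" if "k \<ge> N" "n \<ge> N" for k n
    proof -
      have "1 / real (Suc k) \<le> 1 / real (Suc N)" "1 / real (Suc n) \<le> 1 / real (Suc N)"
        using that by (auto simp: frac_le)
      then have "(cnorm V (s k \<ominus> s n))\<^sup>2 < \<epsilon>\<^sup>2"
        using par[OF s(1) s(1), of k n] s(2)[of k] s(2)[of n] N by simp
      then show ?thesis using \<epsilon> by (simp add: power_less_imp_less_base)
    qed
    then show "\<exists>N. \<forall>k\<ge>N. \<forall>n\<ge>N. cnorm V (s k \<ominus> s n) < \<epsilon>" by blast
  qed (use that in blast)
  have "\<exists>y\<in>M. cnorm V (u \<ominus> y) < \<epsilon>" if \<epsilon>: "\<epsilon> > 0" for \<epsilon>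
  proof -
    obtain n where "cnorm V (s n \<ominus> u) < \<epsilon>"
      using order_tendstoD(2)[OF u(2) \<epsilon>] by (meson eventually_sequentially le_refl)
    then show ?thesis using s(1) sc u(1) by (auto simp: cnorm_diff_commute)
  qed
  then have uM: "u \<in> M" using cl u(1) unfolding closed_iff[OF subspaceD(1)[OF M]] by blast
  have re: "Re (cinner V u v - \<phi> v) = 0" if v: "v \<in> M" for v
  proof (rule quadratic_nonneg_imp_zero)
    fix t :: real
    have vc: "v \<in> carrier V" using v car by auto
    have nn: "0 \<le> 1 / Suc n + t\<^sup>2 * (cnorm V v)\<^sup>2 + 2 * t * Re (cinner V (s n) v - \<phi> v)" for n
    proof -
      have tv: "of_real t \<odot> v \<in> M" by (intro subspaceD(5)[OF M] v)
      have "J (s n \<oplus> of_real t \<odot> v)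
          = J (s n) + t\<^sup>2 * (cnorm V v)\<^sup>2 + 2 * t * Re (cinner V (s n) v - \<phi> v)"
        using vc sc v s(1) tv
        by (simp add: J_def cnorm_sq_add add smult cnorm_smult cinner_simps power_mult_distrib
            algebra_simps)
      then show ?thesis using m[OF subspaceD(4)[OF M s(1) tv], of n] s(2)[of n] by simp
    qed
    have "(\<lambda>n. 1 / Suc n + t\<^sup>2 * (cnorm V v)\<^sup>2 + 2 * t * Re (cinner V (s n) v - \<phi> v))
        \<longlonglongrightarrow> 0 + t\<^sup>2 * (cnorm V v)\<^sup>2 + 2 * t * Re (cinner V u v - \<phi> v)"
      using LIMSEQ_inverse_real_of_nat tendsto_cinner_left[OF sc u(1) vc u(2)]
      by (intro tendsto_intros) (simp_all add: inverse_eq_divide)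
    then have "0 \<le> 0 + t\<^sup>2 * (cnorm V v)\<^sup>2 + 2 * t * Re (cinner V u v - \<phi> v)"
      by (rule LIMSEQ_le_const) (use nn in blast)
    then show "0 \<le> t\<^sup>2 * (cnorm V v)\<^sup>2 + 2 * t * Re (cinner V u v - \<phi> v)" by simp
  qed
  have "\<phi> v = cinner V u v" if v: "v \<in> M" for v
  proof -
    \<comment> \<open>The real part is settled; replacing v by i v turns imaginary parts into real
      ones.\<close>
    have "cinner V u (\<i> \<odot> v) - \<phi> (\<i> \<odot> v) = \<i> * (cinner V u v - \<phi> v)"
      using v car u by (simp add: cinner_smult_right smult algebra_simps)
    then show ?thesis
      using re[OF v] re[OF subspaceD(5)[OF M v, of \<i>]] by (simp add: complex_eq_iff)
  qed
  then show ?thesis using that uM by blast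
qed

text \<open>A norm bound becomes the quadratic bound of \<open>riesz_closed_subspace\<close> through
  2 C t \<le> t^2 + C^2.\<close>

lemma riesz_bounded:
  assumes add: "\<And>x y. \<lbrakk>x \<in> carrier V; y \<in> carrier V\<rbrakk> \<Longrightarrow> \<phi> (x \<oplus> y) = \<phi> x + \<phi> y"
    and smult: "\<And>c x. x \<in> carrier V \<Longrightarrow> \<phi> (c \<odot> x) = c * \<phi> x"
    and bound: "\<And>x. x \<in> carrier V \<Longrightarrow> cmod (\<phi> x) \<le> C * cnorm V x"
  obtains u where "u \<in> carrier V" "\<forall>v\<in>carrier V. \<phi> v = cinner V u v"
proof -
  have "2 * Re (\<phi> x) \<le> (cnorm V x)\<^sup>2 + C\<^sup>2" if "x \<in> carrier V" for x
  proof -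
    have "Re (\<phi> x) \<le> C * cnorm V x"
      using bound[OF that] complex_Re_le_cmod order_trans by blast
    moreover have "0 \<le> (cnorm V x - C)\<^sup>2" by simp
    ultimately show ?thesis by (simp add: power2_diff algebra_simps)
  qed
  then show ?thesis
    using riesz_closed_subspace[OF carrier_is_submodule closed_carrier add smult] that by blast
qed

text \<open>The Riesz lemma on M itself, applied to v -> <x, v>: the representing vector p satisfies
  <x - p, v> = 0 on M.\<close>

lemma projection_exists:
  assumes M: "submodule M complex_ring V" and cl: "closedin (norm_topology V) M"
    and x: "x \<in> carrier V"
  obtains p where "p \<in> M" "x \<ominus> p \<in> orth_complement V M"
proof -
  note car = subspaceD(2)[OF M]
  have "2 * Re (cinner V x v) \<le> (cnorm V v)\<^sup>2 + (cnorm V x)\<^sup>2" if "v \<in> M" for v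
    using cnorm_sq_diff[OF x car[OF that]] zero_le_power2[of "cnorm V (x \<ominus> v)"] by linarith
  then obtain p where p: "p \<in> M" "\<forall>v\<in>M. cinner V x v = cinner V p v"
    using riesz_closed_subspace[OF M cl, of "cinner V x" "(cnorm V x)\<^sup>2"] car x
    by (auto simp: cinner_simps)
  have "cinner V y (x \<ominus> p) = 0" if "y \<in> M" for y
  proof -
    have c: "y \<in> carrier V" "p \<in> carrier V" using that p car by auto
    then show ?thesis
      using p(2) that cinner_commute[of y "x \<ominus> p"] x by (simp add: cinner_diff_left)
  qed
  then show ?thesis using that[OF p(1)] p(1) car x by (auto simp: orth_complement_def)
qed

text \<open>The residual of the projection onto the closure of M is orthogonal to M, hence
  zero.\<close>

lemma dense_if_orth_zero:
  assumes M: "submodule M complex_ring V" and orth: "orth_complement V M \<subseteq> {\<zero>}"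
  shows "norm_topology V closure_of M = carrier V"
proof
  show "norm_topology V closure_of M \<subseteq> carrier V" by (rule closure_subset_carrier)
  show "carrier V \<subseteq> norm_topology V closure_of M"
  proof
    fix x assume x: "x \<in> carrier V"
    obtain p where p: "p \<in> norm_topology V closure_of M"
      "x \<ominus> p \<in> orth_complement V (norm_topology V closure_of M)"
      using projection_exists[OF closure_submodule[OF M] closed_closure x] by blast
    have "x \<ominus> p \<in> orth_complement V M"
      using p(2) closure_superset[OF subspaceD(1)[OF M]] by (auto simp: orth_complement_def)
    then have "x \<ominus> p = \<zero>" using orth by auto
    then show "x \<in> norm_topology V closure_of M"
      using p(1) x closure_subset_carrier diff_eq_zero_iff[of x p] by blast
  qed
qed

lemma orthonormal_basisI:
  assumes e: "orthonormal V I e"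
    and orth: "\<And>x. \<lbrakk>x \<in> carrier V; \<And>i. i \<in> I \<Longrightarrow> cinner V (e i) x = 0\<rbrakk> \<Longrightarrow> x = \<zero>"
  shows "orthonormal_basis V (carrier V) I e"
proof -
  note sub = orthonormalD(2)[OF e]
  have "x = \<zero>" if "x \<in> orth_complement V (lin_span V (e ` I))" for x
    using that lin_span_superset[OF sub] by (intro orth) (auto simp: orth_complement_def)
  then show ?thesis
    using e dense_if_orth_zero[OF lin_span_submodule[OF sub]]
    by (auto simp: orthonormal_basis_iff)
qed

text \<open>The vector is the Riesz representative of v -> sum of cnj (c i) <e i, v>, which avoids
  limits of partial sums. The quadratic bound is the termwise inequality 2 |c t| \<le> |c|^2 + |t|^2
  followed by Bessel.\<close>

lemma riesz_fischer:
  assumes e: "orthonormal V I e" and c: "(\<lambda>i. (cmod (c i))\<^sup>2) summable_on I"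
  obtains x where "x \<in> carrier V" "\<And>i. i \<in> I \<Longrightarrow> cinner V (e i) x = c i"
proof -
  define \<phi> where "\<phi> v = infsum (\<lambda>i. cnj (c i) * cinner V (e i) v) I" for v
  note ec = orthonormalD(1)[OF e]
  have amgm: "2 * cmod (cnj (c i) * cinner V (e i) v) \<le> (cmod (c i))\<^sup>2 + (cmod (cinner V (e i) v))\<^sup>2"
    for i v
    using sum_squares_bound[of "cmod (c i)" "cmod (cinner V (e i) v)"] by (simp add: norm_mult)
  have s2: "(\<lambda>i. (cmod (c i))\<^sup>2 + (cmod (cinner V (e i) v))\<^sup>2) summable_on I" if "v \<in> carrier V" for v
    by (intro summable_on_add c bessel_summable[OF e that])
  have abs: "(\<lambda>i. norm (cnj (c i) * cinner V (e i) v)) summable_on I" if "v \<in> carrier V" for v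
  proof (rule summable_on_comparison_test)
    show "(\<lambda>i. (cmod (c i))\<^sup>2 + (cmod (cinner V (e i) v))\<^sup>2) summable_on I" by (rule s2[OF that])
    show "norm (cnj (c i) * cinner V (e i) v) \<le> (cmod (c i))\<^sup>2 + (cmod (cinner V (e i) v))\<^sup>2" for i
      using amgm[of i v] norm_ge_zero[of "cnj (c i) * cinner V (e i) v"] by linarith
  qed simp
  have sm: "(\<lambda>i. cnj (c i) * cinner V (e i) v) summable_on I" if "v \<in> carrier V" for v
    by (rule abs_summable_summable[OF abs[OF that]])
  have bound: "2 * Re (\<phi> v) \<le> (cnorm V v)\<^sup>2 + infsum (\<lambda>i. (cmod (c i))\<^sup>2) I"
    if v: "v \<in> carrier V" for v
  proof -
    have "cmod (\<phi> v) \<le> infsum (\<lambda>i. cmod (cnj (c i) * cinner V (e i) v)) I"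
      unfolding \<phi>_def by (rule norm_infsum_bound[OF abs[OF v]])
    then have "2 * cmod (\<phi> v) \<le> infsum (\<lambda>i. 2 * cmod (cnj (c i) * cinner V (e i) v)) I"
      by (simp add: infsum_cmult_right')
    also have "\<dots> \<le> infsum (\<lambda>i. (cmod (c i))\<^sup>2 + (cmod (cinner V (e i) v))\<^sup>2) I"
      using amgm by (intro infsum_mono summable_on_cmult_right abs[OF v] s2[OF v]) auto
    also have "\<dots> = infsum (\<lambda>i. (cmod (c i))\<^sup>2) I + infsum (\<lambda>i. (cmod (cinner V (e i) v))\<^sup>2) I"
      by (intro infsum_add c bessel_summable[OF e v])
    also have "infsum (\<lambda>i. (cmod (cinner V (e i) v))\<^sup>2) I \<le> (cnorm V v)\<^sup>2"
      using bessel[OF e _ _ v] by (intro infsum_le_finite_sums bessel_summable[OF e v]) auto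
    finally show ?thesis using complex_Re_le_cmod[of "\<phi> v"] by linarith
  qed
  have add: "\<phi> (x \<oplus> y) = \<phi> x + \<phi> y" if "x \<in> carrier V" "y \<in> carrier V" for x y
  proof -
    have "\<phi> (x \<oplus> y) = infsum (\<lambda>i. cnj (c i) * cinner V (e i) x + cnj (c i) * cinner V (e i) y) I"
      unfolding \<phi>_def using that ec by (intro infsum_cong) (simp add: cinner_add_right algebra_simps)
    then show ?thesis using infsum_add[OF sm sm] that by (simp add: \<phi>_def)
  qed
  have smult: "\<phi> (a \<odot> x) = a * \<phi> x" if "x \<in> carrier V" for a x
  proof -
    have "\<phi> (a \<odot> x) = infsum (\<lambda>i. a * (cnj (c i) * cinner V (e i) x)) I"
      unfolding \<phi>_def using that ec by (intro infsum_cong) (simp add: cinner_smult_right)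
    then show ?thesis by (simp add: \<phi>_def infsum_cmult_right')
  qed
  obtain u where u: "u \<in> carrier V" "\<forall>v\<in>carrier V. \<phi> v = cinner V u v"
    by (rule riesz_closed_subspace[OF carrier_is_submodule closed_carrier add smult bound])
  have "cinner V (e j) u = c j" if j: "j \<in> I" for j
  proof -
    have "\<phi> (e j) = infsum (\<lambda>i. if i = j then cnj (c j) else 0) I"
      unfolding \<phi>_def using j orthonormalD(4)[OF e] by (intro infsum_cong) auto
    also have "\<dots> = infsum (\<lambda>i. if i = j then cnj (c j) else 0) {j}"
      using j by (intro infsum_cong_neutral) auto
    finally have "cinner V u (e j) = cnj (c j)" using u(2) ec[OF j] by simp
    then show ?thesis using cinner_commute[OF ec[OF j] u(1)] by simp
  qed
  then show ?thesis using that u(1) by blast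
qed

end

section \<open>Normalisation, Gram-Schmidt and limits of sequences\<close>

context complex_inner_space
begin

definition normalize :: "'v \<Rightarrow> 'v" where
  "normalize x = of_real (1 / cnorm V x) \<odot> x"

lemma normalize_carrier [simp]: "x \<in> carrier V \<Longrightarrow> normalize x \<in> carrier V"
  by (simp add: normalize_def)

lemma cnorm_normalize: "\<lbrakk>x \<in> carrier V; x \<noteq> \<zero>\<rbrakk> \<Longrightarrow> cnorm V (normalize x) = 1"
  by (simp add: normalize_def cnorm_smult norm_divide)

lemma smult_normalize: "\<lbrakk>x \<in> carrier V; x \<noteq> \<zero>\<rbrakk> \<Longrightarrow> x = of_real (cnorm V x) \<odot> normalize x"
  by (simp add: normalize_def)

lemma cinner_normalize_self: "\<lbrakk>x \<in> carrier V; x \<noteq> \<zero>\<rbrakk> \<Longrightarrow> cinner V (normalize x) (normalize x) = 1"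
  using cnorm_normalize by (simp add: cinner_self)

lemma orthonormal_insert:
  assumes E: "orthonormal V E (\<lambda>e. e)" and x: "x \<in> carrier V" "cinner V x x = 1"
    and orth: "\<And>e. e \<in> E \<Longrightarrow> cinner V e x = 0"
  shows "orthonormal V (insert x E) (\<lambda>e. e)" "x \<notin> E"
proof -
  have "cinner V x e = 0" if "e \<in> E" for e
    using orth[OF that] cinner_commute[of x e] x orthonormalD(1)[OF E that] by simp
  then show "orthonormal V (insert x E) (\<lambda>e. e)"
    using E x orth unfolding orthonormal_def by auto
  show "x \<notin> E" using orth x by force
qed

text \<open>The orthonormal family keeps the index set I, so that eigenvalue multiplicities can
  later be counted by the indices of a merely independent family. The vectors are chosen by
  well-founded recursion on n, each the normalised Fourier residual of \<xi> n.\<close>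

lemma gram_schmidt:
  fixes I :: "nat set"
  assumes \<xi>: "\<And>i. i \<in> I \<Longrightarrow> \<xi> i \<in> carrier V"
    and indep: "\<And>i. i \<in> I \<Longrightarrow> \<xi> i \<notin> lin_span V (\<xi> ` (I \<inter> {..<i}))"
  obtains e where "orthonormal V I e" "lin_span V (e ` I) = lin_span V (\<xi> ` I)"
proof -
  \<comment> \<open>Admissibility of r as the n-th vector after the choices f m, m < n; void for n
    outside I. The two span clauses, one in each direction, yield the equality of spans at the
    end.\<close>
  define P where "P f n r \<longleftrightarrow> (n \<in> I \<longrightarrow> r \<in> carrier V \<and> cnorm V r = 1 \<and>
      (\<forall>i\<in>I \<inter> {..<n}. cinner V (f i) r = 0) \<and> r \<in> lin_span V (\<xi> ` (I \<inter> {..n})) \<and>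
      \<xi> n \<in> lin_span V (insert r (f ` (I \<inter> {..<n}))))" for f :: "nat \<Rightarrow> 'v" and n r
  have mono: "lin_span V A \<subseteq> lin_span V B" if "A \<subseteq> B" for A B
    using that by (auto simp: lin_span_def)
  have orth: "orthonormal V (I \<inter> {..<n}) f" if P: "\<And>m. m < n \<Longrightarrow> P f m (f m)" for f n
    unfolding orthonormal_def
  proof (intro conjI ballI)
    show "f ` (I \<inter> {..<n}) \<subseteq> carrier V" using P by (auto simp: P_def)
    fix i j assume ij: "i \<in> I \<inter> {..<n}" "j \<in> I \<inter> {..<n}"
    then have c: "f i \<in> carrier V" "cnorm V (f i) = 1" "f j \<in> carrier V"
      using P by (auto simp: P_def)
    consider "i < j" | "i = j" | "j < i" by linarith
    then show "cinner V (f i) (f j) = of_bool (i = j)"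
    proof cases
      case 1 then show ?thesis using P[of j] ij by (auto simp: P_def)
    next
      case 2 then show ?thesis using c by (simp add: cinner_self)
    next
      case 3
      then have "cinner V (f j) (f i) = 0" using P[of i] ij by (auto simp: P_def)
      then show ?thesis using 3 cinner_commute[OF c(1,3)] by simp
    qed
  qed
  have "\<exists>f. \<forall>n. P f n (f n)"
  proof (rule dependent_wf_choice[of less_than])
    show "P f n r = P g n r" if "\<And>m. (m, n) \<in> less_than \<Longrightarrow> f m = g m" for f g n r
    proof -
      have "f ` (I \<inter> {..<n}) = g ` (I \<inter> {..<n})" using that by (intro image_cong) auto
      then show ?thesis unfolding P_def using that by auto
    qed
    fix n f assume "\<And>m. (m, n) \<in> less_than \<Longrightarrow> P f m (f m)"
    then have P: "\<And>m. m < n \<Longrightarrow> P f m (f m)" by simp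
    let ?F = "I \<inter> {..<n}"
    have on: "orthonormal V ?F f" using P by (rule orth)
    have sub: "\<xi> ` ?F \<subseteq> carrier V" "\<xi> ` (I \<inter> {..n}) \<subseteq> carrier V" using \<xi> by auto
    note S = lin_span_submodule[OF sub(1)]
    have fin: "f ` ?F \<subseteq> lin_span V (\<xi> ` ?F)"
    proof safe
      fix i assume i: "i \<in> I" "i < n"
      then have "f i \<in> lin_span V (\<xi> ` (I \<inter> {..i}))" using P[of i] by (auto simp: P_def)
      moreover have "\<xi> ` (I \<inter> {..i}) \<subseteq> \<xi> ` ?F" using i by auto
      ultimately show "f i \<in> lin_span V (\<xi> ` ?F)" using mono by blast
    qed
    show "\<exists>r. P f n r"
    proof (cases "n \<in> I")
      case n: True
      let ?p = "fourier_sum f ?F (\<xi> n)"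
      define y where "y = \<xi> n \<ominus> ?p"
      have pc: "?p \<in> carrier V" by (rule fourier_sum_carrier[OF on order_refl])
      have ps: "?p \<in> lin_span V (f ` ?F)"
        by (rule fourier_sum_in_span[OF on]) auto
      have "lin_span V (f ` ?F) \<subseteq> lin_span V (\<xi> ` ?F)"
        by (rule lin_span_minimal[OF fin S])
      then have pin: "?p \<in> lin_span V (\<xi> ` ?F)" using ps by blast
      have yc: "y \<in> carrier V" using \<xi>[OF n] pc by (simp add: y_def)
      have y0: "y \<noteq> \<zero>"
        using pin indep[OF n] diff_eq_zero_iff[OF \<xi>[OF n] pc] by (auto simp: y_def)
      have "cinner V (f i) (normalize y) = 0" if i: "i \<in> ?F" for i
      proof -
        have fi: "f i \<in> carrier V" using orthonormalD(1)[OF on i] .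
        have "f i \<in> lin_span V (f ` ?F)"
          using i lin_span_superset[OF orthonormalD(2)[OF on]] by blast
        then have "cinner V y (f i) = 0"
          using fourier_residual_orth[OF on _ order_refl \<xi>[OF n]] by (simp add: y_def)
        then show ?thesis
          using cinner_commute[OF fi yc] fi yc by (simp add: normalize_def cinner_smult_right)
      qed
      moreover have "normalize y \<in> lin_span V (\<xi> ` (I \<inter> {..n}))"
      proof -
        note S' = lin_span_submodule[OF sub(2)]
        have "\<xi> ` ?F \<subseteq> \<xi> ` (I \<inter> {..n})" by auto
        then have "?p \<in> lin_span V (\<xi> ` (I \<inter> {..n}))" using mono pin by blast
        moreover have "\<xi> n \<in> lin_span V (\<xi> ` (I \<inter> {..n}))"
          using lin_span_superset[OF sub(2)] n by auto
        ultimately show ?thesis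
          unfolding normalize_def y_def by (intro subspaceD(5)[OF S'] subspaceD(6)[OF S'])
      qed
      moreover have "\<xi> n \<in> lin_span V (insert (normalize y) (f ` ?F))"
      proof -
        have s: "insert (normalize y) (f ` ?F) \<subseteq> carrier V"
          using yc orthonormalD(2)[OF on] by simp
        note S' = lin_span_submodule[OF s]
        have "f ` ?F \<subseteq> insert (normalize y) (f ` ?F)" by auto
        then have 1: "?p \<in> lin_span V (insert (normalize y) (f ` ?F))" using ps mono by blast
        have 2: "normalize y \<in> lin_span V (insert (normalize y) (f ` ?F))"
          using lin_span_superset[OF s] by blast
        have "\<xi> n = y \<oplus> ?p"
          unfolding y_def using \<xi>[OF n] pc by (intro cinner_ext) (simp_all add: cinner_simps)
        then have "\<xi> n = of_real (cnorm V y) \<odot> normalize y \<oplus> ?p"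
          using smult_normalize[OF yc y0] by simp
        then show ?thesis
          using subspaceD(4)[OF S' subspaceD(5)[OF S' 2, of "of_real (cnorm V y)"] 1] by argo
      qed
      ultimately have "P f n (normalize y)"
        using yc y0 by (simp add: P_def cnorm_normalize)
      then show ?thesis ..
    qed (simp add: P_def)
  qed simp
  then obtain e where e: "\<And>n. P e n (e n)" by blast
  have "orthonormal V I e"
  proof -
    have on: "orthonormal V (I \<inter> {..<n}) e" for n by (rule orth) (rule e)
    have "e i \<in> carrier V \<and> cinner V (e i) (e j) = of_bool (i = j)" if "i \<in> I" "j \<in> I" for i j
      using on[of "Suc (max i j)"] that unfolding orthonormal_def by (auto simp: less_Suc_eq_le)
    then show ?thesis unfolding orthonormal_def by blast
  qed
  moreover have "lin_span V (e ` I) = lin_span V (\<xi> ` I)"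
  proof (intro equalityI lin_span_minimal lin_span_submodule)
    show "e ` I \<subseteq> carrier V" "\<xi> ` I \<subseteq> carrier V" using \<xi> e by (auto simp: P_def)
    show "e ` I \<subseteq> lin_span V (\<xi> ` I)"
    proof safe
      fix i assume i: "i \<in> I"
      then have "e i \<in> lin_span V (\<xi> ` (I \<inter> {..i}))" using e[of i] by (simp add: P_def)
      moreover have "\<xi> ` (I \<inter> {..i}) \<subseteq> \<xi> ` I" by auto
      ultimately show "e i \<in> lin_span V (\<xi> ` I)" using mono by blast
    qed
    show "\<xi> ` I \<subseteq> lin_span V (e ` I)"
    proof safe
      fix i assume i: "i \<in> I"
      then have "\<xi> i \<in> lin_span V (insert (e i) (e ` (I \<inter> {..<i})))" using e[of i] by (simp add: P_def)
      moreover have "insert (e i) (e ` (I \<inter> {..<i})) \<subseteq> e ` I" using i by auto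
      ultimately show "\<xi> i \<in> lin_span V (e ` I)" using mono by blast
    qed
  qed
  ultimately show ?thesis by (rule that)
qed

lemma limit_unique:
  assumes "\<And>n. s n \<in> carrier V" "x \<in> carrier V" "y \<in> carrier V"
    "(\<lambda>n::nat. cnorm V (s n \<ominus> x)) \<longlonglongrightarrow> 0" "(\<lambda>n. cnorm V (s n \<ominus> y)) \<longlonglongrightarrow> 0"
  shows "x = y"
proof -
  have "(\<lambda>n. cnorm V (s n \<ominus> x) + cnorm V (s n \<ominus> y)) \<longlonglongrightarrow> 0 + 0"
    by (intro tendsto_add assms)
  moreover have "cnorm V (x \<ominus> y) \<le> cnorm V (s n \<ominus> x) + cnorm V (s n \<ominus> y)" for n
    using cnorm_triangle_diff[of x "s n" y] cnorm_diff_commute[of x "s n"] assms(1-3) by simp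
  ultimately have "cnorm V (x \<ominus> y) \<le> 0 + 0" by (intro LIMSEQ_le_const) auto
  then show ?thesis
    using assms(2,3) cnorm_nonneg[of "x \<ominus> y"] cnorm_eq_0[of "x \<ominus> y"] diff_eq_zero_iff
    by (metis a_minus_def add.inv_closed add.m_closed add_0 order_antisym)
qed

lemma limit_in_closed:
  assumes M: "M \<subseteq> carrier V" "closedin (norm_topology V) M"
    and s: "\<And>n. s n \<in> M" "x \<in> carrier V" "(\<lambda>n::nat. cnorm V (s n \<ominus> x)) \<longlonglongrightarrow> 0"
  shows "x \<in> M"
proof -
  have "\<exists>y\<in>M. cnorm V (x \<ominus> y) < \<epsilon>" if \<epsilon>: "\<epsilon> > 0" for \<epsilon>
  proof -
    obtain n where "cnorm V (s n \<ominus> x) < \<epsilon>"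
      using order_tendstoD(2)[OF s(3) \<epsilon>] by (meson eventually_sequentially le_refl)
    moreover have "s n \<in> carrier V" using s M by blast
    ultimately show ?thesis
      using s cnorm_diff_commute[of x "s n"] by (intro bexI[of _ "s n"]) auto
  qed
  then show ?thesis using M s(2) closed_iff by blast
qed

end


section \<open>The spectral theorem for positive operators with bounded trace\<close>

text \<open>\<open>T_pos\<close> encodes boundedness and positivity at once: for T = B* B it holds
  with M a squared bound of the adjoint of B. \<open>trace\<close> bounds the trace over finite
  orthonormal sets and is the source of compactness.\<close>

locale positive_trace_operator = complex_hilbert_space V for V :: "'v inner_space" (structure) +
  fixes T :: "'v \<Rightarrow> 'v" and M C :: real
  assumes T_carrier [simp]: "x \<in> carrier V \<Longrightarrow> T x \<in> carrier V"
    and T_add: "\<lbrakk>x \<in> carrier V; y \<in> carrier V\<rbrakk> \<Longrightarrow> T (x \<oplus> y) = T x \<oplus> T y"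
    and T_smult: "x \<in> carrier V \<Longrightarrow> T (c \<odot> x) = c \<odot> T x"
    and T_sym: "\<lbrakk>x \<in> carrier V; y \<in> carrier V\<rbrakk> \<Longrightarrow> cinner V x (T y) = cinner V (T x) y"
    and T_pos: "x \<in> carrier V \<Longrightarrow> (cnorm V (T x))\<^sup>2 \<le> M * Re (cinner V x (T x))"
    and M_nonneg: "0 \<le> M"
    and trace: "\<lbrakk>finite F; orthonormal V F (\<lambda>e. e)\<rbrakk> \<Longrightarrow> (\<Sum>e\<in>F. Re (cinner V e (T e))) \<le> C"
begin

lemma T_diff: "\<lbrakk>x \<in> carrier V; y \<in> carrier V\<rbrakk> \<Longrightarrow> T (x \<ominus> y) = T x \<ominus> T y"
proof -
  assume xy: "x \<in> carrier V" "y \<in> carrier V"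
  have "x \<ominus> y = x \<oplus> (-1) \<odot> y" using xy by (intro cinner_ext) (simp_all add: cinner_simps)
  then have "T (x \<ominus> y) = T x \<oplus> (-1) \<odot> T y" using xy by (simp add: T_add T_smult)
  also have "\<dots> = T x \<ominus> T y" using xy by (intro cinner_ext) (simp_all add: cinner_simps)
  finally show ?thesis .
qed

text \<open>\<open>T_pos\<close> and Cauchy-Schwarz bound the squared norm of T x by M times the
  norms of x and T x; one factor cancels.\<close>

lemma T_bounded: "x \<in> carrier V \<Longrightarrow> cnorm V (T x) \<le> M * cnorm V x"
proof -
  assume x: "x \<in> carrier V"
  have "(cnorm V (T x))\<^sup>2 \<le> M * (cnorm V x * cnorm V (T x))"
    using T_pos[OF x] cauchy_schwarz[of x "T x"] complex_Re_le_cmod[of "cinner V x (T x)"] x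
      mult_left_mono[OF _ M_nonneg] by (smt (verit) T_carrier)
  then have "cnorm V (T x) * cnorm V (T x) \<le> (M * cnorm V x) * cnorm V (T x)"
    by (simp add: power2_eq_square mult_ac)
  moreover have "0 \<le> M * cnorm V x" using x M_nonneg by simp
  ultimately show ?thesis
    using cnorm_nonneg[OF T_carrier[OF x]] mult_right_le_imp_le[of "cnorm V (T x)" "cnorm V (T x)"]
    by (cases "cnorm V (T x) = 0") auto
qed

lemma T_limit:
  assumes "\<And>n. s n \<in> carrier V" "x \<in> carrier V" "(\<lambda>n::nat. cnorm V (s n \<ominus> x)) \<longlonglongrightarrow> 0"
  shows "(\<lambda>n. cnorm V (T (s n) \<ominus> T x)) \<longlonglongrightarrow> 0"
proof (rule tendsto_sandwich[of "\<lambda>_. 0"])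
  have "cnorm V (T (s n) \<ominus> T x) \<le> M * cnorm V (s n \<ominus> x)" for n
    using T_bounded[of "s n \<ominus> x"] assms(1,2) by (simp add: T_diff)
  then show "\<forall>\<^sub>F n in sequentially. cnorm V (T (s n) \<ominus> T x) \<le> M * cnorm V (s n \<ominus> x)" by simp
  show "(\<lambda>n. M * cnorm V (s n \<ominus> x)) \<longlonglongrightarrow> 0" using tendsto_mult_right_zero[OF assms(3)] by simp
qed (use assms in auto)

lemma T_expectation_nonneg: "x \<in> carrier V \<Longrightarrow> 0 \<le> Re (cinner V x (T x))"
proof -
  assume x: "x \<in> carrier V"
  show ?thesis
  proof (cases "M = 0")
    case True
    then have "(cnorm V (T x))\<^sup>2 \<le> 0" using T_pos[OF x] by simp
    then have "T x = \<zero>" using x by simp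
    then show ?thesis using x by simp
  next
    case False
    then have "0 \<le> M * Re (cinner V x (T x))" "M > 0"
      using T_pos[OF x] M_nonneg order_trans[OF zero_le_power2] by auto
    then show ?thesis by (simp add: zero_le_mult_iff)
  qed
qed

text \<open>A finite orthonormal set almost exhausting the supremum of all finite traces leaves \<open>T\<close> small
  on its orthogonal complement; hence \<open>T\<close> is compact.\<close>

lemma finite_set_almost_exhausting:
  assumes \<epsilon>: "\<epsilon> > 0"
  obtains F where "finite F" "orthonormal V F (\<lambda>e. e)"
    "\<forall>u\<in>carrier V. (\<forall>e\<in>F. cinner V e u = 0) \<longrightarrow> Re (cinner V u (T u)) \<le> \<epsilon> * (cnorm V u)\<^sup>2"
proof -
  define tr where "tr F = (\<Sum>e\<in>F. Re (cinner V e (T e)))" for F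
  define A where "A = {F. finite F \<and> orthonormal V F (\<lambda>e. e)}"
  have bdd: "bdd_above (tr ` A)"
    using trace by (intro bdd_aboveI2[of _ _ C]) (auto simp: A_def tr_def)
  have ne: "tr ` A \<noteq> {}" by (auto simp: A_def orthonormal_def intro: exI[of _ "{}"])
  have "Sup (tr ` A) - \<epsilon> < Sup (tr ` A)" using \<epsilon> by simp
  then obtain F where F: "F \<in> A" "Sup (tr ` A) - \<epsilon> < tr F"
    using less_cSupD[OF ne] by blast
  have "Re (cinner V u (T u)) \<le> \<epsilon> * (cnorm V u)\<^sup>2"
    if u: "u \<in> carrier V" "\<forall>e\<in>F. cinner V e u = 0" for u
  proof (cases "u = \<zero>")
    case True
    then show ?thesis using u T_smult[of \<zero> 0] by simp
  next
    case False
    define e where "e = normalize u"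
    have e: "e \<in> carrier V" "cinner V e e = 1"
      using False u by (auto simp: e_def cinner_normalize_self)
    have orth: "cinner V f e = 0" if f: "f \<in> F" for f
      using F(1) orthonormalD(1)[of V F "\<lambda>e. e" f] u f
      by (auto simp: e_def normalize_def cinner_smult_right A_def simp del: of_real_divide)
    \<comment> \<open>The unit vector e, orthogonal to F, may be adjoined; the trace grows by <e, T
      e> yet stays below the supremum, which exceeds the trace over F by less than
      \<epsilon>.\<close>
    have ins: "insert e F \<in> A" "e \<notin> F"
      using orthonormal_insert[OF _ e orth] F by (auto simp: A_def)
    have "tr (insert e F) \<le> Sup (tr ` A)" using ins(1) bdd by (intro cSup_upper) auto
    moreover have "tr (insert e F) = tr F + Re (cinner V e (T e))"
      using ins(2) F(1) by (auto simp: tr_def A_def)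
    ultimately have "Re (cinner V e (T e)) \<le> \<epsilon>" using F(2) by simp
    moreover have "cinner V u (T u) = of_real ((cnorm V u)\<^sup>2) * cinner V e (T e)"
      using smult_normalize[OF u(1) False] T_smult[OF e(1)] e(1) u(1)
      by (metis (no_types, lifting) T_carrier cinner_smult_left cinner_smult_right complex_cnj_complex_of_real
          e_def mult.assoc of_real_mult power2_eq_square smult_carrier)
    ultimately show ?thesis by (simp add: mult.commute[of \<epsilon>] mult_left_mono)
  qed
  then show ?thesis using that F(1) unfolding A_def by blast
qed

text \<open>A diagonal subsequence makes the coefficients against all of the finite sets F m
  converge. The difference h of two late terms splits into its projection p on the span of F m,
  small because finitely many coefficients are, and a remainder on which T is small by the choice of
  F m.\<close>

lemma T_compact:
  assumes f: "\<And>n. f n \<in> carrier V" "\<And>n. cnorm V (f n) \<le> 1"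
  obtains k y where "strict_mono (k :: nat \<Rightarrow> nat)" "y \<in> carrier V"
    "(\<lambda>n. cnorm V (T (f (k n)) \<ominus> y)) \<longlonglongrightarrow> 0"
proof -
  have "\<exists>F. finite F \<and> orthonormal V F (\<lambda>e. e) \<and> (\<forall>u\<in>carrier V.
      (\<forall>e\<in>F. cinner V e u = 0) \<longrightarrow> Re (cinner V u (T u)) \<le> 1 / Suc m * (cnorm V u)\<^sup>2)" for m
    by (rule finite_set_almost_exhausting[of "1 / Suc m"]) (simp, blast)
  then obtain F where F: "\<And>m. finite (F m)" "\<And>m. orthonormal V (F m) (\<lambda>e. e)"
    and small: "\<And>m u. \<lbrakk>u \<in> carrier V; \<forall>e\<in>F m. cinner V e u = 0\<rbrakk> \<Longrightarrow>
        Re (cinner V u (T u)) \<le> 1 / Suc m * (cnorm V u)\<^sup>2"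
    by metis
  have cnt: "countable (\<Union>m. F m)" using F(1) by (simp add: countable_finite)
  have bd: "norm (cinner V e (f n)) \<le> 1" if "e \<in> (\<Union>m. F m)" for n e
  proof -
    obtain m where m: "e \<in> F m" using \<open>e \<in> (\<Union>m. F m)\<close> by auto
    then have "cmod (cinner V e (f n)) \<le> cnorm V e * cnorm V (f n)"
      using orthonormalD(1)[OF F(2)] f by (intro cauchy_schwarz) auto
    then show ?thesis using orthonormal_cnorm[OF F(2) m] f(2)[of n] by simp
  qed
  obtain k where k: "strict_mono (k :: nat \<Rightarrow> nat)"
    "\<forall>e\<in>(\<Union>m. F m). \<exists>l. (\<lambda>n. cinner V e (f (k n))) \<longlonglongrightarrow> l"
  proof (rule function_convergent_subsequence[OF cnt bd])
    fix k :: "nat \<Rightarrow> nat"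
    assume "strict_mono k" "\<And>e. e \<in> (\<Union>m. F m) \<Longrightarrow> \<exists>l. (\<lambda>n. cinner V e (f (k n))) \<longlonglongrightarrow> l"
    then show thesis by (intro that) blast+
  qed
  have cauchy: "\<exists>N. \<forall>i\<ge>N. \<forall>j\<ge>N. cnorm V (T (f (k i)) \<ominus> T (f (k j))) < \<epsilon>" if \<epsilon>: "\<epsilon> > 0" for \<epsilon>
  proof -
    \<comment> \<open>The remainder h - p has squared norm at most 4, since h has norm at most 2;
      \<open>T_pos\<close> then bounds the squared norm of T (h - p) by 4 M / (m + 1).\<close>
    obtain m where m: "4 * M / Suc m < (\<epsilon>/2)\<^sup>2"
    proof -
      obtain m where "inverse (real (Suc m)) < (\<epsilon>/2)\<^sup>2 / (4 * M + 1)"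
        using reals_Archimedean[of "(\<epsilon>/2)\<^sup>2 / (4 * M + 1)"] \<epsilon> M_nonneg by auto
      then have "(4 * M + 1) / real (Suc m) < (\<epsilon>/2)\<^sup>2"
        using M_nonneg by (simp add: field_simps del: of_nat_Suc)
      moreover have "4 * M / real (Suc m) \<le> (4 * M + 1) / real (Suc m)"
        by (intro divide_right_mono) auto
      ultimately show ?thesis using that[of m] by linarith
    qed
    define c where "c = real (card (F m)) + 1"
    \<comment> \<open>Coefficients of size at most \<delta> give p a norm of at most c \<delta>, as
      c^2 is at least the cardinality of F m; then T p has norm at most M c \<delta> < \<epsilon> /
      2. M + 1 in place of M covers M = 0.\<close>
    define \<delta> where "\<delta> = \<epsilon> / (2 * (M + 1) * c)"
    have c: "c > 0" "card (F m) \<le> c\<^sup>2"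
      using self_le_power[of c 2] by (auto simp: c_def)
    have \<delta>: "\<delta> > 0" using \<epsilon> M_nonneg c by (simp add: \<delta>_def)
    have "\<forall>e\<in>F m. \<forall>\<^sub>F i in sequentially. dist (cinner V e (f (k i)))
        (lim (\<lambda>n. cinner V e (f (k n)))) < \<delta> / 2"
    proof
      fix e assume "e \<in> F m"
      then have "(\<lambda>n. cinner V e (f (k n))) \<longlonglongrightarrow> lim (\<lambda>n. cinner V e (f (k n)))"
        using k(2) by (metis UN_I UNIV_I limI)
      then show "\<forall>\<^sub>F i in sequentially. dist (cinner V e (f (k i)))
          (lim (\<lambda>n. cinner V e (f (k n)))) < \<delta> / 2"
        using \<delta> by (intro tendstoD) auto
    qed
    then have "\<forall>\<^sub>F i in sequentially. \<forall>e\<in>F m. dist (cinner V e (f (k i)))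
        (lim (\<lambda>n. cinner V e (f (k n)))) < \<delta> / 2"
      by (intro eventually_ball_finite F(1))
    then obtain N where N: "\<And>i e. \<lbrakk>i \<ge> N; e \<in> F m\<rbrakk> \<Longrightarrow> dist (cinner V e (f (k i)))
        (lim (\<lambda>n. cinner V e (f (k n)))) < \<delta> / 2"
      by (auto simp: eventually_sequentially)
    have "cnorm V (T (f (k i)) \<ominus> T (f (k j))) < \<epsilon>" if ij: "i \<ge> N" "j \<ge> N" for i j
    proof -
      define h where "h = f (k i) \<ominus> f (k j)"
      define p where "p = fourier_sum (\<lambda>e. e) (F m) h"
      have hc: "h \<in> carrier V" using f by (simp add: h_def)
      have pc: "p \<in> carrier V" unfolding p_def by (rule fourier_sum_carrier[OF F(2) order_refl])
      have h2: "cnorm V h \<le> 2"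
        using cnorm_triangle[of "f (k i)" "\<ominus> f (k j)"] f[of "k i"] f[of "k j"]
        by (simp add: h_def a_minus_def)
      have coeff: "cmod (cinner V e h) \<le> \<delta>" if e: "e \<in> F m" for e
      proof -
        have "cinner V e h = cinner V e (f (k i)) - cinner V e (f (k j))"
          using f orthonormalD(1)[OF F(2) e] by (simp add: h_def cinner_diff_right)
        moreover have "dist (cinner V e (f (k i))) (cinner V e (f (k j))) < \<delta>"
          by (rule dist_triangle_half_l[OF N[OF ij(1) e] N[OF ij(2) e]])
        ultimately show ?thesis by (simp add: dist_norm)
      qed
      have "(cnorm V p)\<^sup>2 = (\<Sum>e\<in>F m. (cmod (cinner V e h))\<^sup>2)"
        unfolding p_def fourier_sum_def by (rule cnorm_sq_combination[OF F(2) F(1) order_refl])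
      also have "\<dots> \<le> (\<Sum>e\<in>F m. \<delta>\<^sup>2)" using coeff by (intro sum_mono power_mono) auto
      also have "\<dots> \<le> (c * \<delta>)\<^sup>2"
        using c(2) by (simp add: power_mult_distrib mult_right_mono)
      finally have "cnorm V p \<le> c * \<delta>" using c \<delta> pc by (simp add: power2_le_iff_abs_le)
      then have "M * cnorm V p \<le> M * (c * \<delta>)" using M_nonneg by (intro mult_left_mono) auto
      also have "M * (c * \<delta>) = (M / (M + 1)) * (\<epsilon> / 2)" using c by (simp add: \<delta>_def)
      also have "\<dots> < 1 * (\<epsilon> / 2)" using \<epsilon> M_nonneg by (intro mult_strict_right_mono) auto
      also have "\<dots> = \<epsilon> / 2" by simp
      finally have 1: "cnorm V (T p) < \<epsilon> / 2" using T_bounded[OF pc] by simp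
      have "(cnorm V (h \<ominus> p))\<^sup>2 \<le> (cnorm V h)\<^sup>2"
        using fourier_residual_norm[OF F(2) F(1) order_refl hc]
        by (simp add: p_def sum_nonneg)
      also have "\<dots> \<le> 4" using power_mono[OF h2, of 2] hc by simp
      finally have hp4: "(cnorm V (h \<ominus> p))\<^sup>2 \<le> 4" .
      have "cinner V e (h \<ominus> p) = 0" if e: "e \<in> F m" for e
        using orthonormal_coeff[OF F(2) F(1) order_refl e] e orthonormalD(1)[OF F(2) e] hc pc
        by (simp add: cinner_diff_right p_def fourier_sum_def)
      then have "Re (cinner V (h \<ominus> p) (T (h \<ominus> p))) \<le> 1 / Suc m * (cnorm V (h \<ominus> p))\<^sup>2"
        using hc pc by (intro small) auto
      also have "\<dots> \<le> 1 / Suc m * 4" using hp4 by (intro mult_left_mono) auto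
      finally have "M * Re (cinner V (h \<ominus> p) (T (h \<ominus> p))) \<le> M * (1 / Suc m * 4)"
        using M_nonneg by (intro mult_left_mono)
      then have "(cnorm V (T (h \<ominus> p)))\<^sup>2 < (\<epsilon>/2)\<^sup>2"
        using T_pos[of "h \<ominus> p"] hc pc m by (simp add: mult.commute)
      then have 2: "cnorm V (T (h \<ominus> p)) < \<epsilon> / 2"
        by (rule power_less_imp_less_base) (use \<epsilon> in simp)
      have "T h = T p \<oplus> T (h \<ominus> p)"
      proof -
        have "h = p \<oplus> (h \<ominus> p)" using hc pc by (intro cinner_ext) (simp_all add: cinner_simps)
        then show ?thesis using T_add[of p "h \<ominus> p"] hc pc by simp
      qed
      then have "cnorm V (T h) < \<epsilon>" using 1 2 cnorm_triangle[of "T p" "T (h \<ominus> p)"] hc pc by simp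
      then show ?thesis using f by (simp add: h_def T_diff)
    qed
    then show ?thesis by blast
  qed
  show ?thesis
  proof (rule cauchy_limit[of "\<lambda>n. T (f (k n))"])
    fix y assume "y \<in> carrier V" "(\<lambda>n. cnorm V (T (f (k n)) \<ominus> y)) \<longlonglongrightarrow> 0"
    then show thesis by (rule that[OF k(1)])
  qed (use f(1) cauchy in auto)
qed

text \<open>Maximising \<open>\<parallel>T u\<parallel>\<close> on the unit sphere produces \<open>z\<close> with \<open>T (T z) = \<sigma> z\<close>; then
  \<open>T z + \<surd>\<sigma> z\<close> is an eigenvector, and it is nonzero since \<open>T\<close> is positive.\<close>

lemma eigenvector_in_invariant_subspace:
  assumes N: "submodule N complex_ring V" "closedin (norm_topology V) N"
    and inv: "\<And>x. x \<in> N \<Longrightarrow> T x \<in> N" and x: "x \<in> N" "x \<noteq> \<zero>"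
  obtains g \<mu> where "g \<in> N" "g \<noteq> \<zero>" "T g = complex_of_real \<mu> \<odot> g"
proof (cases "\<forall>u\<in>N. T u = \<zero>")
  case True
  then show ?thesis using that[of x 0] x subspaceD(2)[OF N(1)] by simp
next
  case False
  then obtain u0 where u0: "u0 \<in> N" "T u0 \<noteq> \<zero>" by blast
  note car = subspaceD(2)[OF N(1)]
  define S where "S = {u \<in> N. cnorm V u = 1}"
  define q where "q u = (cnorm V (T u))\<^sup>2" for u
  define \<sigma> where "\<sigma> = Sup (q ` S)"
  have "q u \<le> M\<^sup>2" if "u \<in> S" for u
  proof -
    have u: "u \<in> carrier V" "cnorm V u = 1" using that car by (auto simp: S_def)
    then have "cnorm V (T u) \<le> M" using T_bounded[of u] by simp
    then show ?thesis unfolding q_def using u by (intro power_mono) auto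
  qed
  then have bdd: "bdd_above (q ` S)" by (rule bdd_aboveI2)
  have T0: "T \<zero> = \<zero>" using T_smult[of \<zero> 0] by simp
  have nS: "normalize u \<in> S" if "u \<in> N" "u \<noteq> \<zero>" for u
    using that car subspaceD(5)[OF N(1)] cnorm_normalize by (auto simp: S_def normalize_def)
  have \<sigma>: "(cnorm V (T u))\<^sup>2 \<le> \<sigma> * (cnorm V u)\<^sup>2" if u: "u \<in> N" for u
  proof (cases "u = \<zero>")
    case True
    then show ?thesis by (simp add: T0)
  next
    case False
    have uc: "u \<in> carrier V" using u car by simp
    have "q (normalize u) \<le> \<sigma>"
      unfolding \<sigma>_def using bdd nS[OF u False] by (intro cSup_upper) auto
    moreover have "T u = of_real (cnorm V u) \<odot> T (normalize u)"
      using smult_normalize[OF uc False] T_smult[of "normalize u"] uc by (metis normalize_carrier)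
    then have "(cnorm V (T u))\<^sup>2 = (cnorm V u)\<^sup>2 * q (normalize u)"
      using uc by (simp add: cnorm_smult q_def power_mult_distrib)
    ultimately show ?thesis by (simp add: mult.commute[of \<sigma>] mult_left_mono)
  qed
  have "(cnorm V (T u0))\<^sup>2 > 0" using u0 car by (simp add: zero_less_power2)
  then have "\<sigma> * (cnorm V u0)\<^sup>2 > 0" using \<sigma>[OF u0(1)] by linarith
  then have \<sigma>0: "\<sigma> > 0" by (simp add: zero_less_mult_iff)
  have "S \<noteq> {}" using nS[of x] x by auto
  then have ne: "q ` S \<noteq> {}" by simp
  have "\<exists>u\<in>S. \<sigma> - 1 / Suc n < q u" for n
  proof -
    have "\<sigma> - 1 / Suc n < Sup (q ` S)" by (simp add: \<sigma>_def)
    then show ?thesis using less_cSupD[OF ne] by blast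
  qed
  then obtain f where f: "\<And>n. f n \<in> S" "\<And>n. \<sigma> - 1 / Suc n < q (f n)" by metis
  have fN: "f n \<in> N" "f n \<in> carrier V" "cnorm V (f n) = 1" for n
    using f(1)[of n] car by (auto simp: S_def)
  obtain k y where k: "strict_mono k" and y: "y \<in> carrier V" "(\<lambda>n. cnorm V (T (f (k n)) \<ominus> y)) \<longlonglongrightarrow> 0"
    using T_compact[of f] fN by (metis order_refl)
  \<comment> \<open>Near-maximisers are approximate eigenvectors of T^2: expand the square, use
    symmetry in the mixed term, and bound the squared norm of T v by \<sigma> times that of v at v =
    T (f n).\<close>
  have ex: "(cnorm V (T (T (f n)) \<ominus> of_real \<sigma> \<odot> f n))\<^sup>2 \<le> \<sigma> / Suc n" for n
  proof -
    have "cinner V (T (T (f n))) (of_real \<sigma> \<odot> f n) = of_real (\<sigma> * q (f n))"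
      using fN[of n] T_sym[of "T (f n)" "f n"] cinner_self[of "T (f n)"]
      by (simp add: cinner_smult_right q_def)
    then have "(cnorm V (T (T (f n)) \<ominus> of_real \<sigma> \<odot> f n))\<^sup>2
        = (cnorm V (T (T (f n))))\<^sup>2 + \<sigma>\<^sup>2 - 2 * (\<sigma> * q (f n))"
      using fN[of n] by (simp add: cnorm_sq_diff cnorm_smult)
    also have "\<dots> \<le> \<sigma> * q (f n) + \<sigma>\<^sup>2 - 2 * (\<sigma> * q (f n))"
      using \<sigma>[OF inv[OF fN(1)], of n] by (simp add: q_def)
    also have "\<dots> = \<sigma> * (\<sigma> - q (f n))" by (simp add: power2_eq_square algebra_simps)
    also have "\<dots> \<le> \<sigma> * (1 / Suc n)" using f(2)[of n] \<sigma>0 by (intro mult_left_mono) auto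
    finally show ?thesis by simp
  qed
  have lim0: "(\<lambda>n. cnorm V (T (T (f (k n))) \<ominus> of_real \<sigma> \<odot> f (k n))) \<longlonglongrightarrow> 0"
  proof -
    have "(\<lambda>n. \<sigma> * (1 / Suc (k n))) \<longlonglongrightarrow> \<sigma> * 0"
      using LIMSEQ_subseq_LIMSEQ[OF LIMSEQ_inverse_real_of_nat k]
      by (intro tendsto_mult_left) (simp add: o_def inverse_eq_divide)
    then have L: "(\<lambda>n. \<sigma> * (1 / Suc (k n))) \<longlonglongrightarrow> 0" by simp
    have "(\<lambda>n. (cnorm V (T (T (f (k n))) \<ominus> of_real \<sigma> \<odot> f (k n)))\<^sup>2) \<longlonglongrightarrow> 0"
      by (rule tendsto_sandwich[OF _ _ tendsto_const L]) (use ex in \<open>simp_all add: del: of_nat_Suc\<close>)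
    then have "(\<lambda>n. sqrt ((cnorm V (T (T (f (k n))) \<ominus> of_real \<sigma> \<odot> f (k n)))\<^sup>2)) \<longlonglongrightarrow> sqrt 0"
      by (rule tendsto_real_sqrt)
    then show ?thesis using fN by simp
  qed
  \<comment> \<open>T (f (k n)) tends to y, so T (T (f (k n))) tends to T y; since f (k n) is close
    to T (T (f (k n))) / \<sigma>, it tends to T y / \<sigma>.\<close>
  define z where "z = of_real (1 / \<sigma>) \<odot> T y"
  have z: "z \<in> carrier V" using y by (simp add: z_def)
  have \<sigma>z: "of_real \<sigma> \<odot> z = T y" using y \<sigma>0 by (simp add: z_def flip: of_real_mult)
  have limz: "(\<lambda>n. cnorm V (f (k n) \<ominus> z)) \<longlonglongrightarrow> 0"
  proof (rule tendsto_sandwich[of "\<lambda>_. 0"])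
    have TT: "(\<lambda>n. cnorm V (T (T (f (k n))) \<ominus> T y)) \<longlonglongrightarrow> 0"
      using y fN by (intro T_limit) auto
    show "(\<lambda>n. 1 / \<sigma> * (cnorm V (T (T (f (k n))) \<ominus> of_real \<sigma> \<odot> f (k n))
        + cnorm V (T (T (f (k n))) \<ominus> T y))) \<longlonglongrightarrow> 0"
      using tendsto_mult_right_zero[OF tendsto_add_zero[OF lim0 TT], of "1 / \<sigma>"] by simp
    have "cnorm V (f (k n) \<ominus> z) \<le> 1 / \<sigma> * (cnorm V (T (T (f (k n))) \<ominus> of_real \<sigma> \<odot> f (k n))
        + cnorm V (T (T (f (k n))) \<ominus> T y))" for n
    proof -
      have "\<sigma> * cnorm V (f (k n) \<ominus> z) = cnorm V (of_real \<sigma> \<odot> (f (k n) \<ominus> z))"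
        using fN z \<sigma>0 by (simp add: cnorm_smult)
      also have "of_real \<sigma> \<odot> (f (k n) \<ominus> z) = of_real \<sigma> \<odot> f (k n) \<ominus> T y"
        using fN z \<sigma>z by (simp flip: smult_diff)
      also have "cnorm V \<dots> \<le> cnorm V (of_real \<sigma> \<odot> f (k n) \<ominus> T (T (f (k n))))
          + cnorm V (T (T (f (k n))) \<ominus> T y)"
        using fN y by (intro cnorm_triangle_diff) auto
      also have "cnorm V (of_real \<sigma> \<odot> f (k n) \<ominus> T (T (f (k n)))) =
          cnorm V (T (T (f (k n))) \<ominus> of_real \<sigma> \<odot> f (k n))"
        using fN by (intro cnorm_diff_commute) auto
      finally show ?thesis using \<sigma>0 by (simp add: field_simps)
    qed
    then show "\<forall>\<^sub>F n in sequentially. cnorm V (f (k n) \<ominus> z) \<le>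
        1 / \<sigma> * (cnorm V (T (T (f (k n))) \<ominus> of_real \<sigma> \<odot> f (k n))
        + cnorm V (T (T (f (k n))) \<ominus> T y))" by simp
  qed (use fN z in auto)
  have zN: "z \<in> N"
    using limit_in_closed[OF subspaceD(1)[OF N(1)] N(2) _ z limz] fN by blast
  have "T z = y"
    using limit_unique[of "\<lambda>n. T (f (k n))" "T z" y] T_limit[OF _ z limz] fN y z by auto
  then have TTz: "T (T z) = of_real \<sigma> \<odot> z" using \<sigma>z by simp
  have z0: "z \<noteq> \<zero>"
  proof
    assume "z = \<zero>"
    moreover have "x \<ominus> \<zero> = x" if "x \<in> carrier V" for x
      using that by (intro cinner_ext) (simp_all add: cinner_diff_right)
    ultimately have "(\<lambda>n::nat. 1::real) \<longlonglongrightarrow> 0" using limz fN by simp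
    then show False by (simp add: LIMSEQ_const_iff)
  qed
  define g where "g = T z \<oplus> of_real (sqrt \<sigma>) \<odot> z"
  have "T g = of_real (sqrt \<sigma>) \<odot> g"
  proof -
    have "T g = of_real \<sigma> \<odot> z \<oplus> of_real (sqrt \<sigma>) \<odot> T z" using z TTz by (simp add: g_def T_add T_smult)
    also have "\<dots> = of_real (sqrt \<sigma>) \<odot> g"
      unfolding g_def using z \<sigma>0
      by (intro cinner_ext) (simp_all add: cinner_simps algebra_simps flip: of_real_mult)
    finally show ?thesis .
  qed
  moreover have "g \<in> N"
    unfolding g_def by (intro subspaceD(4,5)[OF N(1)] inv zN)
  moreover have "g \<noteq> \<zero>"
  proof
    assume "g = \<zero>"
    then have "Re (cinner V z g) = 0" using z by simp
    then have "Re (cinner V z (T z)) + sqrt \<sigma> * (cnorm V z)\<^sup>2 = 0"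
      using z by (simp add: g_def cinner_simps cnorm_sq)
    moreover have "sqrt \<sigma> * (cnorm V z)\<^sup>2 > 0" using z z0 \<sigma>0 by (simp add: zero_less_power2)
    ultimately show False using T_expectation_nonneg[OF z] by linarith
  qed
  ultimately show ?thesis using that by blast
qed

text \<open>Zorn's lemma gives a maximal orthonormal set E of eigenvectors. By symmetry its
  complement is invariant, so a nonzero vector there would yield one more eigenvector. Since <e, T
  e> = \<mu> e, having n eigenvalues above \<epsilon> costs a trace of n \<epsilon>, which bounds n
  by C / \<epsilon>.\<close>

theorem spectral_theorem:
  obtains E \<mu> where "orthonormal_basis V (carrier V) E (\<lambda>e. e)"
    "\<And>e. e \<in> E \<Longrightarrow> T e = complex_of_real (\<mu> e) \<odot> e" "\<And>e. e \<in> E \<Longrightarrow> 0 \<le> \<mu> e"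
    "\<And>\<epsilon>. \<epsilon> > 0 \<Longrightarrow> finite {e \<in> E. \<epsilon> < \<mu> e}"
proof -
  define A where "A = {E. orthonormal V E (\<lambda>e. e) \<and> (\<forall>e\<in>E. \<exists>\<mu>. T e = complex_of_real \<mu> \<odot> e)}"
  have "\<exists>B\<in>A. \<forall>Y\<in>A. B \<subseteq> Y \<longrightarrow> Y = B"
  proof (rule subset_Zorn')
    fix c assume c: "subset.chain A c"
    have "orthonormal V (\<Union>c) (\<lambda>e. e)"
      unfolding orthonormal_def
    proof (intro conjI ballI)
      show "(\<lambda>e. e) ` \<Union>c \<subseteq> carrier V"
        using c unfolding subset_chain_def A_def orthonormal_def by blast
      fix i j assume "i \<in> \<Union>c" "j \<in> \<Union>c"
      then obtain Y where "Y \<in> c" "i \<in> Y" "j \<in> Y"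
        using c unfolding subset_chain_def by blast
      then show "cinner V i j = of_bool (i = j)"
        using c unfolding subset_chain_def A_def orthonormal_def by blast
    qed
    then show "\<Union>c \<in> A" using c unfolding A_def subset_chain_def by blast
  qed
  then obtain E where E: "E \<in> A" and max: "\<And>Y. \<lbrakk>Y \<in> A; E \<subseteq> Y\<rbrakk> \<Longrightarrow> Y = E" by blast
  have on: "orthonormal V E (\<lambda>e. e)" using E by (simp add: A_def)
  note Ec = orthonormalD(1)[OF on]
  have sub: "E \<subseteq> carrier V" using Ec by blast
  obtain \<mu> where \<mu>: "\<And>e. e \<in> E \<Longrightarrow> T e = complex_of_real (\<mu> e) \<odot> e"
    using E unfolding A_def by (simp; metis)
  have "orthonormal_basis V (carrier V) E (\<lambda>e. e)"
  proof (rule orthonormal_basisI[OF on])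
    fix x assume x: "x \<in> carrier V" "\<And>e. e \<in> E \<Longrightarrow> cinner V e x = 0"
    show "x = \<zero>"
    proof (rule ccontr)
      assume "x \<noteq> \<zero>"
      moreover have "x \<in> orth_complement V E" using x by (simp add: orth_complement_def)
      moreover have "T v \<in> orth_complement V E" if v: "v \<in> orth_complement V E" for v
      proof -
        have "v \<in> carrier V" "\<And>e. e \<in> E \<Longrightarrow> cinner V e v = 0"
          using v by (auto simp: orth_complement_def)
        then show ?thesis using Ec by (simp add: orth_complement_def T_sym \<mu> cinner_smult_left)
      qed
      ultimately obtain g m where g: "g \<in> orth_complement V E" "g \<noteq> \<zero>" "T g = complex_of_real m \<odot> g"
        using eigenvector_in_invariant_subspace[OF orth_complement_submodule[OF sub]
            orth_complement_closed[OF sub]] by blast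
      have gc: "g \<in> carrier V" "\<And>e. e \<in> E \<Longrightarrow> cinner V e g = 0"
        using g(1) by (auto simp: orth_complement_def)
      have 1: "cinner V e (normalize g) = 0" if "e \<in> E" for e
        using gc that Ec by (simp add: normalize_def cinner_smult_right)
      have "T (normalize g) = of_real m \<odot> normalize g"
        using gc g(3) by (simp add: normalize_def T_smult mult.commute)
      then have "insert (normalize g) E \<in> A"
        using orthonormal_insert(1)[OF on _ _ 1] gc g(2) E cinner_normalize_self
        unfolding A_def by (auto 0 3)
      moreover have "normalize g \<notin> E"
        using orthonormal_insert(2)[OF on _ _ 1] gc g(2) cinner_normalize_self by auto
      ultimately show False using max[of "insert (normalize g) E"] by blast
    qed
  qed
  moreover have exp: "Re (cinner V e (T e)) = \<mu> e" if "e \<in> E" for e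
    using that Ec \<mu> orthonormalD(4)[OF on that that] by (simp add: cinner_smult_right)
  moreover have "0 \<le> \<mu> e" if "e \<in> E" for e
    using exp[OF that] T_expectation_nonneg[OF Ec[OF that]] by simp
  moreover have "finite {e \<in> E. \<epsilon> < \<mu> e}" if \<epsilon>: "\<epsilon> > 0" for \<epsilon>
  proof (rule ccontr)
    assume "infinite {e \<in> E. \<epsilon> < \<mu> e}"
    moreover obtain n :: nat where n: "C / \<epsilon> < n" using reals_Archimedean2 by blast
    ultimately obtain F where F: "finite F" "card F = n" "F \<subseteq> {e \<in> E. \<epsilon> < \<mu> e}"
      using infinite_arbitrarily_large by blast
    have "(\<Sum>e\<in>F. \<epsilon>) \<le> (\<Sum>e\<in>F. Re (cinner V e (T e)))"
      using F exp by (intro sum_mono) auto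
    also have "\<dots> \<le> C"
      using F by (intro trace orthonormal_subset[OF on]) auto
    finally have "n * \<epsilon> \<le> C" using F by simp
    then show False using n \<epsilon> by (simp add: pos_divide_less_eq)
  qed
  ultimately show ?thesis using that \<mu> by blast
qed

end

section \<open>Enumerating eigenvalues\<close>

lemma finite_decreasing_enumeration:
  fixes \<mu> :: "'e \<Rightarrow> real"
  assumes "finite P"
  obtains b where "bij_betw b {..<card P} P" "antimono_on {..<card P} (\<lambda>i. \<mu> (b i))"
proof -
  obtain xs where xs: "set xs = P" "distinct xs" using finite_distinct_list[OF assms] by blast
  define ys where "ys = sort_key (\<lambda>e. - \<mu> e) xs"
  have ys: "set ys = P" "distinct ys" "sorted (map (\<lambda>e. - \<mu> e) ys)" using xs by (auto simp: ys_def)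
  have len: "length ys = card P" using ys distinct_card by fastforce
  have "bij_betw ((!) ys) {..<card P} P"
    using bij_betw_nth[OF ys(2)] len ys(1) by auto
  moreover have "antimono_on {..<card P} (\<lambda>i. \<mu> (ys ! i))"
    using sorted_nth_mono[OF ys(3)] len by (auto simp: monotone_on_def)
  ultimately show ?thesis by (rule that)
qed

text \<open>Greedy choice: p n maximises \<mu> among the elements not chosen before. An element that
  is never chosen would leave infinitely many values at least as large as its own, which is
  positive.\<close>

lemma infinite_decreasing_enumeration:
  fixes \<mu> :: "'e \<Rightarrow> real"
  assumes inf: "infinite P" and pos: "\<And>e. e \<in> P \<Longrightarrow> 0 < \<mu> e"
    and fin: "\<And>\<epsilon>. \<epsilon> > 0 \<Longrightarrow> finite {e \<in> P. \<epsilon> < \<mu> e}"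
  obtains p :: "nat \<Rightarrow> 'e" where "bij_betw p UNIV P" "antimono (\<lambda>i. \<mu> (p i))"
proof -
  have argmax: "\<exists>e\<in>Q. \<forall>e'\<in>Q. \<mu> e' \<le> \<mu> e" if Q: "Q \<subseteq> P" "Q \<noteq> {}" for Q
  proof -
    obtain e0 where e0: "e0 \<in> Q" using Q by blast
    \<comment> \<open>Candidates for the maximum: finitely many, because they exceed a positive
      bound. The factor 1/2 keeps e0 itself among them, the bound being strict.\<close>
    let ?S = "{e \<in> Q. \<mu> e0 / 2 < \<mu> e}"
    have p0: "\<mu> e0 > 0" using e0 Q pos by blast
    have f: "finite ?S" using fin[of "\<mu> e0 / 2"] p0 Q(1) by (auto elim: rev_finite_subset)
    have e0S: "e0 \<in> ?S" using e0 p0 by simp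
    obtain e where e: "e \<in> ?S" "\<mu> e = Max (\<mu> ` ?S)"
      using Max_in[of "\<mu> ` ?S"] f e0S by (metis (no_types, lifting) empty_iff finite_imageI imageE image_is_empty)
    have "\<mu> e' \<le> \<mu> e" if "e' \<in> Q" for e'
    proof (cases "e' \<in> ?S")
      case True
      then show ?thesis using f e(2) by simp
    next
      case False
      then have "\<mu> e' \<le> \<mu> e0 / 2" using that by simp
      also have "\<dots> < \<mu> e" using e(1) by simp
      finally show ?thesis by simp
    qed
    then show ?thesis using e(1) by blast
  qed
  define R where "R f n r \<longleftrightarrow> r \<in> P - f ` {..<n} \<and> (\<forall>e'\<in>P - f ` {..<n}. \<mu> e' \<le> \<mu> r)"
    for f :: "nat \<Rightarrow> 'e" and n r
  have "\<exists>f. \<forall>n. R f n (f n)"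
  proof (rule dependent_wf_choice[of less_than])
    show "R f n r = R g n r" if "\<And>m. (m, n) \<in> less_than \<Longrightarrow> f m = g m" for f g n r
    proof -
      have "f ` {..<n} = g ` {..<n}" using that by (intro image_cong) auto
      then show ?thesis by (simp add: R_def)
    qed
    fix n :: nat and f :: "nat \<Rightarrow> 'e"
    have "infinite (P - f ` {..<n})" using inf by (intro Diff_infinite_finite) auto
    then have "P - f ` {..<n} \<noteq> {}" by (rule infinite_imp_nonempty)
    then show "\<exists>r. R f n r" using argmax[of "P - f ` {..<n}"] by (auto simp: R_def)
  qed simp
  then obtain p where p: "\<And>n. R p n (p n)" by blast
  have "p m \<noteq> p n" if "m < n" for m n
    using p[of n] that unfolding R_def by (metis DiffD2 image_eqI lessThan_iff)
  then have inj: "inj p" by (metis injI linorder_neqE_nat)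
  have anti: "antimono (\<lambda>i. \<mu> (p i))"
  proof (rule antimonoI)
    fix m n :: nat assume "m \<le> n"
    then have "p n \<in> P - p ` {..<m}" using p[of n] by (auto simp: R_def)
    then show "\<mu> (p n) \<le> \<mu> (p m)" using p[of m] by (auto simp: R_def)
  qed
  have "e \<in> range p" if e: "e \<in> P" for e
  proof (rule ccontr)
    assume ne: "e \<notin> range p"
    have "range p \<subseteq> {e' \<in> P. \<mu> e / 2 < \<mu> e'}"
    proof safe
      fix n
      show "p n \<in> P" using p[of n] by (simp add: R_def)
      have "\<mu> e \<le> \<mu> (p n)" using p[of n] e ne by (auto simp: R_def)
      then show "\<mu> e / 2 < \<mu> (p n)" using pos[OF e] by simp
    qed
    moreover have "finite {e' \<in> P. \<mu> e / 2 < \<mu> e'}" using pos[OF e] by (intro fin) simp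
    ultimately have "finite (range p)" by (rule finite_subset)
    then show False using inj finite_imageD by blast
  qed
  moreover have "p n \<in> P" for n using p[of n] by (simp add: R_def)
  ultimately have "bij_betw p UNIV P" using inj by (auto simp: bij_betw_def)
  then show ?thesis using anti by (rule that)
qed

text \<open>With finitely many positive values these come first and the zeros follow. With
  infinitely many, the positive ones are laid out in decreasing order along an infinite set A of
  positions and the zeros fill the complement of A.\<close>

lemma eigenvalue_enumeration:
  fixes \<mu> :: "'e \<Rightarrow> real"
  assumes cnt: "countable E" and nonneg: "\<And>e. e \<in> E \<Longrightarrow> 0 \<le> \<mu> e"
    and fin: "\<And>\<epsilon>. \<epsilon> > 0 \<Longrightarrow> finite {e \<in> E. \<epsilon> < \<mu> e}"
  obtains I b where "bij_betw b I E" "eigenvalue_sequence I (\<lambda>i. \<mu> (b i))"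
proof (cases "finite E")
  case True
  obtain b where b: "bij_betw b {..<card E} E" "antimono_on {..<card E} (\<lambda>i. \<mu> (b i))"
    by (rule finite_decreasing_enumeration[OF True])
  have "b i \<in> E" if "i < card E" for i using b(1) that by (auto simp: bij_betw_def)
  then have "eigenvalue_sequence {..<card E} (\<lambda>i. \<mu> (b i))"
    unfolding eigenvalue_sequence_def using b(2) nonneg
    by (auto intro: monotone_on_subset)
  then show ?thesis using b(1) that by blast
next
  case infE: False
  define P where "P = {e \<in> E. 0 < \<mu> e}"
  define Z where "Z = E - P"
  have Z: "\<mu> e = 0" if "e \<in> Z" for e using that nonneg[of e] by (auto simp: Z_def P_def)
  have Ppos: "\<And>e. e \<in> P \<Longrightarrow> 0 < \<mu> e" by (simp add: P_def)
  have PZ: "P \<union> Z = E" "P \<inter> Z = {}" by (auto simp: P_def Z_def)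
  have cntZ: "countable Z" using cnt by (simp add: Z_def)
  have lim: "(\<lambda>i. \<mu> (b i)) \<longlonglongrightarrow> 0" if b: "bij_betw b UNIV E" for b :: "nat \<Rightarrow> 'e"
  proof (rule tendstoI)
    fix \<epsilon> :: real assume \<epsilon>: "\<epsilon> > 0"
    have "finite (b -` {e \<in> E. \<epsilon> / 2 < \<mu> e})"
      using fin[of "\<epsilon> / 2"] \<epsilon> b by (intro finite_vimageI) (auto simp: bij_betw_def)
    moreover have "{i. \<not> dist (\<mu> (b i)) 0 < \<epsilon>} \<subseteq> b -` {e \<in> E. \<epsilon> / 2 < \<mu> e}"
    proof
      fix i assume "i \<in> {i. \<not> dist (\<mu> (b i)) 0 < \<epsilon>}"
      moreover have "b i \<in> E" using b by (auto simp: bij_betw_def)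
      ultimately show "i \<in> b -` {e \<in> E. \<epsilon> / 2 < \<mu> e}"
        using nonneg[of "b i"] \<epsilon> by (auto simp: dist_real_def)
    qed
    ultimately show "\<forall>\<^sub>F i in sequentially. dist (\<mu> (b i)) 0 < \<epsilon>"
      unfolding cofinite_eq_sequentially[symmetric] eventually_cofinite
      using finite_subset by blast
  qed
  have mu0: "0 \<le> \<mu> (b i)" if "bij_betw b UNIV E" for b :: "nat \<Rightarrow> 'e" and i
    using that nonneg[of "b i"] by (auto simp: bij_betw_def)
  show ?thesis
  proof (cases "finite P")
    case True
    obtain p where p: "bij_betw p {..<card P} P" "antimono_on {..<card P} (\<lambda>i. \<mu> (p i))"
      by (rule finite_decreasing_enumeration[OF True])
    have "infinite Z" using infE True by (auto simp: Z_def)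
    then have z: "bij_betw (from_nat_into Z) UNIV Z" using cntZ by (intro bij_betw_from_nat_into)
    define b where "b i = (if i < card P then p i else from_nat_into Z (i - card P))" for i
    have 1: "bij_betw b {..<card P} P"
      using p(1) by (rule iffD1[OF bij_betw_cong, rotated]) (simp add: b_def)
    have sh: "bij_betw (\<lambda>i. i - card P) {card P..} UNIV"
      by (rule bij_betw_byWitness[where f' = "\<lambda>i. i + card P"]) auto
    have 2: "bij_betw b {card P..} Z"
      using bij_betw_trans[OF sh z]
      by (rule iffD1[OF bij_betw_cong, rotated]) (auto simp: b_def)
    have "{..<card P} \<union> {card P..} = UNIV" by auto
    then have b: "bij_betw b UNIV E"
      using bij_betw_combine[OF 1 2] PZ by simp
    have b0: "\<mu> (b i) = 0" if "\<not> i < card P" for i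
      using that 2 Z by (auto simp: bij_betw_def)
    have "antimono (\<lambda>i. \<mu> (b i))"
    proof (rule antimonoI)
      fix m n :: nat assume mn: "m \<le> n"
      show "\<mu> (b n) \<le> \<mu> (b m)"
      proof (cases "n < card P")
        case True
        then show ?thesis using p(2) mn by (auto simp: b_def monotone_on_def)
      next
        case False
        then show ?thesis using b0[of n] mu0[OF b, of m] by simp
      qed
    qed
    then have "eigenvalue_sequence UNIV (\<lambda>i. \<mu> (b i))"
      unfolding eigenvalue_sequence_def using lim[OF b] mu0[OF b]
      by (auto intro: monotone_on_subset)
    then show ?thesis using b that by blast
  next
    case False
    have finP: "finite {e \<in> P. \<epsilon> < \<mu> e}" if "\<epsilon> > 0" for \<epsilon>
      using fin[OF that] by (rule rev_finite_subset) (auto simp: P_def)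
    obtain p :: "nat \<Rightarrow> 'e" where p: "bij_betw p UNIV P" "antimono (\<lambda>i. \<mu> (p i))"
    proof (rule infinite_decreasing_enumeration[of P \<mu>])
      show "infinite P" by (rule False)
      show "0 < \<mu> e" if e: "e \<in> P" for e by (rule Ppos[OF e])
      show "finite {e \<in> P. \<epsilon> < \<mu> e}" if \<epsilon>: "0 < \<epsilon>" for \<epsilon> by (rule finP[OF \<epsilon>])
    qed (rule that; assumption)
    \<comment> \<open>Finitely many zeros occupy the initial positions, infinitely many the odd
      ones. If there are none, A is all of nat, so that the entire sequence is non-increasing, as
      \<open>eigenvalue_sequence\<close> requires in that case.\<close>
    have "\<exists>(A::nat set) c. infinite A \<and> bij_betw c (- A) Z"
    proof (cases "finite Z")
      case True
      obtain c where c: "bij_betw c {0..<card Z} Z" using ex_bij_betw_nat_finite[OF True] by blast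
      have "- {card Z..} = {0..<card Z}" by auto
      then show ?thesis
        using c by (intro exI[of _ "{card Z..}"] exI[of _ c]) (auto simp: infinite_Ici)
    next
      case False
      have z: "bij_betw (from_nat_into Z) UNIV Z" using cntZ False by (intro bij_betw_from_nat_into)
      have "bij_betw (\<lambda>i. i div 2) {n::nat. odd n} UNIV"
        by (rule bij_betw_byWitness[where f' = "\<lambda>i. 2 * i + 1"]) auto
      from bij_betw_trans[OF this z] have "bij_betw (from_nat_into Z \<circ> (\<lambda>i. i div 2)) {n. odd n} Z" .
      moreover have "- {n::nat. even n} = {n. odd n}" by auto
      moreover have "infinite {n::nat. even n}"
      proof -
        have "range (\<lambda>n::nat. 2 * n) \<subseteq> {n. even n}" by auto
        moreover have "infinite (range (\<lambda>n::nat. 2 * n))"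
          by (intro range_inj_infinite injI) simp
        ultimately show ?thesis by (rule infinite_super)
      qed
      ultimately show ?thesis by metis
    qed
    then obtain A :: "nat set" and c where A: "infinite A" "bij_betw c (- A) Z" by blast
    have en: "bij_betw (enumerate A) UNIV A" by (rule bij_enumerate[OF A(1)])
    \<comment> \<open>r i is the rank of i within A, so reading p along A preserves the
      order.\<close>
    define r where "r = the_inv_into UNIV (enumerate A)"
    have r: "bij_betw r A UNIV" unfolding r_def by (rule bij_betw_the_inv_into[OF en])
    have enr: "enumerate A (r i) = i" if "i \<in> A" for i
      unfolding r_def using en that by (intro f_the_inv_into_f_bij_betw) auto
    define b where "b i = (if i \<in> A then p (r i) else c i)" for i
    have 1: "bij_betw b A P"
      using bij_betw_trans[OF r p(1)]
      by (rule iffD1[OF bij_betw_cong, rotated]) (simp add: b_def)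
    have 2: "bij_betw b (- A) Z"
      using A(2) by (rule iffD1[OF bij_betw_cong, rotated]) (simp add: b_def)
    have b: "bij_betw b UNIV E"
      using bij_betw_combine[OF 1 2] PZ by (simp add: Compl_partition)
    have bA: "{i. 0 < \<mu> (b i)} = A"
    proof -
      have "b i \<in> P" if "i \<in> A" for i using 1 that by (auto simp: bij_betw_def)
      moreover have "b i \<in> Z" if "i \<notin> A" for i using 2 that by (auto simp: bij_betw_def)
      ultimately show ?thesis using Ppos Z by force
    qed
    have anti: "antimono_on A (\<lambda>i. \<mu> (b i))"
    proof (rule monotone_onI)
      fix i j assume ij: "i \<in> A" "j \<in> A" "i \<le> j"
      have "r i \<le> r j"
      proof (rule ccontr)
        assume "\<not> r i \<le> r j"
        then have "enumerate A (r j) < enumerate A (r i)" using A(1) by (intro enumerate_mono) auto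
        then show False using enr[OF ij(1)] enr[OF ij(2)] ij(3) by simp
      qed
      then show "\<mu> (b i) \<ge> \<mu> (b j)"
        using p(2) ij by (simp add: b_def antimono_def)
    qed
    have "eigenvalue_sequence UNIV (\<lambda>i. \<mu> (b i))"
      unfolding eigenvalue_sequence_def using lim[OF b] mu0[OF b] anti bA A(1) by auto
    then show ?thesis using b that by blast
  qed
qed


section \<open>Everywhere defined operators, adjoints and pseudoinverses\<close>

text \<open>Bridge from total functions, convenient for calculation, to partial maps; undefinedness
  off the carrier makes equality of operators equality on the carrier.\<close>

definition opmap :: "'v inner_space \<Rightarrow> ('v \<Rightarrow> 'w) \<Rightarrow> ('v \<rightharpoonup> 'w)" where
  "opmap V f x = (if x \<in> carrier V then Some (f x) else None)"

definition bounded_map :: "'v inner_space \<Rightarrow> 'w inner_space \<Rightarrow> ('v \<Rightarrow> 'w) \<Rightarrow> bool" where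
  "bounded_map V U f \<longleftrightarrow> f \<in> carrier V \<rightarrow> carrier U \<and>
     (\<forall>x\<in>carrier V. \<forall>y\<in>carrier V. f (x \<oplus>\<^bsub>V\<^esub> y) = f x \<oplus>\<^bsub>U\<^esub> f y) \<and>
     (\<forall>c. \<forall>x\<in>carrier V. f (c \<odot>\<^bsub>V\<^esub> x) = c \<odot>\<^bsub>U\<^esub> f x) \<and>
     (\<exists>C. \<forall>x\<in>carrier V. cnorm U (f x) \<le> C * cnorm V x)"

lemma bounded_mapD:
  assumes "bounded_map V U f"
  shows "x \<in> carrier V \<Longrightarrow> f x \<in> carrier U"
    "\<lbrakk>x \<in> carrier V; y \<in> carrier V\<rbrakk> \<Longrightarrow> f (x \<oplus>\<^bsub>V\<^esub> y) = f x \<oplus>\<^bsub>U\<^esub> f y"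
    "x \<in> carrier V \<Longrightarrow> f (c \<odot>\<^bsub>V\<^esub> x) = c \<odot>\<^bsub>U\<^esub> f x"
  using assms by (auto simp: bounded_map_def)

lemma dom_opmap [simp]: "dom (opmap V f) = carrier V"
  by (auto simp: opmap_def dom_def)

lemma ran_opmap [simp]: "ran (opmap V f) = f ` carrier V"
  by (auto simp: opmap_def ran_def image_def)

lemma opmap_apply [simp]: "x \<in> carrier V \<Longrightarrow> opmap V f x = Some (f x)"
  by (simp add: opmap_def)

lemma opmap_comp:
  "f \<in> carrier V \<rightarrow> carrier U \<Longrightarrow> opmap U g \<circ>\<^sub>m opmap V f = opmap V (\<lambda>x. g (f x))"
  by (auto simp: opmap_def map_comp_def fun_eq_iff)

lemma opmap_cong: "(\<And>x. x \<in> carrier V \<Longrightarrow> f x = g x) \<Longrightarrow> opmap V f = opmap V g"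
  by (auto simp: opmap_def)

lemma op_kernel_opmap: "op_kernel V U (opmap V f) = {x \<in> carrier V. f x = \<zero>\<^bsub>U\<^esub>}"
  by (auto simp: op_kernel_def opmap_def)

locale inner_space_pair = V: complex_inner_space V + U: complex_inner_space U
  for V :: "'v inner_space" and U :: "'u inner_space"
begin

lemma bounded_operator_opmap:
  "bounded_map V U f \<Longrightarrow> bounded_operator V U (opmap V f)"
  unfolding bounded_operator_def linear_operator_def bounded_map_def
  using V.carrier_is_submodule by auto

lemma bounded_operatorE:
  assumes "bounded_operator V U B"
  obtains f where "B = opmap V f" "bounded_map V U f"
proof
  have B: "dom B = carrier V" "ran B \<subseteq> carrier U"
    using assms by (auto simp: bounded_operator_def linear_operator_def)
  have some: "B x = Some (the (B x))" if "x \<in> carrier V" for x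
    using B(1) that domD[of x B] by auto
  have "B x = None" if "x \<notin> carrier V" for x using B(1) that domIff[of x B] by simp
  with some show "B = opmap V (\<lambda>x. the (B x))"
    unfolding opmap_def by (intro ext) metis
  with some show "bounded_map V U (\<lambda>x. the (B x))"
    using assms B unfolding bounded_operator_def linear_operator_def bounded_map_def
    by (auto simp: Pi_iff ran_def)
qed

lemma bounded_map_zero: "bounded_map V U f \<Longrightarrow> f \<zero>\<^bsub>V\<^esub> = \<zero>\<^bsub>U\<^esub>"
  using bounded_mapD(3)[of V U f "\<zero>\<^bsub>V\<^esub>" 0] bounded_mapD(1)[of V U f "\<zero>\<^bsub>V\<^esub>"] by simp

lemma bounded_map_diff:
  assumes f: "bounded_map V U f" and xy: "x \<in> carrier V" "y \<in> carrier V"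
  shows "f (x \<ominus>\<^bsub>V\<^esub> y) = f x \<ominus>\<^bsub>U\<^esub> f y"
proof -
  note c = bounded_mapD(1)[OF f]
  have "x \<ominus>\<^bsub>V\<^esub> y = x \<oplus>\<^bsub>V\<^esub> (-1) \<odot>\<^bsub>V\<^esub> y"
    using xy by (intro V.cinner_ext) (simp_all add: V.cinner_simps)
  then have "f (x \<ominus>\<^bsub>V\<^esub> y) = f x \<oplus>\<^bsub>U\<^esub> (-1) \<odot>\<^bsub>U\<^esub> f y"
    using xy by (simp add: bounded_mapD[OF f])
  also have "\<dots> = f x \<ominus>\<^bsub>U\<^esub> f y"
    using xy c by (intro U.cinner_ext) (simp_all add: U.cinner_simps)
  finally show ?thesis .
qed

lemma bounded_map_bound:
  assumes "bounded_map V U f"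
  obtains C where "C \<ge> 0" "\<forall>x\<in>carrier V. cnorm U (f x) \<le> C * cnorm V x"
proof -
  obtain C where C: "\<forall>x\<in>carrier V. cnorm U (f x) \<le> C * cnorm V x"
    using assms by (auto simp: bounded_map_def)
  have "cnorm U (f x) \<le> \<bar>C\<bar> * cnorm V x" if "x \<in> carrier V" for x
    using bspec[OF C that] mult_right_mono[OF abs_ge_self[of C] V.cnorm_nonneg[OF that]] by linarith
  then show ?thesis using that[of "\<bar>C\<bar>"] by simp
qed

lemma closure_bounded_image:
  assumes f: "bounded_map V U f" and S: "S \<subseteq> carrier V"
    and x: "x \<in> norm_topology V closure_of S"
  shows "f x \<in> norm_topology U closure_of (f ` S)"
proof -
  note c = bounded_mapD(1)[OF f]
  have xc: "x \<in> carrier V" and ap: "\<forall>\<epsilon>>0. \<exists>y\<in>S. cnorm V (x \<ominus>\<^bsub>V\<^esub> y) < \<epsilon>"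
    using x unfolding V.in_closure_iff[OF S] by simp_all
  obtain C where C: "C \<ge> 0" "\<forall>x\<in>carrier V. cnorm U (f x) \<le> C * cnorm V x"
    by (rule bounded_map_bound[OF f])
  have "\<exists>y\<in>f ` S. cnorm U (f x \<ominus>\<^bsub>U\<^esub> y) < \<epsilon>" if \<epsilon>: "\<epsilon> > 0" for \<epsilon>
  proof -
    obtain y where y: "y \<in> S" "cnorm V (x \<ominus>\<^bsub>V\<^esub> y) < \<epsilon> / (C + 1)"
      using ap[rule_format, of "\<epsilon> / (C + 1)"] \<epsilon> C(1) by auto
    have yc: "y \<in> carrier V" using y S by auto
    have "cnorm U (f x \<ominus>\<^bsub>U\<^esub> f y) \<le> C * cnorm V (x \<ominus>\<^bsub>V\<^esub> y)"
      using C(2)[rule_format, of "x \<ominus>\<^bsub>V\<^esub> y"] xc yc by (simp add: bounded_map_diff[OF f])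
    also have "\<dots> \<le> (C + 1) * cnorm V (x \<ominus>\<^bsub>V\<^esub> y)" using xc yc by (intro mult_right_mono) auto
    also have "\<dots> < \<epsilon>" using y(2) C(1) by (simp add: pos_less_divide_eq mult.commute)
    finally show ?thesis using y(1) by blast
  qed
  moreover have "f ` S \<subseteq> carrier U" using S c by auto
  ultimately show ?thesis using U.in_closure_iff[of "f ` S"] c[OF xc] by blast
qed

lemma kernel_submodule:
  assumes f: "bounded_map V U f"
  shows "submodule {x \<in> carrier V. f x = \<zero>\<^bsub>U\<^esub>} complex_ring V"
  using bounded_map_zero[OF f] bounded_mapD[OF f] by (intro V.subspaceI) auto

lemma kernel_closed:
  assumes f: "bounded_map V U f"
  shows "closedin (norm_topology V) {x \<in> carrier V. f x = \<zero>\<^bsub>U\<^esub>}"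
proof (subst V.closed_iff)
  obtain C where C: "C \<ge> 0" "\<forall>x\<in>carrier V. cnorm U (f x) \<le> C * cnorm V x"
    by (rule bounded_map_bound[OF f])
  note c = bounded_mapD(1)[OF f]
  have "f x = \<zero>\<^bsub>U\<^esub>"
    if x: "x \<in> carrier V" "\<And>\<epsilon>. \<epsilon> > 0 \<Longrightarrow> \<exists>y\<in>carrier V. f y = \<zero>\<^bsub>U\<^esub> \<and> cnorm V (x \<ominus>\<^bsub>V\<^esub> y) < \<epsilon>" for x
  proof -
    have "cnorm U (f x) \<le> C * \<epsilon>" if \<epsilon>: "\<epsilon> > 0" for \<epsilon>
    proof -
      obtain y where y: "y \<in> carrier V" "f y = \<zero>\<^bsub>U\<^esub>" "cnorm V (x \<ominus>\<^bsub>V\<^esub> y) < \<epsilon>" using x(2)[OF \<epsilon>] by blast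
      have "x = (x \<ominus>\<^bsub>V\<^esub> y) \<oplus>\<^bsub>V\<^esub> y"
        using x(1) y(1) by (intro V.cinner_ext) (simp_all add: V.cinner_simps)
      then have "f x = f (x \<ominus>\<^bsub>V\<^esub> y)"
        using x(1) y(1,2) bounded_mapD(2)[OF f, of "x \<ominus>\<^bsub>V\<^esub> y" y] c by simp
      then have "cnorm U (f x) \<le> C * cnorm V (x \<ominus>\<^bsub>V\<^esub> y)" using C(2)[rule_format, of "x \<ominus>\<^bsub>V\<^esub> y"] x(1) y(1) by simp
      also have "\<dots> \<le> C * \<epsilon>" using y(3) C(1) by (intro mult_left_mono) auto
      finally show ?thesis .
    qed
    then have "cnorm U (f x) \<le> 0 + e" if "e > 0" for e
    proof -
      have "cnorm U (f x) \<le> C * (e / (C + 1))"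
        using C(1) that \<open>\<And>\<epsilon>. 0 < \<epsilon> \<Longrightarrow> cnorm U (f x) \<le> C * \<epsilon>\<close>[of "e / (C + 1)"] by simp
      also have "\<dots> \<le> e" using C(1) that by (simp add: field_simps)
      finally show ?thesis by simp
    qed
    then have "cnorm U (f x) \<le> 0" by (rule field_le_epsilon)
    then show ?thesis using c[OF x(1)] U.cnorm_nonneg[of "f x"] U.cnorm_eq_0[of "f x"] by linarith
  qed
  then show "\<forall>x\<in>carrier V. (\<forall>\<epsilon>>0. \<exists>y\<in>{x \<in> carrier V. f x = \<zero>\<^bsub>U\<^esub>}. cnorm V (x \<ominus>\<^bsub>V\<^esub> y) < \<epsilon>) \<longrightarrow>
      x \<in> {x \<in> carrier V. f x = \<zero>\<^bsub>U\<^esub>}"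
    by (intro ballI impI CollectI conjI) blast+
qed auto

text \<open>Discharges the description operator: the adjoint identity determines every value of a
  candidate through its pairings.\<close>

lemma adjoint_opI:
  assumes f: "bounded_map V U f" and g: "bounded_map U V g"
    and adj: "\<And>x y. \<lbrakk>x \<in> carrier V; y \<in> carrier U\<rbrakk> \<Longrightarrow> cinner V (g y) x = cinner U y (f x)"
  shows "adjoint_op V U (opmap V f) = opmap U g"
  unfolding adjoint_op_def
proof (rule the_equality)
  interpret UV: inner_space_pair U V ..
  show "bounded_operator U V (opmap U g) \<and> (\<forall>x\<in>carrier V. \<forall>y\<in>carrier U.
      cinner V (the (opmap U g y)) x = cinner U y (the (opmap V f x)))"
    using UV.bounded_operator_opmap[OF g] adj by simp
  fix B assume B: "bounded_operator U V B \<and> (\<forall>x\<in>carrier V. \<forall>y\<in>carrier U.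
      cinner V (the (B y)) x = cinner U y (the (opmap V f x)))"
  then obtain h where h: "B = opmap U h" "bounded_map U V h" using UV.bounded_operatorE by blast
  have "h y = g y" if y: "y \<in> carrier U" for y
  proof (rule V.cinner_ext)
    show c: "h y \<in> carrier V" "g y \<in> carrier V"
      using bounded_mapD(1)[OF h(2) y] bounded_mapD(1)[OF g y] .
    fix x assume x: "x \<in> carrier V"
    have "cinner V (h y) x = cinner V (g y) x" using B h(1) adj x y by simp
    then show "cinner V x (h y) = cinner V x (g y)"
      using V.cinner_commute[OF x c(1)] V.cinner_commute[OF x c(2)] by simp
  qed
  then show "B = opmap U g" using h(1) opmap_cong by blast
qed

end

locale hilbert_pair = inner_space_pair V U + V: complex_hilbert_space V
  for V :: "'v inner_space" and U :: "'u inner_space"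
begin

lemma in_subspace_and_orth:
  assumes "S \<subseteq> carrier V" "x \<in> S" "x \<in> orth_complement V S"
  shows "x = \<zero>\<^bsub>V\<^esub>"
  using assms V.cinner_self_eq_0[of x] by (auto simp: orth_complement_def)

section \<open>The Moore-Penrose pseudoinverse of a bounded map\<close>

context
  fixes f :: "'v \<Rightarrow> 'u"
  assumes bounded: "bounded_map V U f"
begin

abbreviation (input) "N \<equiv> {x \<in> carrier V. f x = \<zero>\<^bsub>U\<^esub>}"
abbreviation (input) "N_orth \<equiv> orth_complement V N"
abbreviation (input) "R \<equiv> f ` carrier V"
abbreviation (input) "R_orth \<equiv> orth_complement U R"

lemmas f_carrier = bounded_mapD(1)[OF bounded]

lemma R_carrier: "R \<subseteq> carrier U"
  using f_carrier by auto

lemma N_orth_submodule: "submodule N_orth complex_ring V"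
  by (rule V.orth_complement_submodule) auto

lemma R_orth_submodule: "submodule R_orth complex_ring U"
  by (rule U.orth_complement_submodule[OF R_carrier])

lemma N_orth_carrier: "u \<in> N_orth \<Longrightarrow> u \<in> carrier V"
  by (simp add: orth_complement_def)

lemma R_orth_carrier: "u \<in> R_orth \<Longrightarrow> u \<in> carrier U"
  by (simp add: orth_complement_def)

lemma in_R_and_R_orth: "\<lbrakk>y \<in> R; y \<in> R_orth\<rbrakk> \<Longrightarrow> y = \<zero>\<^bsub>U\<^esub>"
  using R_carrier U.cinner_self_eq_0[of y] by (auto simp: orth_complement_def)

lemma f_inj_on_N_orth:
  assumes "u \<in> N_orth" "u' \<in> N_orth" "f u = f u'"
  shows "u = u'"
proof -
  have c: "u \<in> carrier V" "u' \<in> carrier V" using assms by (auto simp: orth_complement_def)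
  have "f (u \<ominus>\<^bsub>V\<^esub> u') = \<zero>\<^bsub>U\<^esub>"
    using c assms(3) f_carrier by (simp add: bounded_map_diff[OF bounded] U.diff_eq_zero_iff)
  then have "u \<ominus>\<^bsub>V\<^esub> u' \<in> N" using c by simp
  moreover have "u \<ominus>\<^bsub>V\<^esub> u' \<in> N_orth" by (intro V.subspaceD(6)[OF N_orth_submodule] assms)
  ultimately have "u \<ominus>\<^bsub>V\<^esub> u' = \<zero>\<^bsub>V\<^esub>" by (intro in_subspace_and_orth[of N]) auto
  then show ?thesis using c V.diff_eq_zero_iff by simp
qed

text \<open>The difference of two decompositions lies in both R and R_orth and so vanishes, and f is
  injective on N_orth. This justifies the \<open>THE\<close> in \<open>pseudo\<close>.\<close>

lemma decomposition_unique:
  assumes "u \<in> N_orth" "u' \<in> N_orth" "v \<in> R_orth" "v' \<in> R_orth"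
    "f u \<oplus>\<^bsub>U\<^esub> v = f u' \<oplus>\<^bsub>U\<^esub> v'"
  shows "u = u'" "v = v'"
proof -
  have c: "u \<in> carrier V" "u' \<in> carrier V" "v \<in> carrier U" "v' \<in> carrier U"
    using assms by (auto simp: orth_complement_def)
  note fc = f_carrier[OF c(1)] f_carrier[OF c(2)]
  have *: "f u \<ominus>\<^bsub>U\<^esub> f u' = v' \<ominus>\<^bsub>U\<^esub> v"
  proof (rule U.cinner_ext)
    fix z assume z: "z \<in> carrier U"
    have "cinner U z (f u \<oplus>\<^bsub>U\<^esub> v) = cinner U z (f u' \<oplus>\<^bsub>U\<^esub> v')" using assms(5) by simp
    then show "cinner U z (f u \<ominus>\<^bsub>U\<^esub> f u') = cinner U z (v' \<ominus>\<^bsub>U\<^esub> v)"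
      using z c fc by (simp add: U.cinner_simps algebra_simps)
  qed (use c fc in auto)
  have "f u \<ominus>\<^bsub>U\<^esub> f u' \<in> R"
    using c by (simp flip: bounded_map_diff[OF bounded])
  moreover have "f u \<ominus>\<^bsub>U\<^esub> f u' \<in> R_orth"
    unfolding * by (intro U.subspaceD(6)[OF R_orth_submodule] assms)
  ultimately have "f u \<ominus>\<^bsub>U\<^esub> f u' = \<zero>\<^bsub>U\<^esub>" by (rule in_R_and_R_orth)
  then show "u = u'" using fc U.diff_eq_zero_iff f_inj_on_N_orth[OF assms(1,2)] by simp
  then show "v = v'"
    using * c fc U.diff_eq_zero_iff[of v' v] U.diff_eq_zero_iff[of "f u" "f u"] by auto
qed

lemma preimage_in_N_orth:
  assumes x: "x \<in> carrier V"
  obtains u where "u \<in> N_orth" "f u = f x"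
proof -
  obtain p where p: "p \<in> N" "x \<ominus>\<^bsub>V\<^esub> p \<in> N_orth"
    by (rule V.projection_exists[OF kernel_submodule[OF bounded] kernel_closed[OF bounded] x])
  have "x = (x \<ominus>\<^bsub>V\<^esub> p) \<oplus>\<^bsub>V\<^esub> p"
    using x p by (intro V.cinner_ext) (simp_all add: V.cinner_simps)
  then have "f x = f (x \<ominus>\<^bsub>V\<^esub> p)"
    using x p bounded_mapD(2)[OF bounded, of "x \<ominus>\<^bsub>V\<^esub> p" p] f_carrier by simp
  then show ?thesis using that[OF p(2)] by simp
qed

text \<open>The inverse of f restricted to the orthogonal complement of its kernel, extended by 0 on
  the complement of the range. \<open>pinv\<close> turns out to be this map, and later arguments
  work with the decomposition y = f u + v.\<close>

definition pseudo :: "'u \<rightharpoonup> 'v" where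
  "pseudo y = (if \<exists>u\<in>N_orth. \<exists>v\<in>R_orth. y = f u \<oplus>\<^bsub>U\<^esub> v
     then Some (THE u. u \<in> N_orth \<and> (\<exists>v\<in>R_orth. y = f u \<oplus>\<^bsub>U\<^esub> v)) else None)"

lemma pseudo_Some_iff:
  "pseudo y = Some u \<longleftrightarrow> u \<in> N_orth \<and> (\<exists>v\<in>R_orth. y = f u \<oplus>\<^bsub>U\<^esub> v)" (is "_ \<longleftrightarrow> ?P u")
proof
  assume "?P u"
  moreover have "(THE u. ?P u) = u"
    using \<open>?P u\<close> decomposition_unique(1) by (intro the_equality) blast+
  ultimately show "pseudo y = Some u" by (auto simp: pseudo_def)
next
  assume y: "pseudo y = Some u"
  then obtain u' where u': "?P u'" by (auto simp: pseudo_def split: if_splits)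
  moreover have "(THE u. ?P u) = u'"
    using u' decomposition_unique(1) by (intro the_equality) blast+
  ultimately show "?P u" using y by (auto simp: pseudo_def split: if_splits)
qed

lemma pseudo_SomeI: "\<lbrakk>u \<in> N_orth; v \<in> R_orth; y = f u \<oplus>\<^bsub>U\<^esub> v\<rbrakk> \<Longrightarrow> pseudo y = Some u"
  unfolding pseudo_Some_iff by (intro conjI bexI)

lemma pseudo_SomeE:
  assumes "pseudo y = Some u"
  obtains v where "u \<in> N_orth" "v \<in> R_orth" "y = f u \<oplus>\<^bsub>U\<^esub> v"
  using assms unfolding pseudo_Some_iff by (elim conjE bexE)

lemma zero_in_orth: "\<zero>\<^bsub>V\<^esub> \<in> N_orth" "\<zero>\<^bsub>U\<^esub> \<in> R_orth"
  using V.subspaceD(3)[OF N_orth_submodule] U.subspaceD(3)[OF R_orth_submodule] by blast+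

lemma pseudo_add:
  assumes "pseudo y = Some u" "pseudo z = Some w"
  shows "pseudo (y \<oplus>\<^bsub>U\<^esub> z) = Some (u \<oplus>\<^bsub>V\<^esub> w)"
proof -
  obtain a where a1: "u \<in> N_orth" "a \<in> R_orth" "y = f u \<oplus>\<^bsub>U\<^esub> a"
    by (rule pseudo_SomeE[OF assms(1)])
  obtain b where "w \<in> N_orth" "b \<in> R_orth" "z = f w \<oplus>\<^bsub>U\<^esub> b"
    by (rule pseudo_SomeE[OF assms(2)])
  note a = a1 this
  then have c: "u \<in> carrier V" "w \<in> carrier V" "a \<in> carrier U" "b \<in> carrier U"
    by (auto simp: orth_complement_def)
  note fc = f_carrier[OF c(1)] f_carrier[OF c(2)]
  have "y \<oplus>\<^bsub>U\<^esub> z = f (u \<oplus>\<^bsub>V\<^esub> w) \<oplus>\<^bsub>U\<^esub> (a \<oplus>\<^bsub>U\<^esub> b)"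
    using a c fc by (simp add: bounded_mapD(2)[OF bounded] U.a_ac)
  moreover have "a \<oplus>\<^bsub>U\<^esub> b \<in> R_orth" by (intro U.subspaceD(4)[OF R_orth_submodule] a)
  moreover have "u \<oplus>\<^bsub>V\<^esub> w \<in> N_orth" by (intro V.subspaceD(4)[OF N_orth_submodule] a)
  ultimately show ?thesis by (intro pseudo_SomeI)
qed

lemma pseudo_smult:
  assumes "pseudo y = Some u"
  shows "pseudo (c \<odot>\<^bsub>U\<^esub> y) = Some (c \<odot>\<^bsub>V\<^esub> u)"
proof -
  obtain a where a: "u \<in> N_orth" "a \<in> R_orth" "y = f u \<oplus>\<^bsub>U\<^esub> a"
    using assms by (rule pseudo_SomeE)
  then have car: "u \<in> carrier V" "a \<in> carrier U"
    by (auto simp: orth_complement_def)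
  have "c \<odot>\<^bsub>U\<^esub> y = f (c \<odot>\<^bsub>V\<^esub> u) \<oplus>\<^bsub>U\<^esub> c \<odot>\<^bsub>U\<^esub> a"
    using a car f_carrier[OF car(1)] by (simp add: bounded_mapD(3)[OF bounded] U.smult_r_distr)
  moreover have "c \<odot>\<^bsub>U\<^esub> a \<in> R_orth" by (intro U.subspaceD(5)[OF R_orth_submodule] a)
  moreover have "c \<odot>\<^bsub>V\<^esub> u \<in> N_orth" by (intro V.subspaceD(5)[OF N_orth_submodule] a)
  ultimately show ?thesis by (intro pseudo_SomeI)
qed

lemma dom_pseudo: "dom pseudo = R <+>\<^bsub>U\<^esub> R_orth"
proof
  show "dom pseudo \<subseteq> R <+>\<^bsub>U\<^esub> R_orth"
  proof
    fix y assume "y \<in> dom pseudo"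
    then obtain u where "pseudo y = Some u" by (elim domD[elim_format] exE)
    then obtain v where uv: "u \<in> N_orth" "v \<in> R_orth" "y = f u \<oplus>\<^bsub>U\<^esub> v"
      by (rule pseudo_SomeE)
    then have "f u \<in> R" using N_orth_carrier[OF uv(1)] by simp
    then show "y \<in> R <+>\<^bsub>U\<^esub> R_orth" unfolding set_add_def' using uv(2,3) by blast
  qed
  show "R <+>\<^bsub>U\<^esub> R_orth \<subseteq> dom pseudo"
  proof
    fix y assume "y \<in> R <+>\<^bsub>U\<^esub> R_orth"
    then obtain x v where xv: "x \<in> carrier V" "v \<in> R_orth" "y = f x \<oplus>\<^bsub>U\<^esub> v"
      unfolding set_add_def' by auto
    obtain u where "u \<in> N_orth" "f u = f x" by (rule preimage_in_N_orth[OF xv(1)])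
    then have "pseudo y = Some u" using xv by (intro pseudo_SomeI) auto
    then show "y \<in> dom pseudo" by (rule domI)
  qed
qed

lemma dom_pseudo_submodule: "submodule (dom pseudo) complex_ring U"
proof (rule U.subspaceI)
  show "dom pseudo \<subseteq> carrier U"
  proof
    fix y assume "y \<in> dom pseudo"
    then obtain u where "pseudo y = Some u" by (elim domD[elim_format] exE)
    then obtain v where uv: "u \<in> N_orth" "v \<in> R_orth" "y = f u \<oplus>\<^bsub>U\<^esub> v"
      by (rule pseudo_SomeE)
    then show "y \<in> carrier U" using N_orth_carrier[OF uv(1)] R_orth_carrier[OF uv(2)] f_carrier by simp
  qed
  have "pseudo \<zero>\<^bsub>U\<^esub> = Some \<zero>\<^bsub>V\<^esub>"
  proof (rule pseudo_SomeI[OF zero_in_orth])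
    show "\<zero>\<^bsub>U\<^esub> = f \<zero>\<^bsub>V\<^esub> \<oplus>\<^bsub>U\<^esub> \<zero>\<^bsub>U\<^esub>"
      unfolding bounded_map_zero[OF bounded] by (rule U.l_zero[OF U.zero_closed, symmetric])
  qed
  then show "\<zero>\<^bsub>U\<^esub> \<in> dom pseudo" by (rule domI)
  show "y \<oplus>\<^bsub>U\<^esub> z \<in> dom pseudo" if "y \<in> dom pseudo" "z \<in> dom pseudo" for y z
  proof -
    obtain u w where "pseudo y = Some u" "pseudo z = Some w" using \<open>y \<in> dom pseudo\<close> \<open>z \<in> dom pseudo\<close> by auto
    then have "pseudo (y \<oplus>\<^bsub>U\<^esub> z) = Some (u \<oplus>\<^bsub>V\<^esub> w)" by (rule pseudo_add)
    then show ?thesis by (rule domI)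
  qed
  show "c \<odot>\<^bsub>U\<^esub> y \<in> dom pseudo" if "y \<in> dom pseudo" for c y
  proof -
    obtain u where "pseudo y = Some u" using \<open>y \<in> dom pseudo\<close> by auto
    then have "pseudo (c \<odot>\<^bsub>U\<^esub> y) = Some (c \<odot>\<^bsub>V\<^esub> u)" by (rule pseudo_smult)
    then show ?thesis by (rule domI)
  qed
qed

lemma pseudo_on_range:
  assumes "y \<in> R"
  obtains u where "pseudo y = Some u" "f u = y" "u \<in> N_orth"
proof -
  obtain x where x: "x \<in> carrier V" "y = f x" using assms by blast
  obtain u where u: "u \<in> N_orth" "f u = f x" by (rule preimage_in_N_orth[OF x(1)])
  moreover have "y = f u \<oplus>\<^bsub>U\<^esub> \<zero>\<^bsub>U\<^esub>" using x u(2) f_carrier[OF x(1)] by simp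
  ultimately show ?thesis
    using that[of u] x(2) pseudo_SomeI[OF _ zero_in_orth(2), of u y] by simp
qed

lemma moore_penrose_pseudo: "moore_penrose V U (opmap V f) pseudo"
  unfolding moore_penrose_def op_kernel_opmap ran_opmap
proof (intro conjI ballI)
  show "linear_operator U V pseudo"
    unfolding linear_operator_def
  proof (intro conjI ballI allI)
    show "submodule (dom pseudo) complex_ring U" by (rule dom_pseudo_submodule)
    show "ran pseudo \<subseteq> carrier V"
    proof
      fix u assume "u \<in> ran pseudo"
      then obtain y where "pseudo y = Some u" unfolding ran_def by blast
      then have "u \<in> N_orth" by (rule pseudo_SomeE)
      then show "u \<in> carrier V" by (rule N_orth_carrier)
    qed
    show "pseudo (y \<oplus>\<^bsub>U\<^esub> z) = Some (the (pseudo y) \<oplus>\<^bsub>V\<^esub> the (pseudo z))"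
      if "y \<in> dom pseudo" "z \<in> dom pseudo" for y z
    proof -
      obtain u w where "pseudo y = Some u" "pseudo z = Some w" using \<open>y \<in> dom pseudo\<close> \<open>z \<in> dom pseudo\<close> by auto
      then show ?thesis using pseudo_add[of y u z w] by simp
    qed
    show "pseudo (c \<odot>\<^bsub>U\<^esub> y) = Some (c \<odot>\<^bsub>V\<^esub> the (pseudo y))" if "y \<in> dom pseudo" for c y
    proof -
      obtain u where "pseudo y = Some u" using \<open>y \<in> dom pseudo\<close> by auto
      then show ?thesis using pseudo_smult[of y u c] by simp
    qed
  qed
  show "dom pseudo = R <+>\<^bsub>U\<^esub> R_orth" by (rule dom_pseudo)
  have "pseudo y = Some \<zero>\<^bsub>V\<^esub> \<longleftrightarrow> y \<in> R_orth" if "y \<in> carrier U" for y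
  proof
    assume "pseudo y = Some \<zero>\<^bsub>V\<^esub>"
    then obtain v where "v \<in> R_orth" "y = f \<zero>\<^bsub>V\<^esub> \<oplus>\<^bsub>U\<^esub> v" by (rule pseudo_SomeE)
    then show "y \<in> R_orth" using R_orth_carrier[of v] by (simp add: bounded_map_zero[OF bounded])
  next
    assume "y \<in> R_orth"
    then show "pseudo y = Some \<zero>\<^bsub>V\<^esub>"
    proof (rule pseudo_SomeI[OF zero_in_orth(1)])
      show "y = f \<zero>\<^bsub>V\<^esub> \<oplus>\<^bsub>U\<^esub> y"
        unfolding bounded_map_zero[OF bounded] by (rule U.l_zero[OF that, symmetric])
    qed
  qed
  then show "op_kernel U V pseudo = R_orth"
    unfolding op_kernel_def using R_orth_carrier by blast
  \<comment> \<open>Each u in N_orth is the value at f u, so the range is N_orth, a closed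
    set.\<close>
  have "ran pseudo = N_orth"
  proof -
    have "u \<in> ran pseudo" if "u \<in> N_orth" for u
      using pseudo_SomeI[OF that zero_in_orth(2) refl] by (rule ranI)
    moreover have "u \<in> N_orth" if u: "u \<in> ran pseudo" for u
    proof -
      obtain y where "pseudo y = Some u" using u unfolding ran_def by blast
      then show ?thesis by (rule pseudo_SomeE)
    qed
    ultimately show ?thesis by blast
  qed
  moreover have "closedin (norm_topology V) N_orth" by (intro V.orth_complement_closed) auto
  ultimately show "norm_topology V closure_of ran pseudo = N_orth"
    by (simp add: closure_of_closedin)
  fix y assume "y \<in> R"
  then obtain u where "pseudo y = Some u" "f u = y" "u \<in> N_orth" by (rule pseudo_on_range)
  then show "(opmap V f \<circ>\<^sub>m pseudo) y = Some y" using N_orth_carrier by simp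
qed

text \<open>The domain clause splits y into g in the range and h orthogonal to it; the kernel clause
  sends h to 0; the clause on the range gives B g = u with f u = g, and the closure clause places u
  in N_orth, where it is unique.\<close>

lemma moore_penrose_unique:
  assumes B: "moore_penrose V U (opmap V f) B"
  shows "B = pseudo"
proof
  fix y
  note B' = B[unfolded moore_penrose_def op_kernel_opmap ran_opmap]
  have lin: "linear_operator U V B" and domB: "dom B = R <+>\<^bsub>U\<^esub> R_orth" using B' by auto
  show "B y = pseudo y"
  proof (cases "y \<in> dom B")
    case False
    moreover have "y \<notin> dom pseudo" using False domB dom_pseudo by simp
    ultimately show ?thesis by (auto simp: dom_def)
  next
    case True
    then obtain g h where gh: "g \<in> R" "h \<in> R_orth" "y = g \<oplus>\<^bsub>U\<^esub> h"
      unfolding domB set_add_def' by auto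
    have "h \<in> op_kernel U V B" using gh(2) B' by simp
    then have h: "B h = Some \<zero>\<^bsub>V\<^esub>" by (simp add: op_kernel_def)
    have "(opmap V f \<circ>\<^sub>m B) g = Some g" using B' gh(1) by blast
    then obtain u where u: "B g = Some u" "opmap V f u = Some g"
      by (auto simp: map_comp_def split: option.splits)
    then have uc: "u \<in> carrier V" "f u = g" by (auto simp: opmap_def split: if_splits)
    have "ran B \<subseteq> norm_topology V closure_of ran B"
      using lin by (intro V.closure_superset) (auto simp: linear_operator_def)
    moreover have "u \<in> ran B" using u(1) by (auto simp: ran_def)
    ultimately have uN: "u \<in> N_orth" using B' by auto
    have "B (g \<oplus>\<^bsub>U\<^esub> h) = Some (u \<oplus>\<^bsub>V\<^esub> \<zero>\<^bsub>V\<^esub>)"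
      using lin u(1) h unfolding linear_operator_def by (metis domI option.sel)
    then have "B y = Some u" using gh(3) uc by simp
    moreover have "pseudo y = Some u" using pseudo_SomeI[OF uN gh(2)] gh(3) uc(2) by simp
    ultimately show ?thesis by simp
  qed
qed

lemma pinv_eq_pseudo: "pinv V U (opmap V f) = pseudo"
  unfolding pinv_def using moore_penrose_pseudo moore_penrose_unique by (rule the_equality)

end

end

section \<open>Nystroem operators in Hilbert space\<close>

context complex_inner_space
begin

lemma finite_orthonormal_span:
  assumes "finite S" "S \<subseteq> carrier V"
  obtains B where "finite B" "orthonormal V B (\<lambda>e. e)" "S \<subseteq> lin_span V B"
proof -
  have "\<exists>B. finite B \<and> orthonormal V B (\<lambda>e. e) \<and> S \<subseteq> lin_span V B"
    using assms
  proof (induction S rule: finite_induct)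
    case empty
    show ?case by (rule exI[of _ "{}"]) (simp add: orthonormal_def)
  next
    case (insert x S)
    then obtain B where B: "finite B" "orthonormal V B (\<lambda>e. e)" "S \<subseteq> lin_span V B" by auto
    have x: "x \<in> carrier V" using insert.prems by simp
    define y where "y = x \<ominus> fourier_sum (\<lambda>e. e) B x"
    have pc: "fourier_sum (\<lambda>e. e) B x \<in> carrier V" by (rule fourier_sum_carrier[OF B(2) order_refl])
    have yc: "y \<in> carrier V" using x pc by (simp add: y_def)
    have Bc: "B \<subseteq> carrier V" using orthonormalD(2)[OF B(2)] by simp
    have ps: "fourier_sum (\<lambda>e. e) B x \<in> lin_span V B"
      using fourier_sum_in_span[OF B(2) B(1) order_refl, of x] by simp
    show ?case
    proof (cases "y = \<zero>")
      case True
      then have "x \<in> lin_span V B" using ps diff_eq_zero_iff[OF x pc] by (simp add: y_def)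
      then show ?thesis using B by blast
    next
      case False
      have orth: "cinner V e (normalize y) = 0" if e: "e \<in> B" for e
      proof -
        have ec: "e \<in> carrier V" using e Bc by auto
        have "e \<in> lin_span V ((\<lambda>e. e) ` B)" using lin_span_superset[OF Bc] e by auto
        then have "cinner V y e = 0"
          using fourier_residual_orth[OF B(2) B(1) order_refl x] by (simp add: y_def)
        then show ?thesis
          using cinner_commute[OF ec yc] ec yc by (simp add: normalize_def cinner_smult_right)
      qed
      have ni: "orthonormal V (insert (normalize y) B) (\<lambda>e. e)"
        by (rule orthonormal_insert(1)[OF B(2) _ _ orth])
          (use yc False cinner_normalize_self in auto)
      have sub: "insert (normalize y) B \<subseteq> carrier V" using yc Bc by simp
      note S' = lin_span_submodule[OF sub]
      have mono: "lin_span V B \<subseteq> lin_span V (insert (normalize y) B)"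
        by (auto simp: lin_span_def)
      have "normalize y \<in> lin_span V (insert (normalize y) B)"
        using lin_span_superset[OF sub] by blast
      then have "of_real (cnorm V y) \<odot> normalize y \<in> lin_span V (insert (normalize y) B)"
        by (rule subspaceD(5)[OF S'])
      then have "y \<in> lin_span V (insert (normalize y) B)"
        using smult_normalize[OF yc False] by metis
      moreover have "x = y \<oplus> fourier_sum (\<lambda>e. e) B x"
        unfolding y_def using x pc by (intro cinner_ext) (simp_all add: cinner_simps)
      ultimately have "x \<in> lin_span V (insert (normalize y) B)"
        using subspaceD(4)[OF S', of y "fourier_sum (\<lambda>e. e) B x"] ps mono by auto
      then show ?thesis using B ni mono by (intro exI[of _ "insert (normalize y) B"]) auto
    qed
  qed
  then show ?thesis using that by blast
qed

text \<open>x is its own best approximation in the span, so its Fourier residual vanishes.\<close>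

lemma cnorm_sq_in_finite_span:
  assumes B: "finite B" "orthonormal V B (\<lambda>e. e)" and x: "x \<in> lin_span V B"
  shows "(cnorm V x)\<^sup>2 = (\<Sum>b\<in>B. (cmod (cinner V b x))\<^sup>2)"
proof -
  have Bc: "B \<subseteq> carrier V" using orthonormalD(2)[OF B(2)] by simp
  have xc: "x \<in> carrier V" using lin_span_carrier[OF Bc] x by blast
  have "cnorm V (x \<ominus> fourier_sum (\<lambda>e. e) B x) \<le> cnorm V (x \<ominus> x)"
    using x by (intro fourier_best_approximation[OF B(2) B(1) order_refl xc]) simp
  also have "x \<ominus> x = \<zero>" using diff_eq_zero_iff[OF xc xc] by simp
  finally have "cnorm V (x \<ominus> fourier_sum (\<lambda>e. e) B x) = 0"
    using cnorm_nonneg[of "x \<ominus> fourier_sum (\<lambda>e. e) B x"] xc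
      fourier_sum_carrier[OF B(2) order_refl, of x] by (intro order_antisym) simp_all
  then show ?thesis using fourier_residual_norm[OF B(2) B(1) order_refl xc] by simp
qed

lemma parseval_cinner:
  assumes e: "orthonormal V I e" and x: "x \<in> carrier V"
    and y: "y \<in> norm_topology V closure_of lin_span V (e ` I)"
  shows "((\<lambda>i. cinner V x (e i) * cinner V (e i) y) has_sum cinner V x y) I"
proof -
  have yc: "y \<in> carrier V" using y closure_subset_carrier by blast
  have fs: "cinner V x (fourier_sum e F y) = (\<Sum>i\<in>F. cinner V x (e i) * cinner V (e i) y)"
    if F: "finite F" "F \<subseteq> I" for F
  proof -
    have "cinner V x (fourier_sum e F y) = (\<Sum>i\<in>F. cinner V x (cinner V (e i) y \<odot> e i))"
      unfolding fourier_sum_def using F x orthonormalD(1)[OF e]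
      by (intro cinner_finsum_right) auto
    also have "\<dots> = (\<Sum>i\<in>F. cinner V x (e i) * cinner V (e i) y)"
      using F x orthonormalD(1)[OF e] by (intro sum.cong) (auto simp: cinner_smult_right subset_iff)
    finally show ?thesis .
  qed
  have "\<exists>F. finite F \<and> F \<subseteq> I \<and> (\<forall>F'. finite F' \<and> F \<subseteq> F' \<and> F' \<subseteq> I \<longrightarrow>
      dist (\<Sum>i\<in>F'. cinner V x (e i) * cinner V (e i) y) (cinner V x y) < \<epsilon>)" if \<epsilon>: "\<epsilon> > 0" for \<epsilon>
  proof -
    have pos: "\<epsilon> / (1 + cnorm V x) > 0" using \<epsilon> x by (simp add: add_pos_nonneg)
    obtain F where F: "finite F" "F \<subseteq> I" "\<forall>F'. finite F' \<longrightarrow> F \<subseteq> F' \<longrightarrow> F' \<subseteq> I \<longrightarrow>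
        cnorm V (y \<ominus> fourier_sum e F' y) < \<epsilon> / (1 + cnorm V x)"
      by (rule fourier_approximation[OF e y pos])
    have "dist (\<Sum>i\<in>F'. cinner V x (e i) * cinner V (e i) y) (cinner V x y) < \<epsilon>"
      if F': "finite F'" "F \<subseteq> F'" "F' \<subseteq> I" for F'
    proof -
      have pc: "fourier_sum e F' y \<in> carrier V" by (rule fourier_sum_carrier[OF e F'(3)])
      have "dist (\<Sum>i\<in>F'. cinner V x (e i) * cinner V (e i) y) (cinner V x y)
          = cmod (cinner V x (y \<ominus> fourier_sum e F' y))"
        using fs[OF F'(1,3)] x yc pc by (simp add: dist_norm norm_minus_commute cinner_diff_right)
      also have "\<dots> \<le> cnorm V x * cnorm V (y \<ominus> fourier_sum e F' y)"
        using x yc pc by (intro cauchy_schwarz) auto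
      also have "\<dots> \<le> (1 + cnorm V x) * cnorm V (y \<ominus> fourier_sum e F' y)"
        using x yc pc by (intro mult_right_mono) auto
      also have "\<dots> < \<epsilon>"
        using F(3) F' x by (simp add: pos_less_divide_eq add_pos_nonneg mult.commute)
      finally show ?thesis .
    qed
    then show ?thesis using F(1,2) by (intro exI[of _ F]) auto
  qed
  then show ?thesis
    unfolding has_sum_def tendsto_iff eventually_finite_subsets_at_top by blast
qed

lemma has_sum_in_cong:
  assumes "\<And>i. i \<in> I \<Longrightarrow> f i = g i" "g \<in> I \<rightarrow> carrier V"
  shows "has_sum_in V f I s \<longleftrightarrow> has_sum_in V g I s"
proof -
  have eq: "(\<Oplus>i\<in>F. f i) = (\<Oplus>i\<in>F. g i)" if "F \<subseteq> I" for F
    using that assms by (intro finsum_cong') auto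
  have ev: "\<forall>\<^sub>F F in finite_subsets_at_top I. (\<Oplus>i\<in>F. f i) = (\<Oplus>i\<in>F. g i)"
    by (rule eventually_finite_subsets_at_top_weakI) (rule eq)
  then have ev': "\<forall>\<^sub>F F in finite_subsets_at_top I. (\<Oplus>i\<in>F. g i) = (\<Oplus>i\<in>F. f i)"
    by (rule eventually_mono) simp
  show ?thesis
    unfolding has_sum_in_def using limitin_transform_eventually[OF ev]
      limitin_transform_eventually[OF ev'] by blast
qed

end

lemma bounded_map_comp:
  assumes "complex_inner_space V" "complex_inner_space U" "complex_inner_space Y"
    and f: "bounded_map V U f" and g: "bounded_map U Y g"
  shows "bounded_map V Y (\<lambda>x. g (f x))"
proof -
  interpret inner_space_pair V U using assms by (simp add: inner_space_pair_def)
  interpret UY: inner_space_pair U Y using assms by (simp add: inner_space_pair_def)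
  obtain C where C: "C \<ge> 0" "\<forall>x\<in>carrier V. cnorm U (f x) \<le> C * cnorm V x"
    by (rule bounded_map_bound[OF f])
  obtain C' where C': "C' \<ge> 0" "\<forall>x\<in>carrier U. cnorm Y (g x) \<le> C' * cnorm U x"
    by (rule UY.bounded_map_bound[OF g])
  have "cnorm Y (g (f x)) \<le> C' * C * cnorm V x" if x: "x \<in> carrier V" for x
  proof -
    have "cnorm Y (g (f x)) \<le> C' * cnorm U (f x)" using C'(2) bounded_mapD(1)[OF f x] by blast
    also have "\<dots> \<le> C' * (C * cnorm V x)" using C C'(1) x by (intro mult_left_mono) auto
    finally show ?thesis by simp
  qed
  then show ?thesis
    using f g unfolding bounded_map_def by (auto simp: Pi_iff)
qed

lemma bounded_map_id: "bounded_map V V (\<lambda>x. x)"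
  unfolding bounded_map_def by (auto intro: exI[of _ 1])

text \<open>The data of the symmetrised problem: \<open>inc\<close> is the inclusion of the reproducing kernel space
  into \<open>L\<close>, \<open>coinc\<close> its adjoint, and \<open>sq\<close>, \<open>isq\<close> are multiplication by the square root of \<open>d\<close> and
  by its inverse. The trace bound makes \<open>inc\<close> a Hilbert--Schmidt operator; \<open>accretive\<close> is the
  positive definiteness of the nonsymmetric kernel.\<close>

locale nystrom = L: complex_hilbert_space L + K: complex_hilbert_space K
  for L :: "'v inner_space" and K :: "'u inner_space" +
  fixes inc :: "'u \<Rightarrow> 'v" and coinc :: "'v \<Rightarrow> 'u" and sq isq :: "'v \<Rightarrow> 'v" and C :: real
  assumes inc: "bounded_map K L inc" and coinc: "bounded_map L K coinc"
    and sq: "bounded_map L L sq" and isq: "bounded_map L L isq"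
    and coinc_adjoint: "\<lbrakk>x \<in> carrier L; g \<in> carrier K\<rbrakk> \<Longrightarrow>
      cinner L x (inc g) = cinner K (coinc x) g"
    and sq_sym: "\<lbrakk>x \<in> carrier L; y \<in> carrier L\<rbrakk> \<Longrightarrow> cinner L x (sq y) = cinner L (sq x) y"
    and isq_sq: "x \<in> carrier L \<Longrightarrow> isq (sq x) = x" and sq_isq: "x \<in> carrier L \<Longrightarrow> sq (isq x) = x"
    and trace_bound: "\<lbrakk>finite B; orthonormal K B (\<lambda>b. b)\<rbrakk> \<Longrightarrow> (\<Sum>b\<in>B. (cnorm L (inc b))\<^sup>2) \<le> C"
    and accretive: "x \<in> carrier L \<Longrightarrow> 0 \<le> Re (cinner L x (inc (coinc (sq (sq x)))))"
    and orthonormal_countable: "orthonormal L E (\<lambda>e. e) \<Longrightarrow> countable E"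
begin

sublocale KL: hilbert_pair K L ..
sublocale LK: hilbert_pair L K ..
sublocale LL: hilbert_pair L L ..

lemmas car [simp] = bounded_mapD(1)[OF inc] bounded_mapD(1)[OF coinc]
  bounded_mapD(1)[OF sq] bounded_mapD(1)[OF isq]

lemma coinc_adjoint': "\<lbrakk>x \<in> carrier L; g \<in> carrier K\<rbrakk> \<Longrightarrow>
    cinner L (inc g) x = cinner K g (coinc x)"
  using coinc_adjoint[of x g] L.cinner_commute[of "inc g" x] K.cinner_commute[of g "coinc x"] by simp

lemma sq_isq_adjoint: "\<lbrakk>x \<in> carrier L; y \<in> carrier L\<rbrakk> \<Longrightarrow> cinner L (sq x) (isq y) = cinner L x y"
  using sq_sym[of x "isq y"] by (simp add: sq_isq)

text \<open>Multiplication by d is \<open>sq\<close> applied twice, so that J = isq o H o sq appears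
  on moving one factor. \<open>J_adj\<close> is multiplication by d after
  \<open>inc o coinc\<close>, and H is the operator with the symmetrised kernel.\<close>

definition W where "W x = coinc (sq (sq x))"
definition J where "J x = inc (W x)"
definition J_adj where "J_adj x = sq (sq (inc (coinc x)))"
definition H where "H x = sq (inc (coinc (sq x)))"

lemmas Ls = L.complex_inner_space_axioms and Ks = K.complex_inner_space_axioms

lemma bounded_sq_sq: "bounded_map L L (\<lambda>x. sq (sq x))"
  by (rule bounded_map_comp[OF Ls Ls Ls sq sq])

lemma bounded_W: "bounded_map L K W"
  unfolding W_def[abs_def] by (rule bounded_map_comp[OF Ls Ls Ks bounded_sq_sq coinc])

lemma bounded_J: "bounded_map L L J"
  unfolding J_def[abs_def] by (rule bounded_map_comp[OF Ls Ks Ls bounded_W inc])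

lemma bounded_inc_coinc: "bounded_map L L (\<lambda>x. inc (coinc x))"
  by (rule bounded_map_comp[OF Ls Ks Ls coinc inc])

lemma bounded_J_adj: "bounded_map L L J_adj"
  unfolding J_adj_def[abs_def] by (rule bounded_map_comp[OF Ls Ls Ls bounded_inc_coinc bounded_sq_sq])

lemma bounded_H: "bounded_map L L H"
  unfolding H_def[abs_def]
  by (rule bounded_map_comp[OF Ls Ls Ls bounded_map_comp[OF Ls Ls Ls sq bounded_inc_coinc] sq])

lemmas car' [simp] = bounded_mapD(1)[OF bounded_W] bounded_mapD(1)[OF bounded_J]
  bounded_mapD(1)[OF bounded_J_adj] bounded_mapD(1)[OF bounded_H]

lemma J_adjoint: "\<lbrakk>x \<in> carrier L; y \<in> carrier L\<rbrakk> \<Longrightarrow> cinner L (J_adj y) x = cinner L y (J x)"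
  by (simp add: J_def W_def J_adj_def sq_sym[symmetric] coinc_adjoint coinc_adjoint')

lemma J_adjoint': "\<lbrakk>x \<in> carrier L; y \<in> carrier L\<rbrakk> \<Longrightarrow> cinner L x (J_adj y) = cinner L (J x) y"
  using J_adjoint[of x y] L.cinner_commute[of x "J_adj y"] L.cinner_commute[of "J x" y] by simp

text \<open>H = B* B for B = coinc o sq: symmetry, positivity and the diagonal entries of H all come
  from this form.\<close>

lemma H_form: "\<lbrakk>x \<in> carrier L; y \<in> carrier L\<rbrakk> \<Longrightarrow>
    cinner L x (H y) = cinner K (coinc (sq x)) (coinc (sq y))"
  by (simp add: H_def sq_sym coinc_adjoint)

lemma H_sym: "\<lbrakk>x \<in> carrier L; y \<in> carrier L\<rbrakk> \<Longrightarrow> cinner L x (H y) = cinner L (H x) y"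
  using H_form[of x y] H_form[of y x] L.cinner_commute[of "H x" y]
    K.cinner_commute[of "coinc (sq x)" "coinc (sq y)"] by simp

lemma adjoint_J: "adjoint_op L L (opmap L J) = opmap L J_adj"
  by (rule LL.adjoint_opI[OF bounded_J bounded_J_adj J_adjoint])

lemma adjoint_H: "adjoint_op L L (opmap L H) = opmap L H"
  by (rule LL.adjoint_opI[OF bounded_H bounded_H]) (simp add: H_sym)

lemma sq_eq_0: "x \<in> carrier L \<Longrightarrow> sq x = \<zero>\<^bsub>L\<^esub> \<Longrightarrow> x = \<zero>\<^bsub>L\<^esub>"
  using isq_sq[of x] LL.bounded_map_zero[OF isq] by simp

text \<open><x, inc (coinc x)> is the squared norm of coinc x.\<close>

lemma inc_coinc_eq_0: 
  assumes x: "x \<in> carrier L" and 0: "inc (coinc x) = \<zero>\<^bsub>L\<^esub>"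
  shows "coinc x = \<zero>\<^bsub>K\<^esub>"
proof -
  have "cinner K (coinc x) (coinc x) = 0" using coinc_adjoint[of x "coinc x"] x 0 by simp
  then show ?thesis using x by (simp add: K.cinner_self_eq_0)
qed

lemma J_eq_0_if_coinc_eq_0:
  assumes h: "h \<in> carrier L" and 0: "coinc h = \<zero>\<^bsub>K\<^esub>"
  shows "J h = \<zero>\<^bsub>L\<^esub>"
proof -
  have Jform: "cinner L h (J g) = 0" if "g \<in> carrier L" for g
    using h that 0 by (simp add: J_def coinc_adjoint)
  have "Re (cinner L g (J h)) = 0" if g: "g \<in> carrier L" for g
  proof (rule quadratic_nonneg_imp_zero)
    fix t :: real
    have "0 \<le> Re (cinner L (h \<oplus>\<^bsub>L\<^esub> of_real u \<odot>\<^bsub>L\<^esub> g) (J (h \<oplus>\<^bsub>L\<^esub> of_real u \<odot>\<^bsub>L\<^esub> g)))" for u :: real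
      using accretive[of "h \<oplus>\<^bsub>L\<^esub> of_real u \<odot>\<^bsub>L\<^esub> g"] h g by (simp add: J_def W_def)
    moreover have "J (h \<oplus>\<^bsub>L\<^esub> of_real u \<odot>\<^bsub>L\<^esub> g) = J h \<oplus>\<^bsub>L\<^esub> of_real u \<odot>\<^bsub>L\<^esub> J g" for u :: real
      using h g by (simp add: bounded_mapD(2,3)[OF bounded_J])
    ultimately have "0 \<le> u\<^sup>2 * Re (cinner L g (J g)) + u * Re (cinner L g (J h))" for u :: real
      using h g Jform by (simp add: L.cinner_simps power2_eq_square algebra_simps)
    \<comment> \<open>u = 2 t produces the factor 2 in the linear term of
      \<open>quadratic_nonneg_imp_zero\<close>.\<close>
    from this[of "2 * t"] have "0 \<le> (2 * t)\<^sup>2 * Re (cinner L g (J g)) + 2 * t * Re (cinner L g (J h))" .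
    then show "0 \<le> t\<^sup>2 * (4 * Re (cinner L g (J g))) + 2 * t * Re (cinner L g (J h))"
      by (simp add: power_mult_distrib mult_ac)
  qed
  \<comment> \<open>Tested with g = J h, the real part is the squared norm of J h.\<close>
  from this[of "J h"] have "(cnorm L (J h))\<^sup>2 = 0" using h by (simp add: L.cnorm_sq)
  then show ?thesis using h by simp
qed

text \<open>An operator and its adjoint have the same Hilbert-Schmidt sums. Expanding each coinc (g
  (e i)) in a finite orthonormal set B and exchanging the sums leads to sums over i of |<e i, g (inc
  b)>|^2, which Bessel bounds by the squared norm of g (inc b); \<open>trace_bound\<close> sums
  these over B. The map g will be \<open>sq\<close>, its square, or the identity.\<close>

lemma hilbert_schmidt:
  assumes g: "bounded_map L L g" "\<And>x y. \<lbrakk>x \<in> carrier L; y \<in> carrier L\<rbrakk> \<Longrightarrow>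
      cinner L x (g y) = cinner L (g x) y"
  obtains D where "\<forall>F (e :: 'i \<Rightarrow> 'v). finite F \<longrightarrow> orthonormal L F e \<longrightarrow>
      (\<Sum>i\<in>F. (cnorm K (coinc (g (e i))))\<^sup>2) \<le> D"
proof -
  obtain c where c: "c \<ge> 0" "\<forall>x\<in>carrier L. cnorm L (g x) \<le> c * cnorm L x"
    by (rule LL.bounded_map_bound[OF g(1)])
  note gc = bounded_mapD(1)[OF g(1)]
  have "(\<Sum>i\<in>F. (cnorm K (coinc (g (e i))))\<^sup>2) \<le> c\<^sup>2 * C"
    if F: "finite F" and e: "orthonormal L F e" for F and e :: "'i \<Rightarrow> 'v"
  proof -
    note ec = orthonormalD(1)[OF e]
    obtain B where B: "finite B" "orthonormal K B (\<lambda>e. e)"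
      "(\<lambda>i. coinc (g (e i))) ` F \<subseteq> lin_span K B"
      by (rule K.finite_orthonormal_span[of "(\<lambda>i. coinc (g (e i))) ` F"]) (use F gc ec in auto)
    have Bc: "b \<in> carrier K" if "b \<in> B" for b using orthonormalD(1)[OF B(2) that] .
    have "(\<Sum>i\<in>F. (cnorm K (coinc (g (e i))))\<^sup>2) =
        (\<Sum>i\<in>F. \<Sum>b\<in>B. (cmod (cinner K b (coinc (g (e i)))))\<^sup>2)"
      using B by (intro sum.cong refl K.cnorm_sq_in_finite_span) auto
    also have "\<dots> = (\<Sum>b\<in>B. \<Sum>i\<in>F. (cmod (cinner L (e i) (g (inc b))))\<^sup>2)"
    proof (subst sum.swap, intro sum.cong refl)
      fix b i assume b: "b \<in> B" and i: "i \<in> F"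
      have "cinner K b (coinc (g (e i))) = cinner L (g (inc b)) (e i)"
        using Bc[OF b] ec[OF i] gc g(2) by (simp flip: coinc_adjoint')
      also have "\<dots> = cnj (cinner L (e i) (g (inc b)))"
        using Bc[OF b] ec[OF i] gc by (intro L.cinner_commute) auto
      finally show "(cmod (cinner K b (coinc (g (e i)))))\<^sup>2 = (cmod (cinner L (e i) (g (inc b))))\<^sup>2"
        by simp
    qed
    also have "\<dots> \<le> (\<Sum>b\<in>B. (cnorm L (g (inc b)))\<^sup>2)"
      using F Bc gc by (intro sum_mono L.bessel[OF e]) auto
    also have "\<dots> \<le> (\<Sum>b\<in>B. c\<^sup>2 * (cnorm L (inc b))\<^sup>2)"
    proof (intro sum_mono)
      fix b assume "b \<in> B"
      then have "cnorm L (g (inc b)) \<le> c * cnorm L (inc b)" "inc b \<in> carrier L" using c(2) Bc by auto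
      then show "(cnorm L (g (inc b)))\<^sup>2 \<le> c\<^sup>2 * (cnorm L (inc b))\<^sup>2"
        using gc power_mono[of "cnorm L (g (inc b))" "c * cnorm L (inc b)" 2]
        by (simp add: power_mult_distrib)
    qed
    also have "\<dots> \<le> c\<^sup>2 * C"
      using trace_bound[OF B(1,2)] by (simp add: mult_left_mono flip: sum_distrib_left)
    finally show ?thesis .
  qed
  then show ?thesis using that by blast
qed

text \<open>H is \<open>coinc o sq\<close> followed by its adjoint \<open>sq o inc\<close>; a bound
  c of the latter gives \<open>T_pos\<close> with c^2, and \<open>hilbert_schmidt\<close> gives the
  trace bound. Countability of orthonormal sets allows indices in nat.\<close>

lemma H_spectral:
  obtains I \<eta> \<phi> where "eigenvalue_sequence I \<eta>" "orthonormal_basis L (carrier L) I \<phi>"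
    "\<forall>i\<in>I. H (\<phi> i) = of_real (\<eta> i) \<odot>\<^bsub>L\<^esub> \<phi> i"
proof -
  obtain c where c: "c \<ge> 0" "\<forall>x\<in>carrier K. cnorm L (sq (inc x)) \<le> c * cnorm K x"
    by (rule KL.bounded_map_bound[OF bounded_map_comp[OF Ks Ls Ls inc sq]])
  obtain D where D: "\<forall>F (e :: 'v \<Rightarrow> 'v). finite F \<longrightarrow> orthonormal L F e \<longrightarrow>
      (\<Sum>i\<in>F. (cnorm K (coinc (sq (e i))))\<^sup>2) \<le> D"
    by (rule hilbert_schmidt[OF sq sq_sym])
  have quad: "Re (cinner L x (H x)) = (cnorm K (coinc (sq x)))\<^sup>2" if "x \<in> carrier L" for x
    using that by (simp add: H_form K.cnorm_sq)
  interpret positive_trace_operator L H "c\<^sup>2" D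
  proof
    show "(cnorm L (H x))\<^sup>2 \<le> c\<^sup>2 * Re (cinner L x (H x))" if x: "x \<in> carrier L" for x
    proof -
      have "cnorm L (H x) \<le> c * cnorm K (coinc (sq x))" using c(2) x by (simp add: H_def)
      then have "(cnorm L (H x))\<^sup>2 \<le> (c * cnorm K (coinc (sq x)))\<^sup>2"
        using x by (intro power_mono) auto
      then show ?thesis using quad[OF x] by (simp add: power_mult_distrib)
    qed
    show "(\<Sum>e\<in>F. Re (cinner L e (H e))) \<le> D" if F: "finite F" "orthonormal L F (\<lambda>e. e)" for F
    proof -
      have "(\<Sum>e\<in>F. Re (cinner L e (H e))) = (\<Sum>e\<in>F. (cnorm K (coinc (sq e)))\<^sup>2)"
        using orthonormalD(1)[OF F(2)] by (intro sum.cong refl quad) auto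
      then show ?thesis using D F by simp
    qed
  qed (use H_sym bounded_mapD[OF bounded_H] in auto)
  obtain E \<mu> where E: "orthonormal_basis L (carrier L) E (\<lambda>e. e)"
    "\<And>e. e \<in> E \<Longrightarrow> H e = complex_of_real (\<mu> e) \<odot>\<^bsub>L\<^esub> e" "\<And>e. e \<in> E \<Longrightarrow> 0 \<le> \<mu> e"
    "\<And>\<epsilon>. \<epsilon> > 0 \<Longrightarrow> finite {e \<in> E. \<epsilon> < \<mu> e}"
    by (rule spectral_theorem) blast
  have on: "orthonormal L E (\<lambda>e. e)" using E(1) by (simp add: orthonormal_basis_iff)
  obtain I b where b: "bij_betw b I E" "eigenvalue_sequence I (\<lambda>i. \<mu> (b i))"
    by (rule eigenvalue_enumeration[OF orthonormal_countable[OF on] E(3,4)]) auto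
  have bI: "b ` I = E" "inj_on b I" using b(1) by (auto simp: bij_betw_def)
  have "orthonormal L I b" using orthonormal_reindex[OF bI(2), of L "\<lambda>e. e"] on bI(1) by simp
  then have "orthonormal_basis L (carrier L) I b"
    using E(1) bI(1) by (simp add: orthonormal_basis_iff)
  moreover have "\<forall>i\<in>I. H (b i) = of_real (\<mu> (b i)) \<odot>\<^bsub>L\<^esub> b i" using E(2) bI(1) by blast
  ultimately show ?thesis using that[OF b(2)] by blast
qed

lemma riesz_basis_transform:
  assumes \<phi>: "orthonormal_basis L (carrier L) I \<phi>"
    and A: "bounded_map L L A" and B: "bounded_map L L B"
    and BA: "\<And>x. x \<in> carrier L \<Longrightarrow> B (A x) = x" and AB: "\<And>x. x \<in> carrier L \<Longrightarrow> A (B x) = x"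
  shows "riesz_basis L I (\<lambda>i. A (\<phi> i))"
  unfolding riesz_basis_def
proof (intro exI conjI ballI)
  show "orthonormal_basis L (carrier L) I \<phi>" by (rule \<phi>)
  show "bounded_operator L L (opmap L A)" "bounded_operator L L (opmap L B)"
    by (rule LL.bounded_operator_opmap[OF A], rule LL.bounded_operator_opmap[OF B])
  show "opmap L B \<circ>\<^sub>m opmap L A = Some |` carrier L" "opmap L A \<circ>\<^sub>m opmap L B = Some |` carrier L"
    using BA AB bounded_mapD(1)[OF A] bounded_mapD(1)[OF B]
    by (auto simp: opmap_def map_comp_def restrict_map_def fun_eq_iff)
  show "opmap L A (\<phi> i) = Some (A (\<phi> i))" if "i \<in> I" for i
    using \<phi> that by (intro opmap_apply) (auto simp: orthonormal_basis_def)
qed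

section \<open>Dual eigenbases and eigenspaces of J\<close>

context
  fixes I :: "nat set" and \<eta> :: "nat \<Rightarrow> real" and \<phi> :: "nat \<Rightarrow> 'v"
  assumes basis: "orthonormal_basis L (carrier L) I \<phi>"
    and eigen: "\<forall>i\<in>I. H (\<phi> i) = of_real (\<eta> i) \<odot>\<^bsub>L\<^esub> \<phi> i"
begin

lemma phi_on: "orthonormal L I \<phi>"
  using basis by (simp add: orthonormal_basis_iff)

lemma phi_carrier [simp]: "i \<in> I \<Longrightarrow> \<phi> i \<in> carrier L"
  by (rule orthonormalD(1)[OF phi_on])

lemma eigen': "i \<in> I \<Longrightarrow> H (\<phi> i) = of_real (\<eta> i) \<odot>\<^bsub>L\<^esub> \<phi> i"
  using eigen by blast

lemma xi_dual: "\<lbrakk>i \<in> I; j \<in> I\<rbrakk> \<Longrightarrow> cinner L (sq (\<phi> i)) (isq (\<phi> j)) = (if i = j then 1 else 0)"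
  using orthonormalD(4)[OF phi_on] by (simp add: sq_isq_adjoint)

lemma J_xi: "i \<in> I \<Longrightarrow> J (isq (\<phi> i)) = of_real (\<eta> i) \<odot>\<^bsub>L\<^esub> isq (\<phi> i)"
proof -
  assume i: "i \<in> I"
  have "J (isq (\<phi> i)) = isq (H (\<phi> i))" using i by (simp add: J_def W_def H_def sq_isq isq_sq)
  then show ?thesis using i by (simp add: eigen' bounded_mapD(3)[OF isq])
qed

lemma J_adj_xi: "i \<in> I \<Longrightarrow> J_adj (sq (\<phi> i)) = of_real (\<eta> i) \<odot>\<^bsub>L\<^esub> sq (\<phi> i)"
proof -
  assume i: "i \<in> I"
  have "J_adj (sq (\<phi> i)) = sq (H (\<phi> i))" by (simp add: J_adj_def H_def)
  then show ?thesis using i by (simp add: eigen' bounded_mapD(3)[OF sq])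
qed

lemma xi_nonzero: "i \<in> I \<Longrightarrow> isq (\<phi> i) \<noteq> \<zero>\<^bsub>L\<^esub>" "i \<in> I \<Longrightarrow> sq (\<phi> i) \<noteq> \<zero>\<^bsub>L\<^esub>"
  using xi_dual[of i i] by auto

lemma dual_eigenbases_xi:
  "dual_eigenbases L (opmap L J) I \<eta> (\<lambda>i. isq (\<phi> i)) (\<lambda>i. sq (\<phi> i))"
  unfolding dual_eigenbases_def adjoint_J eigenfunctions_def
  using riesz_basis_transform[OF basis isq sq sq_isq isq_sq]
    riesz_basis_transform[OF basis sq isq isq_sq sq_isq] xi_dual xi_nonzero J_xi J_adj_xi
  by simp

text \<open>The vectors \<open>sq (\<phi> i)\<close> inherit totality from \<phi>, because <sq
  (\<phi> i), x> is the i-th coefficient of sq x and sq is injective.\<close>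

lemma xi_dual_ext:
  assumes "x \<in> carrier L" "y \<in> carrier L"
    and eq: "\<And>i. i \<in> I \<Longrightarrow> cinner L (sq (\<phi> i)) x = cinner L (sq (\<phi> i)) y"
  shows "x = y"
proof -
  have "sq x = sq y"
  proof (rule L.orthonormal_basis_ext[OF basis])
    fix i assume i: "i \<in> I"
    show "cinner L (\<phi> i) (sq x) = cinner L (\<phi> i) (sq y)"
      using eq[OF i] sq_sym[OF phi_carrier[OF i]] assms(1,2) by simp
  qed (rule bounded_mapD(1)[OF sq assms(1)], rule bounded_mapD(1)[OF sq assms(2)])
  then show ?thesis using isq_sq[OF assms(1)] isq_sq[OF assms(2)] by metis
qed

text \<open>Pairing J x = \<mu> x with the dual eigenvectors \<xi>' i = sq (\<phi> i) gives (\<eta>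
  i - \<mu>) <\<xi>' i, x> = 0 for every i, and the \<xi>' i are total.\<close>

lemma eigenspace_eq_orth:
  "eigenspace L (opmap L J) \<mu> =
     orth_complement L ((\<lambda>i. sq (\<phi> i)) ` {i \<in> I. complex_of_real (\<eta> i) \<noteq> \<mu>})"
proof -
  have "J x = \<mu> \<odot>\<^bsub>L\<^esub> x \<longleftrightarrow> (\<forall>i\<in>I. complex_of_real (\<eta> i) \<noteq> \<mu> \<longrightarrow> cinner L (sq (\<phi> i)) x = 0)"
    if x: "x \<in> carrier L" for x
  proof -
    have "cinner L (sq (\<phi> i)) (J x) = of_real (\<eta> i) * cinner L (sq (\<phi> i)) x" if i: "i \<in> I" for i
      using x i J_adjoint[of x "sq (\<phi> i)"] by (simp add: J_adj_xi L.cinner_smult_left)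
    then have *: "cinner L (sq (\<phi> i)) (J x) = cinner L (sq (\<phi> i)) (\<mu> \<odot>\<^bsub>L\<^esub> x) \<longleftrightarrow>
        complex_of_real (\<eta> i) = \<mu> \<or> cinner L (sq (\<phi> i)) x = 0" if "i \<in> I" for i
      using x that by (auto simp: L.cinner_smult_right)
    show ?thesis
    proof
      assume "J x = \<mu> \<odot>\<^bsub>L\<^esub> x"
      then show "\<forall>i\<in>I. complex_of_real (\<eta> i) \<noteq> \<mu> \<longrightarrow> cinner L (sq (\<phi> i)) x = 0"
        using * by metis
    next
      assume "\<forall>i\<in>I. complex_of_real (\<eta> i) \<noteq> \<mu> \<longrightarrow> cinner L (sq (\<phi> i)) x = 0"
      then show "J x = \<mu> \<odot>\<^bsub>L\<^esub> x" using * x by (intro xi_dual_ext) auto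
    qed
  qed
  then show ?thesis by (auto simp: eigenspace_def orth_complement_def opmap_def)
qed

text \<open>The dual vector \<open>sq (\<phi> i)\<close> annihilates every other
  \<open>isq (\<phi> j)\<close> but not \<open>isq (\<phi> i)\<close>.\<close>

lemma xi_linear_independent:
  assumes i: "i \<in> I" and S: "S \<subseteq> I - {i}"
  shows "isq (\<phi> i) \<notin> lin_span L ((\<lambda>i. isq (\<phi> i)) ` S)"
proof
  assume m: "isq (\<phi> i) \<in> lin_span L ((\<lambda>i. isq (\<phi> i)) ` S)"
  have sub: "{sq (\<phi> i)} \<subseteq> carrier L" using i by simp
  have "(\<lambda>i. isq (\<phi> i)) ` S \<subseteq> orth_complement L {sq (\<phi> i)}"
    using S i xi_dual by (auto simp: orth_complement_def subset_iff)
  then have "lin_span L ((\<lambda>i. isq (\<phi> i)) ` S) \<subseteq> orth_complement L {sq (\<phi> i)}"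
    by (intro L.lin_span_minimal L.orth_complement_submodule sub)
  then have "cinner L (sq (\<phi> i)) (isq (\<phi> i)) = 0" using m by (auto simp: orth_complement_def)
  then show False using xi_dual[OF i i] by simp
qed

text \<open>That the eigenspace lies in the closed span is seen after moving x to sq x: its
  coefficients in the orthonormal basis \<phi> are supported in S, so it equals its projection on
  the closed span of the \<phi> i with i \<in> S, and the bounded map isq carries the approximation
  back.\<close>

lemma eigenspace_eq_closed_span:
  fixes \<mu> :: complex
  defines "S \<equiv> {i \<in> I. complex_of_real (\<eta> i) = \<mu>}"
  shows "norm_topology L closure_of lin_span L ((\<lambda>i. isq (\<phi> i)) ` S) =
    eigenspace L (opmap L J) \<mu>"
proof -
  let ?Z = "(\<lambda>i. sq (\<phi> i)) ` {i \<in> I. complex_of_real (\<eta> i) \<noteq> \<mu>}"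
  have Zc: "?Z \<subseteq> carrier L" by auto
  have Sc: "\<phi> ` S \<subseteq> carrier L" "(\<lambda>i. isq (\<phi> i)) ` S \<subseteq> carrier L" by (auto simp: S_def)
  have "(\<lambda>i. isq (\<phi> i)) ` S \<subseteq> orth_complement L ?Z"
    using xi_dual by (auto simp: orth_complement_def S_def)
  then have 1: "norm_topology L closure_of lin_span L ((\<lambda>i. isq (\<phi> i)) ` S) \<subseteq> orth_complement L ?Z"
    by (intro L.closure_minimal L.lin_span_minimal L.orth_complement_submodule
        L.orth_complement_closed Zc)
  have 2: "x \<in> norm_topology L closure_of lin_span L ((\<lambda>i. isq (\<phi> i)) ` S)"
    if x: "x \<in> orth_complement L ?Z" for x
  proof -
    have xc: "x \<in> carrier L" and x0: "\<And>i. i \<in> I \<Longrightarrow> i \<notin> S \<Longrightarrow> cinner L (\<phi> i) (sq x) = 0"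
      using x by (auto simp: orth_complement_def S_def sq_sym)
    let ?M = "norm_topology L closure_of lin_span L (\<phi> ` S)"
    obtain p where p: "p \<in> ?M" "sq x \<ominus>\<^bsub>L\<^esub> p \<in> orth_complement L ?M"
      by (rule L.projection_exists[OF L.closure_submodule[OF L.lin_span_submodule[OF Sc(1)]]
            L.closed_closure bounded_mapD(1)[OF sq xc]])
    have pc: "p \<in> carrier L" using p(1) L.closure_subset_carrier by blast
    have po: "sq x \<ominus>\<^bsub>L\<^esub> p \<in> orth_complement L (\<phi> ` S)"
      using p(2) L.orth_complement_closed_span[OF Sc(1)] by simp
    have "sq x = p"
    proof (rule L.orthonormal_basis_ext[OF basis])
      fix i assume i: "i \<in> I"
      show "cinner L (\<phi> i) (sq x) = cinner L (\<phi> i) p"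
      proof (cases "i \<in> S")
        case True
        then have "cinner L (\<phi> i) (sq x \<ominus>\<^bsub>L\<^esub> p) = 0" using po by (auto simp: orth_complement_def)
        then show ?thesis using i xc pc by (simp add: L.cinner_diff_right)
      next
        case False
        have "{\<phi> i} \<subseteq> carrier L" using i by simp
        moreover have "\<phi> ` S \<subseteq> orth_complement L {\<phi> i}"
          using False i orthonormalD(4)[OF phi_on] by (auto simp: orth_complement_def S_def)
        ultimately have "?M \<subseteq> orth_complement L {\<phi> i}"
          by (intro L.closure_minimal L.lin_span_minimal L.orth_complement_submodule
              L.orth_complement_closed)
        then have "cinner L (\<phi> i) p = 0" using p(1) by (auto simp: orth_complement_def)
        then show ?thesis using x0[OF i False] by simp
      qed
    qed (use xc pc in auto)
    then have "isq (sq x) \<in> norm_topology L closure_of (isq ` lin_span L (\<phi> ` S))"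
      using p(1) LL.closure_bounded_image[OF isq L.lin_span_carrier[OF Sc(1)]] by simp
    moreover have "isq ` lin_span L (\<phi> ` S) \<subseteq> lin_span L ((\<lambda>i. isq (\<phi> i)) ` S)"
    proof -
      note SM = L.lin_span_submodule[OF Sc(2)]
      let ?P = "{y \<in> carrier L. isq y \<in> lin_span L ((\<lambda>i. isq (\<phi> i)) ` S)}"
      have "submodule ?P complex_ring L"
        using L.subspaceD(3-5)[OF SM] bounded_mapD(2,3)[OF isq] LL.bounded_map_zero[OF isq]
        by (intro L.subspaceI) auto
      moreover have "\<phi> ` S \<subseteq> ?P"
        using Sc L.lin_span_superset[OF Sc(2)] by auto
      ultimately have "lin_span L (\<phi> ` S) \<subseteq> ?P" by (intro L.lin_span_minimal)
      then show ?thesis by blast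
    qed
    ultimately show ?thesis
      using isq_sq[OF xc] closure_of_mono by (metis (no_types, lifting) subsetD)
  qed
  show ?thesis unfolding eigenspace_eq_orth using 1 2 by blast
qed

text \<open>Within an eigenspace the vectors \<open>isq (\<phi> i)\<close> are independent with
  dense span but in general not orthogonal. Gram-Schmidt orthonormalises them over the same index
  set, so the number of indices is the multiplicity.\<close>

lemma lists_eigenvalues_J: "lists_eigenvalues L (opmap L J) I \<eta>"
  unfolding lists_eigenvalues_def
proof
  fix \<mu> :: complex
  let ?S = "{i \<in> I. complex_of_real (\<eta> i) = \<mu>}"
  obtain e where e: "orthonormal L ?S e"
    "lin_span L (e ` ?S) = lin_span L ((\<lambda>i. isq (\<phi> i)) ` ?S)"
  proof (rule L.gram_schmidt[of ?S "\<lambda>i. isq (\<phi> i)"])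
    show "isq (\<phi> i) \<in> carrier L" if "i \<in> ?S" for i using that by simp
    show "isq (\<phi> i) \<notin> lin_span L ((\<lambda>i. isq (\<phi> i)) ` (?S \<inter> {..<i}))" if "i \<in> ?S" for i
      using that by (intro xi_linear_independent) auto
  qed (rule that; assumption)
  show "\<exists>e. orthonormal_basis L (eigenspace L (opmap L J) \<mu>) ?S e"
    using e eigenspace_eq_closed_span[of \<mu>] by (auto simp: orthonormal_basis_iff)
qed

end

section \<open>Comparison of the pseudoinverses of inc and J\<close>

abbreviation (input) "N_inc \<equiv> {g \<in> carrier K. inc g = \<zero>\<^bsub>L\<^esub>}"

lemma orth_range_inc: "x \<in> orth_complement L (inc ` carrier K) \<longleftrightarrow> x \<in> carrier L \<and> coinc x = \<zero>\<^bsub>K\<^esub>"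
proof
  assume x: "x \<in> orth_complement L (inc ` carrier K)"
  then have xc: "x \<in> carrier L" by (simp add: orth_complement_def)
  have "cinner L (inc (coinc x)) x = 0" using x xc by (auto simp: orth_complement_def)
  then have "cinner K (coinc x) (coinc x) = 0" using xc by (simp add: coinc_adjoint')
  then show "x \<in> carrier L \<and> coinc x = \<zero>\<^bsub>K\<^esub>" using xc by (simp add: K.cinner_self_eq_0)
qed (auto simp: orth_complement_def coinc_adjoint')

text \<open>For x orthogonal to the range of J, the test vector J (J_adj x) shows J_adj x = 0;
  injectivity of sq removes both its factors, and \<open>inc o coinc\<close> has the same kernel as
  \<open>coinc\<close>.\<close>

lemma orth_range_J: "orth_complement L (J ` carrier L) = orth_complement L (inc ` carrier K)"
proof
  show "orth_complement L (inc ` carrier K) \<subseteq> orth_complement L (J ` carrier L)"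
    by (auto simp: orth_complement_def J_def)
  show "orth_complement L (J ` carrier L) \<subseteq> orth_complement L (inc ` carrier K)"
  proof
    fix x assume x: "x \<in> orth_complement L (J ` carrier L)"
    then have xc: "x \<in> carrier L" by (simp add: orth_complement_def)
    have "cinner L (J (J_adj x)) x = 0" using x xc by (auto simp: orth_complement_def)
    then have "cinner L (J_adj x) (J_adj x) = 0" using xc by (simp add: J_adjoint')
    then have "J_adj x = \<zero>\<^bsub>L\<^esub>" using xc by (simp add: L.cinner_self_eq_0)
    then have "inc (coinc x) = \<zero>\<^bsub>L\<^esub>" using xc by (simp add: J_adj_def sq_eq_0)
    then show "x \<in> orth_complement L (inc ` carrier K)"
      using xc inc_coinc_eq_0 by (simp add: orth_range_inc)
  qed
qed

lemma coinc_in_orth: "x \<in> carrier L \<Longrightarrow> coinc x \<in> orth_complement K N_inc"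
  by (auto simp: orth_complement_def simp flip: coinc_adjoint')

text \<open>A decomposition y = J u + v for J is one for inc with W u in the role of u: J u = inc (W
  u), values of coinc are orthogonal to the kernel of inc, and the two ranges have the same
  orthogonal complement.\<close>

lemma pinv_inc_of_pinv_J:
  assumes "pinv L L (opmap L J) y = Some u"
  shows "pinv K L (opmap K inc) y = Some (W u)" "u \<in> carrier L"
proof -
  have "LL.pseudo J y = Some u" using assms LL.pinv_eq_pseudo[OF bounded_J] by simp
  then obtain v where v: "u \<in> orth_complement L {x \<in> carrier L. J x = \<zero>\<^bsub>L\<^esub>}"
    "v \<in> orth_complement L (J ` carrier L)" "y = J u \<oplus>\<^bsub>L\<^esub> v"
    by (rule LL.pseudo_SomeE[OF bounded_J])
  show uc: "u \<in> carrier L" using v(1) by (simp add: orth_complement_def)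
  have "KL.pseudo inc y = Some (W u)"
  proof (rule KL.pseudo_SomeI[OF inc])
    show "W u \<in> orth_complement K N_inc" using uc by (simp add: W_def coinc_in_orth)
    show "v \<in> orth_complement L (inc ` carrier K)" using v(2) orth_range_J by simp
    show "y = inc (W u) \<oplus>\<^bsub>L\<^esub> v" using v(3) by (simp add: J_def)
  qed
  then show "pinv K L (opmap K inc) y = Some (W u)" by (simp add: KL.pinv_eq_pseudo[OF inc])
qed

lemma dom_pinv_J_submodule: "submodule (dom (pinv L L (opmap L J))) complex_ring L"
  unfolding LL.pinv_eq_pseudo[OF bounded_J] by (rule LL.dom_pseudo_submodule[OF bounded_J])

lemma dom_pinv_J_subset: "dom (pinv L L (opmap L J)) \<subseteq> dom (pinv K L (opmap K inc))"
proof
  fix y assume "y \<in> dom (pinv L L (opmap L J))"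
  then obtain u where "pinv L L (opmap L J) y = Some u" by auto
  then show "y \<in> dom (pinv K L (opmap K inc))" using pinv_inc_of_pinv_J(1) by auto
qed

lemma pinv_inc_restrict:
  "pinv K L (opmap K inc) |` dom (pinv L L (opmap L J)) = opmap L W \<circ>\<^sub>m pinv L L (opmap L J)"
proof
  fix y
  show "(pinv K L (opmap K inc) |` dom (pinv L L (opmap L J))) y =
      (opmap L W \<circ>\<^sub>m pinv L L (opmap L J)) y"
  proof (cases "pinv L L (opmap L J) y")
    case None
    then show ?thesis by (simp add: restrict_map_def map_comp_def domIff)
  next
    case (Some u)
    then have "y \<in> dom (pinv L L (opmap L J))" by (rule domI)
    then show ?thesis using pinv_inc_of_pinv_J[OF Some] Some by simp
  qed
qed

text \<open>The domain contains the range of J and its orthogonal complement; a vector orthogonal to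
  both is orthogonal to itself.\<close>

lemma dom_pinv_J_dense: "norm_topology L closure_of dom (pinv L L (opmap L J)) = carrier L"
proof (rule L.dense_if_orth_zero[OF dom_pinv_J_submodule])
  have sub: "J ` carrier L \<subseteq> dom (pinv L L (opmap L J))"
    "orth_complement L (J ` carrier L) \<subseteq> dom (pinv L L (opmap L J))"
  proof -
    have D: "dom (pinv L L (opmap L J)) = J ` carrier L <+>\<^bsub>L\<^esub> orth_complement L (J ` carrier L)"
      unfolding LL.pinv_eq_pseudo[OF bounded_J] by (rule LL.dom_pseudo[OF bounded_J])
    have z: "\<zero>\<^bsub>L\<^esub> \<in> J ` carrier L" "\<zero>\<^bsub>L\<^esub> \<in> orth_complement L (J ` carrier L)"
      using LL.bounded_map_zero[OF bounded_J] LL.zero_in_orth(2)[OF bounded_J]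
      by (auto intro!: image_eqI[of _ _ "\<zero>\<^bsub>L\<^esub>"])
    show "J ` carrier L \<subseteq> dom (pinv L L (opmap L J))"
    proof
      fix y assume y: "y \<in> J ` carrier L"
      then have "y = y \<oplus>\<^bsub>L\<^esub> \<zero>\<^bsub>L\<^esub>" by (auto simp: L.r_zero)
      then show "y \<in> dom (pinv L L (opmap L J))" unfolding D set_add_def' using y z by blast
    qed
    show "orth_complement L (J ` carrier L) \<subseteq> dom (pinv L L (opmap L J))"
    proof
      fix y assume y: "y \<in> orth_complement L (J ` carrier L)"
      then have "y = \<zero>\<^bsub>L\<^esub> \<oplus>\<^bsub>L\<^esub> y" by (auto simp: L.l_zero orth_complement_def)
      then show "y \<in> dom (pinv L L (opmap L J))" unfolding D set_add_def' using y z by blast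
    qed
  qed
  show "orth_complement L (dom (pinv L L (opmap L J))) \<subseteq> {\<zero>\<^bsub>L\<^esub>}"
  proof
    fix x assume x: "x \<in> orth_complement L (dom (pinv L L (opmap L J)))"
    then have "x \<in> orth_complement L (J ` carrier L)" using sub(1) by (auto simp: orth_complement_def)
    then have "x \<in> dom (pinv L L (opmap L J))" using sub(2) by blast
    then have "cinner L x x = 0" "x \<in> carrier L" using x by (simp_all add: orth_complement_def)
    then show "x \<in> {\<zero>\<^bsub>L\<^esub>}" by (simp add: L.cinner_self_eq_0)
  qed
qed

section \<open>The orthonormal vectors theta and the expansion in them\<close>

context
  fixes I :: "nat set" and \<eta> :: "nat \<Rightarrow> real" and \<phi> :: "nat \<Rightarrow> 'v"
  assumes basis: "orthonormal_basis L (carrier L) I \<phi>"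
    and eigen: "\<forall>i\<in>I. H (\<phi> i) = of_real (\<eta> i) \<odot>\<^bsub>L\<^esub> \<phi> i"
begin

text \<open>At \<eta> i = 0 the convention 1 / 0 = 0 applies; only indices with \<eta> i > 0 enter
  the expansion.\<close>

definition theta :: "nat \<Rightarrow> 'u" where
  "theta i = of_real (1 / sqrt (\<eta> i)) \<odot>\<^bsub>K\<^esub> W (isq (\<phi> i))"

lemma W_xi: "i \<in> I \<Longrightarrow> W (isq (\<phi> i)) = coinc (sq (\<phi> i))"
  using phi_carrier[OF basis eigen] by (simp add: W_def sq_isq)

text \<open>W sends \<open>isq (\<phi> i)\<close> to \<open>coinc (sq (\<phi> i))\<close>, so by
  \<open>H_form\<close> the left side is <\<phi> i, H (\<phi> j)>.\<close>

lemma W_xi_inner: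
  assumes i: "i \<in> I" and j: "j \<in> I"
  shows "cinner K (W (isq (\<phi> i))) (W (isq (\<phi> j))) = (if i = j then of_real (\<eta> i) else 0)"
proof -
  note c = phi_carrier[OF basis eigen i] phi_carrier[OF basis eigen j]
  have "cinner K (W (isq (\<phi> i))) (W (isq (\<phi> j))) = cinner L (\<phi> i) (H (\<phi> j))"
    using c by (simp add: W_xi[OF i] W_xi[OF j] H_form)
  also have "\<dots> = of_real (\<eta> j) * cinner L (\<phi> i) (\<phi> j)"
    using c eigen'[OF basis eigen j] by (simp add: L.cinner_smult_right)
  finally show ?thesis
    using orthonormalD(4)[OF phi_on[OF basis eigen] i j] by simp
qed

lemma W_xi_carrier: "i \<in> I \<Longrightarrow> W (isq (\<phi> i)) \<in> carrier K"
  using phi_carrier[OF basis eigen] by simp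

lemma theta_carrier: "i \<in> I \<Longrightarrow> theta i \<in> carrier K"
  unfolding theta_def by (intro K.smult_carrier W_xi_carrier)

lemma theta_orthonormal: "orthonormal K {i \<in> I. 0 < \<eta> i} theta"
  unfolding orthonormal_def
proof (intro conjI ballI)
  show "theta ` {i \<in> I. 0 < \<eta> i} \<subseteq> carrier K" using theta_carrier by auto
  fix i j assume "i \<in> {i \<in> I. 0 < \<eta> i}" "j \<in> {i \<in> I. 0 < \<eta> i}"
  then have ij: "i \<in> I" "j \<in> I" "0 < \<eta> i" "0 < \<eta> j" by auto
  have "cinner K (theta i) (theta j) =
      of_real (1 / sqrt (\<eta> i) * (1 / sqrt (\<eta> j))) * cinner K (W (isq (\<phi> i))) (W (isq (\<phi> j)))"
    unfolding theta_def using W_xi_carrier[OF ij(1)] W_xi_carrier[OF ij(2)]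
    by (simp only: K.cinner_smult_left K.cinner_smult_right K.smult_carrier
        complex_cnj_complex_of_real of_real_mult mult_ac)
  also have "\<dots> = of_bool (i = j)"
  proof (cases "i = j")
    case True
    have "1 / sqrt (\<eta> i) * (1 / sqrt (\<eta> i)) * \<eta> i = 1" using ij(3) by simp
    then have "complex_of_real (1 / sqrt (\<eta> i) * (1 / sqrt (\<eta> i)) * \<eta> i) = 1" by (simp only: of_real_1)
    then show ?thesis using True W_xi_inner[OF ij(1,1)] by (simp only: of_real_mult simp_thms if_True of_bool_eq)
  next
    case False
    then show ?thesis using W_xi_inner[OF ij(1,2)] by simp
  qed
  finally show "cinner K (theta i) (theta j) = of_bool (i = j)" .
qed

lemma W_xi_eq_theta: "\<lbrakk>i \<in> I; 0 < \<eta> i\<rbrakk> \<Longrightarrow> W (isq (\<phi> i)) = of_real (sqrt (\<eta> i)) \<odot>\<^bsub>K\<^esub> theta i"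
  using W_xi_carrier[of i] by (simp add: theta_def flip: of_real_mult)

text \<open>Let u be the residual of g after projection on the closed span of the theta i. It is
  orthogonal to every W (isq (\<phi> i)), those with \<eta> i = 0 being zero, so all coefficients
  <\<phi> i, sq (inc u)> vanish and inc u = 0. As u also lies in the complement of the kernel of
  inc, it is zero.\<close>

lemma orth_kernel_inc_in_closed_span:
  assumes nonneg: "\<forall>i\<in>I. 0 \<le> \<eta> i" and g: "g \<in> orth_complement K N_inc"
  shows "g \<in> norm_topology K closure_of lin_span K (theta ` {i \<in> I. 0 < \<eta> i})"
proof -
  let ?T = "theta ` {i \<in> I. 0 < \<eta> i}"
  let ?M = "norm_topology K closure_of lin_span K ?T"
  have gc: "g \<in> carrier K" using g by (simp add: orth_complement_def)
  have Tc: "?T \<subseteq> carrier K" using theta_carrier by auto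
  have Nc: "N_inc \<subseteq> carrier K" by auto
  obtain p where p: "p \<in> ?M" "g \<ominus>\<^bsub>K\<^esub> p \<in> orth_complement K ?M"
    by (rule K.projection_exists[OF K.closure_submodule[OF K.lin_span_submodule[OF Tc]]
          K.closed_closure gc])
  have pc: "p \<in> carrier K" using p(1) K.closure_subset_carrier by blast
  note NS = K.orth_complement_submodule[OF Nc]
  have "theta i \<in> orth_complement K N_inc" if i: "i \<in> I" for i
    unfolding theta_def W_xi[OF i] using phi_carrier[OF basis eigen i]
    by (intro K.subspaceD(5)[OF NS] coinc_in_orth) simp
  then have "?T \<subseteq> orth_complement K N_inc" by auto
  then have "?M \<subseteq> orth_complement K N_inc"
    by (intro K.closure_minimal K.lin_span_minimal NS K.orth_complement_closed[OF Nc])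
  then have pN: "p \<in> orth_complement K N_inc" using p(1) by blast
  define u where "u = g \<ominus>\<^bsub>K\<^esub> p"
  have uN: "u \<in> orth_complement K N_inc"
    unfolding u_def by (rule K.subspaceD(6)[OF NS g pN])
  have uc: "u \<in> carrier K" using gc pc by (simp add: u_def)
  have uT: "cinner K (theta i) u = 0" if "i \<in> I" "0 < \<eta> i" for i
    using p(2) K.orth_complement_closed_span[OF Tc] that by (auto simp: orth_complement_def u_def)
  have "sq (inc u) = \<zero>\<^bsub>L\<^esub>"
  proof (rule L.orthonormal_basis_orth_zero[OF basis])
    fix i assume i: "i \<in> I"
    note ic = phi_carrier[OF basis eigen i]
    have "cinner L (\<phi> i) (sq (inc u)) = cinner K (W (isq (\<phi> i))) u"
      using ic uc by (simp add: sq_sym coinc_adjoint W_xi[OF i])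
    also have "\<dots> = 0"
    proof (cases "\<eta> i = 0")
      case True
      then have "W (isq (\<phi> i)) = \<zero>\<^bsub>K\<^esub>"
        using W_xi_inner[OF i i] W_xi_carrier[OF i] by (simp add: K.cinner_self_eq_0)
      then show ?thesis using uc by simp
    next
      case False
      then have pos: "0 < \<eta> i" using nonneg i by (auto simp: less_le)
      then show ?thesis
        using uT[OF i pos] W_xi_eq_theta[OF i pos] theta_carrier[OF i] uc
        by (simp add: K.cinner_smult_left)
    qed
    finally show "cinner L (\<phi> i) (sq (inc u)) = 0" .
  qed (use uc in simp)
  then have "inc u = \<zero>\<^bsub>L\<^esub>" using sq_eq_0 uc by simp
  then have "u \<in> N_inc" using uc by simp
  then have "u = \<zero>\<^bsub>K\<^esub>" by (rule KL.in_subspace_and_orth[OF Nc _ uN])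
  then have "g = p" using gc pc K.diff_eq_zero_iff by (simp add: u_def)
  then show ?thesis using p(1) by simp
qed

text \<open>The series is the Fourier series of g in the orthonormal family theta; what remains is
  to match the coefficients.\<close>

theorem pinv_inc_expansion:
  assumes nonneg: "\<forall>i\<in>I. 0 \<le> \<eta> i" and f: "pinv K L (opmap K inc) f = Some g"
  shows "has_sum_in K (\<lambda>i. (cinner L (sq (\<phi> i)) f / of_real (sqrt (\<eta> i))) \<odot>\<^bsub>K\<^esub> theta i)
    {i \<in> I. 0 < \<eta> i} g"
proof -
  have "KL.pseudo inc f = Some g" using f KL.pinv_eq_pseudo[OF inc] by simp
  then obtain h where h: "g \<in> orth_complement K N_inc"
    "h \<in> orth_complement L (inc ` carrier K)" "f = inc g \<oplus>\<^bsub>L\<^esub> h"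
    by (rule KL.pseudo_SomeE[OF inc])
  have gc: "g \<in> carrier K" using h(1) by (simp add: orth_complement_def)
  have hc: "h \<in> carrier L" "coinc h = \<zero>\<^bsub>K\<^esub>" using h(2) orth_range_inc by auto
  have Jh: "J h = \<zero>\<^bsub>L\<^esub>" by (rule J_eq_0_if_coinc_eq_0[OF hc])
  have coeff: "cinner L (sq (\<phi> i)) f / of_real (sqrt (\<eta> i)) = cinner K (theta i) g"
    if i: "i \<in> I" "0 < \<eta> i" for i
  proof -
    note ic = phi_carrier[OF basis eigen i(1)]
    \<comment> \<open>Absorbing \<eta> i into J_adj trades the pairing of sq (\<phi> i) with h for
      its pairing with J h, which is zero.\<close>
    have "of_real (\<eta> i) * cinner L (sq (\<phi> i)) h = cinner L (J_adj (sq (\<phi> i))) h"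
      using ic hc by (simp add: J_adj_xi[OF basis eigen i(1)] L.cinner_smult_left)
    also have "\<dots> = 0" using ic hc Jh by (simp add: J_adjoint)
    finally have "cinner L (sq (\<phi> i)) h = 0" using i(2) by simp
    then have "cinner L (sq (\<phi> i)) f = cinner K (W (isq (\<phi> i))) g"
      using h(3) ic hc gc by (simp add: L.cinner_add_right coinc_adjoint W_xi[OF i(1)])
    also have "\<dots> = of_real (sqrt (\<eta> i)) * cinner K (theta i) g"
      using W_xi_eq_theta[OF i] theta_carrier[OF i(1)] gc by (simp add: K.cinner_smult_left)
    finally show ?thesis using i(2) by simp
  qed
  have "has_sum_in K (\<lambda>i. cinner K (theta i) g \<odot>\<^bsub>K\<^esub> theta i) {i \<in> I. 0 < \<eta> i} g"
    by (rule K.fourier_has_sum[OF theta_orthonormal orth_kernel_inc_in_closed_span[OF nonneg h(1)]])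
  then show ?thesis
    using coeff theta_carrier by (subst K.has_sum_in_cong) auto
qed

end

text \<open>The absolute value of \<open>J\<close> is diagonal in an eigenbasis of \<open>J\<^sup>*J\<close>, and the singular values
  are summable because \<open>J = inc \<circ> (coinc \<circ> sq\<^sup>2)\<close> is a product of Hilbert--Schmidt operators.\<close>

theorem trace_class_J: "trace_class L (opmap L J)"
proof -
  obtain c where c: "c \<ge> 0" "\<forall>x\<in>carrier K. cnorm L (inc x) \<le> c * cnorm K x"
    by (rule KL.bounded_map_bound[OF inc])
  obtain c1 where c1: "c1 \<ge> 0" "\<forall>x\<in>carrier L. cnorm L (J_adj x) \<le> c1 * cnorm L x"
    by (rule LL.bounded_map_bound[OF bounded_J_adj])
  have sq_sq_sym: "cinner L x (sq (sq y)) = cinner L (sq (sq x)) y"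
    if "x \<in> carrier L" "y \<in> carrier L" for x y
    using that by (simp add: sq_sym)
  \<comment> \<open>D bounds the Hilbert-Schmidt sums of coinc o sq o sq, one factor of J; D1 bounds
    those of coinc, the adjoint of the other factor.\<close>
  obtain D where D: "\<forall>F (e :: 'v \<Rightarrow> 'v). finite F \<longrightarrow> orthonormal L F e \<longrightarrow>
      (\<Sum>i\<in>F. (cnorm K (coinc (sq (sq (e i)))))\<^sup>2) \<le> D"
    by (rule hilbert_schmidt[OF bounded_sq_sq sq_sq_sym])
  obtain D1 where D1: "\<forall>F (e :: 'v \<Rightarrow> 'v). finite F \<longrightarrow> orthonormal L F e \<longrightarrow>
      (\<Sum>i\<in>F. (cnorm K (coinc (e i)))\<^sup>2) \<le> D1"
    by (rule hilbert_schmidt[OF bounded_map_id refl])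
  define T where "T x = J_adj (J x)" for x
  have bT: "bounded_map L L T"
    unfolding T_def[abs_def] by (rule bounded_map_comp[OF Ls Ls Ls bounded_J bounded_J_adj])
  note Tc = bounded_mapD(1)[OF bT]
  have form: "cinner L x (T y) = cinner L (J x) (J y)" if "x \<in> carrier L" "y \<in> carrier L" for x y
    using that by (simp add: T_def J_adjoint')
  have sym: "cinner L x (T y) = cinner L (T x) y" if "x \<in> carrier L" "y \<in> carrier L" for x y
    using that form[of x y] by (simp add: T_def J_adjoint)
  have quad: "Re (cinner L x (T x)) = (cnorm L (J x))\<^sup>2" if "x \<in> carrier L" for x
    using that by (simp add: form L.cnorm_sq)
  interpret positive_trace_operator L T "c1\<^sup>2" "c\<^sup>2 * D"
  proof
    show "(cnorm L (T x))\<^sup>2 \<le> c1\<^sup>2 * Re (cinner L x (T x))" if x: "x \<in> carrier L" for x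
    proof -
      have "cnorm L (T x) \<le> c1 * cnorm L (J x)" using c1(2) x by (simp add: T_def)
      then have "(cnorm L (T x))\<^sup>2 \<le> (c1 * cnorm L (J x))\<^sup>2"
        using x Tc by (intro power_mono) auto
      then show ?thesis using quad[OF x] by (simp add: power_mult_distrib)
    qed
    show "(\<Sum>e\<in>F. Re (cinner L e (T e))) \<le> c\<^sup>2 * D" if F: "finite F" "orthonormal L F (\<lambda>e. e)" for F
    proof -
      have ec: "e \<in> carrier L" if "e \<in> F" for e using orthonormalD(1)[OF F(2) that] .
      have "(\<Sum>e\<in>F. Re (cinner L e (T e))) \<le> (\<Sum>e\<in>F. c\<^sup>2 * (cnorm K (coinc (sq (sq e))))\<^sup>2)"
      proof (intro sum_mono)
        fix e assume "e \<in> F"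
        then have e: "e \<in> carrier L" by (rule ec)
        have "cnorm L (J e) \<le> c * cnorm K (coinc (sq (sq e)))"
          using c(2) e by (simp add: J_def W_def)
        then have "(cnorm L (J e))\<^sup>2 \<le> (c * cnorm K (coinc (sq (sq e))))\<^sup>2"
          using e by (intro power_mono) auto
        then show "Re (cinner L e (T e)) \<le> c\<^sup>2 * (cnorm K (coinc (sq (sq e))))\<^sup>2"
          using quad[OF e] by (simp add: power_mult_distrib)
      qed
      also have "\<dots> \<le> c\<^sup>2 * D"
        using D F by (simp add: mult_left_mono flip: sum_distrib_left)
      finally show ?thesis .
    qed
  qed (use sym bounded_mapD[OF bT] in auto)
  obtain E \<mu> where E: "orthonormal_basis L (carrier L) E (\<lambda>e. e)"
    "\<And>e. e \<in> E \<Longrightarrow> T e = complex_of_real (\<mu> e) \<odot>\<^bsub>L\<^esub> e" "\<And>e. e \<in> E \<Longrightarrow> 0 \<le> \<mu> e"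
    by (rule spectral_theorem) blast
  have on: "orthonormal L E (\<lambda>e. e)" using E(1) by (simp add: orthonormal_basis_iff)
  note Ec = orthonormalD(1)[OF on]
  have cl: "x \<in> norm_topology L closure_of lin_span L ((\<lambda>e. e) ` E)" if "x \<in> carrier L" for x
    using E(1) that by (simp add: orthonormal_basis_iff)
  have ext: "x = y" if "x \<in> carrier L" "y \<in> carrier L" "\<And>e. e \<in> E \<Longrightarrow> cinner L e x = cinner L e y"
    for x y
    by (rule L.orthonormal_basis_ext[OF E(1) that])
  have muJ: "\<mu> e = (cnorm L (J e))\<^sup>2" if e: "e \<in> E" for e
    using quad[OF Ec[OF e]] E(2)[OF e] orthonormalD(4)[OF on e e] Ec[OF e]
    by (simp add: L.cinner_smult_right)
  obtain m where m: "m \<ge> 0" "\<forall>x\<in>carrier L. cnorm L (J x) \<le> m * cnorm L x"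
    by (rule LL.bounded_map_bound[OF bounded_J])
  \<comment> \<open>A uniform bound on the eigenvalues makes the diagonal operator P well defined
    and bounded.\<close>
  have mu_le: "\<mu> e \<le> m\<^sup>2" if e: "e \<in> E" for e
  proof -
    have "cnorm L (J e) \<le> m" using m(2) Ec[OF e] L.orthonormal_cnorm[OF on e] by fastforce
    then show ?thesis using Ec[OF e] muJ[OF e] by (simp add: power_mono)
  qed
  define s where "s e = sqrt (\<mu> e)" for e
  have s: "0 \<le> s e" "(s e)\<^sup>2 = \<mu> e" if "e \<in> E" for e using E(3)[OF that] by (auto simp: s_def)
  have sqn: "(cmod (of_real (s e) * z))\<^sup>2 \<le> m\<^sup>2 * (cmod z)\<^sup>2" if "e \<in> E" for e z
    using s[OF that] mu_le[OF that] by (simp add: norm_mult power_mult_distrib mult_right_mono)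
  \<comment> \<open>P is prescribed through its coefficients in E, multiplied by the singular
    values; Riesz-Fischer supplies the vector.\<close>
  have "\<exists>y. y \<in> carrier L \<and> (\<forall>e\<in>E. cinner L e y = of_real (s e) * cinner L e x)"
    if x: "x \<in> carrier L" for x
  proof -
    have "(\<lambda>e. (cmod (of_real (s e) * cinner L e x))\<^sup>2) summable_on E"
    proof (rule summable_on_comparison_test)
      show "(\<lambda>e. m\<^sup>2 * (cmod (cinner L e x))\<^sup>2) summable_on E"
        by (intro summable_on_cmult_right L.bessel_summable[OF on x])
    qed (use sqn in auto)
    from L.riesz_fischer[OF on this] show ?thesis by metis
  qed
  then obtain P where P: "\<And>x. x \<in> carrier L \<Longrightarrow> P x \<in> carrier L"
    "\<And>x e. \<lbrakk>x \<in> carrier L; e \<in> E\<rbrakk> \<Longrightarrow> cinner L e (P x) = of_real (s e) * cinner L e x"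
    by metis
  have P_norm: "cnorm L (P x) \<le> m * cnorm L x" if x: "x \<in> carrier L" for x
  proof -
    have "((\<lambda>e. (cmod (cinner L e (P x)))\<^sup>2) has_sum (cnorm L (P x))\<^sup>2) E"
      by (rule L.parseval[OF on cl[OF P(1)[OF x]]])
    moreover have "((\<lambda>e. m\<^sup>2 * (cmod (cinner L e x))\<^sup>2) has_sum m\<^sup>2 * (cnorm L x)\<^sup>2) E"
      by (intro has_sum_cmult_right L.parseval[OF on cl[OF x]])
    ultimately have "(cnorm L (P x))\<^sup>2 \<le> m\<^sup>2 * (cnorm L x)\<^sup>2"
    proof (rule has_sum_mono)
      show "(cmod (cinner L e (P x)))\<^sup>2 \<le> m\<^sup>2 * (cmod (cinner L e x))\<^sup>2" if "e \<in> E" for e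
        using sqn[OF that, of "cinner L e x"] P(2)[OF x that] by simp
    qed
    then have "(cnorm L (P x))\<^sup>2 \<le> (m * cnorm L x)\<^sup>2" by (simp add: power_mult_distrib)
    then show ?thesis using m(1) x P(1) by (simp add: power2_le_iff_abs_le)
  qed
  have bP: "bounded_map L L P"
    unfolding bounded_map_def
  proof (intro conjI ballI allI)
    show "P \<in> carrier L \<rightarrow> carrier L" using P(1) by auto
    show "P (x \<oplus>\<^bsub>L\<^esub> y) = P x \<oplus>\<^bsub>L\<^esub> P y" if "x \<in> carrier L" "y \<in> carrier L" for x y
      using that P Ec by (intro ext) (simp_all add: L.cinner_add_right algebra_simps)
    show "P (a \<odot>\<^bsub>L\<^esub> x) = a \<odot>\<^bsub>L\<^esub> P x" if "x \<in> carrier L" for a x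
      using that P Ec by (intro ext) (simp_all add: L.cinner_smult_right)
    show "\<exists>C. \<forall>x\<in>carrier L. cnorm L (P x) \<le> C * cnorm L x" using P_norm by blast
  qed
  have pos: "positive_operator L (opmap L P)"
    unfolding positive_operator_def
  proof (intro conjI ballI)
    show "bounded_operator L L (opmap L P)" by (rule LL.bounded_operator_opmap[OF bP])
    fix x assume x: "x \<in> carrier L"
    let ?f = "\<lambda>e. s e * (cmod (cinner L e x))\<^sup>2"
    have f: "cinner L x e * cinner L e (P x) = of_real (?f e)" if e: "e \<in> E" for e
    proof -
      have "cinner L x e * cinner L e (P x) = of_real (s e) * (cinner L e x * cnj (cinner L e x))"
        using P(2)[OF x e] L.cinner_commute[OF x Ec[OF e]] by simp
      then show ?thesis by (simp only: complex_norm_square of_real_mult)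
    qed
    have hs: "((\<lambda>e. of_real (?f e) :: complex) has_sum cinner L x (P x)) E"
      by (rule iffD1[OF has_sum_cong L.parseval_cinner[OF on x cl[OF P(1)[OF x]]]]) (rule f)
    have "((\<lambda>e. Re (of_real (?f e))) has_sum Re (cinner L x (P x))) E"
      using has_sum_Re[OF hs] by simp
    then have "0 \<le> Re (cinner L x (P x))"
      by (rule has_sum_nonneg) (use s(1) in auto)
    moreover have "((\<lambda>e. Im (of_real (?f e))) has_sum Im (cinner L x (P x))) E"
      using has_sum_Im[OF hs] by simp
    then have "Im (cinner L x (P x)) = 0" using has_sum_unique[OF _ has_sum_0] by fastforce
    ultimately show "cinner L x (the (opmap L P x)) \<in> \<real>\<^sub>\<ge>\<^sub>0"
      using x by (simp add: complex_nonneg_Reals_iff)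
  qed
  have PP: "P (P x) = T x" if x: "x \<in> carrier L" for x
  proof (rule ext)
    fix e assume e: "e \<in> E"
    have "cinner L e (P (P x)) = of_real ((s e)\<^sup>2) * cinner L e x"
      using P x e by (simp add: power2_eq_square mult.assoc)
    also have "\<dots> = cinner L (T e) x"
      using E(2)[OF e] Ec[OF e] x s(2)[OF e] by (simp add: L.cinner_smult_left)
    also have "\<dots> = cinner L e (T x)" using sym[OF Ec[OF e] x] by simp
    finally show "cinner L e (P (P x)) = cinner L e (T x)" .
  qed (use P x Tc in auto)
  have diag: "Re (cinner L e (P e)) = s e" if e: "e \<in> E" for e
    using P(2)[OF Ec[OF e] e] orthonormalD(4)[OF on e e] by simp
  have sum_le: "(\<Sum>e\<in>F. s e) \<le> (D + D1) / 2" if F: "finite F" "F \<subseteq> E" for F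
  proof -
    \<comment> \<open>Zero singular values contribute nothing to the sum and would spoil the
      division in \<open>u\<close>.\<close>
    define G where "G = {e \<in> F. s e > 0}"
    have G: "finite G" "G \<subseteq> E" "\<And>e. e \<in> G \<Longrightarrow> s e > 0" using F by (auto simp: G_def)
    have Gc: "e \<in> carrier L" if "e \<in> G" for e using that G(2) Ec by blast
    \<comment> \<open>The image of e under the partial isometry in the polar decomposition of J, so
      that s e = <u e, J e>.\<close>
    define u where "u e = of_real (1 / s e) \<odot>\<^bsub>L\<^esub> J e" for e
    have uc: "u e \<in> carrier L" if "e \<in> G" for e using Gc[OF that] by (simp add: u_def)
    have JJ: "cinner L (J e) (J f) = (if e = f then of_real (\<mu> e) else 0)"
      if ef: "e \<in> E" "f \<in> E" for e f
      using form[OF Ec[OF ef(1)] Ec[OF ef(2)]] E(2)[OF ef(2)] orthonormalD(4)[OF on ef] Ec[OF ef(1)]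
        Ec[OF ef(2)] by (auto simp: L.cinner_smult_right)
    have uJ: "cinner L (u e) (J f) = (if e = f then of_real (s e) else 0)"
      if ef: "e \<in> G" "f \<in> G" for e f
    proof -
      have "cinner L (u e) (J f) = of_real (1 / s e) * cinner L (J e) (J f)"
        using Gc[OF ef(1)] Gc[OF ef(2)]
        by (simp only: u_def L.cinner_smult_left car' complex_cnj_complex_of_real)
      also have "\<dots> = (if e = f then of_real (s e) else 0)"
      proof (cases "e = f")
        case True
        have "1 / s e * \<mu> e = s e"
          using s(2)[of e] ef G(2) G(3)[OF ef(1)] by (auto simp: power2_eq_square field_simps)
        moreover have "e \<in> E" using ef(1) G(2) by blast
        ultimately show ?thesis
          using True JJ[of e e] by (simp only: refl if_True flip: of_real_mult)
      next
        case False
        then show ?thesis using JJ[of e f] ef G(2) by auto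
      qed
      finally show ?thesis .
    qed
    have onu: "orthonormal L G u"
      unfolding orthonormal_def
    proof (intro conjI ballI)
      show "u ` G \<subseteq> carrier L" using uc by auto
      fix e f assume ef: "e \<in> G" "f \<in> G"
      have "cinner L (u e) (u f) = of_real (1 / s f) * cinner L (u e) (J f)"
        using uc[OF ef(1)] Gc[OF ef(2)] by (simp only: u_def[of f] L.cinner_smult_right car')
      then show "cinner L (u e) (u f) = of_bool (e = f)"
        using uJ[OF ef] G(3)[OF ef(2)] by (auto simp flip: of_real_mult)
    qed
    \<comment> \<open><u e, J e> is the inner product of coinc (u e) and coinc (sq (sq e));
      Cauchy-Schwarz and the arithmetic-geometric mean separate it into terms of the two
      Hilbert-Schmidt sums.\<close>
    have le: "s e \<le> ((cnorm K (coinc (u e)))\<^sup>2 + (cnorm K (coinc (sq (sq e))))\<^sup>2) / 2"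
      if e: "e \<in> G" for e
    proof -
      have "complex_of_real (s e) = cinner K (coinc (u e)) (coinc (sq (sq e)))"
        using uJ[OF e e] uc[OF e] Gc[OF e] by (simp add: J_def W_def coinc_adjoint)
      then have "s e \<le> cmod (cinner K (coinc (u e)) (coinc (sq (sq e))))"
        using s(1)[of e] e G(2) by (metis abs_ge_self norm_of_real)
      also have "\<dots> \<le> cnorm K (coinc (u e)) * cnorm K (coinc (sq (sq e)))"
        using uc[OF e] Gc[OF e] by (intro K.cauchy_schwarz) auto
      also have "\<dots> \<le> ((cnorm K (coinc (u e)))\<^sup>2 + (cnorm K (coinc (sq (sq e))))\<^sup>2) / 2"
        using sum_squares_bound[of "cnorm K (coinc (u e))" "cnorm K (coinc (sq (sq e)))"] by simp
      finally show ?thesis .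
    qed
    have "(\<Sum>e\<in>F. s e) = (\<Sum>e\<in>G. s e)"
      unfolding G_def using F s(1) by (intro sum.mono_neutral_right) (auto simp: less_le)
    also have "\<dots> \<le> (\<Sum>e\<in>G. ((cnorm K (coinc (u e)))\<^sup>2 + (cnorm K (coinc (sq (sq e))))\<^sup>2) / 2)"
      by (rule sum_mono) (rule le)
    also have "\<dots> = ((\<Sum>e\<in>G. (cnorm K (coinc (u e)))\<^sup>2) + (\<Sum>e\<in>G. (cnorm K (coinc (sq (sq e))))\<^sup>2)) / 2"
      by (simp add: sum.distrib flip: sum_divide_distrib)
    also have "\<dots> \<le> (D1 + D) / 2"
    proof -
      have "(\<Sum>e\<in>G. (cnorm K (coinc (u e)))\<^sup>2) \<le> D1" using D1 G(1) onu by blast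
      moreover have "(\<Sum>e\<in>G. (cnorm K (coinc (sq (sq e))))\<^sup>2) \<le> D"
        using D G(1) orthonormal_subset[OF on G(2)] by blast
      ultimately show ?thesis by simp
    qed
    finally show ?thesis by simp
  qed
  have summ: "(\<lambda>e. Re (cinner L e (the (opmap L P e)))) summable_on E"
  proof -
    have "s summable_on E"
      using sum_le s(1) by (intro nonneg_bdd_above_summable_on bdd_aboveI2[of _ _ "(D + D1) / 2"]) auto
    then show ?thesis
      by (rule iffD1[OF summable_on_cong, rotated]) (use diag Ec in auto)
  qed
  have "opmap L P \<circ>\<^sub>m opmap L P = adjoint_op L L (opmap L J) \<circ>\<^sub>m opmap L J"
    unfolding adjoint_J
    using P(1) PP by (subst (1 2) opmap_comp) (auto simp: T_def intro!: opmap_cong)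
  then show ?thesis
    unfolding trace_class_def
    using LL.bounded_operator_opmap[OF bounded_J] pos E(1) summ by blast
qed

end

section \<open>The Hilbert space of square-integrable functions\<close>

lemma square_integrableD:
  assumes "f \<in> square_integrable \<rho>"
  shows "f \<in> borel_measurable \<rho>" "integrable \<rho> (\<lambda>x. (cmod (f x))\<^sup>2)"
  using assms by (auto simp: square_integrable_def)

lemma borel_measurable_cnj [measurable (raw)]:
  "f \<in> borel_measurable M \<Longrightarrow> (\<lambda>x. cnj (f x)) \<in> borel_measurable M"
  by (rule measurable_compose[OF _ borel_measurable_continuous_onI[of cnj]])
    (auto intro: continuous_intros)

lemma square_integrable_zero [simp]: "(\<lambda>x. 0) \<in> square_integrable \<rho>"
  by (simp add: square_integrable_def)

text \<open>The bound is an almost everywhere bound because the continuous multipliers are bounded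
  on the compact set carrying \<rho>, perhaps not beyond it.\<close>

lemma square_integrable_bounded_mult:
  assumes f: "f \<in> square_integrable \<rho>" and g: "g \<in> borel_measurable \<rho>"
    and bound: "AE x in \<rho>. cmod (g x) \<le> B"
  shows "(\<lambda>x. g x * f x) \<in> square_integrable \<rho>"
proof -
  note [measurable] = square_integrableD(1)[OF f] g
  have "integrable \<rho> (\<lambda>x. (cmod (g x * f x))\<^sup>2)"
  proof (rule Bochner_Integration.integrable_bound)
    show "integrable \<rho> (\<lambda>x. B\<^sup>2 * (cmod (f x))\<^sup>2)" using square_integrableD(2)[OF f] by simp
    show "AE x in \<rho>. norm ((cmod (g x * f x))\<^sup>2) \<le> norm (B\<^sup>2 * (cmod (f x))\<^sup>2)"
      using bound
    proof eventually_elim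
      case (elim x)
      then have "(cmod (g x))\<^sup>2 \<le> B\<^sup>2" by (intro power_mono) auto
      then show ?case by (simp add: norm_mult power_mult_distrib mult_right_mono)
    qed
  qed measurable
  then show ?thesis by (simp add: square_integrable_def)
qed

lemma square_integrable_cmult:
  "f \<in> square_integrable \<rho> \<Longrightarrow> (\<lambda>x. c * f x) \<in> square_integrable \<rho>"
  by (rule square_integrable_bounded_mult[where B = "cmod c"]) auto

lemma square_integrable_add:
  assumes f: "f \<in> square_integrable \<rho>" and g: "g \<in> square_integrable \<rho>"
  shows "(\<lambda>x. f x + g x) \<in> square_integrable \<rho>"
proof -
  note [measurable] = square_integrableD(1)[OF f] square_integrableD(1)[OF g]
  have "integrable \<rho> (\<lambda>x. (cmod (f x + g x))\<^sup>2)"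
  proof (rule Bochner_Integration.integrable_bound)
    show "integrable \<rho> (\<lambda>x. 2 * (cmod (f x))\<^sup>2 + 2 * (cmod (g x))\<^sup>2)"
      using square_integrableD(2)[OF f] square_integrableD(2)[OF g] by simp
    have "(cmod (f x + g x))\<^sup>2 \<le> 2 * (cmod (f x))\<^sup>2 + 2 * (cmod (g x))\<^sup>2" for x
    proof -
      have "(cmod (f x + g x))\<^sup>2 \<le> (cmod (f x) + cmod (g x))\<^sup>2"
        by (intro power_mono norm_triangle_ineq) auto
      also have "\<dots> \<le> 2 * (cmod (f x))\<^sup>2 + 2 * (cmod (g x))\<^sup>2"
        using sum_squares_bound[of "cmod (f x)" "cmod (g x)"] by (simp add: power2_sum)
      finally show ?thesis .
    qed
    then show "AE x in \<rho>. norm ((cmod (f x + g x))\<^sup>2) \<le>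
        norm (2 * (cmod (f x))\<^sup>2 + 2 * (cmod (g x))\<^sup>2)" by simp
  qed measurable
  then show ?thesis by (simp add: square_integrable_def)
qed

lemma square_integrable_diff:
  "\<lbrakk>f \<in> square_integrable \<rho>; g \<in> square_integrable \<rho>\<rbrakk> \<Longrightarrow> (\<lambda>x. f x - g x) \<in> square_integrable \<rho>"
  using square_integrable_add[OF _ square_integrable_cmult[of g \<rho> "-1"], of f] by simp

lemma integrable_cnj_mult:
  assumes f: "f \<in> square_integrable \<rho>" and g: "g \<in> square_integrable \<rho>"
  shows "integrable \<rho> (\<lambda>x. cnj (f x) * g x)"
proof (rule Bochner_Integration.integrable_bound)
  note [measurable] = square_integrableD(1)[OF f] square_integrableD(1)[OF g]
  show "integrable \<rho> (\<lambda>x. (cmod (f x))\<^sup>2 + (cmod (g x))\<^sup>2)"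
    using square_integrableD(2)[OF f] square_integrableD(2)[OF g] by simp
  have "cmod (cnj (f x) * g x) \<le> (cmod (f x))\<^sup>2 + (cmod (g x))\<^sup>2" for x
  proof -
    have "0 \<le> cmod (f x) * cmod (g x)" by simp
    then have "cmod (f x) * cmod (g x) \<le> (cmod (f x))\<^sup>2 + (cmod (g x))\<^sup>2"
      using sum_squares_bound[of "cmod (f x)" "cmod (g x)"] by linarith
    then show ?thesis by (simp add: norm_mult)
  qed
  then show "AE x in \<rho>. norm (cnj (f x) * g x) \<le> norm ((cmod (f x))\<^sup>2 + (cmod (g x))\<^sup>2)" by simp
  show "(\<lambda>x. cnj (f x) * g x) \<in> borel_measurable \<rho>" by measurable
qed

lemma equiv_ae_equal: "equiv (square_integrable \<rho>) (ae_equal \<rho>)"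
proof (rule equivI)
  show "ae_equal \<rho> \<subseteq> square_integrable \<rho> \<times> square_integrable \<rho>" by (auto simp: ae_equal_def)
  show "refl_on (square_integrable \<rho>) (ae_equal \<rho>)" by (auto simp: refl_on_def ae_equal_def)
  show "sym (ae_equal \<rho>)" unfolding sym_def ae_equal_def by auto
  show "trans (ae_equal \<rho>)" unfolding trans_def ae_equal_def by auto
qed

lemma l2_class_eq_iff:
  "\<lbrakk>f \<in> square_integrable \<rho>; g \<in> square_integrable \<rho>\<rbrakk> \<Longrightarrow>
     l2_class \<rho> f = l2_class \<rho> g \<longleftrightarrow> (AE x in \<rho>. f x = g x)"
  unfolding l2_class_def
  using eq_equiv_class_iff[OF equiv_ae_equal, of f \<rho> g] by (auto simp: ae_equal_def)

lemma l2_class_in_carrier [simp]: "f \<in> square_integrable \<rho> \<Longrightarrow> l2_class \<rho> f \<in> carrier (L2 \<rho>)"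
  by (simp add: L2_def l2_class_def quotientI)

lemma L2_cases:
  assumes "F \<in> carrier (L2 \<rho>)"
  obtains f where "f \<in> square_integrable \<rho>" "F = l2_class \<rho> f"
  using assms by (auto simp: L2_def l2_class_def elim!: quotientE)

lemma mem_l2_class:
  "f \<in> square_integrable \<rho> \<Longrightarrow>
     g \<in> l2_class \<rho> f \<longleftrightarrow> g \<in> square_integrable \<rho> \<and> (AE x in \<rho>. f x = g x)"
  by (auto simp: l2_class_def ae_equal_def)

lemma self_in_l2_class: "f \<in> square_integrable \<rho> \<Longrightarrow> f \<in> l2_class \<rho> f"
  by (simp add: mem_l2_class)

text \<open>Evaluates the unions over representatives in \<open>L2\<close> once independence of the
  representative is known.\<close>

lemma UN_constant_on: "\<lbrakk>a \<in> A; \<And>x. x \<in> A \<Longrightarrow> f x = c\<rbrakk> \<Longrightarrow> (\<Union>x\<in>A. f x) = c"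
  by blast

lemma L2_add:
  assumes f: "f \<in> square_integrable \<rho>" and g: "g \<in> square_integrable \<rho>"
  shows "l2_class \<rho> f \<oplus>\<^bsub>L2 \<rho>\<^esub> l2_class \<rho> g = l2_class \<rho> (\<lambda>x. f x + g x)"
proof -
  have "l2_class \<rho> (\<lambda>x. f' x + g' x) = l2_class \<rho> (\<lambda>x. f x + g x)"
    if "f' \<in> l2_class \<rho> f" "g' \<in> l2_class \<rho> g" for f' g'
  proof -
    have *: "f' \<in> square_integrable \<rho>" "g' \<in> square_integrable \<rho>"
      "AE x in \<rho>. f x = f' x" "AE x in \<rho>. g x = g' x"
      using that mem_l2_class[OF f] mem_l2_class[OF g] by auto
    show ?thesis
    proof (subst l2_class_eq_iff)
      show "AE x in \<rho>. f' x + g' x = f x + g x" using *(3,4) by eventually_elim simp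
    qed (use * f g square_integrable_add in blast)+
  qed
  then have "(\<Union>f'\<in>l2_class \<rho> f. \<Union>g'\<in>l2_class \<rho> g. l2_class \<rho> (\<lambda>x. f' x + g' x)) =
      l2_class \<rho> (\<lambda>x. f x + g x)"
    by (rule UN_constant_on[OF self_in_l2_class[OF f] UN_constant_on[OF self_in_l2_class[OF g]]])
  then show ?thesis by (simp add: L2_def)
qed

text \<open>Common core of scalar multiplication and of \<open>l2_mult\<close>.\<close>

lemma l2_class_pointwise:
  assumes f: "f \<in> square_integrable \<rho>"
    and closed: "\<And>f. f \<in> square_integrable \<rho> \<Longrightarrow> (\<lambda>x. h x * f x) \<in> square_integrable \<rho>"
  shows "(\<Union>f'\<in>l2_class \<rho> f. l2_class \<rho> (\<lambda>x. h x * f' x)) = l2_class \<rho> (\<lambda>x. h x * f x)"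
proof (rule UN_constant_on[OF self_in_l2_class[OF f]])
  fix f' assume "f' \<in> l2_class \<rho> f"
  then have *: "f' \<in> square_integrable \<rho>" "AE x in \<rho>. f x = f' x"
    using mem_l2_class[OF f] by auto
  show "l2_class \<rho> (\<lambda>x. h x * f' x) = l2_class \<rho> (\<lambda>x. h x * f x)"
  proof (subst l2_class_eq_iff)
    show "AE x in \<rho>. h x * f' x = h x * f x" using *(2) by eventually_elim simp
  qed (use * f closed in blast)+
qed

lemma L2_smult:
  assumes f: "f \<in> square_integrable \<rho>"
  shows "c \<odot>\<^bsub>L2 \<rho>\<^esub> l2_class \<rho> f = l2_class \<rho> (\<lambda>x. c * f x)"
  using l2_class_pointwise[OF f, of "\<lambda>_. c"] square_integrable_cmult[of _ \<rho> c]
  by (simp add: L2_def)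

lemma L2_cinner:
  assumes f: "f \<in> square_integrable \<rho>" and g: "g \<in> square_integrable \<rho>"
  shows "cinner (L2 \<rho>) (l2_class \<rho> f) (l2_class \<rho> g) = (LINT x|\<rho>. cnj (f x) * g x)"
proof -
  have "(LINT x|\<rho>. cnj (f' x) * g' x) = (LINT x|\<rho>. cnj (f x) * g x)"
    if "f' \<in> l2_class \<rho> f" "g' \<in> l2_class \<rho> g" for f' g'
  proof -
    have *: "f' \<in> square_integrable \<rho>" "g' \<in> square_integrable \<rho>"
      "AE x in \<rho>. f x = f' x" "AE x in \<rho>. g x = g' x"
      using that mem_l2_class[OF f] mem_l2_class[OF g] by auto
    note [measurable] = square_integrableD(1)[OF f] square_integrableD(1)[OF g]
      square_integrableD(1)[OF *(1)] square_integrableD(1)[OF *(2)]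
    show ?thesis by (rule integral_cong_AE) (use *(3,4) in auto)
  qed
  then have "(\<Union>f'\<in>l2_class \<rho> f. \<Union>g'\<in>l2_class \<rho> g. {LINT x|\<rho>. cnj (f' x) * g' x}) =
      {LINT x|\<rho>. cnj (f x) * g x}"
    by (intro UN_constant_on[OF self_in_l2_class[OF f]] UN_constant_on[OF self_in_l2_class[OF g]])
      simp
  then show ?thesis by (simp add: L2_def)
qed

lemma L2_zero: "\<zero>\<^bsub>L2 \<rho>\<^esub> = l2_class \<rho> (\<lambda>x. 0)"
  by (simp add: L2_def)

lemma L2_cinner_self:
  assumes "f \<in> square_integrable \<rho>"
  shows "cinner (L2 \<rho>) (l2_class \<rho> f) (l2_class \<rho> f) = of_real (LINT x|\<rho>. (cmod (f x))\<^sup>2)"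
proof -
  have "(LINT x|\<rho>. cnj (f x) * f x) = (LINT x|\<rho>. complex_of_real ((cmod (f x))\<^sup>2))"
    by (intro Bochner_Integration.integral_cong refl) (simp only: complex_norm_square mult.commute)
  then show ?thesis using L2_cinner[OF assms assms] by (simp only: integral_complex_of_real)
qed

lemma L2_cnorm_sq:
  "f \<in> square_integrable \<rho> \<Longrightarrow> (cnorm (L2 \<rho>) (l2_class \<rho> f))\<^sup>2 = (LINT x|\<rho>. (cmod (f x))\<^sup>2)"
  by (simp add: cnorm_def L2_cinner_self)

lemma abelian_group_L2: "abelian_group (L2 \<rho>)"
proof (rule abelian_groupI)
  show "\<zero>\<^bsub>L2 \<rho>\<^esub> \<in> carrier (L2 \<rho>)" by (simp add: L2_zero)
  fix F assume "F \<in> carrier (L2 \<rho>)"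
  then obtain f where f: "f \<in> square_integrable \<rho>" "F = l2_class \<rho> f" by (rule L2_cases)
  show "\<zero>\<^bsub>L2 \<rho>\<^esub> \<oplus>\<^bsub>L2 \<rho>\<^esub> F = F" using f by (simp add: L2_zero L2_add)
  have m: "(\<lambda>x. - f x) \<in> square_integrable \<rho>" using square_integrable_cmult[OF f(1), of "-1"] by simp
  show "\<exists>G\<in>carrier (L2 \<rho>). G \<oplus>\<^bsub>L2 \<rho>\<^esub> F = \<zero>\<^bsub>L2 \<rho>\<^esub>"
    by (rule bexI[of _ "l2_class \<rho> (\<lambda>x. - f x)"]) (use f m in \<open>simp_all add: L2_zero L2_add\<close>)
  fix G assume "G \<in> carrier (L2 \<rho>)"
  then obtain g where g: "g \<in> square_integrable \<rho>" "G = l2_class \<rho> g" by (rule L2_cases)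
  show "F \<oplus>\<^bsub>L2 \<rho>\<^esub> G \<in> carrier (L2 \<rho>)" using f g by (simp add: L2_add square_integrable_add)
  show "F \<oplus>\<^bsub>L2 \<rho>\<^esub> G = G \<oplus>\<^bsub>L2 \<rho>\<^esub> F" using f g by (simp add: L2_add add.commute)
  fix H assume "H \<in> carrier (L2 \<rho>)"
  then obtain h where h: "h \<in> square_integrable \<rho>" "H = l2_class \<rho> h" by (rule L2_cases)
  show "F \<oplus>\<^bsub>L2 \<rho>\<^esub> G \<oplus>\<^bsub>L2 \<rho>\<^esub> H = F \<oplus>\<^bsub>L2 \<rho>\<^esub> (G \<oplus>\<^bsub>L2 \<rho>\<^esub> H)"
    using f g h by (simp add: L2_add square_integrable_add add.assoc)
qed

lemma module_L2: "module complex_ring (L2 \<rho>)"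
proof (rule moduleI)
  show "cring complex_ring" by (rule cring_from_type_algebra)
  show "abelian_group (L2 \<rho>)" by (rule abelian_group_L2)
  fix a b :: complex and F assume "F \<in> carrier (L2 \<rho>)"
  then obtain f where f: "f \<in> square_integrable \<rho>" "F = l2_class \<rho> f" by (rule L2_cases)
  show "a \<odot>\<^bsub>L2 \<rho>\<^esub> F \<in> carrier (L2 \<rho>)" using f by (simp add: L2_smult square_integrable_cmult)
  show "(a \<oplus>\<^bsub>complex_ring\<^esub> b) \<odot>\<^bsub>L2 \<rho>\<^esub> F = a \<odot>\<^bsub>L2 \<rho>\<^esub> F \<oplus>\<^bsub>L2 \<rho>\<^esub> b \<odot>\<^bsub>L2 \<rho>\<^esub> F"
    using f by (simp add: L2_smult L2_add square_integrable_cmult distrib_right)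
  show "(a \<otimes>\<^bsub>complex_ring\<^esub> b) \<odot>\<^bsub>L2 \<rho>\<^esub> F = a \<odot>\<^bsub>L2 \<rho>\<^esub> (b \<odot>\<^bsub>L2 \<rho>\<^esub> F)"
    using f by (simp add: L2_smult square_integrable_cmult mult.assoc)
  show "\<one>\<^bsub>complex_ring\<^esub> \<odot>\<^bsub>L2 \<rho>\<^esub> F = F" using f by (simp add: L2_smult)
  fix G assume "G \<in> carrier (L2 \<rho>)"
  then obtain g where g: "g \<in> square_integrable \<rho>" "G = l2_class \<rho> g" by (rule L2_cases)
  show "a \<odot>\<^bsub>L2 \<rho>\<^esub> (F \<oplus>\<^bsub>L2 \<rho>\<^esub> G) = a \<odot>\<^bsub>L2 \<rho>\<^esub> F \<oplus>\<^bsub>L2 \<rho>\<^esub> a \<odot>\<^bsub>L2 \<rho>\<^esub> G"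
    using f g
    by (simp add: L2_smult L2_add square_integrable_cmult square_integrable_add distrib_left)
qed

lemma complex_inner_space_L2: "complex_inner_space (L2 \<rho>)"
proof (intro complex_inner_space.intro complex_inner_space_axioms.intro module_L2)
  fix F G assume "F \<in> carrier (L2 \<rho>)" "G \<in> carrier (L2 \<rho>)"
  then obtain f g where f: "f \<in> square_integrable \<rho>" "F = l2_class \<rho> f"
    and g: "g \<in> square_integrable \<rho>" "G = l2_class \<rho> g" by (metis L2_cases)
  have "(LINT x|\<rho>. cnj (f x) * g x) = (LINT x|\<rho>. cnj (cnj (g x) * f x))"
    by (simp add: mult.commute del: Bochner_Integration.integral_cnj)
  also have "\<dots> = cnj (LINT x|\<rho>. cnj (g x) * f x)" by (rule Bochner_Integration.integral_cnj)
  finally show "cinner (L2 \<rho>) F G = cnj (cinner (L2 \<rho>) G F)"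
    using f g by (simp only: L2_cinner)
  show "cinner (L2 \<rho>) F (c \<odot>\<^bsub>L2 \<rho>\<^esub> G) = c * cinner (L2 \<rho>) F G" for c
    using f g by (simp add: L2_cinner L2_smult square_integrable_cmult mult.left_commute)
  show "cinner (L2 \<rho>) F (G \<oplus>\<^bsub>L2 \<rho>\<^esub> H) = cinner (L2 \<rho>) F G + cinner (L2 \<rho>) F H"
    if H: "H \<in> carrier (L2 \<rho>)" for H
  proof -
    obtain h where h: "h \<in> square_integrable \<rho>" "H = l2_class \<rho> h" by (rule L2_cases[OF H])
    have "(LINT x|\<rho>. cnj (f x) * (g x + h x)) =
        (LINT x|\<rho>. cnj (f x) * g x) + (LINT x|\<rho>. cnj (f x) * h x)"
      using integrable_cnj_mult[OF f(1) g(1)] integrable_cnj_mult[OF f(1) h(1)]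
      by (simp add: distrib_left)
    then show ?thesis using f g h by (simp add: L2_cinner L2_add square_integrable_add)
  qed
next
  fix F assume F: "F \<in> carrier (L2 \<rho>)" "F \<noteq> \<zero>\<^bsub>L2 \<rho>\<^esub>"
  then obtain f where f: "f \<in> square_integrable \<rho>" "F = l2_class \<rho> f" by (metis L2_cases)
  have "\<not> (AE x in \<rho>. f x = 0)" using F(2) f by (simp add: L2_zero l2_class_eq_iff)
  then have "(LINT x|\<rho>. (cmod (f x))\<^sup>2) \<noteq> 0"
    using integral_nonneg_eq_0_iff_AE[OF square_integrableD(2)[OF f(1)]] by simp
  moreover have "0 \<le> (LINT x|\<rho>. (cmod (f x))\<^sup>2)" by (rule integral_nonneg_AE) simp
  ultimately have "(LINT x|\<rho>. (cmod (f x))\<^sup>2) > 0" by (rule order_neq_le_trans[OF not_sym])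
  then show "0 < Re (cinner (L2 \<rho>) F F)" using f by (simp add: L2_cinner_self)
qed

lemma L2_diff:
  assumes f: "f \<in> square_integrable \<rho>" and g: "g \<in> square_integrable \<rho>"
  shows "l2_class \<rho> f \<ominus>\<^bsub>L2 \<rho>\<^esub> l2_class \<rho> g = l2_class \<rho> (\<lambda>x. f x - g x)"
proof -
  interpret complex_inner_space "L2 \<rho>" by (rule complex_inner_space_L2)
  have "l2_class \<rho> f \<ominus>\<^bsub>L2 \<rho>\<^esub> l2_class \<rho> g = l2_class \<rho> f \<oplus>\<^bsub>L2 \<rho>\<^esub> (-1) \<odot>\<^bsub>L2 \<rho>\<^esub> l2_class \<rho> g"
    using f g by (intro cinner_ext) (simp_all add: cinner_simps)
  then show ?thesis
    using f g square_integrable_cmult[OF g, of "-1"] by (simp add: L2_smult L2_add)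
qed

text \<open>Riesz--Fischer: along a rapidly converging subsequence the increments are summable almost
  everywhere, and Fatou's lemma identifies the pointwise limit as the limit in norm.\<close>

lemma L2_complete_aux:
  assumes fin: "finite_measure \<rho>" and g: "\<And>n. g n \<in> square_integrable \<rho>"
    and cauchy: "\<And>m n. n \<le> m \<Longrightarrow> (LINT x|\<rho>. (cmod (g m x - g n x))\<^sup>2) \<le> (1/4) ^ n"
  obtains G where "G \<in> square_integrable \<rho>"
    "\<And>n. (LINT x|\<rho>. (cmod (G x - g n x))\<^sup>2) \<le> (1/4) ^ n"
proof -
  interpret finite_measure \<rho> by (rule fin)
  have [measurable]: "g n \<in> borel_measurable \<rho>" for n by (rule square_integrableD(1)[OF g])
  have d: "(\<lambda>x. g m x - g n x) \<in> square_integrable \<rho>" for m n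
    by (intro square_integrable_diff g)
  define h where "h n x = g (Suc n) x - g n x" for n x
  have [measurable]: "h n \<in> borel_measurable \<rho>" for n unfolding h_def by measurable
  \<comment> \<open>Since |h n x| \<le> (2^n |h n x|^2 + 2^-n) / 2 and the integral of |h n|^2 is at
    most 4^-n, both terms integrate to multiples of 2^-n; the second brings in the total mass of
    \<rho>.\<close>
  define c where "c = (1 + measure \<rho> (space \<rho>)) / 2"
  have "(\<integral>\<^sup>+x. ennreal (cmod (h n x)) \<partial>\<rho>) \<le> ennreal (c * (1/2) ^ n)" for n
  proof -
    have int: "integrable \<rho> (\<lambda>x. (2 ^ n * (cmod (h n x))\<^sup>2 + (1/2) ^ n) / 2)"
      using square_integrableD(2)[OF d[of "Suc n" n]] by (simp add: h_def)
    have "(\<integral>\<^sup>+x. ennreal (cmod (h n x)) \<partial>\<rho>)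
        \<le> (\<integral>\<^sup>+x. ennreal ((2 ^ n * (cmod (h n x))\<^sup>2 + (1/2) ^ n) / 2) \<partial>\<rho>)"
    proof (intro nn_integral_mono ennreal_leI)
      fix x
      define t where "t = cmod (h n x)"
      have "0 \<le> 2 ^ n * (t - (1/2) ^ n)\<^sup>2" by simp
      also have "\<dots> = 2 ^ n * t\<^sup>2 - 2 * t * (2 ^ n * (1/2) ^ n) + (2 ^ n * (1/2) ^ n) * (1/2) ^ n"
        by (simp add: power2_eq_square algebra_simps)
      also have "2 ^ n * (1/2) ^ n = (1 :: real)" by (simp flip: power_mult_distrib)
      finally show "t \<le> (2 ^ n * t\<^sup>2 + (1/2) ^ n) / 2" by simp
    qed
    also have "\<dots> = ennreal (LINT x|\<rho>. (2 ^ n * (cmod (h n x))\<^sup>2 + (1/2) ^ n) / 2)"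
      using int by (intro nn_integral_eq_integral) auto
    also have "(LINT x|\<rho>. (2 ^ n * (cmod (h n x))\<^sup>2 + (1/2) ^ n) / 2)
        = (2 ^ n * (LINT x|\<rho>. (cmod (h n x))\<^sup>2) + (1/2) ^ n * measure \<rho> (space \<rho>)) / 2"
      using square_integrableD(2)[OF d[of "Suc n" n]] by (simp add: h_def)
    also have "ennreal \<dots> \<le> ennreal (c * (1/2) ^ n)"
    proof (rule ennreal_leI)
      have "2 ^ n * (LINT x|\<rho>. (cmod (h n x))\<^sup>2) \<le> 2 ^ n * (1/4) ^ n"
        using cauchy[of n "Suc n"] by (intro mult_left_mono) (auto simp: h_def)
      also have "\<dots> = (1/2 :: real) ^ n" by (simp flip: power_mult_distrib)
      finally have le: "2 ^ n * (LINT x|\<rho>. (cmod (h n x))\<^sup>2) \<le> (1/2) ^ n" .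
      have "(a + b * m) / 2 \<le> (1 + m) / 2 * b" if "a \<le> b" for a b m :: real
        using that by (simp add: algebra_simps)
      from this[OF le, of "measure \<rho> (space \<rho>)"]
      show "(2 ^ n * (LINT x|\<rho>. (cmod (h n x))\<^sup>2) + (1/2) ^ n * measure \<rho> (space \<rho>)) / 2
          \<le> c * (1/2) ^ n"
        by (simp only: c_def)
    qed
    finally show ?thesis .
  qed
  then have "(\<Sum>n. \<integral>\<^sup>+x. ennreal (cmod (h n x)) \<partial>\<rho>) \<le> (\<Sum>n. ennreal (c * (1/2) ^ n))"
    by (intro suminf_le) auto
  also have "\<dots> = ennreal (\<Sum>n. c * (1/2) ^ n)"
  proof (rule suminf_ennreal2)
    show "0 \<le> c * (1/2) ^ n" for n by (simp add: c_def)
    show "summable (\<lambda>n. c * (1/2) ^ n)" by (intro summable_mult summable_geometric) simp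
  qed
  also have "\<dots> < \<infinity>" by simp
  finally have "(\<integral>\<^sup>+x. (\<Sum>n. ennreal (cmod (h n x))) \<partial>\<rho>) < \<infinity>" by (subst nn_integral_suminf) auto
  then have "AE x in \<rho>. (\<Sum>n. ennreal (cmod (h n x))) \<noteq> \<infinity>"
    by (intro nn_integral_noteq_infinite) auto
  then have summ: "AE x in \<rho>. summable (\<lambda>n. h n x)"
  proof eventually_elim
    case (elim x)
    then have "summable (\<lambda>n. cmod (h n x))" by (intro summable_suminf_not_top) auto
    then show ?case by (rule summable_norm_cancel)
  qed
  \<comment> \<open>Where the series converges it telescopes to the limit of g m x; elsewhere, on a
    null set, its value is arbitrary.\<close>
  define G where "G x = g 0 x + (\<Sum>n. h n x)" for x
  have [measurable]: "G \<in> borel_measurable \<rho>" unfolding G_def by measurable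
  have lim: "AE x in \<rho>. (\<lambda>m. g m x) \<longlonglongrightarrow> G x"
    using summ
  proof eventually_elim
    case (elim x)
    have "(\<Sum>k<m. h k x) = g m x - g 0 x" for m unfolding h_def by (rule sum_lessThan_telescope)
    then have "(\<lambda>m. g 0 x + (g m x - g 0 x)) \<longlonglongrightarrow> G x"
      unfolding G_def using summable_LIMSEQ[OF elim] by (intro tendsto_intros) simp
    then show ?case by simp
  qed
  have le: "(\<integral>\<^sup>+x. ennreal ((cmod (G x - g n x))\<^sup>2) \<partial>\<rho>) \<le> ennreal ((1/4) ^ n)" for n
  proof -
    have "AE x in \<rho>. ennreal ((cmod (G x - g n x))\<^sup>2) =
        liminf (\<lambda>m. ennreal ((cmod (g m x - g n x))\<^sup>2))"
      using lim
    proof eventually_elim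
      case (elim x)
      then have "(\<lambda>m. ennreal ((cmod (g m x - g n x))\<^sup>2)) \<longlonglongrightarrow> ennreal ((cmod (G x - g n x))\<^sup>2)"
        by (intro tendsto_intros)
      then show ?case by (intro lim_imp_Liminf[symmetric]) auto
    qed
    then have "(\<integral>\<^sup>+x. ennreal ((cmod (G x - g n x))\<^sup>2) \<partial>\<rho>) =
        (\<integral>\<^sup>+x. liminf (\<lambda>m. ennreal ((cmod (g m x - g n x))\<^sup>2)) \<partial>\<rho>)"
      by (rule nn_integral_cong_AE)
    also have "\<dots> \<le> liminf (\<lambda>m. \<integral>\<^sup>+x. ennreal ((cmod (g m x - g n x))\<^sup>2) \<partial>\<rho>)"
      by (rule nn_integral_liminf) measurable
    also have "\<dots> \<le> ennreal ((1/4) ^ n)"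
    proof (rule Liminf_le)
      show "\<forall>\<^sub>F m in sequentially. (\<integral>\<^sup>+x. ennreal ((cmod (g m x - g n x))\<^sup>2) \<partial>\<rho>) \<le> ennreal ((1/4) ^ n)"
        using eventually_ge_at_top[of n]
      proof eventually_elim
        case (elim m)
        have "(\<integral>\<^sup>+x. ennreal ((cmod (g m x - g n x))\<^sup>2) \<partial>\<rho>) =
            ennreal (LINT x|\<rho>. (cmod (g m x - g n x))\<^sup>2)"
          using square_integrableD(2)[OF d] by (intro nn_integral_eq_integral) auto
        then show ?case using cauchy[OF elim] by (simp add: ennreal_leI)
      qed
    qed auto
    finally show ?thesis .
  qed
  have diff: "(\<lambda>x. G x - g n x) \<in> square_integrable \<rho>" for n
  proof -
    have "integrable \<rho> (\<lambda>x. (cmod (G x - g n x))\<^sup>2)"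
      using le[of n] by (intro integrableI_bounded) (auto simp: less_top[symmetric] top_unique intro: le_less_trans)
    then show ?thesis by (simp add: square_integrable_def)
  qed
  have "G \<in> square_integrable \<rho>"
    using square_integrable_add[OF diff[of 0] g[of 0]] by simp
  moreover have "(LINT x|\<rho>. (cmod (G x - g n x))\<^sup>2) \<le> (1/4) ^ n" for n
    using le[of n] nn_integral_eq_integral[OF square_integrableD(2)[OF diff[of n]]]
    by (simp add: ennreal_le_iff)
  ultimately show ?thesis using that by blast
qed

lemma complex_hilbert_space_L2:
  assumes fin: "finite_measure \<rho>"
  shows "complex_hilbert_space (L2 \<rho>)"
proof (intro complex_hilbert_space.intro complex_hilbert_space_axioms.intro complex_inner_space_L2)
  interpret complex_inner_space "L2 \<rho>" by (rule complex_inner_space_L2)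
  interpret M: Metric_space "carrier (L2 \<rho>)" "cdist (L2 \<rho>)" by (rule metric_space_cdist)
  show "M.mcomplete"
    unfolding M.mcomplete_def
  proof (intro allI impI)
    fix \<sigma> assume \<sigma>: "M.MCauchy \<sigma>"
    have car: "\<sigma> n \<in> carrier (L2 \<rho>)" for n using \<sigma> unfolding M.MCauchy_def by auto
    have "\<forall>n. \<exists>f. f \<in> square_integrable \<rho> \<and> \<sigma> n = l2_class \<rho> f" using car by (metis L2_cases)
    then obtain f where f: "\<And>n. f n \<in> square_integrable \<rho>" "\<And>n. \<sigma> n = l2_class \<rho> (f n)" by metis
    have "\<exists>N. \<forall>m n. N \<le> m \<longrightarrow> N \<le> n \<longrightarrow> cdist (L2 \<rho>) (\<sigma> m) (\<sigma> n) < (1/2) ^ k" for k :: nat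
    proof -
      have "(1/2 :: real) ^ k > 0" by simp
      then show ?thesis using \<sigma> unfolding M.MCauchy_def by blast
    qed
    then obtain N where N: "\<And>k m n. \<lbrakk>N k \<le> m; N k \<le> n\<rbrakk> \<Longrightarrow> cdist (L2 \<rho>) (\<sigma> m) (\<sigma> n) < (1/2) ^ k"
      by metis
    \<comment> \<open>Adding up the N i + 1 gives a strictly increasing r with r m \<ge> N n
      whenever m \<ge> n.\<close>
    define r where "r n = (\<Sum>i\<le>n. N i + 1)" for n
    have r: "strict_mono r" unfolding strict_mono_Suc_iff by (simp add: r_def)
    have rN: "N n \<le> r m" if "n \<le> m" for n m
    proof -
      have "N n + 1 \<le> r m" unfolding r_def using that by (intro member_le_sum) auto
      then show ?thesis by simp
    qed
    have sq: "(LINT x|\<rho>. (cmod (f (r m) x - f (r n) x))\<^sup>2) \<le> (1/4) ^ n" if "n \<le> m" for m n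
    proof -
      have "cnorm (L2 \<rho>) (l2_class \<rho> (\<lambda>x. f (r m) x - f (r n) x)) < (1/2) ^ n"
        using N[of n "r m" "r n"] rN that f car by (simp add: cdist_def L2_diff)
      moreover have "0 \<le> cnorm (L2 \<rho>) (l2_class \<rho> (\<lambda>x. f (r m) x - f (r n) x))"
        by (intro cnorm_nonneg l2_class_in_carrier square_integrable_diff f(1))
      ultimately have "(cnorm (L2 \<rho>) (l2_class \<rho> (\<lambda>x. f (r m) x - f (r n) x)))\<^sup>2 \<le> ((1/2) ^ n)\<^sup>2"
        by (intro power_mono) auto
      also have "((1/2 :: real) ^ n)\<^sup>2 = (1/4) ^ n" by (simp add: power2_eq_square flip: power_mult_distrib)
      finally show ?thesis by (simp add: L2_cnorm_sq square_integrable_diff f(1))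
    qed
    obtain G where G: "G \<in> square_integrable \<rho>"
      "\<And>n. (LINT x|\<rho>. (cmod (G x - f (r n) x))\<^sup>2) \<le> (1/4) ^ n"
      by (rule L2_complete_aux[OF fin, of "\<lambda>n. f (r n)"]) (use f sq in auto)
    have le: "cnorm (L2 \<rho>) (\<sigma> (r n) \<ominus>\<^bsub>L2 \<rho>\<^esub> l2_class \<rho> G) \<le> (1/2) ^ n" for n
    proof -
      have "(cnorm (L2 \<rho>) (l2_class \<rho> G \<ominus>\<^bsub>L2 \<rho>\<^esub> \<sigma> (r n)))\<^sup>2 \<le> (1/4) ^ n"
        using f G by (simp add: L2_diff L2_cnorm_sq square_integrable_diff)
      also have "(1/4 :: real) ^ n = ((1/2) ^ n)\<^sup>2" by (simp add: power2_eq_square flip: power_mult_distrib)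
      finally have "cnorm (L2 \<rho>) (l2_class \<rho> G \<ominus>\<^bsub>L2 \<rho>\<^esub> \<sigma> (r n)) \<le> (1/2) ^ n"
        by (rule power2_le_imp_le) simp
      then show ?thesis using G(1) car cnorm_diff_commute[of "l2_class \<rho> G" "\<sigma> (r n)"] by simp
    qed
    have pos: "0 \<le> cnorm (L2 \<rho>) (\<sigma> (r n) \<ominus>\<^bsub>L2 \<rho>\<^esub> l2_class \<rho> G)" for n
      using car G(1) by (intro cnorm_nonneg) simp
    have lim: "(\<lambda>n. (1/2 :: real) ^ n) \<longlonglongrightarrow> 0" by (intro LIMSEQ_realpow_zero) auto
    have "(\<lambda>n. cnorm (L2 \<rho>) (\<sigma> (r n) \<ominus>\<^bsub>L2 \<rho>\<^esub> l2_class \<rho> G)) \<longlonglongrightarrow> 0"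
      by (rule tendsto_sandwich[OF _ _ tendsto_const lim]) (simp_all add: le pos)
    then have "limitin (norm_topology (L2 \<rho>)) (\<sigma> \<circ> r) (l2_class \<rho> G) sequentially"
      unfolding limitin_norm_iff using car G(1) by simp
    then show "\<exists>F. limitin (norm_topology (L2 \<rho>)) \<sigma> F sequentially"
      using M.MCauchy_convergent_subsequence[OF \<sigma> r] by blast
  qed
qed

text \<open>Pairing with the constant 1, which is square-integrable because \<rho> is
  finite.\<close>

lemma square_integrable_imp_integrable_finite:
  assumes "finite_measure \<rho>" and f: "f \<in> square_integrable \<rho>"
  shows "integrable \<rho> f"
proof -
  interpret finite_measure \<rho> by fact
  have "(\<lambda>x. 1) \<in> square_integrable \<rho>" by (simp add: square_integrable_def)
  then show ?thesis using integrable_cnj_mult[OF _ f, of "\<lambda>x. 1"] by simp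
qed


subsection \<open>Separability\<close>

text \<open>The whole space may fail to be second countable. Balls of radius 1 / (n + 1) around
  finite nets for S form a countable family that behaves like a base at the points of S.\<close>

lemma compact_countable_base:
  fixes S :: "'a::metric_space set"
  assumes S: "compact S"
  obtains B where "countable B" "\<And>A. A \<in> B \<Longrightarrow> open A"
    "\<And>U x. \<lbrakk>open U; x \<in> U; x \<in> S\<rbrakk> \<Longrightarrow> \<exists>A\<in>B. x \<in> A \<and> A \<subseteq> U"
proof -
  have "\<exists>Q. finite Q \<and> S \<subseteq> (\<Union>q\<in>Q. ball q (1 / Suc n))" for n
  proof -
    have "S \<subseteq> (\<Union>q\<in>S. ball q (1 / Suc n))" by auto
    then obtain Q where "Q \<subseteq> S" "finite Q" "S \<subseteq> (\<Union>q\<in>Q. ball q (1 / Suc n))"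
      using compactE_image[OF S, of S "\<lambda>q. ball q (1 / Suc n)"] by auto
    then show ?thesis by blast
  qed
  then obtain Q where Q: "\<And>n. finite (Q n)" "\<And>n. S \<subseteq> (\<Union>q\<in>Q n. ball q (1 / Suc n))" by metis
  define B where "B = (\<Union>n. (\<lambda>q. ball q (1 / Suc n)) ` Q n)"
  have "countable B" unfolding B_def using Q(1) by (intro countable_UN) (auto intro: countable_finite)
  moreover have "open A" if "A \<in> B" for A using that by (auto simp: B_def)
  moreover have "\<exists>A\<in>B. x \<in> A \<and> A \<subseteq> U" if U: "open U" "x \<in> U" "x \<in> S" for U x
  proof -
    obtain e where e: "e > 0" "ball x e \<subseteq> U" using U openE by blast
    obtain n where n: "1 / real (Suc n) < e / 2"
      using reals_Archimedean[of "e / 2"] e(1) by (auto simp: inverse_eq_divide)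
    obtain q where q: "q \<in> Q n" "x \<in> ball q (1 / Suc n)" using Q(2)[of n] U(3) by blast
    have "ball q (1 / Suc n) \<subseteq> ball x e"
    proof
      fix y assume "y \<in> ball q (1 / Suc n)"
      then have "dist x y < 1 / Suc n + 1 / Suc n"
        using q(2) dist_triangle[of x y q] by (simp add: dist_commute)
      then show "y \<in> ball x e" using n by simp
    qed
    then show ?thesis using q e(2) unfolding B_def by blast
  qed
  ultimately show ?thesis by (rule that)
qed

text \<open>Finite intersections of members of B are stable under intersection, with UNIV as the
  empty one, so vanishing integrals spread to the sigma-algebra generated by B. Up to a null set
  every open set is a union of members of B, and a second induction, now over the open sets, reaches
  all Borel sets.\<close>

lemma AE_zero_if_base_integrals_zero:
  fixes f :: "'a::metric_space \<Rightarrow> complex"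
  assumes sets: "sets \<rho> = sets borel" and fin: "finite_measure \<rho>"
    and f: "integrable \<rho> f" and S: "AE x in \<rho>. x \<in> S"
    and B: "countable B" "\<And>A. A \<in> B \<Longrightarrow> open A"
      "\<And>U x. \<lbrakk>open U; x \<in> U; x \<in> S\<rbrakk> \<Longrightarrow> \<exists>A\<in>B. x \<in> A \<and> A \<subseteq> U"
    and zero: "\<And>F. \<lbrakk>finite F; F \<subseteq> B\<rbrakk> \<Longrightarrow> set_lebesgue_integral \<rho> (\<Inter>F) f = 0"
  shows "AE x in \<rho>. f x = 0"
proof -
  interpret finite_measure \<rho> by (rule fin)
  have sp: "space \<rho> = UNIV" using sets_eq_imp_space_eq[OF sets] by simp
  have opn: "open U \<Longrightarrow> U \<in> sets \<rho>" for U by (simp add: sets)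
  define P where "P A \<longleftrightarrow> A \<in> sets \<rho> \<and> set_lebesgue_integral \<rho> A f = 0" for A
  have si: "set_integrable \<rho> A f" if "A \<in> sets \<rho>" for A
    using that f by (auto simp: set_integrable_def intro: integrable_mult_indicator)
  have P_empty: "P {}" by (simp add: P_def set_lebesgue_integral_def)
  have P_compl: "P (UNIV - A)" if A: "P A" and U: "P UNIV" for A
  proof -
    have A': "A \<in> sets \<rho>" using A by (simp add: P_def)
    then have C: "UNIV - A \<in> sets \<rho>" using sets.compl_sets[of A \<rho>] unfolding sp by blast
    have "(LINT x:A \<union> (UNIV - A)|\<rho>. f x) = (LINT x:A|\<rho>. f x) + (LINT x:UNIV - A|\<rho>. f x)"
      by (rule set_integral_Un[OF _ si[OF A'] si[OF C]]) blast
    then show ?thesis using A U C by (simp add: P_def)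
  qed
  have P_Union: "P (\<Union>i. A i)" if d: "disjoint_family A" and A: "\<And>i::nat. P (A i)" for A
  proof -
    have "(LINT x:(\<Union>i. A i)|\<rho>. f x) = (\<Sum>i. (LINT x:A i|\<rho>. f x))"
      using A d by (intro lebesgue_integral_countable_add si)
        (auto simp: P_def disjoint_family_on_def)
    then show ?thesis using A by (auto simp: P_def)
  qed
  define G where "G = {\<Inter>F | F. finite F \<and> F \<subseteq> B}"
  have G_P: "P A" if A: "A \<in> G" for A
  proof -
    obtain F where F: "finite F" "F \<subseteq> B" "A = \<Inter>F" using A unfolding G_def by blast
    have "open (\<Inter>F)" using F(1,2) B(2) by (intro open_Inter) auto
    then show ?thesis unfolding F(3) P_def using zero[OF F(1,2)] opn by simp
  qed
  have "UNIV \<in> G" unfolding G_def by (auto intro!: exI[of _ "{}"])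
  then have PU: "P UNIV" by (rule G_P)
  have stable: "Int_stable G"
  proof (rule Int_stableI)
    fix a b assume "a \<in> G" "b \<in> G"
    then obtain F F' where "finite F" "F \<subseteq> B" "a = \<Inter>F" "finite F'" "F' \<subseteq> B" "b = \<Inter>F'"
      by (auto simp: G_def)
    then show "a \<inter> b \<in> G" unfolding G_def by (intro CollectI exI[of _ "F \<union> F'"]) auto
  qed
  have G_Pow: "G \<subseteq> Pow UNIV" by simp
  have P_G: "P A" if "A \<in> sigma_sets UNIV G" for A
    using stable G_Pow that
  proof (induction rule: sigma_sets_induct_disjoint)
    case (compl A)
    then show ?case using P_compl PU by blast
  next
    case (union A)
    then show ?case using P_Union by blast
  qed (use G_P P_empty in auto)
  have P_open: "P U" if U: "open U" for U
  proof -
    \<comment> \<open>V is a countable union of base sets and agrees with U at all points of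
      S.\<close>
    define V where "V = \<Union>{A \<in> B. A \<subseteq> U}"
    have "{A \<in> B. A \<subseteq> U} \<subseteq> sigma_sets UNIV G"
    proof
      fix A assume "A \<in> {A \<in> B. A \<subseteq> U}"
      then have "A \<in> G" unfolding G_def by (intro CollectI exI[of _ "{A}"]) auto
      then show "A \<in> sigma_sets UNIV G" by (rule sigma_sets.Basic)
    qed
    then have "V \<in> sigma_sets UNIV G"
      unfolding V_def using B(1) by (intro sigma_sets_UNION) auto
    then have V: "P V" by (rule P_G)
    have "AE x in \<rho>. indicator U x *\<^sub>R f x = indicator V x *\<^sub>R f x"
      using S
    proof eventually_elim
      case (elim x)
      have "x \<in> V \<longleftrightarrow> x \<in> U" using B(3)[OF U _ elim] by (auto simp: V_def)
      then show ?case by (simp add: indicator_def)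
    qed
    moreover have "f \<in> borel_measurable \<rho>" using f by simp
    ultimately have "set_lebesgue_integral \<rho> U f = set_lebesgue_integral \<rho> V f"
      unfolding set_lebesgue_integral_def using V opn[OF U]
      by (intro integral_cong_AE) (auto simp: P_def)
    then show ?thesis using V opn[OF U] by (simp add: P_def)
  qed
  have "P A" if A: "A \<in> sets \<rho>" for A
  proof -
    have "Int_stable {U::'a set. open U}" by (intro Int_stableI) auto
    moreover have "{U::'a set. open U} \<subseteq> Pow UNIV" by simp
    moreover have "A \<in> sigma_sets UNIV {U. open U}" using A sets by (simp add: borel_def)
    ultimately show ?thesis
    proof (induction rule: sigma_sets_induct_disjoint)
      case (compl A)
      then show ?case using P_compl PU by blast
    next
      case (union A)
      then show ?case using P_Union by blast
    qed (use P_open P_empty in auto)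
  qed
  then show ?thesis using density_zero[OF f] by (auto simp: P_def)
qed

text \<open>A nonzero vector of L^2 pairs nontrivially with the indicator of some finite
  intersection of base sets. There are countably many of these, and by Bessel's inequality each
  pairs nontrivially with only countably many members of E.\<close>

lemma countable_orthonormal_L2:
  fixes \<rho> :: "'a::metric_space measure"
  assumes sets: "sets \<rho> = sets borel" and fin: "finite_measure \<rho>"
    and supp: "compactly_supported \<rho>" and E: "orthonormal (L2 \<rho>) E (\<lambda>e. e)"
  shows "countable E"
proof -
  interpret complex_inner_space "L2 \<rho>" by (rule complex_inner_space_L2)
  interpret finite_measure \<rho> by (rule fin)
  obtain S where S: "compact S" "AE x in \<rho>. x \<in> S" using supp by (auto simp: compactly_supported_def)
  obtain B :: "'a set set" where B: "countable B" "\<And>A. A \<in> B \<Longrightarrow> open A"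
    "\<And>U x. \<lbrakk>open U; x \<in> U; x \<in> S\<rbrakk> \<Longrightarrow> \<exists>A\<in>B. x \<in> A \<and> A \<subseteq> U"
    by (rule compact_countable_base[OF S(1)]) blast
  define I where "I F = l2_class \<rho> (indicator (\<Inter>F) :: 'a \<Rightarrow> complex)" for F
  have ind: "(indicator (\<Inter>F) :: 'a \<Rightarrow> complex) \<in> square_integrable \<rho>" if F: "finite F" "F \<subseteq> B" for F
  proof -
    have "open (\<Inter>F)" using F B(2) by (intro open_Inter) auto
    then have "\<Inter>F \<in> sets \<rho>" by (simp add: sets)
    moreover have "(\<lambda>x. (cmod (indicator (\<Inter>F) x :: complex))\<^sup>2) = indicator (\<Inter>F)"
      by (auto simp: indicator_def)
    ultimately show ?thesis by (simp add: square_integrable_def less_top[symmetric])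
  qed
  have sub: "E \<subseteq> (\<Union>F\<in>{F. finite F \<and> F \<subseteq> B}. {e \<in> E. (cmod (cinner (L2 \<rho>) e (I F)))\<^sup>2 \<noteq> 0})"
  proof
    fix e assume e: "e \<in> E"
    have ec: "e \<in> carrier (L2 \<rho>)" by (rule orthonormalD(1)[OF E e])
    show "e \<in> (\<Union>F\<in>{F. finite F \<and> F \<subseteq> B}. {e \<in> E. (cmod (cinner (L2 \<rho>) e (I F)))\<^sup>2 \<noteq> 0})"
    proof (rule ccontr)
      assume "\<not> ?thesis"
      then have z: "cinner (L2 \<rho>) e (I F) = 0" if "finite F" "F \<subseteq> B" for F using e that by auto
      obtain f where f: "f \<in> square_integrable \<rho>" "e = l2_class \<rho> f" using ec by (rule L2_cases)
      have "AE x in \<rho>. f x = 0"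
      proof (rule AE_zero_if_base_integrals_zero[OF sets fin _ S(2) B])
        show "integrable \<rho> f" by (rule square_integrable_imp_integrable_finite[OF fin f(1)])
        show "set_lebesgue_integral \<rho> (\<Inter>F) f = 0" if F: "finite F" "F \<subseteq> B" for F
        proof -
          have "cinner (L2 \<rho>) (I F) e = 0"
            using z[OF F] cinner_commute[of "I F" e] ec ind[OF F] by (simp add: I_def)
          then have "(LINT x|\<rho>. cnj (indicator (\<Inter>F) x) * f x) = 0"
            using f ind[OF F] by (simp add: I_def L2_cinner)
          moreover have "cnj (indicator (\<Inter>F) x) * f x = indicator (\<Inter>F) x *\<^sub>R f x" for x
            by (auto simp: indicator_def)
          ultimately show ?thesis by (simp add: set_lebesgue_integral_def)
        qed
      qed auto
      then have "e = \<zero>\<^bsub>L2 \<rho>\<^esub>" using f by (simp add: L2_zero l2_class_eq_iff)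
      then show False using orthonormalD(4)[OF E e e] ec by simp
    qed
  qed
  have "countable {F. finite F \<and> F \<subseteq> B}" by (rule countable_Collect_finite_subset[OF B(1)])
  moreover have "countable {e \<in> E. (cmod (cinner (L2 \<rho>) e (I F)))\<^sup>2 \<noteq> 0}"
    if "F \<in> {F. finite F \<and> F \<subseteq> B}" for F
    using that ind[of F] bessel_summable[OF E, of "I F"]
    by (intro summable_countable_real) (auto simp: I_def)
  ultimately show ?thesis using sub by (intro countable_subset[OF sub] countable_UN) auto
qed

section \<open>Symmetrizable kernels\<close>

lemma continuous_kernel:
  fixes w :: "'a::metric_space \<Rightarrow> 'a \<Rightarrow> real"
  assumes "continuous_on UNIV (\<lambda>(x, x'). w x x')" "continuous_on UNIV d" "\<And>x. 0 < d x"
  shows "continuous_on UNIV (\<lambda>(x, x'). w x x' / d x')"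
proof -
  have "continuous_on UNIV (\<lambda>p. d (snd p))"
    by (rule continuous_on_compose2[OF assms(2) continuous_on_snd[OF continuous_on_id]]) simp
  then have "continuous_on UNIV (\<lambda>p. (case p of (x, x') \<Rightarrow> w x x') / d (snd p))"
    using assms(1,3) less_imp_neq[OF assms(3)] by (intro continuous_on_divide) (auto simp: less_le)
  then show ?thesis by (simp add: split_beta)
qed

text \<open>With \<open>u a = (a - 1) / (a + 1)\<close> one has \<open>1 / (a + b) = 2 / ((a + 1) (b + 1)) * (\<Sum>n. (u a * u b) ^ n)\<close>,
  so \<open>1 / (d x + d y)\<close> is a limit of sums of products \<open>v x * v y\<close>. Since
  \<open>k x y = (w x y + w y x) / (d x + d y)\<close>, this exhibits the quadratic form of \<open>k\<close> as a series of
  values of the quadratic form of \<open>w\<close>.\<close>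

lemma positive_definite_symmetrized:
  fixes w :: "'a \<Rightarrow> 'a \<Rightarrow> real"
  assumes w: "positive_definite w" and d: "\<And>x. 0 < d x" and sym: "\<And>x y. d x * w x y = d y * w y x"
  shows "positive_definite (\<lambda>x y. w x y / d y)"
  unfolding positive_definite_def
proof (intro allI)
  fix m :: nat and x :: "nat \<Rightarrow> 'a" and a :: "nat \<Rightarrow> real"
  \<comment> \<open>The map t -> (t - 1) / (t + 1) takes positive numbers into the open interval
    from -1 to 1, so the geometric series in u i * u j converges.\<close>
  define u where "u i = (d (x i) - 1) / (d (x i) + 1)" for i
  define c where "c i = a i / (d (x i) + 1)" for i
  have u1: "\<bar>u i\<bar> < 1" for i
    using d[of "x i"] by (simp add: u_def abs_if divide_less_eq less_divide_eq)
  have geo: "(\<lambda>n. c i * c j * (w (x i) (x j) + w (x j) (x i)) * 2 * (u i * u j) ^ n) sums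
      (a i * a j * (w (x i) (x j) / d (x j)))" for i j
  proof -
    let ?p = "d (x i)" and ?q = "d (x j)"
    have pq: "?p > 0" "?q > 0" using d by auto
    have "\<bar>u i * u j\<bar> < 1"
      using mult_strict_mono'[OF u1[of i] u1[of j]] by (simp add: abs_mult)
    then have "(\<lambda>n. (u i * u j) ^ n) sums (1 / (1 - u i * u j))" by (intro geometric_sums) simp
    then have s: "(\<lambda>n. c i * c j * (w (x i) (x j) + w (x j) (x i)) * 2 * (u i * u j) ^ n) sums
        (c i * c j * (w (x i) (x j) + w (x j) (x i)) * 2 * (1 / (1 - u i * u j)))"
      by (rule sums_mult)
    have "1 - u i * u j = 2 * (?p + ?q) / ((?p + 1) * (?q + 1))"
      using pq by (simp add: u_def divide_simps) (simp add: algebra_simps)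
    then have inv: "1 / (1 - u i * u j) = (?p + 1) * (?q + 1) / (2 * (?p + ?q))" by simp
    have A: "c i * c j * 2 * (1 / (1 - u i * u j)) = a i * a j / (?p + ?q)"
      unfolding inv c_def using pq by (simp add: divide_simps)
    \<comment> \<open>The symmetry hypothesis expresses w (x j) (x i) through w (x i) (x j), after
      which d (x i) + d (x j) cancels.\<close>
    have B: "(w (x i) (x j) + w (x j) (x i)) / (?p + ?q) = w (x i) (x j) / ?q"
    proof -
      have "w (x j) (x i) = ?p * w (x i) (x j) / ?q"
        using sym[of "x i" "x j"] pq by (simp add: field_simps)
      then show ?thesis using pq by (simp add: divide_simps) (simp add: algebra_simps)
    qed
    have "c i * c j * (w (x i) (x j) + w (x j) (x i)) * 2 * (1 / (1 - u i * u j)) =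
        (c i * c j * 2 * (1 / (1 - u i * u j))) * (w (x i) (x j) + w (x j) (x i))"
      by (simp only: mult_ac)
    also have "\<dots> = a i * a j * ((w (x i) (x j) + w (x j) (x i)) / (?p + ?q))"
      unfolding A by simp
    also have "\<dots> = a i * a j * (w (x i) (x j) / ?q)" unfolding B by (rule refl)
    finally show ?thesis using s by metis
  qed
  have lim: "(\<lambda>n. \<Sum>i<m. \<Sum>j<m. c i * c j * (w (x i) (x j) + w (x j) (x i)) * 2 * (u i * u j) ^ n) sums
      (\<Sum>i<m. \<Sum>j<m. a i * a j * (w (x i) (x j) / d (x j)))"
    by (intro sums_sum geo)
  have pos: "0 \<le> (\<Sum>i<m. \<Sum>j<m. c i * c j * (w (x i) (x j) + w (x j) (x i)) * 2 * (u i * u j) ^ n)"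
    for n
  proof -
    let ?b = "\<lambda>i. c i * u i ^ n"
    let ?Q = "\<Sum>i<m. \<Sum>j<m. ?b i * ?b j * w (x i) (x j)"
    have "(\<Sum>i<m. \<Sum>j<m. c i * c j * (w (x i) (x j) + w (x j) (x i)) * 2 * (u i * u j) ^ n) =
        (\<Sum>i<m. \<Sum>j<m. 2 * (?b i * ?b j * w (x i) (x j)) + 2 * (?b j * ?b i * w (x j) (x i)))"
      by (intro sum.cong refl) (simp add: power_mult_distrib algebra_simps)
    also have "\<dots> = 2 * ?Q + 2 * (\<Sum>i<m. \<Sum>j<m. ?b j * ?b i * w (x j) (x i))"
      by (simp add: sum.distrib sum_distrib_left)
    also have "(\<Sum>i<m. \<Sum>j<m. ?b j * ?b i * w (x j) (x i)) = ?Q" by (rule sum.swap)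
    finally show ?thesis
      using w[unfolded positive_definite_def, rule_format, where a = ?b and x = x and m = m] by simp
  qed
  show "0 \<le> (\<Sum>i<m. \<Sum>j<m. a i * a j * (w (x i) (x j) / d (x j)))"
    using sums_le[OF pos sums_zero lim] .
qed

text \<open>For real w the mixed products of real and imaginary parts of the coefficients contribute
  only to the imaginary part of the form, which may be nonzero when w is not symmetric; hence the
  real part in the statement.\<close>

lemma complex_form_nonneg:
  assumes w: "positive_definite w"
  shows "0 \<le> Re (\<Sum>i<n::nat. \<Sum>j<n. cnj (a i) * a j * of_real (w (p i) (p j)))"
proof -
  have "Re (\<Sum>i<n. \<Sum>j<n. cnj (a i) * a j * of_real (w (p i) (p j))) =
      (\<Sum>i<n. \<Sum>j<n. Re (a i) * Re (a j) * w (p i) (p j)) +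
      (\<Sum>i<n. \<Sum>j<n. Im (a i) * Im (a j) * w (p i) (p j))"
    by (simp add: sum.distrib[symmetric] algebra_simps)
  then show ?thesis
    using w[unfolded positive_definite_def, rule_format, where a = "\<lambda>i. Re (a i)" and x = p and m = n]
      w[unfolded positive_definite_def, rule_format, where a = "\<lambda>i. Im (a i)" and x = p and m = n]
    by simp
qed

text \<open>Each value g x is the Riesz representative of v -> <x, f v>; inserting v = g x shows
  that g obeys the same bound as f.\<close>

lemma (in hilbert_pair) adjoint_exists:
  assumes f: "bounded_map V U f"
  obtains g where "bounded_map U V g"
    "\<forall>x\<in>carrier U. \<forall>v\<in>carrier V. cinner U x (f v) = cinner V (g x) v"
proof -
  obtain C where C: "C \<ge> 0" "\<forall>x\<in>carrier V. cnorm U (f x) \<le> C * cnorm V x"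
    by (rule bounded_map_bound[OF f])
  note fc = bounded_mapD(1)[OF f]
  have "\<exists>u. u \<in> carrier V \<and> (\<forall>v\<in>carrier V. cinner U x (f v) = cinner V u v)"
    if x: "x \<in> carrier U" for x
  proof -
    have bound: "cmod (cinner U x (f v)) \<le> cnorm U x * C * cnorm V v" if v: "v \<in> carrier V" for v
    proof -
      have "cmod (cinner U x (f v)) \<le> cnorm U x * cnorm U (f v)"
        by (rule U.cauchy_schwarz[OF x fc[OF v]])
      also have "\<dots> \<le> cnorm U x * (C * cnorm V v)" using C(2) v x by (intro mult_left_mono) auto
      finally show ?thesis by simp
    qed
    obtain u where "u \<in> carrier V" "\<forall>v\<in>carrier V. cinner U x (f v) = cinner V u v"
    proof (rule V.riesz_bounded[of "\<lambda>v. cinner U x (f v)" "cnorm U x * C"])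
      show "cinner U x (f (v \<oplus>\<^bsub>V\<^esub> v')) = cinner U x (f v) + cinner U x (f v')"
        if "v \<in> carrier V" "v' \<in> carrier V" for v v'
        using that x fc by (simp add: bounded_mapD(2)[OF f] U.cinner_add_right)
      show "cinner U x (f (c \<odot>\<^bsub>V\<^esub> v)) = c * cinner U x (f v)" if "v \<in> carrier V" for c v
        using that x fc by (simp add: bounded_mapD(3)[OF f] U.cinner_smult_right)
      show "cmod (cinner U x (f v)) \<le> cnorm U x * C * cnorm V v" if "v \<in> carrier V" for v
        by (rule bound[OF that])
    qed (rule that; assumption)
    then show ?thesis by blast
  qed
  then obtain g where g: "\<And>x. x \<in> carrier U \<Longrightarrow> g x \<in> carrier V"
    "\<And>x v. \<lbrakk>x \<in> carrier U; v \<in> carrier V\<rbrakk> \<Longrightarrow> cinner U x (f v) = cinner V (g x) v"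
    by metis
  have ext: "y = z" if "y \<in> carrier V" "z \<in> carrier V"
    "\<And>v. v \<in> carrier V \<Longrightarrow> cinner V y v = cinner V z v" for y z
  proof (rule V.cinner_ext[OF that(1,2)])
    fix v assume v: "v \<in> carrier V"
    then show "cinner V v y = cinner V v z"
      using that(3)[OF v] V.cinner_commute[OF v that(1)] V.cinner_commute[OF v that(2)] by simp
  qed
  have "bounded_map U V g"
    unfolding bounded_map_def
  proof (intro conjI ballI allI)
    show "g \<in> carrier U \<rightarrow> carrier V" using g(1) by blast
    show "g (x \<oplus>\<^bsub>U\<^esub> y) = g x \<oplus>\<^bsub>V\<^esub> g y" if "x \<in> carrier U" "y \<in> carrier U" for x y
      using that g(1) fc by (intro ext) (simp_all add: V.cinner_add_left U.cinner_add_left flip: g(2))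
    show "g (c \<odot>\<^bsub>U\<^esub> x) = c \<odot>\<^bsub>V\<^esub> g x" if "x \<in> carrier U" for c x
      using that g(1) fc by (intro ext) (simp_all add: V.cinner_smult_left U.cinner_smult_left flip: g(2))
    have "cnorm V (g x) \<le> C * cnorm U x" if x: "x \<in> carrier U" for x
    proof -
      have "(cnorm V (g x))\<^sup>2 = Re (cinner U x (f (g x)))"
        using g x by (simp add: V.cnorm_sq)
      also have "\<dots> \<le> cmod (cinner U x (f (g x)))" by (rule complex_Re_le_cmod)
      also have "\<dots> \<le> cnorm U x * cnorm U (f (g x))" using x g(1) fc by (intro U.cauchy_schwarz) auto
      also have "\<dots> \<le> cnorm U x * (C * cnorm V (g x))"
        using C(2) x g(1) by (intro mult_left_mono) auto
      finally have "cnorm V (g x) * cnorm V (g x) \<le> (C * cnorm U x) * cnorm V (g x)"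
        by (simp add: power2_eq_square mult_ac)
      moreover have "0 \<le> C * cnorm U x" using C(1) x by simp
      ultimately show ?thesis
        using V.cnorm_nonneg[OF g(1)[OF x]] mult_right_le_imp_le[of "cnorm V (g x)" "cnorm V (g x)"]
        by (cases "cnorm V (g x) = 0") auto
    qed
    then show "\<exists>C. \<forall>x\<in>carrier U. cnorm V (g x) \<le> C * cnorm U x" by blast
  qed
  then show ?thesis using that g(2) by blast
qed

section \<open>Kernels and compactly supported measures\<close>

locale kernel_setting =
  fixes w :: "'a::metric_space \<Rightarrow> 'a \<Rightarrow> real" and d :: "'a \<Rightarrow> real" and k :: "'a \<Rightarrow> 'a \<Rightarrow> real"
    and \<rho> :: "'a measure" and K :: "('a \<Rightarrow> complex) inner_space"
  assumes w_cont: "continuous_on UNIV (\<lambda>(x, x'). w x x')"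
    and w_pd: "positive_definite w"
    and d_cont: "continuous_on UNIV d"
    and d_pos: "\<And>x. 0 < d x"
    and d_w: "\<And>x x'. d x * w x x' = d x' * w x' x"
    and k_eq: "\<And>x x'. k x x' = w x x' / d x'"
    and sets_rho: "sets \<rho> = sets borel"
    and fin: "finite_measure \<rho>"
    and supp: "compactly_supported \<rho>"
    and rkhs: "is_rkhs k K"
begin

sublocale finite_measure \<rho> by (rule fin)
sublocale K: complex_hilbert_space K using rkhs by (simp add: is_rkhs_def)
sublocale L: complex_hilbert_space "L2 \<rho>" by (rule complex_hilbert_space_L2[OF fin])
sublocale KL: hilbert_pair K "L2 \<rho>" ..

lemma k_cont: "continuous_on UNIV (\<lambda>(x, x'). k x x')"
  unfolding k_eq by (rule continuous_kernel[OF w_cont d_cont d_pos])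

lemma k_sym: "k x x' = k x' x"
  using d_w[of x x'] d_pos[of x] d_pos[of x'] by (simp add: k_eq field_simps)

lemma k_d: "k x y * d y = w x y"
  using d_pos[of y] by (simp add: k_eq)

lemma continuous_section:
  fixes v :: "'a \<Rightarrow> 'a \<Rightarrow> real"
  assumes "continuous_on UNIV (\<lambda>(x, x'). v x x')"
  shows "continuous_on UNIV (v x)"
proof -
  have "continuous_on UNIV (\<lambda>y. (\<lambda>(x, x'). v x x') (x, y))"
    by (rule continuous_on_compose2[OF assms]) (auto intro!: continuous_intros)
  then show ?thesis by simp
qed

lemma measurable_continuous:
  fixes g :: "'a \<Rightarrow> 'b::topological_space"
  assumes "continuous_on UNIV g"
  shows "g \<in> borel_measurable \<rho>"
  using borel_measurable_continuous_onI[OF assms] by (simp add: measurable_cong_sets[OF sets_rho refl])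

definition S where "S = (SOME S. compact S \<and> (AE x in \<rho>. x \<in> S))"

lemma S: "compact S" "AE x in \<rho>. x \<in> S"
proof -
  have "compact S \<and> (AE x in \<rho>. x \<in> S)"
    unfolding S_def using supp unfolding compactly_supported_def by (rule someI_ex)
  then show "compact S" "AE x in \<rho>. x \<in> S" by auto
qed

lemma AE_bounded_continuous:
  fixes g :: "'a \<Rightarrow> 'b::real_normed_vector"
  assumes "continuous_on UNIV g"
  obtains B where "AE x in \<rho>. norm (g x) \<le> B"
proof -
  have "compact (g ` S)"
    using S(1) continuous_on_subset[OF assms] by (intro compact_continuous_image) auto
  then obtain B where "\<forall>y\<in>g ` S. norm y \<le> B" using compact_imp_bounded bounded_iff by metis
  have "AE x in \<rho>. norm (g x) \<le> B"
    using S(2) by eventually_elim (use \<open>\<forall>y\<in>g ` S. norm y \<le> B\<close> in blast)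
  then show ?thesis by (rule that)
qed

lemma integrable_continuous:
  fixes g :: "'a \<Rightarrow> 'b::{banach, second_countable_topology}"
  assumes "continuous_on UNIV g"
  shows "integrable \<rho> g"
proof -
  obtain B where "AE x in \<rho>. norm (g x) \<le> B" by (rule AE_bounded_continuous[OF assms])
  then show ?thesis by (rule integrable_const_bound) (rule measurable_continuous[OF assms])
qed

lemma square_integrable_continuous:
  "continuous_on UNIV g \<Longrightarrow> g \<in> square_integrable \<rho>"
  unfolding square_integrable_def
  by (intro CollectI conjI measurable_continuous integrable_continuous continuous_intros)

lemma square_integrable_continuous_mult:
  assumes g: "continuous_on UNIV g" and f: "f \<in> square_integrable \<rho>"
  shows "(\<lambda>x. complex_of_real (g x) * f x) \<in> square_integrable \<rho>"
proof -
  have c: "continuous_on UNIV (\<lambda>x. complex_of_real (g x))" using g by (intro continuous_intros)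
  obtain B where "AE x in \<rho>. cmod (complex_of_real (g x)) \<le> B" by (rule AE_bounded_continuous[OF c])
  then show ?thesis
    by (rule square_integrable_bounded_mult[OF f measurable_continuous[OF c]])
qed

lemma integrable_continuous_mult:
  assumes g: "continuous_on UNIV g" and f: "f \<in> square_integrable \<rho>"
  shows "integrable \<rho> (\<lambda>x. complex_of_real (g x) * f x)"
  by (rule square_integrable_imp_integrable_finite[OF fin square_integrable_continuous_mult[OF g f]])


subsection \<open>The inclusion of the reproducing kernel Hilbert space\<close>

definition kx where "kx x = (\<lambda>y. complex_of_real (k y x))"

lemma kx_carrier [simp]: "kx x \<in> carrier K"
  using rkhs by (simp add: is_rkhs_def kx_def)

lemma reproducing: "f \<in> carrier K \<Longrightarrow> cinner K (kx x) f = f x"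
  using rkhs by (simp add: is_rkhs_def kx_def)

lemma K_add: "\<lbrakk>f \<in> carrier K; g \<in> carrier K\<rbrakk> \<Longrightarrow> f \<oplus>\<^bsub>K\<^esub> g = (\<lambda>x. f x + g x)"
  and K_smult: "f \<in> carrier K \<Longrightarrow> c \<odot>\<^bsub>K\<^esub> f = (\<lambda>x. c * f x)"
  using rkhs by (simp_all add: is_rkhs_def)

lemma kx_inner: "cinner K (kx x) (kx y) = of_real (k x y)"
  using reproducing[OF kx_carrier, of x y] by (simp add: kx_def)

lemma kx_norm: "(cnorm K (kx x))\<^sup>2 = k x x"
  by (simp add: K.cnorm_sq kx_inner)

text \<open>By the reproducing property f y - f x = <kx y - kx x, f>, and the squared norm of kx y -
  kx x is k y y + k x x - 2 k y x, which tends to 0. Continuity makes members of K measurable and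
  bounded on S, so that the inclusion into L^2 makes sense.\<close>

lemma continuous_K:
  assumes f: "f \<in> carrier K"
  shows "continuous_on UNIV f"
  unfolding continuous_on_def
proof
  fix x
  let ?h = "\<lambda>y. sqrt (k y y + k x x - 2 * k y x) * cnorm K f"
  have kc: "isCont (\<lambda>(x, x'). k x x') p" for p
    using k_cont continuous_on_eq_continuous_at[OF open_UNIV] by blast
  have "((\<lambda>y. (\<lambda>(x, x'). k x x') (y, y)) \<longlongrightarrow> (\<lambda>(x, x'). k x x') (x, x)) (at x)"
    by (rule isCont_tendsto_compose[OF kc]) (intro tendsto_intros)
  moreover have "((\<lambda>y. (\<lambda>(x, x'). k x x') (y, x)) \<longlongrightarrow> (\<lambda>(x, x'). k x x') (x, x)) (at x)"
    by (rule isCont_tendsto_compose[OF kc]) (intro tendsto_intros)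
  ultimately have "(?h \<longlongrightarrow> sqrt (k x x + k x x - 2 * k x x) * cnorm K f) (at x)"
    by (intro tendsto_intros) auto
  then have lim: "(?h \<longlongrightarrow> 0) (at x)" by simp
  have "((\<lambda>y. f y - f x) \<longlongrightarrow> 0) (at x)"
  proof (rule Lim_null_comparison[OF _ lim], rule always_eventually, rule allI)
    fix y
    have "(cnorm K (kx y \<ominus>\<^bsub>K\<^esub> kx x))\<^sup>2 = k y y + k x x - 2 * k y x"
      by (simp add: K.cnorm_sq_diff kx_norm kx_inner)
    then have n: "cnorm K (kx y \<ominus>\<^bsub>K\<^esub> kx x) = sqrt (k y y + k x x - 2 * k y x)"
      by (metis K.cnorm_nonneg K.minus_closed kx_carrier real_sqrt_unique)
    have "f y - f x = cinner K (kx y \<ominus>\<^bsub>K\<^esub> kx x) f"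
      using f by (simp add: K.cinner_diff_left reproducing)
    then show "norm (f y - f x) \<le> ?h y"
      using K.cauchy_schwarz[of "kx y \<ominus>\<^bsub>K\<^esub> kx x" f] f n by simp
  qed
  then show "(f \<longlongrightarrow> f x) (at x within UNIV)" by (simp add: LIM_zero_iff)
qed

lemma square_integrable_K [simp]: "f \<in> carrier K \<Longrightarrow> f \<in> square_integrable \<rho>"
  by (intro square_integrable_continuous continuous_K)

lemma continuous_diagonal: "continuous_on UNIV (\<lambda>x. k x x)"
proof -
  have "continuous_on UNIV (\<lambda>x. (\<lambda>(x, x'). k x x') (x, x))"
    by (rule continuous_on_compose2[OF k_cont]) (auto intro!: continuous_intros)
  then show ?thesis by simp
qed

lemma pointwise_bound:
  assumes f: "f \<in> carrier K"
  shows "(cmod (f x))\<^sup>2 \<le> k x x * (cnorm K f)\<^sup>2"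
proof -
  have "cmod (f x) \<le> cnorm K (kx x) * cnorm K f"
    using K.cauchy_schwarz[OF kx_carrier f, of x] f by (simp add: reproducing)
  then have "(cmod (f x))\<^sup>2 \<le> (cnorm K (kx x) * cnorm K f)\<^sup>2" by (intro power_mono) auto
  then show ?thesis by (simp add: power_mult_distrib kx_norm)
qed

lemma bounded_inclusion: "bounded_map K (L2 \<rho>) (l2_class \<rho>)"
  unfolding bounded_map_def
proof (intro conjI ballI allI)
  show "l2_class \<rho> \<in> carrier K \<rightarrow> carrier (L2 \<rho>)" by auto
  show "l2_class \<rho> (f \<oplus>\<^bsub>K\<^esub> g) = l2_class \<rho> f \<oplus>\<^bsub>L2 \<rho>\<^esub> l2_class \<rho> g"
    if "f \<in> carrier K" "g \<in> carrier K" for f g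
    using that by (simp add: K_add L2_add)
  show "l2_class \<rho> (c \<odot>\<^bsub>K\<^esub> f) = c \<odot>\<^bsub>L2 \<rho>\<^esub> l2_class \<rho> f" if "f \<in> carrier K" for c f
    using that by (simp add: K_smult L2_smult)
  let ?C = "LINT x|\<rho>. k x x"
  have "cnorm (L2 \<rho>) (l2_class \<rho> f) \<le> sqrt ?C * cnorm K f" if f: "f \<in> carrier K" for f
  proof -
    have "(cnorm (L2 \<rho>) (l2_class \<rho> f))\<^sup>2 = (LINT x|\<rho>. (cmod (f x))\<^sup>2)"
      using f by (simp add: L2_cnorm_sq)
    also have "\<dots> \<le> (LINT x|\<rho>. k x x * (cnorm K f)\<^sup>2)"
      using pointwise_bound[OF f] square_integrableD(2)[OF square_integrable_K[OF f]]
        integrable_continuous[OF continuous_diagonal]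
      by (intro integral_mono) auto
    also have "\<dots> = ?C * (cnorm K f)\<^sup>2" by simp
    finally have le: "(cnorm (L2 \<rho>) (l2_class \<rho> f))\<^sup>2 \<le> ?C * (cnorm K f)\<^sup>2" .
    have "0 \<le> k x x" for x using zero_le_power2[of "cnorm K (kx x)"] by (simp only: kx_norm)
    then have "0 \<le> ?C" by (rule Bochner_Integration.integral_nonneg)
    then have "(cnorm (L2 \<rho>) (l2_class \<rho> f))\<^sup>2 \<le> (sqrt ?C * cnorm K f)\<^sup>2"
      using le by (simp add: power_mult_distrib)
    then show ?thesis
      by (rule power2_le_imp_le) (use f \<open>0 \<le> ?C\<close> in simp)
  qed
  then show "\<exists>C. \<forall>f\<in>carrier K. cnorm (L2 \<rho>) (l2_class \<rho> f) \<le> C * cnorm K f" by blast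
qed

text \<open>Since b x = <kx x, b>, the pointwise bound by k x x is Bessel's inequality for the
  vector kx x.\<close>

lemma inclusion_trace_bound:
  assumes B: "finite B" "orthonormal K B (\<lambda>b. b)"
  shows "(\<Sum>b\<in>B. (cnorm (L2 \<rho>) (l2_class \<rho> b))\<^sup>2) \<le> (LINT x|\<rho>. k x x)"
proof -
  have Bc: "b \<in> carrier K" if "b \<in> B" for b using orthonormalD(1)[OF B(2) that] .
  have int: "integrable \<rho> (\<lambda>x. (cmod (b x))\<^sup>2)" if "b \<in> B" for b
    using square_integrableD(2)[OF square_integrable_K[OF Bc[OF that]]] .
  have "(\<Sum>b\<in>B. (cnorm (L2 \<rho>) (l2_class \<rho> b))\<^sup>2) = (\<Sum>b\<in>B. LINT x|\<rho>. (cmod (b x))\<^sup>2)"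
    using Bc by (intro sum.cong refl L2_cnorm_sq) simp
  also have "\<dots> = (LINT x|\<rho>. (\<Sum>b\<in>B. (cmod (b x))\<^sup>2))"
    using int by (intro Bochner_Integration.integral_sum[symmetric]) auto
  also have "\<dots> \<le> (LINT x|\<rho>. k x x)"
  proof (intro integral_mono)
    fix x
    have "(\<Sum>b\<in>B. (cmod (b x))\<^sup>2) = (\<Sum>b\<in>B. (cmod (cinner K b (kx x)))\<^sup>2)"
    proof (intro sum.cong refl)
      fix b assume "b \<in> B"
      then show "(cmod (b x))\<^sup>2 = (cmod (cinner K b (kx x)))\<^sup>2"
        using K.cinner_commute[OF Bc kx_carrier, of b x] Bc by (simp add: reproducing)
    qed
    also have "\<dots> \<le> k x x"
      using K.bessel[OF B(2) B(1) order_refl kx_carrier] by (simp add: kx_norm)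
    finally show "(\<Sum>b\<in>B. (cmod (b x))\<^sup>2) \<le> k x x" .
  qed (use int integrable_continuous[OF continuous_diagonal] in auto)
  finally show ?thesis .
qed

text \<open>The adjoint of the inclusion, obtained abstractly so that its values lie in K from the
  start; the integral formula is derived in \<open>adj_eq_integral\<close>.\<close>

definition adj where
  "adj = (SOME g. bounded_map (L2 \<rho>) K g \<and>
     (\<forall>F\<in>carrier (L2 \<rho>). \<forall>v\<in>carrier K. cinner (L2 \<rho>) F (l2_class \<rho> v) = cinner K (g F) v))"

lemma adj: "bounded_map (L2 \<rho>) K adj"
  "\<lbrakk>F \<in> carrier (L2 \<rho>); v \<in> carrier K\<rbrakk> \<Longrightarrow> cinner (L2 \<rho>) F (l2_class \<rho> v) = cinner K (adj F) v"
proof -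
  obtain g where "bounded_map (L2 \<rho>) K g"
    "\<forall>F\<in>carrier (L2 \<rho>). \<forall>v\<in>carrier K. cinner (L2 \<rho>) F (l2_class \<rho> v) = cinner K (g F) v"
    by (rule KL.adjoint_exists[OF bounded_inclusion])
  then have "\<exists>g. bounded_map (L2 \<rho>) K g \<and>
     (\<forall>F\<in>carrier (L2 \<rho>). \<forall>v\<in>carrier K. cinner (L2 \<rho>) F (l2_class \<rho> v) = cinner K (g F) v)"
    by (intro exI[of _ g] conjI)
  then have "bounded_map (L2 \<rho>) K adj \<and>
     (\<forall>F\<in>carrier (L2 \<rho>). \<forall>v\<in>carrier K. cinner (L2 \<rho>) F (l2_class \<rho> v) = cinner K (adj F) v)"
    unfolding adj_def by (rule someI_ex)
  then show "bounded_map (L2 \<rho>) K adj"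
    "\<lbrakk>F \<in> carrier (L2 \<rho>); v \<in> carrier K\<rbrakk> \<Longrightarrow> cinner (L2 \<rho>) F (l2_class \<rho> v) = cinner K (adj F) v"
    by blast+
qed

text \<open>Evaluation at x is pairing with \<open>kx x\<close>, and the adjoint identity moves this
  pairing to L^2.\<close>

lemma adj_eq_integral:
  assumes f: "f \<in> square_integrable \<rho>"
  shows "adj (l2_class \<rho> f) = (\<lambda>x. LINT y|\<rho>. of_real (k x y) * f y)"
proof
  fix x
  have c: "adj (l2_class \<rho> f) \<in> carrier K" using bounded_mapD(1)[OF adj(1)] f by simp
  have "adj (l2_class \<rho> f) x = cnj (cinner K (adj (l2_class \<rho> f)) (kx x))"
    using reproducing[OF c, of x] K.cinner_commute[OF kx_carrier c, of x] by simp
  also have "\<dots> = cnj (LINT y|\<rho>. cnj (f y) * kx x y)"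
    using f adj(2)[of "l2_class \<rho> f" "kx x"] by (simp add: L2_cinner)
  also have "\<dots> = (LINT y|\<rho>. cnj (cnj (f y) * kx x y))"
    by (rule Bochner_Integration.integral_cnj[symmetric])
  also have "\<dots> = (LINT y|\<rho>. of_real (k x y) * f y)"
    by (intro Bochner_Integration.integral_cong refl) (simp add: kx_def k_sym[of x] mult.commute)
  finally show "adj (l2_class \<rho> f) x = (LINT y|\<rho>. of_real (k x y) * f y)" .
qed

subsection \<open>Integral operators\<close>

lemma l2_mult_class:
  assumes g: "continuous_on UNIV g" and f: "f \<in> square_integrable \<rho>"
  shows "l2_mult \<rho> g (l2_class \<rho> f) = l2_class \<rho> (\<lambda>x. of_real (g x) * f x)"
  unfolding l2_mult_def
  by (rule l2_class_pointwise[OF f square_integrable_continuous_mult[OF g]])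

lemma bounded_l2_mult:
  assumes g: "continuous_on UNIV g"
  shows "bounded_map (L2 \<rho>) (L2 \<rho>) (l2_mult \<rho> g)"
  unfolding bounded_map_def
proof (intro conjI ballI allI)
  note m = l2_mult_class[OF g] square_integrable_continuous_mult[OF g]
  show "l2_mult \<rho> g \<in> carrier (L2 \<rho>) \<rightarrow> carrier (L2 \<rho>)"
    using m by (auto elim!: L2_cases)
  show "l2_mult \<rho> g (F \<oplus>\<^bsub>L2 \<rho>\<^esub> F') = l2_mult \<rho> g F \<oplus>\<^bsub>L2 \<rho>\<^esub> l2_mult \<rho> g F'"
    if FF: "F \<in> carrier (L2 \<rho>)" "F' \<in> carrier (L2 \<rho>)" for F F'
  proof -
    obtain f f' where "f \<in> square_integrable \<rho>" "F = l2_class \<rho> f"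
      "f' \<in> square_integrable \<rho>" "F' = l2_class \<rho> f'" using FF by (metis L2_cases)
    then show ?thesis by (simp add: m L2_add square_integrable_add distrib_left)
  qed
  show "l2_mult \<rho> g (c \<odot>\<^bsub>L2 \<rho>\<^esub> F) = c \<odot>\<^bsub>L2 \<rho>\<^esub> l2_mult \<rho> g F" if F: "F \<in> carrier (L2 \<rho>)" for c F
  proof -
    obtain f where "f \<in> square_integrable \<rho>" "F = l2_class \<rho> f" using F by (rule L2_cases)
    then show ?thesis by (simp add: m L2_smult square_integrable_cmult mult.left_commute)
  qed
  obtain B where B: "AE x in \<rho>. norm (g x) \<le> B" by (rule AE_bounded_continuous[OF g])
  have "cnorm (L2 \<rho>) (l2_mult \<rho> g F) \<le> \<bar>B\<bar> * cnorm (L2 \<rho>) F" if F: "F \<in> carrier (L2 \<rho>)" for F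
  proof -
    obtain f where f: "f \<in> square_integrable \<rho>" "F = l2_class \<rho> f" using F by (rule L2_cases)
    have "(cnorm (L2 \<rho>) (l2_mult \<rho> g F))\<^sup>2 = (LINT x|\<rho>. (cmod (of_real (g x) * f x))\<^sup>2)"
      using f by (simp only: m L2_cnorm_sq)
    also have "\<dots> \<le> (LINT x|\<rho>. B\<^sup>2 * (cmod (f x))\<^sup>2)"
    proof (rule integral_mono_AE)
      show "integrable \<rho> (\<lambda>x. (cmod (of_real (g x) * f x))\<^sup>2)"
        by (rule square_integrableD(2)[OF m(2)[OF f(1)]])
      show "integrable \<rho> (\<lambda>x. B\<^sup>2 * (cmod (f x))\<^sup>2)" using square_integrableD(2)[OF f(1)] by simp
      show "AE x in \<rho>. (cmod (of_real (g x) * f x))\<^sup>2 \<le> B\<^sup>2 * (cmod (f x))\<^sup>2"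
        using B
      proof eventually_elim
        case (elim x)
        then have "(norm (g x))\<^sup>2 \<le> B\<^sup>2" by (intro power_mono) auto
        then show ?case by (simp add: norm_mult power_mult_distrib mult_right_mono)
      qed
    qed
    also have "\<dots> = (\<bar>B\<bar> * cnorm (L2 \<rho>) F)\<^sup>2"
      using f by (simp add: power_mult_distrib L2_cnorm_sq)
    finally show ?thesis by (rule power2_le_imp_le) (use F in simp)
  qed
  then show "\<exists>C. \<forall>F\<in>carrier (L2 \<rho>). cnorm (L2 \<rho>) (l2_mult \<rho> g F) \<le> C * cnorm (L2 \<rho>) F" by blast
qed

lemma l2_mult_sym:
  assumes g: "continuous_on UNIV g" and F: "F \<in> carrier (L2 \<rho>)" and F': "F' \<in> carrier (L2 \<rho>)"
  shows "cinner (L2 \<rho>) F (l2_mult \<rho> g F') = cinner (L2 \<rho>) (l2_mult \<rho> g F) F'"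
proof -
  obtain f f' where "f \<in> square_integrable \<rho>" "F = l2_class \<rho> f"
    "f' \<in> square_integrable \<rho>" "F' = l2_class \<rho> f'" using F F' by (metis L2_cases)
  then show ?thesis
    by (simp add: l2_mult_class[OF g] square_integrable_continuous_mult[OF g] L2_cinner)
      (simp add: mult_ac)
qed

lemma l2_mult_inverse:
  assumes g: "continuous_on UNIV g" and h: "continuous_on UNIV h"
    and gh: "\<And>x. h x * g x = 1" and F: "F \<in> carrier (L2 \<rho>)"
  shows "l2_mult \<rho> h (l2_mult \<rho> g F) = F"
proof -
  obtain f where f: "f \<in> square_integrable \<rho>" "F = l2_class \<rho> f" using F by (rule L2_cases)
  have "of_real (h x) * (of_real (g x) * f x) = f x" for x
    using gh[of x] by (metis mult.assoc mult_1 of_real_1 of_real_mult)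
  then show ?thesis
    using f
    by (simp only: l2_mult_class[OF g] l2_mult_class[OF h] square_integrable_continuous_mult[OF g])
qed

lemma integral_op_class:
  assumes \<kappa>: "\<And>x. continuous_on UNIV (\<kappa> x)" and f: "f \<in> square_integrable \<rho>"
  shows "integral_op \<rho> \<kappa> (l2_class \<rho> f) = Some (\<lambda>x. LINT y|\<rho>. of_real (\<kappa> x y) * f y)"
proof -
  have "(LINT y|\<rho>. of_real (\<kappa> x y) * f' y) = (LINT y|\<rho>. of_real (\<kappa> x y) * f y)"
    if f': "f' \<in> l2_class \<rho> f" for f' x
  proof -
    have *: "f' \<in> square_integrable \<rho>" "AE y in \<rho>. f y = f' y" using f' mem_l2_class[OF f] by auto
    show ?thesis
    proof (rule integral_cong_AE)
      show "AE y in \<rho>. of_real (\<kappa> x y) * f' y = of_real (\<kappa> x y) * f y"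
        using *(2) by eventually_elim simp
    qed (use integrable_continuous_mult[OF \<kappa>] f * in \<open>blast intro: borel_measurable_integrable\<close>)+
  qed
  then have "(\<Union>f'\<in>l2_class \<rho> f. {\<lambda>x. LINT y|\<rho>. of_real (\<kappa> x y) * f' y}) =
      {\<lambda>x. LINT y|\<rho>. of_real (\<kappa> x y) * f y}"
    by (intro UN_constant_on[OF self_in_l2_class[OF f]]) auto
  then show ?thesis using f by (simp add: integral_op_def)
qed

lemma w_section: "continuous_on UNIV (w x)"
  by (rule continuous_section[OF w_cont])

text \<open>w x y = k x y * d y, so integrating against w is \<open>adj\<close> applied to d f; this
  is why W has values in K.\<close>

lemma adj_d:
  assumes f: "f \<in> square_integrable \<rho>"
  shows "adj (l2_class \<rho> (\<lambda>x. of_real (d x) * f x)) = (\<lambda>x. LINT y|\<rho>. of_real (w x y) * f y)"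
proof -
  have "of_real (k x y) * (of_real (d y) * f y) = of_real (w x y) * f y" for x y
    by (metis k_d mult.assoc of_real_mult)
  then show ?thesis
    using adj_eq_integral[OF square_integrable_continuous_mult[OF d_cont f]] by (simp only:)
qed

lemma adj_d_in_K:
  "f \<in> square_integrable \<rho> \<Longrightarrow> (\<lambda>x. LINT y|\<rho>. of_real (w x y) * f y) \<in> carrier K"
  using bounded_mapD(1)[OF adj(1), of "l2_class \<rho> (\<lambda>x. of_real (d x) * f x)"]
    square_integrable_continuous_mult[OF d_cont, of f]
  by (simp add: adj_d)

text \<open>The integrated quadratic form is a limit of finite quadratic forms: \<open>w\<close> is uniformly
  continuous on \<open>S \<times> S\<close>, so it may be frozen on the cells of a fine partition of \<open>S\<close>.\<close>

lemma integral_form_approximation: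
  assumes f: "f \<in> square_integrable \<rho>" and \<epsilon>: "\<epsilon> > 0"
  shows "- (\<epsilon> * (LINT x|\<rho>. cmod (f x))\<^sup>2) \<le>
    Re (LINT x|\<rho>. cnj (f x) * (LINT y|\<rho>. of_real (w x y) * f y))"
proof -
  have fi: "integrable \<rho> f" by (rule square_integrable_imp_integrable_finite[OF fin f])
  define N1 where "N1 = (LINT x|\<rho>. cmod (f x))"
  define g where "g x = (LINT y|\<rho>. of_real (w x y) * f y)" for x
  have gSI: "g \<in> square_integrable \<rho>" unfolding g_def by (rule square_integrable_K[OF adj_d_in_K[OF f]])
  have "uniformly_continuous_on (S \<times> S) (\<lambda>(x, y). w x y)"
    using S(1) by (intro compact_uniformly_continuous continuous_on_subset[OF w_cont] compact_Times) auto
  then obtain \<delta> where \<delta>: "\<delta> > 0" "\<And>p q. \<lbrakk>p \<in> S \<times> S; q \<in> S \<times> S; dist q p < \<delta>\<rbrakk> \<Longrightarrow>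
      dist ((\<lambda>(x, y). w x y) q) ((\<lambda>(x, y). w x y) p) < \<epsilon>"
    using \<epsilon> unfolding uniformly_continuous_on_def by metis
  have "S \<subseteq> (\<Union>q\<in>S. ball q (\<delta> / 2))" using \<delta>(1) by auto
  then obtain Q where Q: "Q \<subseteq> S" "finite Q" "S \<subseteq> (\<Union>q\<in>Q. ball q (\<delta> / 2))"
    using compactE_image[OF S(1), of S "\<lambda>q. ball q (\<delta> / 2)"] by auto
  obtain n and p :: "nat \<Rightarrow> 'a" where np: "Q = p ` {i. i < n}"
    using iffD1[OF finite_conv_nat_seg_image Q(2)] by blast
  have pS: "p i \<in> S" if "i < n" for i using that np Q(1) by auto
  \<comment> \<open>Removing the earlier balls makes the cells disjoint; a point of S lies in the
    cell of the first ball that contains it.\<close>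
  define B where "B i = ball (p i) (\<delta> / 2) - (\<Union>j<i. ball (p j) (\<delta> / 2))" for i
  have Bs: "B i \<in> sets \<rho>" for i unfolding B_def by (simp add: sets_rho)
  have Bdisj: "i = j" if "x \<in> B i" "x \<in> B j" for x i j
    using that unfolding B_def by (cases i j rule: linorder_cases) auto
  have Bcover: "\<exists>i<n. x \<in> B i" if x: "x \<in> S" for x
  proof -
    obtain i where i: "i < n" "x \<in> ball (p i) (\<delta> / 2)" using Q(3) x np by auto
    define i0 where "i0 = (LEAST i. x \<in> ball (p i) (\<delta> / 2))"
    have "x \<in> ball (p i0) (\<delta> / 2)" "i0 \<le> i"
      unfolding i0_def using i(2) by (auto intro: LeastI Least_le)
    moreover have "x \<notin> ball (p j) (\<delta> / 2)" if "j < i0" for j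
      using not_less_Least[OF that[unfolded i0_def]] .
    ultimately show ?thesis using i(1) unfolding B_def by (intro exI[of _ i0]) auto
  qed
  have near: "\<bar>w x y - w (p i) (p j)\<bar> \<le> \<epsilon>" if "x \<in> S" "y \<in> S" "x \<in> B i" "y \<in> B j" "i < n" "j < n"
    for x y i j
  proof -
    have "dist (x, y) (p i, p j) \<le> dist x (p i) + dist y (p j)"
      by (simp add: dist_Pair_Pair sqrt_sum_squares_le_sum)
    also have "\<dots> < \<delta>" using that(3,4) by (simp add: B_def dist_commute)
    finally have "dist ((\<lambda>(x, y). w x y) (x, y)) ((\<lambda>(x, y). w x y) (p i, p j)) < \<epsilon>"
      using that pS by (intro \<delta>(2)) auto
    then show ?thesis by (simp add: dist_real_def)
  qed
  \<comment> \<open>a i is the integral of f over a cell; gs is W f with w frozen at the centres in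
    both arguments, hence constant on each cell. The pairing of f with gs is the finite form of w
    with coefficients a.\<close>
  define a where "a i = (LINT y|\<rho>. indicator (B i) y *\<^sub>R f y)" for i
  define c where "c i = (\<Sum>j<n. complex_of_real (w (p i) (p j)) * a j)" for i
  define gs where "gs x = (\<Sum>i<n. indicator (B i) x *\<^sub>R c i)" for x
  have ind: "integrable \<rho> (\<lambda>y. indicator (B i) y *\<^sub>R f y)" for i
    by (rule integrable_mult_indicator[OF Bs fi])
  have step: "(\<Sum>i<n. indicator (B i) x *\<^sub>R v i) = v j"
    if "x \<in> B j" "j < n" for x j and v :: "nat \<Rightarrow> complex"
  proof -
    have "(\<Sum>i<n. indicator (B i) x *\<^sub>R v i) = (\<Sum>i<n. if i = j then v i else 0)"
      using that Bdisj by (intro sum.cong refl) (auto simp: indicator_def)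
    then show ?thesis using that by simp
  qed
  \<comment> \<open>Freezing changes w by at most \<epsilon>, hence the inner integral by at most
    \<epsilon> times the L^1 norm N1 of f.\<close>
  have err: "cmod (g x - gs x) \<le> \<epsilon> * N1" if x: "x \<in> S" for x
  proof -
    obtain i where i: "i < n" "x \<in> B i" using Bcover[OF x] by blast
    let ?u = "\<lambda>y. \<Sum>j<n. complex_of_real (w (p i) (p j)) * (indicator (B j) y *\<^sub>R f y)"
    have ui: "integrable \<rho> ?u"
      using ind by (intro Bochner_Integration.integrable_sum integrable_mult_right)
    have wi: "integrable \<rho> (\<lambda>y. of_real (w x y) * f y)" by (rule integrable_continuous_mult[OF w_section f])
    have "gs x = c i" unfolding gs_def by (rule step[OF i(2,1)])
    also have "\<dots> = (LINT y|\<rho>. ?u y)"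
      unfolding c_def a_def using ind by (simp del: mult_scaleR_right)
    finally have "g x - gs x = (LINT y|\<rho>. of_real (w x y) * f y - ?u y)"
      unfolding g_def using ui wi by simp
    also have "cmod \<dots> \<le> (LINT y|\<rho>. cmod (of_real (w x y) * f y - ?u y))"
      by (rule integral_norm_bound)
    also have "\<dots> \<le> (LINT y|\<rho>. \<epsilon> * cmod (f y))"
    proof (rule integral_mono_AE)
      show "integrable \<rho> (\<lambda>y. cmod (of_real (w x y) * f y - ?u y))"
        by (intro integrable_norm Bochner_Integration.integrable_diff wi ui)
      show "integrable \<rho> (\<lambda>y. \<epsilon> * cmod (f y))" using fi by simp
      show "AE y in \<rho>. cmod (of_real (w x y) * f y - ?u y) \<le> \<epsilon> * cmod (f y)"
        using S(2)
      proof eventually_elim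
        case (elim y)
        obtain j where j: "j < n" "y \<in> B j" using Bcover[OF elim] by blast
        have "?u y = (\<Sum>j<n. indicator (B j) y *\<^sub>R (complex_of_real (w (p i) (p j)) * f y))"
          by (intro sum.cong refl) (simp add: scaleR_conv_of_real mult_ac)
        also have "\<dots> = complex_of_real (w (p i) (p j)) * f y" by (rule step[OF j(2,1)])
        finally have "of_real (w x y) * f y - ?u y = of_real (w x y - w (p i) (p j)) * f y"
          by (simp add: algebra_simps)
        then have "cmod (of_real (w x y) * f y - ?u y) = \<bar>w x y - w (p i) (p j)\<bar> * cmod (f y)"
          by (simp only: norm_mult norm_of_real)
        also have "\<dots> \<le> \<epsilon> * cmod (f y)"
          by (intro mult_right_mono near[OF x elim i(2) j(2) i(1) j(1)]) simp
        finally show ?case .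
      qed
    qed
    also have "\<dots> = \<epsilon> * N1" by (simp add: N1_def)
    finally show ?thesis .
  qed
  have fg: "integrable \<rho> (\<lambda>x. cnj (f x) * g x)" by (rule integrable_cnj_mult[OF f gSI])
  have indc: "integrable \<rho> (\<lambda>x. indicator (B i) x *\<^sub>R cnj (f x))" for i
    by (rule integrable_mult_indicator[OF Bs]) (use fi in simp)
  have fgs_eq: "cnj (f x) * gs x = (\<Sum>i<n. c i * (indicator (B i) x *\<^sub>R cnj (f x)))" for x
    unfolding gs_def sum_distrib_left by (intro sum.cong refl) (simp add: scaleR_conv_of_real mult_ac)
  have fgs: "integrable \<rho> (\<lambda>x. cnj (f x) * gs x)"
    unfolding fgs_eq using indc by (intro Bochner_Integration.integrable_sum integrable_mult_right)
  have a_cnj: "(LINT x|\<rho>. indicator (B i) x *\<^sub>R cnj (f x)) = cnj (a i)" for i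
  proof -
    have "(LINT x|\<rho>. indicator (B i) x *\<^sub>R cnj (f x)) = (LINT x|\<rho>. cnj (indicator (B i) x *\<^sub>R f x))"
      by (simp only: complex_cnj_scaleR)
    then show ?thesis unfolding a_def by (simp only: Bochner_Integration.integral_cnj)
  qed
  have "(LINT x|\<rho>. cnj (f x) * gs x) = (\<Sum>i<n. c i * cnj (a i))"
    unfolding fgs_eq using indc by (simp add: a_cnj del: mult_scaleR_right)
  also have "\<dots> = (\<Sum>i<n. \<Sum>j<n. cnj (a i) * a j * of_real (w (p i) (p j)))"
    unfolding c_def sum_distrib_right by (intro sum.cong refl) (simp add: mult_ac)
  finally have pos: "0 \<le> Re (LINT x|\<rho>. cnj (f x) * gs x)"
    using complex_form_nonneg[OF w_pd, where a = a and p = p and n = n] by simp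
  have "cmod ((LINT x|\<rho>. cnj (f x) * g x) - (LINT x|\<rho>. cnj (f x) * gs x)) =
      cmod (LINT x|\<rho>. cnj (f x) * g x - cnj (f x) * gs x)"
    using fg fgs by simp
  also have "\<dots> \<le> (LINT x|\<rho>. cmod (cnj (f x) * g x - cnj (f x) * gs x))"
    by (rule integral_norm_bound)
  also have "\<dots> \<le> (LINT x|\<rho>. cmod (f x) * (\<epsilon> * N1))"
  proof (rule integral_mono_AE)
    show "integrable \<rho> (\<lambda>x. cmod (cnj (f x) * g x - cnj (f x) * gs x))"
      by (intro integrable_norm Bochner_Integration.integrable_diff fg fgs)
    show "integrable \<rho> (\<lambda>x. cmod (f x) * (\<epsilon> * N1))" using fi by simp
    show "AE x in \<rho>. cmod (cnj (f x) * g x - cnj (f x) * gs x) \<le> cmod (f x) * (\<epsilon> * N1)"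
      using S(2)
    proof eventually_elim
      case (elim x)
      have "cmod (cnj (f x) * g x - cnj (f x) * gs x) = cmod (f x) * cmod (g x - gs x)"
        by (simp add: norm_mult flip: right_diff_distrib)
      then show ?case using err[OF elim] by (simp add: mult_left_mono)
    qed
  qed
  also have "\<dots> = \<epsilon> * N1\<^sup>2" by (simp add: N1_def power2_eq_square)
  finally have "cmod ((LINT x|\<rho>. cnj (f x) * gs x) - (LINT x|\<rho>. cnj (f x) * g x)) \<le> \<epsilon> * N1\<^sup>2"
    by (simp add: norm_minus_commute)
  then have "Re (LINT x|\<rho>. cnj (f x) * gs x) - Re (LINT x|\<rho>. cnj (f x) * g x) \<le> \<epsilon> * N1\<^sup>2"
    using complex_Re_le_cmod[of "(LINT x|\<rho>. cnj (f x) * gs x) - (LINT x|\<rho>. cnj (f x) * g x)"]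
    by simp
  then show ?thesis using pos by (simp add: N1_def g_def)
qed

lemma integral_form_nonneg:
  assumes f: "f \<in> square_integrable \<rho>"
  shows "0 \<le> Re (LINT x|\<rho>. cnj (f x) * (LINT y|\<rho>. of_real (w x y) * f y))" (is "0 \<le> ?r")
proof (rule ccontr)
  let ?N = "(LINT x|\<rho>. cmod (f x))\<^sup>2"
  assume "\<not> 0 \<le> ?r"
  then have r: "?r < 0" by simp
  have N: "0 \<le> ?N" by simp
  \<comment> \<open>With this value as \<epsilon>, the product of \<epsilon> and ?N is less than -
    ?r, against the approximation; ?N + 1 keeps the denominator positive.\<close>
  have "- ?r / (?N + 1) > 0" using r N by (intro divide_pos_pos) linarith+
  from integral_form_approximation[OF f this] have "?r / (?N + 1) * ?N \<le> ?r" by simp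
  moreover have "?r / (?N + 1) * ?N > ?r"
  proof -
    have "a < a / (b + 1) * b" if "a < 0" "0 \<le> b" for a b :: real
      using that by (simp add: pos_less_divide_eq algebra_simps)
    then show ?thesis using r N by blast
  qed
  ultimately show False by simp
qed

section \<open>The concrete operators as an instance of the abstract ones\<close>

abbreviation (input) "sqrt_mult \<equiv> l2_mult \<rho> (\<lambda>x. d x powr (1 / 2))"
abbreviation (input) "inv_sqrt_mult \<equiv> l2_mult \<rho> (\<lambda>x. d x powr (- 1 / 2))"

lemma continuous_d_powr: "continuous_on UNIV (\<lambda>x. d x powr a)"
  using d_cont d_pos by (intro continuous_on_powr continuous_on_const) (auto simp: less_le)

lemma d_powr_inverse: "d x powr (- 1 / 2) * d x powr (1 / 2) = 1"
    "d x powr (1 / 2) * d x powr (- 1 / 2) = 1"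
  using d_pos[of x] by (simp_all flip: powr_add)

lemma sqrt_mult_twice:
  assumes f: "f \<in> square_integrable \<rho>"
  shows "sqrt_mult (sqrt_mult (l2_class \<rho> f)) = l2_class \<rho> (\<lambda>x. of_real (d x) * f x)"
proof -
  note c = continuous_d_powr
  have "of_real (d x powr (1 / 2)) * (of_real (d x powr (1 / 2)) * f x) = of_real (d x) * f x" for x
  proof -
    have "d x powr (1 / 2) * d x powr (1 / 2) = d x" using d_pos[of x] by (simp flip: powr_add)
    then show ?thesis by (metis mult.assoc of_real_mult)
  qed
  then show ?thesis
    using f by (simp only: l2_mult_class[OF c] square_integrable_continuous_mult[OF c])
qed

sublocale N: nystrom "L2 \<rho>" K "l2_class \<rho>" adj sqrt_mult inv_sqrt_mult "LINT x|\<rho>. k x x"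
proof
  note c = continuous_d_powr
  show "bounded_map K (L2 \<rho>) (l2_class \<rho>)" by (rule bounded_inclusion)
  show "bounded_map (L2 \<rho>) K adj" by (rule adj(1))
  show "bounded_map (L2 \<rho>) (L2 \<rho>) sqrt_mult" "bounded_map (L2 \<rho>) (L2 \<rho>) inv_sqrt_mult"
    by (rule bounded_l2_mult[OF c])+
  show "cinner (L2 \<rho>) F (l2_class \<rho> g) = cinner K (adj F) g"
    if "F \<in> carrier (L2 \<rho>)" "g \<in> carrier K" for F g
    by (rule adj(2)[OF that])
  show "cinner (L2 \<rho>) F (sqrt_mult F') = cinner (L2 \<rho>) (sqrt_mult F) F'"
    if "F \<in> carrier (L2 \<rho>)" "F' \<in> carrier (L2 \<rho>)" for F F'
    by (rule l2_mult_sym[OF c that])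
  show "inv_sqrt_mult (sqrt_mult F) = F" "sqrt_mult (inv_sqrt_mult F) = F"
    if "F \<in> carrier (L2 \<rho>)" for F
    by (rule l2_mult_inverse[OF c c d_powr_inverse(1) that],
        rule l2_mult_inverse[OF c c d_powr_inverse(2) that])
  show "(\<Sum>b\<in>B. (cnorm (L2 \<rho>) (l2_class \<rho> b))\<^sup>2) \<le> (LINT x|\<rho>. k x x)"
    if "finite B" "orthonormal K B (\<lambda>b. b)" for B
    by (rule inclusion_trace_bound[OF that])
  show "0 \<le> Re (cinner (L2 \<rho>) F (l2_class \<rho> (adj (sqrt_mult (sqrt_mult F)))))"
    if F: "F \<in> carrier (L2 \<rho>)" for F
  proof -
    obtain f where f: "f \<in> square_integrable \<rho>" "F = l2_class \<rho> f" using F by (rule L2_cases)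
    then show ?thesis
      using integral_form_nonneg[OF f(1)] square_integrable_K[OF adj_d_in_K[OF f(1)]]
      by (simp add: sqrt_mult_twice adj_d L2_cinner)
  qed
  show "countable E" if "orthonormal (L2 \<rho>) E (\<lambda>e. e)" for E
    by (rule countable_orthonormal_L2[OF sets_rho fin supp that])
qed

lemma W_class:
  "f \<in> square_integrable \<rho> \<Longrightarrow> N.W (l2_class \<rho> f) = (\<lambda>x. LINT y|\<rho>. of_real (w x y) * f y)"
  by (simp add: N.W_def sqrt_mult_twice adj_d)

lemma inclusion_op_eq: "inclusion_op \<rho> K = opmap K (l2_class \<rho>)"
  by (simp add: fun_eq_iff inclusion_op_def opmap_def)

lemma integral_op_eq: "integral_op \<rho> w = opmap (L2 \<rho>) N.W"
proof
  fix F
  show "integral_op \<rho> w F = opmap (L2 \<rho>) N.W F"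
  proof (cases "F \<in> carrier (L2 \<rho>)")
    case True
    then obtain f where f: "f \<in> square_integrable \<rho>" "F = l2_class \<rho> f" by (rule L2_cases)
    then show ?thesis using integral_op_class[OF w_section f(1)] W_class by simp
  qed (simp add: integral_op_def opmap_def)
qed

lemma J_eq: "inclusion_op \<rho> K \<circ>\<^sub>m integral_op \<rho> w = opmap (L2 \<rho>) N.J"
proof -
  have "N.W \<in> carrier (L2 \<rho>) \<rightarrow> carrier K" using bounded_mapD(1)[OF N.bounded_W] by blast
  from opmap_comp[OF this, of "l2_class \<rho>"] show ?thesis
    unfolding inclusion_op_eq integral_op_eq by (simp add: N.J_def[abs_def])
qed

text \<open>The factor sqrt (d x) leaves the integral over y and the other one is absorbed into f,
  which is the factorisation of \<open>N.H\<close>. Since d is positive, \<open>sqrt\<close> agrees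
  with the power 1 / 2.\<close>

lemma Khat_eq:
  "l2_integral_op \<rho> (\<lambda>x x'. sqrt (d x) * k x x' * sqrt (d x')) = opmap (L2 \<rho>) N.H"
proof
  fix F
  let ?\<kappa> = "\<lambda>x x'. sqrt (d x) * k x x' * sqrt (d x')"
  have s: "sqrt (d x) = d x powr (1 / 2)" for x using d_pos[of x] by (simp add: powr_half_sqrt)
  note c = continuous_d_powr
  show "l2_integral_op \<rho> ?\<kappa> F = opmap (L2 \<rho>) N.H F"
  proof (cases "F \<in> carrier (L2 \<rho>)")
    case True
    then obtain f where f: "f \<in> square_integrable \<rho>" "F = l2_class \<rho> f" by (rule L2_cases)
    let ?h = "\<lambda>y. of_real (d y powr (1 / 2)) * f y"
    have h: "?h \<in> square_integrable \<rho>" by (rule square_integrable_continuous_mult[OF c f(1)])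
    have kc: "continuous_on UNIV (?\<kappa> x)" for x
      by (intro continuous_intros continuous_section[OF k_cont] d_cont)
    have eq: "(LINT y|\<rho>. of_real (?\<kappa> x y) * f y) =
        of_real (d x powr (1 / 2)) * (LINT y|\<rho>. of_real (k x y) * ?h y)" for x
    proof -
      have "(LINT y|\<rho>. of_real (?\<kappa> x y) * f y) =
          (LINT y|\<rho>. of_real (d x powr (1 / 2)) * (of_real (k x y) * ?h y))"
        by (intro Bochner_Integration.integral_cong refl) (simp add: s mult_ac)
      then show ?thesis by (simp only: integral_mult_right_zero)
    qed
    have "adj (l2_class \<rho> ?h) \<in> carrier K" using bounded_mapD(1)[OF adj(1)] h by simp
    then have "N.H F = l2_class \<rho> (\<lambda>x. of_real (d x powr (1 / 2)) *
        (LINT y|\<rho>. of_real (k x y) * ?h y))"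
      using f h by (simp add: N.H_def l2_mult_class[OF c] adj_eq_integral)
    moreover have "integral_op \<rho> ?\<kappa> F = Some (\<lambda>x. of_real (d x powr (1 / 2)) *
        (LINT y|\<rho>. of_real (k x y) * ?h y))"
      using integral_op_class[of ?\<kappa>, OF kc f(1)] unfolding f(2) eq .
    ultimately show ?thesis using True by (simp add: l2_integral_op_def)
  qed (simp add: l2_integral_op_def integral_op_def opmap_def)
qed

lemma eigenfunctions_H:
  assumes "eigenfunctions (L2 \<rho>) (opmap (L2 \<rho>) N.H) I \<eta> \<phi>"
  shows "\<forall>i\<in>I. N.H (\<phi> i) = of_real (\<eta> i) \<odot>\<^bsub>L2 \<rho>\<^esub> \<phi> i"
  using assms by (auto simp: eigenfunctions_def opmap_def split: if_splits)

text \<open>The eigenbasis \<phi> is arbitrary rather than the one produced by the spectral theorem,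
  because the expansion is claimed for every orthonormal basis of eigenfunctions with the listed
  eigenvalues.\<close>

lemma nystrom_expansion:
  fixes I :: "nat set" and \<eta> :: "nat \<Rightarrow> real"
  defines "\<xi> \<equiv> \<lambda>\<phi> i. inv_sqrt_mult (\<phi> i)" and "\<xi>' \<equiv> \<lambda>\<phi> i. sqrt_mult (\<phi> i)"
  defines "\<theta> \<equiv> \<lambda>\<phi> i. of_real (1 / sqrt (\<eta> i)) \<odot>\<^bsub>K\<^esub> the (opmap (L2 \<rho>) N.W (\<xi> \<phi> i))"
  assumes basis: "orthonormal_basis (L2 \<rho>) (carrier (L2 \<rho>)) I \<phi>"
    and eigen: "eigenfunctions (L2 \<rho>) (opmap (L2 \<rho>) N.H) I \<eta> \<phi>"
    and nonneg: "\<forall>i\<in>I. 0 \<le> \<eta> i"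
  shows "dual_eigenbases (L2 \<rho>) (opmap (L2 \<rho>) N.J) I \<eta> (\<xi> \<phi>) (\<xi>' \<phi>)"
    and "\<forall>i\<in>{i \<in> I. 0 < \<eta> i}. \<theta> \<phi> i \<in> carrier K"
    and "\<forall>i\<in>{i \<in> I. 0 < \<eta> i}. \<forall>j\<in>{i \<in> I. 0 < \<eta> i}. i \<noteq> j \<longrightarrow> cinner K (\<theta> \<phi> i) (\<theta> \<phi> j) = 0"
    and "\<forall>f\<in>dom (pinv K (L2 \<rho>) (opmap K (l2_class \<rho>))). has_sum_in K
      (\<lambda>i. (cinner (L2 \<rho>) (\<xi>' \<phi> i) f / of_real (sqrt (\<eta> i))) \<odot>\<^bsub>K\<^esub> \<theta> \<phi> i) {i \<in> I. 0 < \<eta> i}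
      (the (pinv K (L2 \<rho>) (opmap K (l2_class \<rho>)) f))"
proof -
  note H = eigenfunctions_H[OF eigen]
  have \<theta>: "\<theta> \<phi> i = N.theta \<eta> \<phi> i" if i: "i \<in> I" for i
  proof -
    have "inv_sqrt_mult (\<phi> i) \<in> carrier (L2 \<rho>)"
      using N.phi_carrier[OF basis H i] by (rule bounded_mapD(1)[OF N.isq])
    then show ?thesis by (simp only: \<theta>_def \<xi>_def N.theta_def[OF basis H] opmap_apply option.sel)
  qed
  show "dual_eigenbases (L2 \<rho>) (opmap (L2 \<rho>) N.J) I \<eta> (\<xi> \<phi>) (\<xi>' \<phi>)"
    unfolding \<xi>_def \<xi>'_def by (rule N.dual_eigenbases_xi[OF basis H])
  show "\<forall>i\<in>{i \<in> I. 0 < \<eta> i}. \<theta> \<phi> i \<in> carrier K"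
    using N.theta_carrier[OF basis H] \<theta> by simp
  show "\<forall>i\<in>{i \<in> I. 0 < \<eta> i}. \<forall>j\<in>{i \<in> I. 0 < \<eta> i}. i \<noteq> j \<longrightarrow> cinner K (\<theta> \<phi> i) (\<theta> \<phi> j) = 0"
  proof (intro ballI impI)
    fix i j assume ij: "i \<in> {i \<in> I. 0 < \<eta> i}" "j \<in> {i \<in> I. 0 < \<eta> i}" "i \<noteq> j"
    then show "cinner K (\<theta> \<phi> i) (\<theta> \<phi> j) = 0"
      using orthonormalD(4)[OF N.theta_orthonormal[OF basis H] ij(1,2)] \<theta> by simp
  qed
  show "\<forall>f\<in>dom (pinv K (L2 \<rho>) (opmap K (l2_class \<rho>))). has_sum_in K
      (\<lambda>i. (cinner (L2 \<rho>) (\<xi>' \<phi> i) f / of_real (sqrt (\<eta> i))) \<odot>\<^bsub>K\<^esub> \<theta> \<phi> i) {i \<in> I. 0 < \<eta> i}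
      (the (pinv K (L2 \<rho>) (opmap K (l2_class \<rho>)) f))"
  proof
    fix f assume "f \<in> dom (pinv K (L2 \<rho>) (opmap K (l2_class \<rho>)))"
    then obtain g where g: "pinv K (L2 \<rho>) (opmap K (l2_class \<rho>)) f = Some g" by auto
    have "has_sum_in K
      (\<lambda>i. (cinner (L2 \<rho>) (sqrt_mult (\<phi> i)) f / of_real (sqrt (\<eta> i))) \<odot>\<^bsub>K\<^esub> N.theta \<eta> \<phi> i)
      {i \<in> I. 0 < \<eta> i} g"
      by (rule N.pinv_inc_expansion[OF basis H nonneg g])
    then show "has_sum_in K
      (\<lambda>i. (cinner (L2 \<rho>) (\<xi>' \<phi> i) f / of_real (sqrt (\<eta> i))) \<odot>\<^bsub>K\<^esub> \<theta> \<phi> i) {i \<in> I. 0 < \<eta> i}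
      (the (pinv K (L2 \<rho>) (opmap K (l2_class \<rho>)) f))"
      unfolding g option.sel
      by (rule iffD2[OF K.has_sum_in_cong, rotated 2])
        (use \<theta> N.theta_carrier[OF basis H] in \<open>auto simp: \<xi>'_def\<close>)
  qed
qed

end

theorem proposition16:
  fixes w :: "'a::metric_space \<Rightarrow> 'a \<Rightarrow> real" and d :: "'a \<Rightarrow> real"
  assumes "continuous_on UNIV (\<lambda>(x, x'). w x x')"
    and "positive_definite w"
    and "continuous_on UNIV d"
    and "\<And>x. 0 < d x"
    and "\<And>x x'. d x * w x x' = d x' * w x' x"
  defines "k \<equiv> \<lambda>x x'. w x x' / d x'"
  shows
    "continuous_on UNIV (\<lambda>(x, x'). k x x') \<and>
     (\<forall>x x'. k x x' = k x' x) \<and>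
     positive_definite k \<and>
     (\<forall>(\<rho> :: 'a measure) K.
        sets \<rho> = sets borel \<and> finite_measure \<rho> \<and> compactly_supported \<rho> \<and> is_rkhs k K \<longrightarrow>
        (let L = L2 \<rho>;
             \<iota> = inclusion_op \<rho> K;
             T = pinv K L \<iota>;
             W = integral_op \<rho> w;
             J = \<iota> \<circ>\<^sub>m W;
             J\<^sub>p = pinv L L J;
             Khat = l2_integral_op \<rho> (\<lambda>x x'. sqrt (d x) * k x x' * sqrt (d x'))
         in
           (\<forall>f\<in>square_integrable \<rho>.
              (\<forall>x. integrable \<rho> (\<lambda>y. of_real (w x y) * f y)) \<and>
              W (l2_class \<rho> f) = Some (\<lambda>x. LINT y|\<rho>. of_real (w x y) * f y)) \<and>
           bounded_operator L K W \<and>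
           trace_class L J \<and>
           (\<exists>I \<eta>. eigenvalue_sequence I \<eta> \<and> lists_eigenvalues L J I \<eta> \<and>
              (\<exists>\<xi> \<xi>'. dual_eigenbases L J I \<eta> \<xi> \<xi>') \<and>
              submodule (dom J\<^sub>p) complex_ring L \<and>
              dom J\<^sub>p \<subseteq> dom T \<and> dom T \<subseteq> norm_topology L closure_of dom J\<^sub>p \<and>
              T |` dom J\<^sub>p = W \<circ>\<^sub>m J\<^sub>p \<and>
              bounded_operator L L Khat \<and> adjoint_op L L Khat = Khat \<and>
              (\<exists>\<phi>. orthonormal_basis L (carrier L) I \<phi> \<and> eigenfunctions L Khat I \<eta> \<phi>) \<and>
              (\<forall>\<phi>. orthonormal_basis L (carrier L) I \<phi> \<and> eigenfunctions L Khat I \<eta> \<phi> \<longrightarrow>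
                 (let \<xi> = (\<lambda>i. l2_mult \<rho> (\<lambda>x. d x powr (- 1 / 2)) (\<phi> i));
                      \<xi>' = (\<lambda>i. l2_mult \<rho> (\<lambda>x. d x powr (1 / 2)) (\<phi> i));
                      \<theta> = (\<lambda>i. of_real (1 / sqrt (\<eta> i)) \<odot>\<^bsub>K\<^esub> the (W (\<xi> i)));
                      I\<^sub>p = {i \<in> I. 0 < \<eta> i}
                  in
                    dual_eigenbases L J I \<eta> \<xi> \<xi>' \<and>
                    (\<forall>i\<in>I\<^sub>p. \<theta> i \<in> carrier K) \<and>
                    (\<forall>i\<in>I\<^sub>p. \<forall>j\<in>I\<^sub>p. i \<noteq> j \<longrightarrow> cinner K (\<theta> i) (\<theta> j) = 0) \<and>
                    (\<forall>f\<in>dom T.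
                       has_sum_in K
                         (\<lambda>i. (cinner L (\<xi>' i) f / of_real (sqrt (\<eta> i))) \<odot>\<^bsub>K\<^esub> \<theta> i)
                         I\<^sub>p (the (T f))))))))"
proof -
  \<comment> \<open>Matching against the goal names the hypotheses and the conclusion for a given
    measure and space, so that the long conclusion is not restated.\<close>
  let "_ \<and> _ \<and> _ \<and> (\<forall>\<rho> K. ?hyp \<rho> K \<longrightarrow> ?concl \<rho> K)" = ?thesis
  have "?concl \<rho> K" if "?hyp \<rho> K" for \<rho> :: "'a measure" and K
  proof -
    have \<rho>: "sets \<rho> = sets borel" "finite_measure \<rho>" "compactly_supported \<rho>" "is_rkhs k K" using that by auto
    have k_eq: "k x x' = w x x' / d x'" for x x' by (simp add: k_def)
    interpret kernel_setting w d k \<rho> K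
      by (rule kernel_setting.intro[OF assms(1-5) k_eq \<rho>])
    obtain I \<eta> \<phi> where spec: "eigenvalue_sequence I \<eta>"
      "orthonormal_basis (L2 \<rho>) (carrier (L2 \<rho>)) I \<phi>"
      "\<forall>i\<in>I. N.H (\<phi> i) = of_real (\<eta> i) \<odot>\<^bsub>L2 \<rho>\<^esub> \<phi> i"
      by (rule N.H_spectral)
    have nonneg: "\<forall>i\<in>I. 0 \<le> \<eta> i" using spec(1) by (simp add: eigenvalue_sequence_def)
    have phi_ne: "\<phi> i \<noteq> \<zero>\<^bsub>L2 \<rho>\<^esub>" if i: "i \<in> I" for i
      using L.orthonormal_cnorm[OF N.phi_on[OF spec(2,3)] i] by auto
    have phi: "eigenfunctions (L2 \<rho>) (opmap (L2 \<rho>) N.H) I \<eta> \<phi>"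
      unfolding eigenfunctions_def using spec(3) N.phi_carrier[OF spec(2,3)] phi_ne by simp
    note expansion = nystrom_expansion[OF _ _ nonneg]
    have W: "\<forall>f\<in>square_integrable \<rho>. (\<forall>x. integrable \<rho> (\<lambda>y. of_real (w x y) * f y)) \<and>
        opmap (L2 \<rho>) N.W (l2_class \<rho> f) = Some (\<lambda>x. LINT y|\<rho>. of_real (w x y) * f y)"
      using integrable_continuous_mult[OF w_section] W_class by simp
    show "?concl \<rho> K"
      unfolding Let_def J_eq Khat_eq unfolding inclusion_op_eq integral_op_eq
    proof (intro conjI exI[of _ I] exI[of _ \<eta>] allI impI)
      show "\<exists>\<xi> \<xi>'. dual_eigenbases (L2 \<rho>) (opmap (L2 \<rho>) N.J) I \<eta> \<xi> \<xi>'"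
        using N.dual_eigenbases_xi[OF spec(2,3)] by blast
      show "\<exists>\<phi>. orthonormal_basis (L2 \<rho>) (carrier (L2 \<rho>)) I \<phi> \<and>
          eigenfunctions (L2 \<rho>) (opmap (L2 \<rho>) N.H) I \<eta> \<phi>"
        using spec(2) phi by blast
      \<comment> \<open>The domain of the pseudoinverse of J is dense in all of L^2, hence its
        closure contains the domain of the Nystroem operator.\<close>
      show "dom (pinv K (L2 \<rho>) (opmap K (l2_class \<rho>))) \<subseteq>
          norm_topology (L2 \<rho>) closure_of dom (pinv (L2 \<rho>) (L2 \<rho>) (opmap (L2 \<rho>) N.J))"
        unfolding N.dom_pinv_J_dense using KL.dom_pseudo_submodule[OF bounded_inclusion]
        by (simp add: KL.pinv_eq_pseudo[OF bounded_inclusion] L.subspaceD(1))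
    qed (rule W spec(1) N.LK.bounded_operator_opmap[OF N.bounded_W] N.trace_class_J
        N.lists_eigenvalues_J[OF spec(2,3)] N.dom_pinv_J_submodule N.dom_pinv_J_subset
        N.pinv_inc_restrict N.LL.bounded_operator_opmap[OF N.bounded_H] N.adjoint_H
      | (elim conjE, rule expansion; assumption))+
  qed
  moreover have "continuous_on UNIV (\<lambda>(x, x'). k x x')"
    unfolding k_def by (rule continuous_kernel[OF assms(1,3,4)])
  moreover have "k x x' = k x' x" for x x'
    using assms(4)[of x] assms(4)[of x'] assms(5)[of x x'] by (simp add: k_def field_simps)
  moreover have "positive_definite k"
    unfolding k_def by (rule positive_definite_symmetrized[OF assms(2,4,5)])
  ultimately show ?thesis by (intro conjI allI impI)
qed

end
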